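(* Let $\Omega\subset\mathbb{R}^d$ be a nonempty open set and let the coefficients $A=(a^{ij})$, $b=(b^i)$, $G=(g^{ij})$, $h=(h^i)$ on $\Omega$ satisfy conditions (H1), (H2), (H3) listed in the context, with some $p>d$ and $p'=p/(p-1)$. Suppose in addition that all functions $g^{ij}$ are continuous on $\Omega$. Let $\varrho\in L^{p'}_{loc}(\Omega)$ be a solution to the equation $$ {\rm div}^2(\varrho A)-{\rm div}(\varrho b)={\rm div}^2G-{\rm div}\,h $$ on $\Omega$ such that $\varrho(x)\ge 0$ for almost all $x\in\Omega$. Let $D$ be a bounded domain with boundary $\partial D$ of class $C^2$ and $\overline{D}\subset\Omega$. Then there exists a bounded (possibly signed) Borel measure $\eta$ on $\partial D$ such that $\varrho$ is a solution to the Dirichlet problem on $D$ for this equation with boundary condition $\varrho|_{\partial D}=\eta+\kappa\sigma_{d-1}$ (in the sense of the integral identity in the context). If it is known in advance that $\varrho\in L^\infty_{loc}(\Omega)$, then the assumption of nonnegativity of $\varrho$ can be omitted; moreover, in this case the corresponding measure $\eta$ has a bounded density with respect to the surface measure $\sigma_{d-1}$ on $\partial D$.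
   Context: $A=(a^{ij})_{i,j\le d}$ and $G=(g^{ij})_{i,j\le d}$ are mappings from $\Omega$ to symmetric $d\times d$ matrices and $b=(b^i)$, $h=(h^i)$ are vector fields on $\Omega$, all with Borel components ($G$ need not be nonnegative definite). For such a pair, $$ L_{A,b}u={\rm trace}(A D^2u)+\langle b,\nabla u\rangle,\qquad L_{G,h}u={\rm trace}(G D^2u)+\langle h,\nabla u\rangle . $$ Conditions: (H1) all $a^{ij}$ are continuous on $\Omega$ and there is a nondecreasing continuous function $\omega$ on $[0,+\infty)$ with $\omega(0)=0$ and $\|A(x)-A(y)\|\le\omega(|x-y|)$ for all $x,y\in\Omega$; (H2) there is $\theta>0$ such that $\theta\,{\rm I}\le A(x)\le\theta^{-1}{\rm I}$ for all $x\in\Omega$, where ${\rm I}$ is the unit matrix; (H3) for some $p>d$ one has $b^i\in L^p_{loc}(\Omega)$, $h^i\in L^1_{loc}(\Omega)$, $g^{ij}\in L^{p'}_{loc}(\Omega)$, where $p'=p/(p-1)$ and $L^q_{loc}(\Omega)$ is the class of measurable functions integrable to power $q$ on compact subsets of $\Omega$. Solution of the equation: $\varrho\in L^1_{loc}(\Omega)$ is a solution to ${\rm div}^2(\varrho A)-{\rm div}(\varrho b)={\rm div}^2G-{\rm div}\,h$ on $\Omega$ if $a^{ij}\varrho,\ b^i\varrho,\ h^i,\ g^{ij}\in L^1_{loc}(\Omega)$ and $\int_\Omega L_{A,b}u\,\varrho\,dx=\int_\Omega L_{G,h}u\,dx$ for every $u\in C_0^\infty(\Omega)$. Dirichlet problem: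 for a bounded Borel measure $\eta$ (possibly signed) on $\partial D$, a function $\varrho\in L^{p'}(D)$ is a solution to the Dirichlet problem for this equation on $D$ with boundary condition $\varrho|_{\partial D}=\eta+\kappa\sigma_{d-1}$ if for every $u\in W^{p,2}(D)\cap C^1(\overline{D})$ vanishing on $\partial D$ one has $$ \int_D L_{A,b}u\,\varrho\,dx=\int_D L_{G,h}u\,dx+\int_{\partial D}\langle A(x)\nabla u(x),\nu(x)\rangle\,\eta(dx). $$ Here $W^{p,2}(D)$ is the Sobolev space of functions in $L^p(D)$ whose first and second order generalized derivatives are in $L^p(D)$, $\nu(x)$ is the unit outer normal to $\partial D$, $\sigma_{d-1}$ is the standard surface measure on $\partial D$, and $\kappa(x)=\langle G(x)\nu(x),\nu(x)\rangle/\langle A(x)\nu(x),\nu(x)\rangle$. The term $\kappa\sigma_{d-1}$ does not enter the defining identity. *)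

theory Defs
  imports "HOL-Analysis.Analysis"
begin

subsection \<open>Classical derivatives and test functions\<close>

definition partial_deriv :: "'n::finite \<Rightarrow> (real^'n \<Rightarrow> real) \<Rightarrow> real^'n \<Rightarrow> real" where
  "partial_deriv i f x = frechet_derivative f (at x) (axis i 1)"

definition grad :: "(real^'n::finite \<Rightarrow> real) \<Rightarrow> real^'n \<Rightarrow> real^'n" where
  "grad f x = (\<chi> i. partial_deriv i f x)"

definition hess :: "(real^'n::finite \<Rightarrow> real) \<Rightarrow> real^'n \<Rightarrow> real^'n^'n" where
  "hess f x = (\<chi> i j. partial_deriv i (partial_deriv j f) x)"

text \<open>The class \<open>C\<^sup>k\<close> on the whole space.\<close>
primrec Ck :: "nat \<Rightarrow> (real^'n::finite \<Rightarrow> real) \<Rightarrow> bool" where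
  "Ck 0 f \<longleftrightarrow> continuous_on UNIV f"
| "Ck (Suc k) f \<longleftrightarrow> (\<forall>x. f differentiable (at x)) \<and> (\<forall>i. Ck k (partial_deriv i f))"

text \<open>\<open>C\<^sub>0\<^sup>\<infinity>(S)\<close> for open \<open>S\<close>; its elements are regarded as extended by zero to the whole space.\<close>
definition C0_infty :: "(real^'n::finite) set \<Rightarrow> (real^'n \<Rightarrow> real) set" where
  "C0_infty S = {u. (\<forall>k. Ck k u) \<and> compact (closure {x. u x \<noteq> 0}) \<and> closure {x. u x \<noteq> 0} \<subseteq> S}"

subsection \<open>Lebesgue classes\<close>

definition Lp_on :: "real \<Rightarrow> (real^'n::finite) set \<Rightarrow> (real^'n \<Rightarrow> real) \<Rightarrow> bool" where
  "Lp_on q S f \<longleftrightarrow> f \<in> borel_measurable (lebesgue_on S) \<and>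
     integrable (lebesgue_on S) (\<lambda>x. \<bar>f x\<bar> powr q)"

definition Lp_loc :: "real \<Rightarrow> (real^'n::finite) set \<Rightarrow> (real^'n \<Rightarrow> real) \<Rightarrow> bool" where
  "Lp_loc q S f \<longleftrightarrow> f \<in> borel_measurable (lebesgue_on S) \<and>
     (\<forall>K. compact K \<and> K \<subseteq> S \<longrightarrow> integrable (lebesgue_on K) (\<lambda>x. \<bar>f x\<bar> powr q))"

definition Linfty_loc :: "(real^'n::finite) set \<Rightarrow> (real^'n \<Rightarrow> real) \<Rightarrow> bool" where
  "Linfty_loc S f \<longleftrightarrow> f \<in> borel_measurable (lebesgue_on S) \<and>
     (\<forall>K. compact K \<and> K \<subseteq> S \<longrightarrow> (\<exists>M. AE x in lebesgue_on K. \<bar>f x\<bar> \<le> M))"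

subsection \<open>Generalized derivatives and Sobolev functions\<close>

definition gen_partial ::
    "(real^'n::finite) set \<Rightarrow> 'n \<Rightarrow> (real^'n \<Rightarrow> real) \<Rightarrow> (real^'n \<Rightarrow> real) \<Rightarrow> bool" where
  "gen_partial D i u v \<longleftrightarrow> Lp_loc 1 D u \<and> Lp_loc 1 D v \<and>
     (\<forall>\<phi>\<in>C0_infty D. (LINT x|lebesgue_on D. u x * partial_deriv i \<phi> x)
                      = - (LINT x|lebesgue_on D. v x * \<phi> x))"

definition gen_partial2 ::
    "(real^'n::finite) set \<Rightarrow> 'n \<Rightarrow> 'n \<Rightarrow> (real^'n \<Rightarrow> real) \<Rightarrow> (real^'n \<Rightarrow> real) \<Rightarrow> bool" where
  "gen_partial2 D i j u w \<longleftrightarrow> Lp_loc 1 D u \<and> Lp_loc 1 D w \<and>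
     (\<forall>\<phi>\<in>C0_infty D. (LINT x|lebesgue_on D. u x * partial_deriv i (partial_deriv j \<phi>) x)
                      = (LINT x|lebesgue_on D. w x * \<phi> x))"

text \<open>The Sobolev class \<open>W\<^sup>p\<^sup>,\<^sup>2(D)\<close> (integrability exponent first).\<close>
definition Sobolev_Wp2 :: "real \<Rightarrow> (real^'n::finite) set \<Rightarrow> (real^'n \<Rightarrow> real) set" where
  "Sobolev_Wp2 p D = {u. Lp_on p D u \<and>
     (\<forall>i. \<exists>v. gen_partial D i u v \<and> Lp_on p D v) \<and>
     (\<forall>i j. \<exists>w. gen_partial2 D i j u w \<and> Lp_on p D w)}"

text \<open>A representative of the generalized Hessian on \<open>D\<close>; it is unique up to null sets,
  so integrals containing it do not depend on the choice.\<close>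
definition gen_hess :: "(real^'n::finite) set \<Rightarrow> (real^'n \<Rightarrow> real) \<Rightarrow> real^'n \<Rightarrow> real^'n^'n" where
  "gen_hess D u = (SOME H. \<forall>i j. gen_partial2 D i j u (\<lambda>x. H x $ i $ j))"

text \<open>\<open>C\<^sup>1\<close> up to the boundary, for open \<open>D\<close>: the function and its gradient on \<open>D\<close> extend
  continuously to the closure. Values outside the closure of \<open>D\<close> play no role.\<close>
definition C1_closure :: "(real^'n::finite) set \<Rightarrow> (real^'n \<Rightarrow> real) set" where
  "C1_closure D = {u. continuous_on (closure D) u \<and> (\<forall>x\<in>D. u differentiable (at x)) \<and>
     (\<exists>g. continuous_on (closure D) g \<and> (\<forall>x\<in>D. g x = grad u x))}"

definition boundary_grad ::
    "(real^'n::finite) set \<Rightarrow> (real^'n \<Rightarrow> real) \<Rightarrow> real^'n \<Rightarrow> real^'n" where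
  "boundary_grad D u x = Lim (at x within D) (grad u)"

subsection \<open>Boundaries of class \<open>C\<^sup>2\<close>\<close>

text \<open>Near \<open>x0\<close> the set \<open>D\<close> is the part of the ball above the graph of a \<open>C\<^sup>2\<close> function of the
  \<open>d - 1\<close> variables orthogonal to the unit vector \<open>e\<close>. Such a function is encoded as a function
  of \<open>d\<close> variables that is constant in the direction of \<open>e\<close>.\<close>
definition C2_graph_at ::
    "(real^'n::finite) set \<Rightarrow> real^'n \<Rightarrow> real^'n \<Rightarrow> (real^'n \<Rightarrow> real) \<Rightarrow> real \<Rightarrow> bool" where
  "C2_graph_at D x0 e \<gamma> r \<longleftrightarrow> norm e = 1 \<and> 0 < r \<and> Ck 2 \<gamma> \<and>
     (\<forall>x t. \<gamma> (x + t *\<^sub>R e) = \<gamma> x) \<and>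
     D \<inter> ball x0 r = {x \<in> ball x0 r. \<gamma> x < x \<bullet> e}"

definition C2_boundary :: "(real^'n::finite) set \<Rightarrow> bool" where
  "C2_boundary D \<longleftrightarrow> (\<forall>x0\<in>frontier D. \<exists>e \<gamma> r. C2_graph_at D x0 e \<gamma> r)"

text \<open>Locally \<open>D\<close> is the set where \<open>\<gamma> x - x \<bullet> e\<close> is negative, and the gradient of this function
  is nonzero and points out of \<open>D\<close>.\<close>
definition outer_normal :: "(real^'n::finite) set \<Rightarrow> real^'n \<Rightarrow> real^'n" where
  "outer_normal D x =
     (THE \<nu>. \<exists>e \<gamma> r. C2_graph_at D x e \<gamma> r \<and> \<nu> = sgn (grad \<gamma> x - e))"

subsection \<open>Surface measure\<close>

text \<open>The \<open>s\<close>-dimensional Hausdorff measure, normalized so as to agree with Lebesgue measure on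
  \<open>s\<close>-dimensional planes. The empty set is treated separately since \<open>0 ^ 0 = 1\<close>, and boundedness
  is required since \<open>diameter\<close> is unspecified on unbounded sets.\<close>
definition hausdorff_outer :: "nat \<Rightarrow> (real^'n::finite) set \<Rightarrow> ennreal" where
  "hausdorff_outer s S =
     (SUP \<delta>\<in>{0::real<..}.
        INF C\<in>{C :: nat \<Rightarrow> (real^'n) set.
                 S \<subseteq> (\<Union>k. C k) \<and> (\<forall>k. bounded (C k) \<and> diameter (C k) \<le> \<delta>)}.
          (\<Sum>k. if C k = {} then 0
               else ennreal (unit_ball_vol (real s) * (diameter (C k) / 2) ^ s)))"

definition hausdorff_measure :: "nat \<Rightarrow> (real^'n::finite) measure" where
  "hausdorff_measure s = measure_of UNIV (sets borel) (hausdorff_outer s)"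

definition surface_measure :: "(real^'n::finite) set \<Rightarrow> (real^'n) measure" where
  "surface_measure D = restrict_space (hausdorff_measure (CARD('n) - 1)) (frontier D)"

subsection \<open>Bounded signed Borel measures\<close>

definition bounded_signed_measure :: "'a::topological_space set \<Rightarrow> ('a set \<Rightarrow> real) \<Rightarrow> bool" where
  "bounded_signed_measure S \<eta> \<longleftrightarrow>
     (\<forall>F :: nat \<Rightarrow> 'a set. range F \<subseteq> sets (restrict_space borel S) \<and> disjoint_family F \<longrightarrow>
        (\<lambda>k. \<eta> (F k)) sums \<eta> (\<Union>k. F k)) \<and>
     (\<exists>M. \<forall>B\<in>sets (restrict_space borel S). \<bar>\<eta> B\<bar> \<le> M)"

text \<open>The positive part in the Jordan decomposition; \<open>ennreal\<close> cuts negative values off at 0,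
  which is the value for the empty set anyway.\<close>
definition positive_variation ::
    "'a::topological_space set \<Rightarrow> ('a set \<Rightarrow> real) \<Rightarrow> 'a measure" where
  "positive_variation S \<eta> = measure_of S (sets (restrict_space borel S))
     (\<lambda>B. SUP E\<in>{E \<in> sets (restrict_space borel S). E \<subseteq> B}. ennreal (\<eta> E))"

definition signed_integral ::
    "'a::topological_space set \<Rightarrow> ('a set \<Rightarrow> real) \<Rightarrow> ('a \<Rightarrow> real) \<Rightarrow> real" where
  "signed_integral S \<eta> f =
     (LINT x|positive_variation S \<eta>. f x) - (LINT x|positive_variation S (\<lambda>B. - \<eta> B). f x)"

definition has_bounded_surface_density :: "(real^'n::finite) set \<Rightarrow> ((real^'n) set \<Rightarrow> real) \<Rightarrow> bool"
  where
  "has_bounded_surface_density D \<eta> \<longleftrightarrow>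
     (\<exists>f\<in>borel_measurable (surface_measure D).
        (\<exists>M. \<forall>x\<in>frontier D. \<bar>f x\<bar> \<le> M) \<and>
        (\<forall>B\<in>sets (surface_measure D). \<eta> B = (LINT x:B|surface_measure D. f x)))"

subsection \<open>The equation and the Dirichlet problem\<close>

definition borel_symmetric_matrix_field ::
    "(real^'n::finite) set \<Rightarrow> (real^'n \<Rightarrow> real^'n^'n) \<Rightarrow> bool" where
  "borel_symmetric_matrix_field \<Omega> A \<longleftrightarrow>
     (\<forall>x\<in>\<Omega>. transpose (A x) = A x) \<and>
     (\<forall>i j. (\<lambda>x. A x $ i $ j) \<in> borel_measurable (restrict_space borel \<Omega>))"

definition borel_vector_field :: "(real^'n::finite) set \<Rightarrow> (real^'n \<Rightarrow> real^'n) \<Rightarrow> bool" where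
  "borel_vector_field \<Omega> b \<longleftrightarrow>
     (\<forall>i. (\<lambda>x. b x $ i) \<in> borel_measurable (restrict_space borel \<Omega>))"

text \<open>\<open>norm\<close> is the Frobenius norm of a matrix; another choice of norm would only change
  \<open>\<omega>\<close> by a constant factor.\<close>
definition cond_H1 :: "(real^'n::finite) set \<Rightarrow> (real^'n \<Rightarrow> real^'n^'n) \<Rightarrow> bool" where
  "cond_H1 \<Omega> A \<longleftrightarrow> (\<forall>i j. continuous_on \<Omega> (\<lambda>x. A x $ i $ j)) \<and>
     (\<exists>\<omega> :: real \<Rightarrow> real. mono_on {0..} \<omega> \<and> continuous_on {0..} \<omega> \<and> \<omega> 0 = 0 \<and>
        (\<forall>x\<in>\<Omega>. \<forall>y\<in>\<Omega>. norm (A x - A y) \<le> \<omega> (norm (x - y))))"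

definition cond_H2 :: "(real^'n::finite) set \<Rightarrow> (real^'n \<Rightarrow> real^'n^'n) \<Rightarrow> bool" where
  "cond_H2 \<Omega> A \<longleftrightarrow> (\<exists>\<theta>>0. \<forall>x\<in>\<Omega>. \<forall>\<xi>.
     \<theta> * (\<xi> \<bullet> \<xi>) \<le> (A x *v \<xi>) \<bullet> \<xi> \<and> (A x *v \<xi>) \<bullet> \<xi> \<le> inverse \<theta> * (\<xi> \<bullet> \<xi>))"

definition conj_exp :: "real \<Rightarrow> real" where
  "conj_exp p = p / (p - 1)"

definition cond_H3 :: "real \<Rightarrow> (real^'n::finite) set \<Rightarrow> (real^'n \<Rightarrow> real^'n) \<Rightarrow>
    (real^'n \<Rightarrow> real^'n^'n) \<Rightarrow> (real^'n \<Rightarrow> real^'n) \<Rightarrow> bool" where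
  "cond_H3 p \<Omega> b G h \<longleftrightarrow> real CARD('n) < p \<and>
     (\<forall>i. Lp_loc p \<Omega> (\<lambda>x. b x $ i)) \<and>
     (\<forall>i. Lp_loc 1 \<Omega> (\<lambda>x. h x $ i)) \<and>
     (\<forall>i j. Lp_loc (conj_exp p) \<Omega> (\<lambda>x. G x $ i $ j))"

text \<open>The value at \<open>x\<close> of \<open>trace (A D\<^sup>2u) + \<langle>b, \<nabla>u\<rangle>\<close>, where the first and second derivatives of \<open>u\<close>
  are passed as \<open>g\<close> and \<open>H\<close> so that both classical and generalized ones can be used.\<close>
definition diff_op :: "(real^'n::finite \<Rightarrow> real^'n^'n) \<Rightarrow> (real^'n \<Rightarrow> real^'n) \<Rightarrow>
    (real^'n \<Rightarrow> real^'n) \<Rightarrow> (real^'n \<Rightarrow> real^'n^'n) \<Rightarrow> real^'n \<Rightarrow> real" where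
  "diff_op A b g H x = trace (A x ** H x) + b x \<bullet> g x"

text \<open>\<open>\<rho>\<close> solves \<open>div\<^sup>2(\<rho>A) - div(\<rho>b) = div\<^sup>2G - div h\<close> on \<open>\<Omega>\<close>.\<close>
definition solves_equation :: "(real^'n::finite) set \<Rightarrow> (real^'n \<Rightarrow> real^'n^'n) \<Rightarrow>
    (real^'n \<Rightarrow> real^'n) \<Rightarrow> (real^'n \<Rightarrow> real^'n^'n) \<Rightarrow> (real^'n \<Rightarrow> real^'n) \<Rightarrow>
    (real^'n \<Rightarrow> real) \<Rightarrow> bool" where
  "solves_equation \<Omega> A b G h \<rho> \<longleftrightarrow>
     Lp_loc 1 \<Omega> \<rho> \<and>
     (\<forall>i j. Lp_loc 1 \<Omega> (\<lambda>x. A x $ i $ j * \<rho> x)) \<and>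
     (\<forall>i. Lp_loc 1 \<Omega> (\<lambda>x. b x $ i * \<rho> x)) \<and>
     (\<forall>i. Lp_loc 1 \<Omega> (\<lambda>x. h x $ i)) \<and>
     (\<forall>i j. Lp_loc 1 \<Omega> (\<lambda>x. G x $ i $ j)) \<and>
     (\<forall>u\<in>C0_infty \<Omega>.
        (LINT x|lebesgue_on \<Omega>. diff_op A b (grad u) (hess u) x * \<rho> x) =
        (LINT x|lebesgue_on \<Omega>. diff_op G h (grad u) (hess u) x))"

text \<open>\<open>\<rho>\<close> solves the Dirichlet problem on \<open>D\<close> with boundary condition \<open>\<eta> + \<kappa>\<sigma>\<close>, where
  \<open>\<kappa> = \<langle>G\<nu>, \<nu>\<rangle> / \<langle>A\<nu>, \<nu>\<rangle>\<close> and \<open>\<sigma>\<close> is the surface measure. The term \<open>\<kappa>\<sigma>\<close> does not enter the defining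
  identity, hence only \<open>\<eta>\<close> is a parameter.\<close>
definition solves_Dirichlet :: "real \<Rightarrow> (real^'n::finite) set \<Rightarrow> (real^'n \<Rightarrow> real^'n^'n) \<Rightarrow>
    (real^'n \<Rightarrow> real^'n) \<Rightarrow> (real^'n \<Rightarrow> real^'n^'n) \<Rightarrow> (real^'n \<Rightarrow> real^'n) \<Rightarrow>
    ((real^'n) set \<Rightarrow> real) \<Rightarrow> (real^'n \<Rightarrow> real) \<Rightarrow> bool" where
  "solves_Dirichlet p D A b G h \<eta> \<rho> \<longleftrightarrow>
     Lp_on (conj_exp p) D \<rho> \<and>
     (\<forall>u \<in> Sobolev_Wp2 p D \<inter> C1_closure D. (\<forall>x\<in>frontier D. u x = 0) \<longrightarrow>
        (LINT x|lebesgue_on D. diff_op A b (grad u) (gen_hess D u) x * \<rho> x) =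
        (LINT x|lebesgue_on D. diff_op G h (grad u) (gen_hess D u) x) +
        signed_integral (frontier D) \<eta>
          (\<lambda>x. (A x *v boundary_grad D u x) \<bullet> outer_normal D x))"

end

theory Submission
  imports Defs
begin

text \<open>
Fix a function \<open>r\<close> of class \<open>C\<^sup>2\<close> that is positive exactly on \<open>D\<close>, vanishes on the boundary and has
nonzero gradient there. Put \<open>Q = \<rho>A - G\<close> and \<open>B = \<rho>b - h\<close> on \<open>D\<close>, so that the equation says that the
pairings of \<open>Q\<close> with the second derivatives and of \<open>B\<close> with the first derivatives of a test
function add up to 0. Mollification extends this from smooth test functions to functions of class
\<open>C\<^sup>1\<close> with compact support in \<open>D\<close> and generalized second derivatives in \<open>L\<^sup>p\<close>
(\<open>equation_weak_hessian\<close>).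

Now let \<open>u\<close> vanish on the boundary. There the gradient of \<open>u\<close> is \<open>W\<close> times that of \<open>r\<close> for a
continuous function \<open>W\<close> (\<open>boundary_gradient\<close>). The equation holds for \<open>u step(r/s - 1)\<close>. As \<open>s\<close>
tends to 0, the terms with derivatives of the cut-off combine to the integral of \<open>W\<close> against a
density that is concentrated on the layer \<open>s <= r <= 2s\<close> and bounded there by \<open>|Q| / s\<close>
(\<open>layer_limit\<close>). If the mass of \<open>|Q|\<close> in the layer is of order \<open>s\<close>, these densities have limit points
among the measures on the boundary (\<open>boundary_measures\<close>), and the identity for \<open>u\<close> acquires a
boundary integral of \<open>W\<close>.

The mass bound is where the assumptions on \<open>\<rho>\<close> enter. For bounded \<open>\<rho>\<close> it follows from the volume of
the layer. For nonnegative \<open>\<rho>\<close> it is obtained from the equation itself: testing with a convex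
function of \<open>r\<close> bounds the integral over the layer of the form of \<open>Q\<close> at the gradient of \<open>r\<close>
(\<open>layer_bound\<close>), and by ellipticity this form is at least \<open>c\<rho>\<close> minus a constant because \<open>G\<close> is bounded
on \<open>D\<close>.

The densities change sign, so their positive and negative parts are treated separately. Each gives
positive functionals, whose limits are measures by the representation theorem of Riesz, proved
here for compact sets in metric spaces by covering with continuous functions. On the boundary
\<open>\<langle>A\<nabla>u, \<nu>\<rangle>\<close> is \<open>W\<close> times a continuous function without zeros, and dividing by it turns the difference
of the two measures into \<open>\<eta>\<close>. For bounded \<open>\<rho>\<close> the measure of a ball of radius \<open>t\<close> is at most of order
\<open>t\<close> to the power \<open>d - 1\<close>. Covering by sets of small diameter shows that both measures are bounded by
a multiple of the Hausdorff measure, which is finite on the boundary, and the theorem of Radon and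
Nikodym provides the bounded density.
\<close>

section \<open>Calculus of the classes \<open>C\<^sup>k\<close>\<close>

abbreviation pd :: "'n::finite => (real^'n => real) => real^'n => real" where "pd == partial_deriv"

lemma partial_deriv_eqI:
  assumes "(f has_derivative f') (at x)"
  shows "pd i f x = f' (axis i 1)"
  using frechet_derivative_at[OF assms] by (simp add: partial_deriv_def)

lemma differentiable_has_derivative_grad:
  fixes f :: "real^'n::finite => real"
  assumes "f differentiable (at x)"
  shows "(f has_derivative (%v. grad f x \<bullet> v)) (at x)"
proof -
  define f' where "f' = frechet_derivative f (at x)"
  have d: "(f has_derivative f') (at x)"
    using assms frechet_derivative_works f'_def by blast
  then interpret bounded_linear f' by (rule has_derivative_bounded_linear)
  have "f' v = grad f x \<bullet> v" for v
  proof -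
    have "f' v = f' (\<Sum>i\<in>UNIV. v $ i *\<^sub>R axis i 1)"
      by (simp add: basis_expansion scalar_mult_eq_scaleR[symmetric])
    also have "... = (\<Sum>i\<in>UNIV. v $ i * f' (axis i 1))"
      by (simp add: sum scaleR)
    also have "... = grad f x \<bullet> v"
      by (simp add: inner_vec_def grad_def partial_deriv_def f'_def mult.commute)
    finally show ?thesis .
  qed
  then show ?thesis using d by (metis (no_types, lifting) has_derivative_transform_within UNIV_I ext)
qed

lemma grad_eqI:
  fixes f :: "real^'n::finite => real"
  assumes "(f has_derivative (%v. a \<bullet> v)) (at x)"
  shows "grad f x = a"
  using partial_deriv_eqI[OF assms] by (simp add: grad_def vec_eq_iff inner_axis)

lemma Ck_Suc_differentiable: "Ck (Suc k) f ==> f differentiable (at x)" by simp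

lemma Ck_Suc_has_derivative: "Ck (Suc k) f ==> (f has_derivative (%v. grad f x \<bullet> v)) (at x)"
  by (simp add: differentiable_has_derivative_grad)

lemma Ck_continuous: "Ck k f ==> continuous_on S f"
proof (cases k)
  case (Suc j)
  assume "Ck k f"
  then have "f differentiable (at x)" for x using Suc by simp
  then show ?thesis
    by (meson differentiable_imp_continuous_within continuous_at_imp_continuous_on)
next
  case 0
  assume "Ck k f"
  then show ?thesis using 0 continuous_on_subset by (metis Ck.simps(1) subset_UNIV)
qed

lemma Ck_SucD: "Ck (Suc k) f ==> Ck k f"
proof (induction k arbitrary: f)
  case 0
  then show ?case using Ck_continuous by (metis Ck.simps(1))
next
  case (Suc k)
  have "Ck (Suc k) (pd i f)" for i using Suc.prems by simp
  then have "Ck k (pd i f)" for i using Suc.IH by blast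
  then show ?case using Suc.prems by simp
qed

lemma Ck_mono: "Ck k f ==> j <= k ==> Ck j f"
proof (induction k)
  case (Suc k)
  then show ?case using Ck_SucD[of k f] by (metis le_Suc_eq)
qed simp

lemma Ck_partial: "Ck (Suc k) f ==> Ck k (pd i f)" by simp

lemma Ck_grad_continuous: "Ck (Suc k) f ==> continuous_on S (grad f)"
  unfolding grad_def by (intro continuous_on_vec_lambda) (auto intro: Ck_continuous)

lemma Ck_SucI:
  fixes f :: "real^'n::finite => real"
  assumes "!!x. (f has_derivative (%v. g x \<bullet> v)) (at x)" and "!!i. Ck k (%x. g x $ i)"
  shows "Ck (Suc k) f"
proof -
  have "pd i f = (%x. g x $ i)" for i
    using grad_eqI[OF assms(1)] by (auto simp: grad_def fun_eq_iff vec_eq_iff)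
  then show ?thesis using assms by (auto simp: differentiable_def)
qed

lemma partial_deriv_const [simp]: "pd i (%x. c) = (%x. 0)"
  by (rule ext) (rule partial_deriv_eqI[where f' = "%v. 0"], simp)

lemma Ck_const [simp]: "Ck k (%x. c)"
  by (induction k arbitrary: c) (simp_all)

lemma partial_deriv_add:
  assumes "f differentiable (at x)" "g differentiable (at x)"
  shows "pd i (%x. f x + g x) x = pd i f x + pd i g x"
  using partial_deriv_eqI[OF has_derivative_add[OF assms[unfolded frechet_derivative_works]]]
  by (simp add: partial_deriv_def)

lemma partial_deriv_mult:
  assumes "f differentiable (at x)" "g differentiable (at x)"
  shows "pd i (%x. f x * g x) x = pd i f x * g x + f x * pd i g x"
  using partial_deriv_eqI[OF has_derivative_mult[OF assms[unfolded frechet_derivative_works]]]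
  by (simp add: partial_deriv_def)

lemma Ck_add:
  "Ck k f ==> Ck k g ==> Ck k (%x. f x + g x)"
proof (induction k arbitrary: f g)
  case (Suc k)
  have "pd i (%x. f x + g x) = (%x. pd i f x + pd i g x)" for i
    using Suc.prems by (auto simp: partial_deriv_add)
  then show ?case using Suc by auto
qed (auto intro: continuous_intros)

lemma Ck_mult:
  "Ck k f ==> Ck k g ==> Ck k (%x. f x * g x)"
proof (induction k arbitrary: f g)
  case (Suc k)
  have eq: "pd i (%x. f x * g x) = (%x. pd i f x * g x + f x * pd i g x)" for i
    using Suc.prems by (auto simp: partial_deriv_mult)
  have "Ck k (pd i f)" "Ck k (pd i g)" "Ck k f" "Ck k g" for i
    using Suc.prems Ck_SucD by auto
  then have "Ck k (pd i (%x. f x * g x))" for i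
    unfolding eq by (intro Ck_add Suc.IH)
  then show ?case using Suc.prems by auto
qed (auto intro: continuous_intros)

lemma Ck_cmult: "Ck k f ==> Ck k (%x. c * f x)"
  by (intro Ck_mult) auto

lemma Ck_diff: "Ck k f ==> Ck k g ==> Ck k (%x. f x - g x)"
  using Ck_add[of k f "%x. -1 * g x"] Ck_cmult[of k g "-1"] by simp

lemma Ck_sum: "(!!a. a \<in> S ==> Ck k (f a)) ==> Ck k (%x. \<Sum>a\<in>S. f a x)"
  by (induction S rule: infinite_finite_induct) (auto intro: Ck_add)

lemma Ck_inner_const: "Ck k (%x. x \<bullet> (e::real^'n::finite))"
proof (cases k)
  case (Suc j)
  have "((%x. x \<bullet> e) has_derivative (%v. e \<bullet> v)) (at x)" for x
    by (auto intro!: derivative_eq_intros simp: inner_commute)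
  then show ?thesis using Suc Ck_SucI[of "%x. x \<bullet> e" "%x. e"] by simp
qed (auto intro: continuous_intros)

lemma Ck_norm_sq: "Ck k (%x::real^'n::finite. (x - a) \<bullet> (x - a))"
proof -
  have "(%x. (x - a) \<bullet> (x - a)) = (%x. \<Sum>i\<in>UNIV. (x \<bullet> axis i 1 - a $ i) * (x \<bullet> axis i 1 - a $ i))"
    by (rule ext, subst inner_vec_def) (simp add: inner_axis)
  then show ?thesis by (simp only:) (intro Ck_sum Ck_mult Ck_diff Ck_inner_const Ck_const)
qed

lemma partial_deriv_compose:
  assumes "f differentiable (at x)" "(F has_real_derivative F') (at (f x))"
  shows "pd i (%x. F (f x)) x = F' * pd i f x"
proof -
  have "(f has_derivative frechet_derivative f (at x)) (at x)"
    using assms(1) frechet_derivative_works by blast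
  from has_derivative_compose[OF this has_field_derivative_imp_has_derivative[OF assms(2)]]
  show ?thesis using partial_deriv_eqI by (fastforce simp: partial_deriv_def)
qed

lemma Ck_compose:
  assumes "!!j t. j < k ==> (Fs j has_real_derivative Fs (Suc j) t) (at t)"
    and "continuous_on UNIV (Fs k)" and "Ck k f"
  shows "Ck k (%x. Fs 0 (f x))"
  using assms
proof (induction k arbitrary: Fs)
  case 0
  then show ?case using continuous_on_compose2[of UNIV "Fs 0" UNIV f] by auto
next
  case (Suc k)
  have eq: "pd i (%x. Fs 0 (f x)) = (%x. Fs (Suc 0) (f x) * pd i f x)" for i
    using Suc.prems by (auto simp: fun_eq_iff intro!: partial_deriv_compose)
  have "Ck k (%x. Fs (Suc 0) (f x))"
    using Suc.IH[of "%j. Fs (Suc j)"] Suc.prems Ck_SucD by auto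
  then have "Ck k (pd i (%x. Fs 0 (f x)))" for i
    unfolding eq using Suc.prems by (intro Ck_mult) auto
  moreover have "(%x. Fs 0 (f x)) differentiable (at x)" for x
  proof -
    have "Fs 0 differentiable (at (f x))"
      using Suc.prems(1)[of 0] by (auto simp: differentiable_def has_field_derivative_def)
    then show ?thesis using Suc.prems differentiable_compose by fastforce
  qed
  ultimately show ?case by simp
qed

lemma Ck_2_compose:
  assumes "!!t. (F has_real_derivative F1 t) (at t)" "!!t. (F1 has_real_derivative F2 t) (at t)"
    and "continuous_on UNIV F2" and "Ck 2 f"
  shows "Ck 2 (%x. F (f x))"
proof -
  define Fs where "Fs j = (if j = 0 then F else if j = 1 then F1 else F2)" for j :: nat
  have "(Fs j has_real_derivative Fs (Suc j) t) (at t)" if "j < 2" for j t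
    using that assms(1,2) by (auto simp: less_2_cases_iff Fs_def)
  moreover have "continuous_on UNIV (Fs 2)" using assms(3) by (simp add: Fs_def)
  ultimately have "Ck 2 (%x. Fs 0 (f x))" using Ck_compose[of 2 Fs f] assms(4) by blast
  then show ?thesis by (simp add: Fs_def)
qed

lemma Ck_2_partial_compose:
  assumes "!!t. (F has_real_derivative F1 t) (at t)" "!!t. (F1 has_real_derivative F2 t) (at t)"
    and "Ck 2 f"
  shows "pd i (pd j (%x. F (f x))) x =
    F2 (f x) * pd i f x * pd j f x + F1 (f x) * pd i (pd j f) x"
proof -
  have d: "f differentiable (at x)" "pd j f differentiable (at x)" for x
    using assms(3) by (auto simp: numeral_2_eq_2)
  have "pd j (%x. F (f x)) = (%x. F1 (f x) * pd j f x)"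
    using partial_deriv_compose[OF d(1) assms(1)] by auto
  moreover have "(%x. F1 (f x)) differentiable (at x)"
    using d(1)[of x] assms(2)[of "f x"] differentiable_compose
    by (metis (mono_tags) differentiable_def has_field_derivative_imp_has_derivative)
  ultimately show ?thesis
    using partial_deriv_mult[of "%x. F1 (f x)" x "pd j f"] d
      partial_deriv_compose[OF d(1) assms(2)] by simp
qed

lemma partial_deriv_cong_open:
  assumes "open S" "x \<in> S" "!!y. y \<in> S ==> f y = g y"
  shows "pd i f x = pd i g x"
proof -
  have "(f has_derivative D) (at x) \<longleftrightarrow> (g has_derivative D) (at x)" for D
    using has_derivative_transform_within_open[OF _ assms(1,2)] assms(3) by metis
  then show ?thesis by (simp add: partial_deriv_def frechet_derivative_def)
qed

lemma partial_deriv_zero_open: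
  assumes "open S" "x \<in> S" "!!y. y \<in> S ==> f y = 0"
  shows "pd i f x = 0"
  using partial_deriv_cong_open[of S x f "%x. 0"] assms by simp

section \<open>Smooth bumps and twice differentiable steps\<close>

text \<open>The functions \<open>P(1/t) exp(-1/t)\<close> with a polynomial \<open>P\<close> are
  closed under differentiation; this gives a smooth function that vanishes exactly on the
  half-line \<open>t <= 0\<close>.\<close>
definition flat_exp :: "real poly => real => real" where
  "flat_exp P t = (if t <= 0 then 0 else poly P (1/t) * exp (- (1/t)))"

lemma poly_times_exp_minus_tendsto_0: "((%z. poly P z * exp (- z)) \<longlongrightarrow> 0) (at_top :: real filter)"
proof -
  have "((%z. \<Sum>i\<le>degree P. coeff P i * (z ^ i / exp z)) \<longlongrightarrow> (\<Sum>i\<le>degree P. coeff P i * 0)) at_top"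
    by (intro tendsto_intros tendsto_power_div_exp_0)
  then show ?thesis by (simp add: poly_altdef sum_distrib_right exp_minus divide_inverse mult.assoc)
qed

lemma flat_exp_has_derivative:
  "(flat_exp P has_real_derivative flat_exp ([:0,0,1:] * (P - pderiv P)) t) (at t)"
proof (cases "t = 0")
  case False
  show ?thesis
  proof (cases "t < 0")
    case True
    have "((%_. 0) has_real_derivative 0) (at t)" by simp
    then have "(flat_exp P has_real_derivative 0) (at t)"
      by (rule has_field_derivative_transform_within_open[where S="{..<0}"]) (use True in \<open>auto simp: flat_exp_def\<close>)
    then show ?thesis using True by (simp add: flat_exp_def)
  next
    case f: False
    then have t: "t > 0" using False by simp
    have "((%t. poly P (1/t) * exp (- (1/t))) has_real_derivative
        flat_exp ([:0,0,1:] * (P - pderiv P)) t) (at t)"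
      using t by (auto intro!: derivative_eq_intros DERIV_chain2[OF poly_DERIV]
          simp: flat_exp_def field_simps power2_eq_square)
    then show ?thesis
      by (rule has_field_derivative_transform_within_open[where S="{0<..}"]) (use t in \<open>auto simp: flat_exp_def\<close>)
  qed
next
  case True
  have "((%h. flat_exp P h / h) \<longlongrightarrow> 0) (at 0)"
  proof (rule filterlim_split_at)
    show "((%h. flat_exp P h / h) \<longlongrightarrow> 0) (at_left 0)"
      by (rule tendsto_eventually) (auto simp: eventually_at_filter flat_exp_def)
    have "((%h. poly ([:0,1:] * P) (inverse h) * exp (- inverse h)) \<longlongrightarrow> 0) (at_right (0::real))"
      by (rule filterlim_compose[OF poly_times_exp_minus_tendsto_0 filterlim_inverse_at_top_right])
    then show "((%h. flat_exp P h / h) \<longlongrightarrow> 0) (at_right 0)"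
      by (rule Lim_transform_eventually)
        (auto simp: eventually_at_filter flat_exp_def field_simps intro!: always_eventually)
  qed
  then show ?thesis using True by (simp add: has_field_derivative_iff flat_exp_def)
qed

lemma Ck_flat_exp_compose: "Ck k f ==> Ck k (%x. flat_exp P (f x))"
proof -
  assume f: "Ck k f"
  define Ps where "Ps j = ((%P. [:0,0,1:] * (P - pderiv P)) ^^ j) P" for j
  have "(flat_exp (Ps j) has_real_derivative flat_exp (Ps (Suc j)) t) (at t)" for j t
    using flat_exp_has_derivative[of "Ps j"] by (simp add: Ps_def)
  then have d: "!!j t. (flat_exp (Ps j) has_real_derivative flat_exp (Ps (Suc j)) t) (at t)" .
  then have "continuous_on UNIV (flat_exp (Ps k))"
    by (meson DERIV_continuous continuous_at_imp_continuous_on)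
  from Ck_compose[of k "%j. flat_exp (Ps j)" f, OF d this f] show ?thesis by (simp add: Ps_def)
qed

lemma flat_exp_1: "flat_exp 1 t \<ge> 0" "t <= 0 ==> flat_exp P t = 0" "t > 0 ==> flat_exp 1 t > 0"
  by (auto simp: flat_exp_def)

definition pcube :: "real => real" where "pcube t = (max 0 t)^3"
definition pcube1 :: "real => real" where "pcube1 t = 3 * (max 0 t)^2"
definition pcube2 :: "real => real" where "pcube2 t = 6 * max 0 t"

lemma pos_power_has_derivative:
  "((%t. (max 0 t)^Suc (Suc k)) has_real_derivative (real (Suc (Suc k)) * (max 0 t)^Suc k)) (at t)"
proof (cases "t = 0")
  case True
  have "((%h::real. (max 0 h) ^ Suc k) \<longlongrightarrow> (max 0 0) ^ Suc k) (at 0)"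
    by (intro tendsto_intros)
  then have "((%h::real. (max 0 h) ^ Suc k) \<longlongrightarrow> 0) (at 0)" by simp
  then have "((%h::real. (max 0 h) ^ Suc (Suc k) / h) \<longlongrightarrow> 0) (at 0)"
    by (rule Lim_transform_eventually) (auto simp: eventually_at_filter max_def)
  then show ?thesis using True by (simp add: has_field_derivative_iff)
next
  case False
  show ?thesis
  proof (cases "t < 0")
    case True
    have "((%_. 0) has_real_derivative 0) (at t)" by simp
    then have "((%t::real. (max 0 t)^Suc (Suc k)) has_real_derivative 0) (at t)"
      by (rule has_field_derivative_transform_within_open[where S="{..<0}"]) (use True in auto)
    then show ?thesis using True by simp
  next
    case f: False
    then have t: "t > 0" using False by simp
    have "((%t. t^Suc (Suc k)) has_real_derivative (real (Suc (Suc k)) * t^Suc k)) (at t)"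
      using DERIV_pow[of "Suc (Suc k)" t] by simp
    then have "((%t. (max 0 t)^Suc (Suc k)) has_real_derivative (real (Suc (Suc k)) * t^Suc k)) (at t)"
      by (rule has_field_derivative_transform_within_open[where S="{0<..}"]) (use t in auto)
    then show ?thesis using t by simp
  qed
qed

lemma pcube_DERIV: "(pcube has_real_derivative pcube1 t) (at t)"
  using pos_power_has_derivative[of 1 t] unfolding pcube_def[abs_def] pcube1_def
  by (simp add: numeral_3_eq_3 numeral_2_eq_2)

lemma pcube1_DERIV: "(pcube1 has_real_derivative pcube2 t) (at t)"
  using DERIV_cmult[OF pos_power_has_derivative[of 0 t], of 3] unfolding pcube1_def[abs_def] pcube2_def
  by (simp add: numeral_2_eq_2)

lemma continuous_pcube2: "continuous_on S pcube2"
  unfolding pcube2_def[abs_def] by (intro continuous_intros)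

lemma Ck_pcube: "Ck 2 f ==> Ck 2 (%x. pcube (f x))"
  by (rule Ck_2_compose[OF pcube_DERIV pcube1_DERIV continuous_pcube2])

text \<open>Composing \<open>1 - s^3\<close> twice, with all cubes cut off at 0, gives a monotone
  function that rises from 0 at 0 to 1 at 1 and has two continuous derivatives,
  \<open>step1\<close> and \<open>step2\<close>. These explicit formulas serve for all cut-offs in
  the boundary layers.\<close>
definition step :: "real => real" where "step t = 1 - pcube (1 - pcube t)"
definition step1 :: "real => real" where "step1 t = pcube1 (1 - pcube t) * pcube1 t"
definition step2 :: "real => real" where
  "step2 t = - pcube2 (1 - pcube t) * pcube1 t * pcube1 t + pcube1 (1 - pcube t) * pcube2 t"

lemma step_DERIV: "(step has_real_derivative step1 t) (at t)"
  unfolding step_def[abs_def] step1_def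
  by (rule derivative_eq_intros DERIV_chain2[OF pcube_DERIV] pcube_DERIV refl | simp)+

lemma step1_DERIV: "(step1 has_real_derivative step2 t) (at t)"
  unfolding step1_def[abs_def] step2_def
  by (rule derivative_eq_intros DERIV_chain2[OF pcube1_DERIV] pcube1_DERIV pcube_DERIV refl | simp)+

lemma continuous_step: "continuous_on S step" "continuous_on S step1" "continuous_on S step2"
proof -
  show "continuous_on S step" "continuous_on S step1"
    by (meson step_DERIV step1_DERIV DERIV_continuous continuous_at_imp_continuous_on)+
  have [continuous_intros]: "continuous_on S f ==> continuous_on S (%x. pcube (f x))"
     "continuous_on S f ==> continuous_on S (%x. pcube1 (f x))"
     "continuous_on S f ==> continuous_on S (%x. pcube2 (f x))" for f :: "real => real"
    unfolding pcube_def pcube1_def pcube2_def by (intro continuous_intros; assumption)+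
  show "continuous_on S step2" unfolding step2_def[abs_def] by (intro continuous_intros)
qed

lemma step_simps: "t <= 0 ==> step t = 0" "t \<ge> 1 ==> step t = 1" "t <= 0 ==> step1 t = 0" "t \<ge> 1 ==> step1 t = 0"
   "t <= 0 ==> step2 t = 0" "t \<ge> 1 ==> step2 t = 0"
proof -
  have "pcube t \<ge> 1" if "t \<ge> 1"
    using that by (simp add: pcube_def max_def)
  then show "t \<ge> 1 ==> step t = 1" "t \<ge> 1 ==> step1 t = 0" "t \<ge> 1 ==> step2 t = 0"
    by (auto simp: step_def step1_def step2_def pcube_def[of "1 - pcube t"] pcube1_def[of "1 - pcube t"]
        pcube2_def[of "1 - pcube t"] max_def)
qed (auto simp: step_def step1_def step2_def pcube_def pcube1_def pcube2_def max_def)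

lemma step_bounds: "0 <= step t" "step t <= 1"
proof -
  have "0 <= pcube s" for s by (simp add: pcube_def)
  then show "step t <= 1" by (simp add: step_def)
  have "pcube (1 - pcube t) <= 1"
    using \<open>0 <= pcube t\<close> by (auto simp: pcube_def[of "1 - pcube t"] intro!: power_le_one)
  then show "0 <= step t" by (simp add: step_def)
qed

lemma step1_nonneg: "0 <= step1 t" by (simp add: step1_def pcube1_def)

lemma step1_pos: "0 < t ==> t < 1 ==> 0 < step1 t"
proof -
  assume t: "0 < t" "t < 1"
  then have "t ^ 3 < 1" by (simp add: power_less_one_iff)
  with t show ?thesis by (simp add: step1_def pcube1_def pcube_def)
qed

lemma step_derivs_bounded: obtains B where "B > 0" "!!t. \<bar>step1 t\<bar> <= B" "!!t. \<bar>step2 t\<bar> <= B"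
proof -
  have "bounded (step1 ` {0..1})" "bounded (step2 ` {0..1})"
    by (intro compact_imp_bounded compact_continuous_image continuous_step; simp)+
  then obtain B1 B2 where B: "\<forall>y\<in>step1 ` {0..1}. norm y <= B1" "\<forall>y\<in>step2 ` {0..1}. norm y <= B2"
    unfolding bounded_iff by blast
  have "\<bar>step1 t\<bar> <= \<bar>B1\<bar> + \<bar>B2\<bar> + 1 \<and> \<bar>step2 t\<bar> <= \<bar>B1\<bar> + \<bar>B2\<bar> + 1" for t
  proof (cases "t \<in> {0..1}")
    case True
    then have "norm (step1 t) <= B1" "norm (step2 t) <= B2" using B by blast+
    then show ?thesis unfolding real_norm_def by linarith
  next
    case False
    then have "step1 t = 0" "step2 t = 0" using step_simps(3-6)[of t] by auto
    then show ?thesis by simp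
  qed
  then show thesis using that[of "\<bar>B1\<bar> + \<bar>B2\<bar> + 1"] by auto
qed

section \<open>Convolution\<close>

lemma integral_lborel_translate:
  fixes f :: "'a::euclidean_space => real"
  assumes [measurable]: "f \<in> borel_measurable borel"
  shows "(LBINT x. f (a + x)) = (LBINT x. f x)"
    and "integrable lborel (%x. f (a + x)) \<longleftrightarrow> integrable lborel f"
proof -
  have eq: "distr lborel borel (%x. a + x) = (lborel :: 'a measure)"
    by (rule lborel_distr_plus)
  have "(LBINT x. f x) = (LINT x|distr lborel borel (%x. a + x). f x)" by (simp add: eq)
  also have "... = (LBINT x. f (a + x))" by (rule integral_distr) auto
  finally show "(LBINT x. f (a + x)) = (LBINT x. f x)" by simp
  have "integrable lborel f \<longleftrightarrow> integrable (distr lborel borel (%x. a + x)) f" by (simp add: eq)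
  also have "... \<longleftrightarrow> integrable lborel (%x. f (a + x))" by (rule integrable_distr_eq) auto
  finally show "integrable lborel (%x. f (a + x)) \<longleftrightarrow> integrable lborel f" by simp
qed

lemma integral_lborel_reflect:
  fixes f :: "'a::euclidean_space => real"
  assumes [measurable]: "f \<in> borel_measurable borel"
  shows "(LBINT x. f (a - x)) = (LBINT x. f x)"
    and "integrable lborel (%x. f (a - x)) \<longleftrightarrow> integrable lborel f"
proof -
  have eq: "distr lborel borel (%x. a - x) = (lborel :: 'a measure)"
    using lborel_affine[of "-1" a] by (simp add: density_1 one_ennreal_def[symmetric])
  have "(LBINT x. f x) = (LINT x|distr lborel borel (%x. a - x). f x)" by (simp add: eq)
  also have "... = (LBINT x. f (a - x))" by (rule integral_distr) auto
  finally show "(LBINT x. f (a - x)) = (LBINT x. f x)" by simp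
  have "integrable lborel f \<longleftrightarrow> integrable (distr lborel borel (%x. a - x)) f" by (simp add: eq)
  also have "... \<longleftrightarrow> integrable lborel (%x. f (a - x))" by (rule integrable_distr_eq) auto
  finally show "integrable lborel (%x. f (a - x)) \<longleftrightarrow> integrable lborel f" by simp
qed

lemma integrable_continuous_compact_support:
  fixes f :: "'a::euclidean_space => real"
  assumes "continuous_on UNIV f" "compact K" "!!x. x \<notin> K ==> f x = 0"
  shows "integrable lborel f"
proof -
  have "(%x. indicator K x *\<^sub>R f x) = f" using assms(3) by (auto simp: indicator_def fun_eq_iff)
  moreover have "integrable lborel (%x. indicator K x *\<^sub>R f x)"
    by (rule borel_integrable_compact[OF assms(2) continuous_on_subset[OF assms(1)]]) simp
  ultimately show ?thesis by simp
qed

definition conv :: "('a::euclidean_space => real) => ('a => real) => 'a => real" where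
  "conv f g x = (LBINT y. f (x - y) * g y)"

lemma conv_commute:
  assumes [measurable]: "f \<in> borel_measurable borel" "g \<in> borel_measurable borel"
  shows "conv f g x = conv g f x"
  using integral_lborel_reflect(1)[of "%y. f (x - y) * g y" x] by (simp add: conv_def mult.commute)

lemma conv_eq_integral_cbox:
  fixes f g :: "'a::euclidean_space => real"
  assumes f: "continuous_on UNIV f" and g: "continuous_on UNIV g"
    and 0: "!!y. y \<notin> cbox a b ==> g y = 0"
  shows "conv f g x = integral (cbox a b) (%y. f (x - y) * g y)"
proof -
  have c: "continuous_on UNIV (%y. f (x - y) * g y)"
    by (intro continuous_intros continuous_on_compose2[OF f] g) auto
  have "integrable lborel (%y. f (x - y) * g y)"
    by (rule integrable_continuous_compact_support[OF c compact_cbox[of a b]]) (simp add: 0)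
  then have "conv f g x = integral UNIV (%y. f (x - y) * g y)"
    unfolding conv_def by (simp add: integral_lborel)
  also have "... = integral UNIV (%y. if y \<in> cbox a b then f (x - y) * g y else 0)"
    by (rule arg_cong[where f = "integral UNIV"]) (use 0 in auto)
  also have "... = integral (cbox a b) (%y. f (x - y) * g y)"
    by (rule integral_restrict_UNIV)
  finally show ?thesis .
qed

lemma continuous_conv:
  fixes f g :: "'a::euclidean_space => real"
  assumes f: "continuous_on UNIV f" and g: "continuous_on UNIV g"
    and 0: "!!y. y \<notin> cbox a b ==> g y = 0"
  shows "continuous_on UNIV (conv f g)"
proof -
  have eq: "conv f g = (%x. integral (cbox a b) (%y. f (x - y) * g y))"
    using conv_eq_integral_cbox[OF assms] by auto
  have "continuous_on (UNIV \<times> cbox a b) (%(x, y). f (x - y) * g y)"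
    unfolding split_def
    by (intro continuous_intros continuous_on_compose2[OF f] continuous_on_compose2[OF g]) auto
  then show ?thesis unfolding eq by (rule integral_continuous_on_param)
qed

lemma conv_has_derivative:
  fixes f g :: "real^'n::finite => real"
  assumes f: "Ck (Suc 0) f" and g: "continuous_on UNIV g"
    and 0: "!!y. y \<notin> cbox a b ==> g y = 0"
  shows "(conv f g has_derivative (%v. (\<chi> i. conv (pd i f) g x) \<bullet> v)) (at x)"
proof -
  have fc: "continuous_on UNIV f" using f Ck_continuous by blast
  have gc: "continuous_on S (%x. grad f (h x))" if "continuous_on S h" for S and h :: "'b::topological_space => _"
    by (rule continuous_on_compose2[OF Ck_grad_continuous[OF f, of UNIV] that]) auto
  have pc: "continuous_on UNIV (pd i f)" for i using f by simp
  define fx where "fx x y = g y *\<^sub>R blinfun_inner_right (grad f (x - y))" for x y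
  have d: "((%x. f (x - y) * g y) has_derivative blinfun_apply (fx x y)) (at x within UNIV)" for x y
    unfolding fx_def
    by (auto intro!: derivative_eq_intros has_derivative_compose[OF _ Ck_Suc_has_derivative[OF f]]
      simp: scaleR_blinfun.rep_eq fun_eq_iff)
  have c: "continuous_on (UNIV \<times> cbox a b) (%(x, y). fx x y)"
    unfolding split_def fx_def
    by (intro continuous_intros gc continuous_on_compose2[OF g]
      bounded_linear.continuous_on[OF bounded_linear_blinfun_inner_right]) auto
  have i: "(%y. f (x - y) * g y) integrable_on cbox a b" for x
    by (intro integrable_continuous continuous_intros continuous_on_compose2[OF fc]
       continuous_on_subset[OF g]) auto
  have D: "((%x. integral (cbox a b) (%y. f (x - y) * g y)) has_derivative
      blinfun_apply (integral (cbox a b) (fx x))) (at x within UNIV)"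
    by (rule leibniz_rule[OF d i c]) auto
  have "blinfun_apply (integral (cbox a b) (fx x)) v = (\<chi> i. conv (pd i f) g x) \<bullet> v" for v
  proof -
    have ci: "(%y. pd i f (x - y) * g y) integrable_on cbox a b" for i
      by (intro integrable_continuous continuous_intros continuous_on_compose2[OF pc]
        continuous_on_subset[OF g]) auto
    have "continuous_on (cbox a b) (fx x)"
      using continuous_on_compose2[OF c continuous_on_Pair[OF continuous_on_const[of _ x] continuous_on_id]] by auto
    then have "fx x integrable_on cbox a b" by (rule integrable_continuous)
    then have "blinfun_apply (integral (cbox a b) (fx x)) v = integral (cbox a b) (%y. blinfun_apply (fx x y) v)"
      using integral_linear[OF _ blinfun.bounded_linear_left, of "fx x" "cbox a b" v] by (simp add: comp_def)
    also have "... = integral (cbox a b) (%y. \<Sum>i\<in>UNIV. (pd i f (x - y) * g y) * v $ i)"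
      unfolding fx_def
      by (simp add: scaleR_blinfun.rep_eq inner_vec_def grad_def sum_distrib_left ac_simps)
    also have "... = (\<Sum>i\<in>UNIV. integral (cbox a b) (%y. (pd i f (x - y) * g y)) * v $ i)"
      by (subst integral_sum) (auto intro: integrable_on_mult_left ci)
    also have "... = (\<chi> i. conv (pd i f) g x) \<bullet> v"
      by (simp add: inner_vec_def conv_eq_integral_cbox[OF pc g 0])
    finally show ?thesis .
  qed
  then have "blinfun_apply (integral (cbox a b) (fx x)) = (%v. (\<chi> i. conv (pd i f) g x) \<bullet> v)" by blast
  moreover have "conv f g = (%x. integral (cbox a b) (%y. f (x - y) * g y))"
    by (rule ext) (rule conv_eq_integral_cbox[OF fc g 0])
  ultimately show ?thesis using D by simp
qed

lemma partial_deriv_conv: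
  fixes f g :: "real^'n::finite => real"
  assumes f: "Ck (Suc 0) f" and g: "continuous_on UNIV g"
    and 0: "!!y. y \<notin> cbox a b ==> g y = 0"
  shows "pd i (conv f g) = conv (pd i f) g"
  using partial_deriv_eqI[OF conv_has_derivative[OF assms]] by (auto simp: inner_axis)

lemma Ck_conv:
  fixes f g :: "real^'n::finite => real"
  assumes f: "Ck k f" and g: "continuous_on UNIV g"
    and z: "!!y. y \<notin> cbox a b ==> g y = 0"
  shows "Ck k (conv f g)"
  using f
proof (induction k arbitrary: f)
  case 0
  then show ?case using continuous_conv[OF _ g z] by simp
next
  case (Suc k)
  have 1: "Ck (Suc 0) f" by (rule Ck_mono[OF Suc.prems]) simp
  have "Ck k (conv (pd i f) g)" for i using Suc by simp
  moreover have "conv f g differentiable (at x)" for x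
    using conv_has_derivative[OF 1 g z] by (auto simp: differentiable_def)
  ultimately show ?case by (simp add: partial_deriv_conv[OF 1 g z])
qed

section \<open>Mollifiers\<close>

definition mollifier :: "real => (real^'n::finite => real) => bool" where
  "mollifier d \<phi> \<longleftrightarrow> (\<forall>k. Ck k \<phi>) \<and> (\<forall>x. 0 <= \<phi> x) \<and> (\<forall>x. d <= norm x --> \<phi> x = 0)
     \<and> (LBINT x. \<phi> x) = 1"

text \<open>Normalize \<open>flat_exp\<close> of \<open>d^2 - norm x^2\<close>.\<close>
lemma mollifier_exists:
  assumes "0 < d" shows "\<exists>\<phi>::real^'n::finite => real. mollifier d \<phi>"
proof -
  define f :: "real^'n => real" where "f x = flat_exp 1 (d^2 - (x - 0) \<bullet> (x - 0))" for x
  have C: "Ck k f" for k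
    unfolding f_def[abs_def] by (intro Ck_flat_exp_compose Ck_diff Ck_const Ck_norm_sq)
  have nn: "0 <= f x" for x by (simp add: f_def flat_exp_1)
  have z: "f x = 0" if "d <= norm x" for x
  proof -
    have "d^2 <= (norm x)^2" using that assms by (intro power_mono) auto
    then show ?thesis by (simp add: f_def flat_exp_1 power2_norm_eq_inner)
  qed
  have int: "integrable lborel f"
    by (rule integrable_continuous_compact_support[of _ "cball 0 d"]) (use C Ck_continuous z in auto)
  have "0 < (LBINT x. f x)"
  proof -
    have "(LBINT x. f x) \<noteq> 0"
    proof
      assume "(LBINT x. f x) = 0"
      then have "AE x in lborel. f x = 0"
        using integral_nonneg_eq_0_iff_AE[OF int] nn by auto
      then have "AE x in lborel. x \<notin> ball (0::real^'n) d"
      proof eventually_elim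
        case (elim x)
        then show ?case
          using flat_exp_1(3)[of "d^2 - x \<bullet> x"] assms
          by (auto simp: f_def power2_norm_eq_inner[symmetric] power_strict_mono)
      qed
      then have "ball (0::real^'n) d \<in> null_sets lborel"
        by (subst AE_iff_null_sets) auto
      then have "emeasure lborel (ball (0::real^'n) d) = 0" by auto
      then show False
        using emeasure_lborel_ball_finite[of "0::real^'n" d] assms content_ball_pos[OF assms, of "0::real^'n"]
        by (simp add: measure_def)
    qed
    moreover have "0 <= (LBINT x. f x)" using nn by simp
    ultimately show ?thesis by simp
  qed
  then have "mollifier d (%x. inverse (LBINT x. f x) * f x)"
    unfolding mollifier_def using C nn z int by (auto intro!: Ck_cmult)
  then show ?thesis by blast
qed

lemma mollifierD:
  assumes "mollifier d \<phi>"
  shows "Ck k \<phi>" "0 <= \<phi> x" "d <= norm x ==> \<phi> x = 0" "(LBINT x. \<phi> x) = 1"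
    "continuous_on S \<phi>" "\<phi> \<in> borel_measurable borel" "integrable lborel \<phi>"
    "x \<notin> cbox (- (\<chi> i. d)) (\<chi> i. d) ==> \<phi> x = 0"
proof -
  show 1: "Ck k \<phi>" "0 <= \<phi> x" "d <= norm x ==> \<phi> x = 0" "(LBINT x. \<phi> x) = 1" for k x
    using assms by (auto simp: mollifier_def)
  show "continuous_on S \<phi>" for S using 1(1) by (rule Ck_continuous)
  then show "\<phi> \<in> borel_measurable borel" by (rule borel_measurable_continuous_onI)
  show "integrable lborel \<phi>"
    by (rule integrable_continuous_compact_support[of _ "cball 0 d"]) (use \<open>!!S. continuous_on S \<phi>\<close> 1 in auto)
  show "x \<notin> cbox (- (\<chi> i. d)) (\<chi> i. d) ==> \<phi> x = 0"
  proof (rule 1(3), rule ccontr)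
    assume x: "x \<notin> cbox (- (\<chi> i. d)) (\<chi> i. d)" and "\<not> d <= norm x"
    then have "\<bar>x $ i\<bar> <= d" for i using component_le_norm_cart[of x i] by linarith
    with x show False by (auto simp: mem_box_cart abs_le_iff minus_le_iff)
  qed
qed

lemma conv_mollifier_close:
  assumes m: "mollifier d \<phi>" and f: "continuous_on UNIV f"
    and e: "!!y. norm y < d ==> \<bar>f (x - y) - f x\<bar> <= e"
  shows "\<bar>conv f \<phi> x - f x\<bar> <= e"
proof -
  note [measurable] = mollifierD(6)[OF m] borel_measurable_continuous_onI[OF f]
  have fx: "continuous_on UNIV (%y. f (x - y))"
    by (intro continuous_on_compose2[OF f] continuous_intros) auto
  have i1: "integrable lborel (%y. f (x - y) * \<phi> y)"
    by (rule integrable_continuous_compact_support[of _ "cball 0 d"])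
      (use mollifierD(3,5)[OF m] fx in \<open>auto intro!: continuous_intros\<close>)
  have i2: "integrable lborel \<phi>" by (rule mollifierD(7)[OF m])
  have "conv f \<phi> x - f x = (LBINT y. f (x - y) * \<phi> y) - (LBINT y. f x * \<phi> y)"
    using mollifierD(4)[OF m] by (simp add: conv_def)
  also have "... = (LBINT y. (f (x - y) - f x) * \<phi> y)"
    using i1 i2 by (subst Bochner_Integration.integral_diff[symmetric]) (auto simp: left_diff_distrib)
  also have "\<bar>...\<bar> <= (LBINT y. e * \<phi> y)"
  proof (rule order_trans[OF integral_abs_bound], rule integral_mono)
    show "integrable lborel (%y. \<bar>(f (x - y) - f x) * \<phi> y\<bar>)"
      using i1 i2 by (auto simp: left_diff_distrib)
    show "\<bar>(f (x - y) - f x) * \<phi> y\<bar> <= e * \<phi> y" for y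
      using e[of y] mollifierD(2,3)[OF m, of y]
      by (cases "norm y < d") (auto simp: abs_mult intro!: mult_right_mono)
  qed (use i2 in auto)
  also have "... = e" using mollifierD(4)[OF m] by simp
  finally show ?thesis .
qed

lemma conv_mollifier_zero:
  assumes m: "mollifier d \<phi>" and "!!y. norm y < d ==> f (x - y) = 0"
  shows "conv f \<phi> x = 0"
proof -
  have "f (x - y) * \<phi> y = 0" for y
    using assms(2)[of y] mollifierD(3)[OF m, of y] by (cases "norm y < d") auto
  then show ?thesis unfolding conv_def by (simp only: Bochner_Integration.integral_zero)
qed

lemma continuous_compact_support_uniform:
  fixes f :: "'a::euclidean_space => real"
  assumes f: "continuous_on UNIV f" and K: "compact K" and 0: "!!x. x \<notin> K ==> f x = 0" and e: "0 < e"
  obtains d where "0 < d" "!!x y. norm y < d ==> \<bar>f (x - y) - f x\<bar> <= e"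
proof -
  obtain R where R: "K \<subseteq> ball 0 R" "R > 0"
    using compact_imp_bounded[OF K] bounded_subset_ballD by blast
  have "uniformly_continuous_on (cball 0 (R + 1)) f"
    by (rule compact_uniformly_continuous) (use f continuous_on_subset in auto)
  then obtain d where d: "0 < d" "!!x y. x \<in> cball 0 (R+1) ==> y \<in> cball 0 (R+1) ==> dist y x < d ==> dist (f y) (f x) < e"
    using e unfolding uniformly_continuous_on_def by metis
  have "\<bar>f (x - y) - f x\<bar> <= e" if y: "norm y < min d 1" for x y
  proof (cases "x \<in> cball 0 (R+1) \<and> x - y \<in> cball 0 (R+1)")
    case True
    then show ?thesis using d(2)[of x "x - y"] y by (simp add: dist_norm)
  next
    case False
    have "R < norm x" "R < norm (x - y)"
      using False y norm_triangle_ineq4[of x y] norm_triangle_ineq2[of x y] by auto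
    then have "x \<notin> K" "x - y \<notin> K" using R(1) by auto
    then show ?thesis using 0 e by simp
  qed
  then show thesis using that[of "min d 1"] d(1) by simp
qed

lemma compact_neighbourhood:
  fixes K S :: "'a::euclidean_space set"
  assumes K: "compact K" and S: "open S" "K \<subseteq> S"
  obtains d K' where "0 < d" "compact K'" "K' \<subseteq> S" "K \<subseteq> K'" "!!x y. x \<in> K ==> norm y <= d ==> x + y \<in> K'"
proof -
  obtain e where e: "0 < e" "(\<Union>x\<in>K. cball x e) \<subseteq> S"
    using compact_subset_open_imp_cball_epsilon_subset[OF K S] by blast
  define K' where "K' = (%(x, y). x + y) ` (K \<times> cball 0 e)"
  have K': "compact K'" unfolding K'_def
    by (intro compact_continuous_image compact_Times K compact_cball)
      (auto simp: split_def intro!: continuous_intros)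
  have mem: "x + y \<in> K'" if "x \<in> K" "norm y <= e" for x y
    unfolding K'_def using that by (auto intro!: image_eqI[where x="(x, y)"])
  have "K' \<subseteq> S"
  proof
    fix z assume "z \<in> K'"
    then obtain x y where "x \<in> K" "norm y <= e" "z = x + y" by (auto simp: K'_def)
    then have "z \<in> cball x e" "x \<in> K" by (auto simp: dist_norm)
    then show "z \<in> S" using e by blast
  qed
  moreover have "K \<subseteq> K'" using mem[of _ 0] e by force
  ultimately show thesis using that[of e K'] e mem K' by blast
qed

lemma C0_inftyI:
  assumes "!!k. Ck k u" "compact K" "K \<subseteq> S" "!!x. x \<notin> K ==> u x = 0"
  shows "u \<in> C0_infty S"
proof -
  have "{x. u x \<noteq> 0} \<subseteq> K" using assms(4) by auto
  then have "closure {x. u x \<noteq> 0} \<subseteq> K" by (simp add: closure_minimal compact_imp_closed assms(2))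
  moreover from this have "compact (closure {x. u x \<noteq> 0})"
    using assms(2) by (meson bounded_subset closed_closure compact_eq_bounded_closed)
  ultimately show ?thesis using assms by (auto simp: C0_infty_def)
qed

lemma C0_inftyD:
  assumes "u \<in> C0_infty S"
  obtains K where "!!k. Ck k u" "compact K" "K \<subseteq> S" "!!x. x \<notin> K ==> u x = 0"
proof (rule that[of "closure {x. u x \<noteq> 0}"])
  show "u x = 0" if "x \<notin> closure {x. u x \<noteq> 0}" for x
    using that closure_subset[of "{x. u x \<noteq> 0}"] by blast
qed (use assms in \<open>auto simp: C0_infty_def\<close>)

definition molls :: "nat => real^'n::finite => real" where
  "molls n = (SOME \<phi>. mollifier (1 / real (Suc n)) \<phi>)"

lemma molls: "mollifier (1 / real (Suc n)) (molls n)"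
  unfolding molls_def by (rule someI_ex[OF mollifier_exists]) simp

lemma eventually_inverse_Suc_less: "0 < d ==> eventually (%n. 1 / real (Suc n) < d) sequentially"
  using lim_inverse_n' LIMSEQ_Suc[OF lim_inverse_n'] order_tendstoD(2) by fastforce

lemma conv_molls_uniform:
  fixes f :: "real^'n::finite => real"
  assumes f: "continuous_on UNIV f" and K: "compact K" and 0: "!!x. x \<notin> K ==> f x = 0"
  shows "uniform_limit UNIV (%n. conv f (molls n)) f sequentially"
proof (rule uniform_limitI)
  fix e :: real assume "0 < e"
  then obtain d where d: "0 < d" "!!x y. norm y < d ==> \<bar>f (x - y) - f x\<bar> <= e/2"
    using continuous_compact_support_uniform[OF f K 0, of "e/2"] by (metis half_gt_zero)
  show "\<forall>\<^sub>F n in sequentially. \<forall>x\<in>UNIV. dist (conv f (molls n) x) (f x) < e"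
    using eventually_inverse_Suc_less[OF d(1)]
  proof eventually_elim
    case (elim n)
    have "\<bar>conv f (molls n) x - f x\<bar> <= e/2" for x
      by (rule conv_mollifier_close[OF molls f]) (use d(2) elim in auto)
    then show ?case using \<open>0 < e\<close> by (force simp: dist_real_def intro: le_less_trans[of _ "e/2"])
  qed
qed

lemma conv_molls_C0_infty:
  fixes f :: "real^'n::finite => real"
  assumes f: "continuous_on UNIV f" and K: "compact K" and 0: "!!x. x \<notin> K ==> f x = 0"
    and S: "open S" "K \<subseteq> S"
  obtains K' N where "compact K'" "K' \<subseteq> S" "K \<subseteq> K'"
    "!!n. n \<ge> N ==> conv f (molls n) \<in> C0_infty S"
    "!!n x. n \<ge> N ==> x \<notin> K' ==> conv f (molls n) x = 0"
proof -
  obtain d K' where K': "0 < d" "compact K'" "K' \<subseteq> S" "K \<subseteq> K'"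
    "!!x y. x \<in> K ==> norm y <= d ==> x + y \<in> K'"
    using compact_neighbourhood[OF K S] by metis
  obtain N where N: "!!n. n \<ge> N ==> 1 / real (Suc n) < d"
    using eventually_inverse_Suc_less[OF K'(1)] eventually_sequentially by auto
  have z: "conv f (molls n) x = 0" if "n \<ge> N" "x \<notin> K'" for n x
  proof (rule conv_mollifier_zero[OF molls])
    fix y :: "real^'n" assume "norm y < 1 / real (Suc n)"
    then have "norm y <= d" using N[OF that(1)] by simp
    then have "x - y \<notin> K" using K'(5)[of "x - y" y] that(2) by auto
    then show "f (x - y) = 0" by (rule 0)
  qed
  obtain R where "K \<subseteq> cbox (-R) R" using bounded_subset_cbox_symmetric compact_imp_bounded[OF K] by metis
  then have R: "!!y. y \<notin> cbox (-R) R ==> f y = 0" using 0 by auto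
  have "conv f (molls n) = conv (molls n) f" for n
    by (rule ext, rule conv_commute)
      (auto intro: borel_measurable_continuous_onI f mollifierD(6)[OF molls])
  then have "Ck k (conv f (molls n))" for k n
    using Ck_conv[OF mollifierD(1)[OF molls] f R] by simp
  then have "conv f (molls n) \<in> C0_infty S" if "n \<ge> N" for n
    using C0_inftyI[OF _ K'(2,3)] z[OF that] by blast
  then show thesis using that[of K' N] K' z by blast
qed

section \<open>Integration by parts\<close>

lemma partial_deriv_outside:
  assumes "compact K" "!!x. x \<notin> K ==> f x = 0" "x \<notin> K"
  shows "pd i f x = 0"
  by (rule partial_deriv_zero_open[of "-K"]) (use assms compact_imp_closed in auto)

text \<open>The convolution of \<open>f\<close> with a function that is 1 on a large ball is
  constant near 0, and its partial derivative there is, after a reflection, the integral in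
  question.\<close>
lemma integral_partial_deriv_zero:
  fixes f :: "real^'n::finite => real"
  assumes f: "Ck (Suc 0) f" and K: "compact K" and 0: "!!x. x \<notin> K ==> f x = 0"
  shows "(LBINT x. pd i f x) = 0"
proof -
  obtain R where R: "K \<subseteq> ball 0 R" "R > 0"
    using compact_imp_bounded[OF K] bounded_subset_ballD by blast
  define g :: "real^'n => real" where "g y = max 0 (min 1 (R + 2 - norm y))" for y
  have g: "continuous_on UNIV g" unfolding g_def by (intro continuous_intros)
  have g1: "g y = 1" if "norm y <= R + 1" for y using that by (simp add: g_def)
  have "bounded (cball (0::real^'n) (R + 2))" by simp
  then obtain a where a: "cball (0::real^'n) (R + 2) \<subseteq> cbox (-a) a"
    using bounded_subset_cbox_symmetric by blast
  have g0: "g y = 0" if "y \<notin> cbox (-a) a" for y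
  proof -
    have "R + 2 < norm y" using that a by (auto simp: subset_iff not_le[symmetric])
    then show ?thesis by (simp add: g_def)
  qed
  have fc: "continuous_on UNIV f" and pc: "continuous_on UNIV (pd i f)"
    using f Ck_continuous by (auto simp del: Ck.simps intro: Ck_continuous[OF Ck_partial[OF f]])
  have [measurable]: "f \<in> borel_measurable borel" "pd i f \<in> borel_measurable borel"
    by (auto intro: borel_measurable_continuous_onI fc pc)
  have eq: "h (x - y) * g y = h (x - y)" if "x \<in> ball 0 1" "!!x. x \<notin> K ==> h x = 0" for x y h
  proof (cases "x - y \<in> K")
    case True
    then have "norm (x - y) < R" using R by auto
    then have "norm y <= R + 1" using that(1) norm_triangle_ineq2[of y x] by (auto simp: norm_minus_commute)
    then show ?thesis by (simp add: g1)
  qed (use that in auto)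
  have "conv f g x = (LBINT x. f x)" if "x \<in> ball 0 1" for x
  proof -
    have "(%y. f (x - y) * g y) = (%y. f (x - y))" using eq[of x f, OF that 0] by (intro ext)
    then show ?thesis unfolding conv_def using integral_lborel_reflect(1)[of f x] by simp
  qed
  then have "pd i (conv f g) 0 = pd i (%x. LBINT x. f x) (0::real^'n)"
    by (intro partial_deriv_cong_open[of "ball 0 1"]) auto
  moreover have "pd i (conv f g) 0 = conv (pd i f) g 0"
    by (simp add: partial_deriv_conv[OF f g g0])
  moreover have "conv (pd i f) g 0 = (LBINT x. pd i f x)"
  proof -
    have "(%y. pd i f (0 - y) * g y) = (%y. pd i f (0 - y))"
      using eq[of 0 "pd i f", OF _ partial_deriv_outside[OF K 0]] by (intro ext) simp
    then show ?thesis unfolding conv_def using integral_lborel_reflect(1)[of "pd i f" 0] by simp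
  qed
  ultimately show ?thesis by simp
qed

lemma integration_by_parts:
  fixes f g :: "real^'n::finite => real"
  assumes f: "Ck (Suc 0) f" and g: "Ck (Suc 0) g" and K: "compact K" and 0: "!!x. x \<notin> K ==> f x = 0"
  shows "(LBINT x. f x * pd i g x) = - (LBINT x. pd i f x * g x)"
proof -
  have c: "continuous_on UNIV f" "continuous_on UNIV g" "continuous_on UNIV (pd i f)" "continuous_on UNIV (pd i g)"
    using f g by (auto simp del: Ck.simps intro: Ck_continuous Ck_continuous[OF Ck_partial])
  have i1: "integrable lborel (%x. pd i f x * g x)"
    by (rule integrable_continuous_compact_support[OF _ K])
      (use c partial_deriv_outside[OF K 0] in \<open>auto intro: continuous_intros\<close>)
  have i2: "integrable lborel (%x. f x * pd i g x)"
    by (rule integrable_continuous_compact_support[OF _ K])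
      (use c 0 in \<open>auto intro: continuous_intros\<close>)
  have "0 = (LBINT x. pd i (%x. f x * g x) x)"
    by (rule integral_partial_deriv_zero[symmetric, OF Ck_mult[OF f g] K]) (simp add: 0)
  also have "... = (LBINT x. pd i f x * g x + f x * pd i g x)"
    using f g by (simp add: partial_deriv_mult)
  also have "... = (LBINT x. pd i f x * g x) + (LBINT x. f x * pd i g x)"
    by (rule Bochner_Integration.integral_add[OF i1 i2])
  finally show ?thesis by simp
qed

lemma Ck_2_partials:
  assumes "Ck 2 v" shows "Ck (Suc 0) v" "Ck (Suc 0) (pd i v)" "continuous_on S v"
    "continuous_on S (pd i v)" "continuous_on S (pd i (pd j v))"
    "v differentiable (at x)" "pd i v differentiable (at x)"
proof -
  have v: "Ck (Suc (Suc 0)) v" using assms by (simp only: numeral_2_eq_2)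
  show 1: "Ck (Suc 0) v" "Ck (Suc 0) (pd i v)" for i by (rule Ck_SucD[OF v], rule Ck_partial[OF v])
  show "continuous_on S v" "continuous_on S (pd i v)" "continuous_on S (pd i (pd j v))"
    by (rule Ck_continuous[OF 1(1)], rule Ck_continuous[OF 1(2)], rule Ck_continuous[OF Ck_partial[OF 1(2)]])
  show "v differentiable (at x)" "pd i v differentiable (at x)"
    by (rule Ck_Suc_differentiable[OF 1(1)], rule Ck_Suc_differentiable[OF 1(2)])
qed

lemma partial_conv_molls:
  assumes "Ck (Suc 0) v"
  shows "pd i (conv v (molls n)) = conv (pd i v) (molls n)"
  by (rule partial_deriv_conv[OF assms mollifierD(5)[OF molls] mollifierD(8)[OF molls]])

section \<open>Limits of integrals\<close>

lemma integrable_mult_bounded: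
  fixes F g :: "'a => real"
  assumes F: "integrable M F" and [measurable]: "g \<in> borel_measurable M" and b: "!!x. \<bar>g x\<bar> <= B"
  shows "integrable M (%x. F x * g x)"
proof (rule Bochner_Integration.integrable_bound[where f = "%x. B * F x"])
  have [measurable]: "F \<in> borel_measurable M" using F by simp
  show "(%x. F x * g x) \<in> borel_measurable M" by simp
  show "AE x in M. norm (F x * g x) <= norm (B * F x)"
  proof (rule AE_I2)
    fix x
    have "\<bar>F x\<bar> * \<bar>g x\<bar> <= \<bar>F x\<bar> * \<bar>B\<bar>" using b[of x] by (intro mult_left_mono) auto
    then show "norm (F x * g x) <= norm (B * F x)" by (simp add: abs_mult mult.commute)
  qed
qed (use F in simp)

lemma continuous_compact_support_bounded:
  fixes f :: "'a::euclidean_space => real"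
  assumes "continuous_on UNIV f" "compact K" "!!x. x \<notin> K ==> f x = 0"
  obtains B where "!!x. \<bar>f x\<bar> <= B" "0 < B"
proof -
  have "compact (f ` K)" by (rule compact_continuous_image[OF continuous_on_subset[OF assms(1) subset_UNIV] assms(2)])
  then obtain B where B: "!!y. y \<in> f ` K ==> norm y <= B" using compact_imp_bounded bounded_iff by metis
  have "\<bar>f x\<bar> <= \<bar>B\<bar> + 1" for x
    using B[of "f x"] assms(3)[of x] by (cases "x \<in> K") auto
  then show thesis using that[of "\<bar>B\<bar> + 1"] by simp
qed

lemma tendsto_integral_uniform:
  fixes f :: "'a::euclidean_space => real"
  assumes f: "integrable lborel (%x. indicator K x * f x)" and K: "compact K"
    and g: "continuous_on UNIV g" "!!x. x \<notin> K ==> g x = 0"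
    and gn: "!!n. continuous_on UNIV (gs n)" "!!n x. x \<notin> K ==> gs n x = 0"
    and u: "uniform_limit UNIV gs g sequentially"
  shows "(%n. LBINT x. f x * gs n x) \<longlonglongrightarrow> (LBINT x. f x * g x)"
proof -
  define F where "F x = indicator K x * f x" for x
  have F: "integrable lborel F" using f by (simp add: F_def[abs_def])
  have eq: "f x * h x = F x * h x" if "!!x. x \<notin> K ==> h x = 0" for h x
    using that[of x] by (auto simp: F_def indicator_def)
  have int: "integrable lborel (%x. F x * h x)" if h: "continuous_on UNIV h" "!!x. x \<notin> K ==> h x = 0" for h
  proof -
    obtain B where B: "!!x. \<bar>h x\<bar> <= B" using continuous_compact_support_bounded[OF h(1) K h(2)] by blast
    show ?thesis
      by (rule integrable_mult_bounded[OF F _ B]) (use borel_measurable_continuous_onI[OF h(1)] in simp)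
  qed
  have "(%n. LBINT x. F x * gs n x) \<longlonglongrightarrow> (LBINT x. F x * g x)"
  proof (rule tendstoI)
    fix e :: real assume e: "0 < e"
    define C where "C = (LBINT x. \<bar>F x\<bar>)"
    have C: "0 <= C" by (simp add: C_def)
    define e' where "e' = e / (C + 1) / 2"
    have e': "0 < e'" using e C by (simp add: e'_def)
    show "\<forall>\<^sub>F n in sequentially. dist (LBINT x. F x * gs n x) (LBINT x. F x * g x) < e"
      using uniform_limitD[OF u e']
    proof eventually_elim
      case (elim n)
      have "dist (LBINT x. F x * gs n x) (LBINT x. F x * g x)
        = \<bar>LBINT x. F x * gs n x - F x * g x\<bar>"
        by (simp add: dist_real_def int g gn)
      also have "... <= (LBINT x. e' * \<bar>F x\<bar>)"
      proof (rule order_trans[OF integral_abs_bound], rule integral_mono)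
        show "integrable lborel (%x. \<bar>F x * gs n x - F x * g x\<bar>)"
          by (intro integrable_abs Bochner_Integration.integrable_diff int g gn)
        show "\<bar>F x * gs n x - F x * g x\<bar> <= e' * \<bar>F x\<bar>" for x
        proof -
          have "\<bar>F x * gs n x - F x * g x\<bar> = \<bar>gs n x - g x\<bar> * \<bar>F x\<bar>"
            by (simp add: abs_mult[symmetric] algebra_simps)
          also have "... <= e' * \<bar>F x\<bar>"
            using elim by (intro mult_right_mono) (auto simp: dist_real_def less_imp_le)
          finally show ?thesis .
        qed
      qed (use F in simp)
      also have "... = e' * C" by (simp add: C_def)
      also have "... <= e / 2"
        using e C by (simp add: e'_def field_simps)
      also have "... < e" using e by simp
      finally show ?case .
    qed
  qed
  moreover have "(%x. f x * g x) = (%x. F x * g x)" by (rule ext) (rule eq[of g, OF g(2)])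
  moreover have "(%x. f x * gs n x) = (%x. F x * gs n x)" for n by (rule ext) (rule eq[of "gs n", OF gn(2)])
  ultimately show ?thesis by simp
qed

text \<open>Local integrability on \<open>D\<close> is expressed for a Borel function on the whole
  space, so that all pairings with test functions are integrals over \<open>lborel\<close>.\<close>
definition Lloc :: "(real^'n::finite) set => (real^'n => real) => bool" where
  "Lloc D f \<longleftrightarrow> f \<in> borel_measurable borel \<and>
     (\<forall>K. compact K \<and> K \<subseteq> D --> integrable lborel (%x. indicator K x * f x))"

text \<open>Mollification commutes with partial derivatives, and a continuous function with
  compact support is the uniform limit of its mollifications.\<close>
lemma C2_approximation:
  fixes v :: "real^'n::finite => real"
  assumes v: "Ck 2 v" and K: "compact K" "!!x. x \<notin> K ==> v x = 0" and D: "open D" "K \<subseteq> D"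
  obtains vs K' where "compact K'" "K' \<subseteq> D" "K \<subseteq> K'" "!!n. vs n \<in> C0_infty D" "!!n x. x \<notin> K' ==> vs n x = 0"
    "uniform_limit UNIV vs v sequentially"
    "!!i j. uniform_limit UNIV (%n. pd i (pd j (vs n))) (pd i (pd j v)) sequentially"
proof -
  note C = Ck_2_partials[OF v]
  obtain K' N where K': "compact K'" "K' \<subseteq> D" "K \<subseteq> K'"
    "!!n. n \<ge> N ==> conv v (molls n) \<in> C0_infty D"
    "!!n x. n \<ge> N ==> x \<notin> K' ==> conv v (molls n) x = 0"
    using conv_molls_C0_infty[OF C(3) K D] by metis
  have p1: "!!x i. x \<notin> K ==> pd i v x = 0" by (rule partial_deriv_outside[OF K])
  have p2: "!!x i j. x \<notin> K ==> pd i (pd j v) x = 0" by (rule partial_deriv_outside[OF K(1) p1])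
  have eq: "pd i (pd j (conv v (molls n))) = conv (pd i (pd j v)) (molls n)" for i j n
    by (simp add: partial_conv_molls[OF C(1)] partial_conv_molls[OF C(2)])
  have sh: "uniform_limit UNIV (%n. f (n + N)) l sequentially" if "uniform_limit UNIV f l sequentially"
    for f and l :: "real^'n => real"
    using filterlim_compose[OF that[unfolded filterlim_iff[symmetric]] filterlim_add_const_nat_at_top] by simp
  show thesis
  proof (rule that[of K' "%n. conv v (molls (n + N))"])
    show "uniform_limit UNIV (%n. conv v (molls (n + N))) v sequentially"
      by (rule sh[OF conv_molls_uniform[OF C(3) K]])
    show "uniform_limit UNIV (%n. pd i (pd j (conv v (molls (n + N)))))
        (pd i (pd j v)) sequentially" for i j
      unfolding eq by (rule sh[OF conv_molls_uniform[OF C(5) K(1) p2]])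
  qed (use K' in auto)
qed

text \<open>Both sides of the defining identity of the weak derivative pass to the limit along
  smooth approximations of \<open>v\<close>.\<close>
lemma weak_derivative2_C2_test:
  fixes f w :: "real^'n::finite => real"
  assumes D: "open D" and f: "Lloc D f" and w: "Lloc D w"
    and eq: "!!\<phi>. \<phi> \<in> C0_infty D ==> (LBINT x. f x * pd i (pd j \<phi>) x) = (LBINT x. w x * \<phi> x)"
    and v: "Ck 2 v" and K: "compact K" "!!x. x \<notin> K ==> v x = 0" "K \<subseteq> D"
  shows "(LBINT x. f x * pd i (pd j v) x) = (LBINT x. w x * v x)"
proof -
  obtain vs K' where K': "compact K'" "K' \<subseteq> D" "K \<subseteq> K'" "!!n. vs n \<in> C0_infty D" "!!n x. x \<notin> K' ==> vs n x = 0"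
    "uniform_limit UNIV vs v sequentially"
    "!!i j. uniform_limit UNIV (%n. pd i (pd j (vs n))) (pd i (pd j v)) sequentially"
    using C2_approximation[OF v K(1,2) D K(3)] by metis
  have v0: "!!x. x \<notin> K' ==> v x = 0" using K K' by blast
  have "Ck 2 (vs n)" for n using K'(4)[of n] by (simp only: C0_infty_def mem_Collect_eq)
  note Cn = Ck_2_partials[OF this] and C = Ck_2_partials[OF v]
  have 1: "(%n. LBINT x. f x * pd i (pd j (vs n)) x) \<longlonglongrightarrow>
    (LBINT x. f x * pd i (pd j v) x)"
    by (rule tendsto_integral_uniform[where K=K'])
      (use f K' C Cn partial_deriv_outside[OF K'(1) partial_deriv_outside[OF K'(1)]] v0 in \<open>auto simp: Lloc_def\<close>)
  have 2: "(%n. LBINT x. w x * vs n x) \<longlonglongrightarrow> (LBINT x. w x * v x)"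
    by (rule tendsto_integral_uniform[where K=K']) (use w K' C Cn v0 in \<open>auto simp: Lloc_def\<close>)
  show ?thesis using LIMSEQ_unique[OF 1] 2 eq[OF K'(4)] by simp
qed

text \<open>Mollification extends the hypothesis to continuous test functions, and these decrease
  to indicators of compact sets. Inner regularity then forces the sets where \<open>f\<close> is
  positive or negative to be null.\<close>
lemma fundamental_lemma:
  fixes f :: "real^'n::finite => real"
  assumes D: "open D" and f: "Lloc D f"
    and eq: "!!\<phi>. \<phi> \<in> C0_infty D ==> (LBINT x. f x * \<phi> x) = 0"
  shows "AE x in lborel. x \<in> D --> f x = 0"
proof -
  have [measurable]: "f \<in> borel_measurable borel" using f by (simp add: Lloc_def)
  have 1: "(LBINT x. f x * g x) = 0" if g: "continuous_on UNIV g" "compact K" "!!x. x \<notin> K ==> g x = 0" "K \<subseteq> D" for g K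
  proof -
    obtain K' N where K': "compact K'" "K' \<subseteq> D" "K \<subseteq> K'"
      "!!n. n \<ge> N ==> conv g (molls n) \<in> C0_infty D"
      "!!n x. n \<ge> N ==> x \<notin> K' ==> conv g (molls n) x = 0"
      using conv_molls_C0_infty[OF g(1,2,3) D g(4)] by metis
    have "uniform_limit UNIV (%n. conv g (molls (n + N))) g sequentially"
      using filterlim_compose[OF conv_molls_uniform[OF g(1,2,3)] filterlim_add_const_nat_at_top] by simp
    moreover have "continuous_on UNIV (conv g (molls (n + N)))" for n
    proof -
      have "conv g (molls (n + N)) \<in> C0_infty D" by (rule K'(4)) simp
      then have "Ck 0 (conv g (molls (n + N)))" unfolding C0_infty_def mem_Collect_eq by blast
      then show ?thesis by (rule Ck_continuous)
    qed
    moreover have "g x = 0" if "x \<notin> K'" for x using that K'(3) g(3) by blast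
    ultimately have "(%n. LBINT x. f x * conv g (molls (n + N)) x) \<longlonglongrightarrow> (LBINT x. f x * g x)"
      by (intro tendsto_integral_uniform[where K=K']) (use f K' g in \<open>auto simp: Lloc_def\<close>)
    then show ?thesis using eq[OF K'(4)] by (simp add: LIMSEQ_const_iff)
  qed
  have 2: "(LBINT x. f x * indicator K x) = 0" if K: "compact K" "K \<subseteq> D" for K
  proof (cases "K = {}")
    case False
    obtain d K' where K': "0 < d" "compact K'" "K' \<subseteq> D" "K \<subseteq> K'" "!!x y. x \<in> K ==> norm y <= d ==> x + y \<in> K'"
      using compact_neighbourhood[OF K(1) D K(2)] by metis
    define g where "g n x = max 0 (1 - real (Suc n) / d * infdist x K)" for n x
    have gc: "continuous_on UNIV (g n)" for n unfolding g_def[abs_def] by (intro continuous_intros)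
    have g0: "g n x = 0" if "x \<notin> K'" for n x
    proof -
      obtain k where k: "k \<in> K" "infdist x K = dist x k"
        using infdist_attains_inf[OF compact_imp_closed[OF K(1)] False] by metis
      have "d < infdist x K"
        using K'(5)[OF k(1), of "x - k"] that k(2) by (force simp: dist_norm)
      then have "1 <= infdist x K / d" using K'(1) by simp
      also have "... <= real (Suc n) * (infdist x K / d)"
      proof -
        have "0 <= infdist x K / d" by (rule divide_nonneg_pos[OF infdist_nonneg K'(1)])
        then show ?thesis using mult_right_mono[of 1 "real (Suc n)" "infdist x K / d"] by linarith
      qed
      finally show ?thesis by (simp add: g_def)
    qed
    have "(%n. LBINT x. f x * g n x) \<longlonglongrightarrow> (LBINT x. f x * indicator K x)"
    proof (rule integral_dominated_convergence[where w = "%x. \<bar>indicator K' x * f x\<bar>"])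
      show "integrable lborel (%x. \<bar>indicator K' x * f x\<bar>)" using f K' by (auto simp: Lloc_def)
      have [measurable]: "K \<in> sets borel" using K(1) by (simp add: borel_compact)
      show "(%x. f x * indicator K x) \<in> borel_measurable lborel" by simp
      have [measurable]: "g n \<in> borel_measurable borel" for n by (rule borel_measurable_continuous_onI[OF gc])
      show "(%x. f x * g n x) \<in> borel_measurable lborel" for n by simp
      have "0 <= real (Suc n) / d * infdist x K" for n x using K'(1) infdist_nonneg[of x K] by (intro mult_nonneg_nonneg) auto
      then have "\<bar>g n x\<bar> <= 1" for n x by (simp add: g_def)
      then have "\<bar>f x\<bar> * \<bar>g n x\<bar> <= \<bar>f x\<bar> * 1" for n x by (intro mult_left_mono) auto
      then show "AE x in lborel. norm (f x * g n x) <= \<bar>indicator K' x * f x\<bar>" for n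
        using g0 by (intro AE_I2) (auto simp: indicator_def abs_mult)
      show "AE x in lborel. (%n. f x * g n x) \<longlonglongrightarrow> f x * indicator K x"
      proof (rule AE_I2, rule tendsto_mult_left)
        fix x
        show "(%n. g n x) \<longlonglongrightarrow> indicator K x"
        proof (cases "x \<in> K")
          case True
          then show ?thesis by (simp add: g_def)
        next
          case F: False
          then have pos: "0 < infdist x K"
            using infdist_pos_not_in_closed[OF compact_imp_closed[OF K(1)] False] by simp
          have "eventually (%n. 1 / real (Suc n) < infdist x K / d) sequentially"
            using pos K'(1) by (intro eventually_inverse_Suc_less) simp
          then have "eventually (%n. g n x = 0) sequentially"
          proof eventually_elim
            case (elim n)
            have "1 < real (Suc n) * (infdist x K / d)"
              using elim by (simp add: divide_simps mult.commute split: if_splits)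
            then show ?case by (simp add: g_def)
          qed
          then show ?thesis using F by (simp add: tendsto_eventually)
        qed
      qed
    qed
    moreover have "(LBINT x. f x * g n x) = 0" for n by (rule 1[OF gc K'(2) g0 K'(3)])
    ultimately show ?thesis by (simp add: LIMSEQ_const_iff)
  qed simp
  have 3: "{x\<in>D. s * f x > 0} \<in> null_sets lborel" for s
  proof -
    define P where "P = {x\<in>D. s * f x > 0}"
    have [measurable]: "D \<in> sets borel" using D by simp
    have P: "P \<in> sets borel" unfolding P_def by measurable
    have cpt: "emeasure lebesgue K = 0" if K: "compact K" "K \<subseteq> P" for K
    proof -
      have [measurable]: "K \<in> sets borel" using K(1) by (simp add: borel_compact)
      have i: "integrable lborel (%x. s * (f x * indicator K x))"
        using f K by (auto simp: Lloc_def P_def mult.commute)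
      have "(LBINT x. s * (f x * indicator K x)) = 0"
        using 2[of K] K by (auto simp: P_def)
      then have "AE x in lborel. s * (f x * indicator K x) = 0"
      proof (subst (asm) integral_nonneg_eq_0_iff_AE[OF i])
        show "AE x in lborel. 0 <= s * (f x * indicator K x)"
          using K(2) by (intro AE_I2) (auto simp: P_def indicator_def less_imp_le)
      qed
      then have "AE x in lborel. x \<notin> K"
        by eventually_elim (use K(2) in \<open>force simp: P_def indicator_def\<close>)
      then have "K \<in> null_sets lborel" by (subst AE_iff_null_sets) auto
      then show ?thesis by (simp add: null_sets_def)
    qed
    have "emeasure lebesgue P <= ennreal e" if e: "0 < e" for e
    proof -
      obtain T where T: "closed T" "T \<subseteq> P" "P - T \<in> lmeasurable" "emeasure lebesgue (P - T) < ennreal e"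
        using sets_lebesgue_inner_closed[of P e] P e by auto
      have "emeasure lebesgue T = 0"
      proof -
        have eq: "T = (\<Union>n::nat. T \<inter> cball 0 (real n))"
          using real_arch_simple by fastforce
        have "T \<inter> cball 0 (real n) \<in> null_sets lebesgue" for n
          using cpt[OF closed_Int_compact[OF T(1) compact_cball]] T(1,2)
          by (auto simp: null_sets_def intro!: borel_closed)
        then have "(\<Union>n::nat. T \<inter> cball 0 (real n)) \<in> null_sets lebesgue" by (rule null_sets_UN)
        then show ?thesis using eq by (simp add: null_sets_def)
      qed
      moreover have "emeasure lebesgue P = emeasure lebesgue (P - T) + emeasure lebesgue T"
        using T P by (subst plus_emeasure) (auto intro!: arg_cong2[where f=emeasure] borel_closed)
      ultimately show ?thesis using T(4) by (simp add: less_imp_le)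
    qed
    then have "emeasure lebesgue P = 0"
      by (metis ennreal_le_epsilon add_0 bot_ennreal le_zero_eq zero_le)
    then show ?thesis using P by (simp add: null_sets_def P_def)
  qed
  have "AE x in lborel. x \<notin> {x\<in>D. 1 * f x > 0}" "AE x in lborel. x \<notin> {x\<in>D. -1 * f x > 0}"
    by (rule AE_not_in[OF 3])+
  then show ?thesis by eventually_elim auto
qed

section \<open>Pairing of conjugate Lebesgue classes under mollification\<close>

text \<open>Instead of the norm inequality of Hoelder, integrability of products and their
  continuity come from the cruder bound of \<open>young\<close>, which is applied after scaling
  one factor.\<close>
locale conjugate_exponents =
  fixes p q :: real
  assumes p: "1 < p" and q: "1 < q" and pq: "1 / p + 1 / q = 1"
begin

lemma young: "\<bar>a * b\<bar> <= \<bar>a\<bar> powr q + \<bar>b\<bar> powr p"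
proof -
  have "\<bar>a\<bar> * \<bar>b\<bar> <= \<bar>a\<bar> powr q / q + \<bar>b\<bar> powr p / p"
    using p q pq by (intro Youngs_inequality) auto
  also have "... <= \<bar>a\<bar> powr q + \<bar>b\<bar> powr p"
  proof -
    have "x / r <= x" if "0 <= x" "1 < r" for x r :: real
      using mult_left_mono[of 1 r x] that by (simp add: divide_le_eq)
    then show ?thesis using p q by (intro add_mono) auto
  qed
  finally show ?thesis by (simp add: abs_mult)
qed

lemma integrable_mult_Lp:
  assumes [measurable]: "a \<in> borel_measurable M" "b \<in> borel_measurable M"
    and "integrable M (%x. \<bar>a x\<bar> powr q)" "integrable M (%x. \<bar>b x\<bar> powr p)"
  shows "integrable M (%x. a x * b x)"
  by (rule Bochner_Integration.integrable_bound[where f = "%x. \<bar>a x\<bar> powr q + \<bar>b x\<bar> powr p"])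
    (use assms(3,4) young in auto)

lemma integrable_translate_mult:
  fixes P H :: "'a::euclidean_space => real"
  assumes [measurable]: "P \<in> borel_measurable borel" "H \<in> borel_measurable borel"
    and "integrable lborel (%x. \<bar>P x\<bar> powr q)" "integrable lborel (%x. \<bar>H x\<bar> powr p)"
  shows "integrable lborel (%x. P x * H (x - y))"
proof (rule integrable_mult_Lp)
  show "integrable lborel (%x. \<bar>H (x - y)\<bar> powr p)"
    using integral_lborel_translate(2)[of "%x. \<bar>H x\<bar> powr p" "-y"] assms(4) by simp
qed (use assms in auto)

text \<open>Scaling \<open>P\<close> by a large number and \<open>H\<close> by its inverse makes
  the contribution of \<open>H\<close> in \<open>young\<close> small; the translation of
  \<open>H\<close> has no effect on its integral.\<close>
lemma translate_pairing_small:
  fixes H :: "'a::euclidean_space => real"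
  assumes H[measurable]: "H \<in> borel_measurable borel" and iH: "integrable lborel (%x. \<bar>H x\<bar> powr p)" and e: "0 < e"
  obtains \<delta> where "0 < \<delta>" "!!P y. P \<in> borel_measurable borel ==> integrable lborel (%x. \<bar>P x\<bar> powr q) ==>
    (LBINT x. \<bar>P x\<bar> powr q) <= \<delta> ==> \<bar>LBINT x. P x * H (x - y)\<bar> <= e"
proof -
  define M where "M = (LBINT x. \<bar>H x\<bar> powr p)"
  have M: "0 <= M" by (simp add: M_def)
  define l where "l = 1 + 2 * M / e"
  have l: "1 <= l" using M e by (simp add: l_def)
  have "l powr 1 <= l powr p" using l p by (intro powr_mono) auto
  then have lp: "l <= l powr p" using l by simp
  have Ml: "M / l powr p <= e / 2"
  proof -
    have "M / l powr p <= M / l" using lp l M by (intro divide_left_mono) auto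
    also have "... <= e / 2" using M e l by (simp add: l_def field_simps)
    finally show ?thesis .
  qed
  define \<delta> where "\<delta> = e / (2 * l powr q)"
  have "0 < \<delta>" using l e by (simp add: \<delta>_def)
  moreover have "\<bar>LBINT x. P x * H (x - y)\<bar> <= e"
    if [measurable]: "P \<in> borel_measurable borel" and iP: "integrable lborel (%x. \<bar>P x\<bar> powr q)"
      and small: "(LBINT x. \<bar>P x\<bar> powr q) <= \<delta>" for P y
  proof -
    have iHy: "integrable lborel (%x. \<bar>H (x - y)\<bar> powr p)" and eqH: "(LBINT x. \<bar>H (x - y)\<bar> powr p) = M"
      using integral_lborel_translate[of "%x. \<bar>H x\<bar> powr p" "-y"] iH by (auto simp: M_def)
    have "\<bar>P x * H (x - y)\<bar> <= l powr q * \<bar>P x\<bar> powr q + \<bar>H (x - y)\<bar> powr p / l powr p" for x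
      using young[of "l * P x" "H (x - y) / l"] l by (simp add: abs_mult powr_mult powr_divide)
    then have "\<bar>LBINT x. P x * H (x - y)\<bar> <= (LBINT x. l powr q * \<bar>P x\<bar> powr q + \<bar>H (x - y)\<bar> powr p / l powr p)"
      using iHy iP integrable_translate_mult[OF that(1) H iP iH]
      by (intro order_trans[OF integral_abs_bound] integral_mono) auto
    also have "... = l powr q * (LBINT x. \<bar>P x\<bar> powr q) + M / l powr p"
      using iHy iP eqH by simp
    also have "... <= l powr q * \<delta> + e / 2"
      using small Ml l by (intro add_mono mult_left_mono) auto
    also have "... = e" using l by (simp add: \<delta>_def)
    finally show ?thesis .
  qed
  ultimately show thesis using that by blast
qed

text \<open>Continuity at 0 of the pairing of \<open>Q\<close> with the translates of
  \<open>H\<close>.\<close>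
definition pairing_cont :: "('a::euclidean_space => real) => ('a => real) => bool" where
  "pairing_cont Q H \<longleftrightarrow> (\<forall>e>0. \<exists>d>0. \<forall>y. norm y < d -->
     \<bar>(LBINT x. Q x * H (x - y)) - (LBINT x. Q x * H x)\<bar> <= e)"

lemma pairing_cont_approx:
  fixes H :: "'a::euclidean_space => real"
  assumes H[measurable]: "H \<in> borel_measurable borel" and iH: "integrable lborel (%x. \<bar>H x\<bar> powr p)"
    and Q[measurable]: "Q \<in> borel_measurable borel" and iQ: "integrable lborel (%x. \<bar>Q x\<bar> powr q)"
    and Qn[measurable]: "!!n. Qn n \<in> borel_measurable borel"
    and w: "integrable lborel w" "!!n. AE x in lborel. \<bar>Q x - Qn n x\<bar> powr q <= w x"
    and iQn: "!!n. integrable lborel (%x. \<bar>Qn n x\<bar> powr q)"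
    and lim: "AE x in lborel. (%n. Qn n x) \<longlonglongrightarrow> Q x"
    and good: "!!n. pairing_cont (Qn n) H"
  shows "pairing_cont Q H"
  unfolding pairing_cont_def
proof (intro allI impI)
  fix e :: real assume e: "0 < e"
  obtain \<delta> where \<delta>: "0 < \<delta>" "!!P y. P \<in> borel_measurable borel ==> integrable lborel (%x. \<bar>P x\<bar> powr q) ==>
    (LBINT x. \<bar>P x\<bar> powr q) <= \<delta> ==> \<bar>LBINT x. P x * H (x - y)\<bar> <= e / 3"
  proof -
    have "0 < e / 3" using e by simp
    from translate_pairing_small[OF H iH this] that show ?thesis by blast
  qed
  have int: "integrable lborel (%x. \<bar>Q x - Qn n x\<bar> powr q)" for n
    by (rule Bochner_Integration.integrable_bound[OF w(1)]) (use w(2)[of n] in auto)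
  have "(%n. LBINT x. \<bar>Q x - Qn n x\<bar> powr q) \<longlonglongrightarrow> (LBINT (x::'a). 0)"
  proof (rule integral_dominated_convergence[where w = w])
    show "AE x in lborel. (%n. \<bar>Q x - Qn n x\<bar> powr q) \<longlonglongrightarrow> 0"
      using lim
    proof eventually_elim
      case (elim x)
      have "(%n. \<bar>Q x - Qn n x\<bar> powr q) \<longlonglongrightarrow> \<bar>Q x - Q x\<bar> powr q"
        using q elim by (intro tendsto_powr' tendsto_intros) auto
      then show ?case by simp
    qed
  qed (use w in auto)
  then have "eventually (%n. (LBINT x. \<bar>Q x - Qn n x\<bar> powr q) < \<delta>) sequentially"
    using \<delta>(1) by (intro order_tendstoD(2)) auto
  then obtain n where n: "(LBINT x. \<bar>Q x - Qn n x\<bar> powr q) < \<delta>"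
    using eventually_happens'[OF sequentially_bot] by blast
  have close: "\<bar>(LBINT x. Q x * H (x - y)) - (LBINT x. Qn n x * H (x - y))\<bar> <= e / 3" for y
  proof -
    have "(LBINT x. Q x * H (x - y)) - (LBINT x. Qn n x * H (x - y))
      = (LBINT x. (Q x - Qn n x) * H (x - y))"
      using integrable_translate_mult[OF Q H iQ iH, of y] integrable_translate_mult[OF Qn H iQn iH, of n y]
      by (simp add: left_diff_distrib)
    then show ?thesis using \<delta>(2)[of "%x. Q x - Qn n x" y] n int by simp
  qed
  obtain d where d: "d > 0" "!!y. norm y < d ==>
     \<bar>(LBINT x. Qn n x * H (x - y)) - (LBINT x. Qn n x * H x)\<bar> <= e / 3"
  proof -
    have "0 < e / 3" using e by simp
    from good[of n, unfolded pairing_cont_def, rule_format, OF this] that show ?thesis by blast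
  qed
  have "\<bar>(LBINT x. Q x * H (x - y)) - (LBINT x. Q x * H x)\<bar> <= e" if "norm y < d" for y
    using d(2)[OF that] close[of y] close[of 0] by (simp only: diff_zero)
  then show "\<exists>d>0. \<forall>y. norm y < d -->
     \<bar>(LBINT x. Q x * H (x - y)) - (LBINT x. Q x * H x)\<bar> <= e"
    using d(1) by blast
qed

lemma Lp_compact_support_integrable:
  fixes H :: "'a::euclidean_space => real"
  assumes [measurable]: "H \<in> borel_measurable borel" and iH: "integrable lborel (%x. \<bar>H x\<bar> powr p)"
    and K: "compact K" "!!x. x \<notin> K ==> H x = 0"
  shows "integrable lborel H"
proof (rule Bochner_Integration.integrable_bound[where f = "%x. indicator K x + \<bar>H x\<bar> powr p"])
  have "integrable lborel (%x. indicator K x *\<^sub>R (1::real))"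
    by (rule borel_integrable_compact[OF K(1)]) simp
  then show "integrable lborel (%x. indicator K x + \<bar>H x\<bar> powr p)" using iH by simp
  have "\<bar>t\<bar> <= 1 + \<bar>t\<bar> powr p" for t :: real
  proof (cases "\<bar>t\<bar> <= 1")
    case False
    then have "\<bar>t\<bar> powr 1 <= \<bar>t\<bar> powr p" using p by (intro powr_mono) auto
    then show ?thesis using False by simp
  next
    case True
    then show ?thesis using powr_ge_zero[of "\<bar>t\<bar>" p] by linarith
  qed
  then show "AE x in lborel. norm (H x) <= norm (indicator K x + \<bar>H x\<bar> powr p)"
    using K(2) by (intro AE_I2) (auto simp: indicator_def)
qed simp

lemma pairing_cont_continuous:
  fixes H :: "'a::euclidean_space => real"
  assumes H[measurable]: "H \<in> borel_measurable borel" and iH: "integrable lborel (%x. \<bar>H x\<bar> powr p)"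
    and K: "compact K" "!!x. x \<notin> K ==> H x = 0"
    and g: "continuous_on UNIV g" "compact L" "!!x. x \<notin> L ==> g x = 0"
  shows "pairing_cont g H"
  unfolding pairing_cont_def
proof (intro allI impI)
  fix e :: real assume e: "0 < e"
  have [measurable]: "g \<in> borel_measurable borel" by (rule borel_measurable_continuous_onI[OF g(1)])
  have i: "integrable lborel H" by (rule Lp_compact_support_integrable[OF H iH K])
  define M where "M = (LBINT x. \<bar>H x\<bar>)"
  have M: "0 <= M" by (simp add: M_def)
  obtain d where d: "0 < d" "!!x y. norm y < d ==> \<bar>g (x - y) - g x\<bar> <= e / (M + 1)"
  proof -
    have "0 < e / (M + 1)" using e M by simp
    from continuous_compact_support_uniform[OF g this] that show ?thesis by blast
  qed
  obtain B where B: "!!x. \<bar>g x\<bar> <= B" using continuous_compact_support_bounded[OF g] by blast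
  have "\<bar>(LBINT x. g x * H (x - y)) - (LBINT x. g x * H x)\<bar> <= e" if y: "norm y < d" for y
  proof -
    have i1: "integrable lborel (%x. H x * g (y + x))" "integrable lborel (%x. H x * g x)"
      by (rule integrable_mult_bounded[OF i _ B]; simp)+
    have "(LBINT x. g x * H (x - y)) = (LBINT x. g (y + x) * H x)"
      using integral_lborel_translate(1)[of "%x. g x * H (x - y)" y] by simp
    then have "(LBINT x. g x * H (x - y)) - (LBINT x. g x * H x) = (LBINT x. H x * (g (y + x) - g x))"
      using i1 by (simp add: mult.commute[of "H _"] left_diff_distrib)
    also have "\<bar>...\<bar> <= (LBINT x. \<bar>H x\<bar> * (e / (M + 1)))"
    proof (rule order_trans[OF integral_abs_bound], rule integral_mono)
      show "integrable lborel (%x. \<bar>H x * (g (y + x) - g x)\<bar>)"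
        using i1 by (simp add: right_diff_distrib)
      show "\<bar>H x * (g (y + x) - g x)\<bar> <= \<bar>H x\<bar> * (e / (M + 1))" for x
        unfolding abs_mult using d(2)[of "-y" x] y by (intro mult_left_mono) (auto simp: add.commute)
    qed (use i in simp)
    also have "... = M * (e / (M + 1))" by (simp add: M_def)
    also have "... <= e" using e M by (simp add: field_simps)
    finally show ?thesis .
  qed
  then show "\<exists>d>0. \<forall>y. norm y < d -->
     \<bar>(LBINT x. g x * H (x - y)) - (LBINT x. g x * H x)\<bar> <= e"
    using d(1) by blast
qed

text \<open>A bounded function of bounded support is the limit almost everywhere of continuous
  functions with a common bound and common support.\<close>
lemma pairing_cont_bounded:
  fixes H :: "'a::euclidean_space => real"
  assumes H[measurable]: "H \<in> borel_measurable borel" and iH: "integrable lborel (%x. \<bar>H x\<bar> powr p)"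
    and K: "compact K" "!!x. x \<notin> K ==> H x = 0"
    and Q[measurable]: "Q \<in> borel_measurable borel" and M: "!!x. \<bar>Q x\<bar> <= M"
    and R: "!!x. R < norm x ==> Q x = 0"
  shows "pairing_cont Q H"
proof -
  have M0: "0 <= M" using M[of 0] by simp
  have "Q measurable_on UNIV"
    by (rule lebesgue_measurable_imp_measurable_on_real[OF measurable_completion]) auto
  then obtain N g where N: "negligible N" and g: "!!n. continuous_on UNIV (g n)"
    "!!x. x \<notin> N ==> (%n. g n x) \<longlonglongrightarrow> Q x"
    unfolding measurable_on_def by auto
  define G where "G n x = max 0 (min 1 (R + 1 - norm x)) * max (-M) (min M (g n x))" for n x
  have Gc: "continuous_on UNIV (G n)" for n unfolding G_def by (intro continuous_intros g)
  have G0: "G n x = 0" if "x \<notin> cball 0 (R + 1)" for n x using that by (simp add: G_def)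
  have c01: "\<bar>max 0 (min 1 t)\<bar> <= 1" for t :: real by simp
  have GM: "\<bar>G n x\<bar> <= M" for n x
  proof -
    have "\<bar>max (-M) (min M (g n x))\<bar> <= M" using M0 by (auto simp: max_def min_def abs_le_iff)
    then have "\<bar>G n x\<bar> <= 1 * M" unfolding G_def abs_mult by (intro mult_mono c01) auto
    then show ?thesis by simp
  qed
  define w :: "'a => real" where "w x = (2 * M) powr q * indicator (cball 0 (R + 1)) x" for x
  have "integrable lborel (%x::'a. indicator (cball 0 (R + 1)) x *\<^sub>R (1::real))"
    by (rule borel_integrable_compact) auto
  then have w: "integrable lborel w" by (simp add: w_def[abs_def])
  have AEN: "AE x in lborel. x \<notin> N"
  proof -
    have "AE x in lebesgue. x \<notin> N" using N by (intro AE_not_in) (simp add: negligible_iff_null_sets)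
    then show ?thesis by (simp add: AE_completion_iff)
  qed
  show ?thesis
  proof (rule pairing_cont_approx[OF H iH Q _ _ w, where Qn = G])
    show [measurable]: "G n \<in> borel_measurable borel" for n by (rule borel_measurable_continuous_onI[OF Gc])
    have b: "\<bar>t\<bar> powr q <= (2 * M) powr q" if "\<bar>t\<bar> <= 2 * M" for t using that q by (intro powr_mono2) auto
    have z: "x \<notin> cball 0 (R + 1) ==> Q x = 0" for x using R[of x] by simp
    have bb: "\<bar>t\<bar> powr q <= w x" if "\<bar>t\<bar> <= 2 * M" "x \<notin> cball 0 (R + 1) ==> t = 0" for t x
      using b[OF that(1)] that(2) q by (auto simp: w_def indicator_def)
    show "integrable lborel (%x. \<bar>Q x\<bar> powr q)"
      by (rule Bochner_Integration.integrable_bound[OF w])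
        (use bb[OF order_trans[OF M]] z M0 in \<open>auto intro!: AE_I2 order_trans[OF _ abs_ge_self]\<close>)
    show "integrable lborel (%x. \<bar>G n x\<bar> powr q)" for n
      by (rule Bochner_Integration.integrable_bound[OF w])
        (use bb[OF order_trans[OF GM]] G0 M0 in \<open>auto intro!: AE_I2 order_trans[OF _ abs_ge_self]\<close>)
    show "AE x in lborel. \<bar>Q x - G n x\<bar> powr q <= w x" for n
    proof (rule AE_I2, rule bb)
      fix x show "\<bar>Q x - G n x\<bar> <= 2 * M" using M[of x] GM[of n x] by linarith
    qed (use z G0 in auto)
    show "AE x in lborel. (%n. G n x) \<longlonglongrightarrow> Q x"
      using AEN
    proof eventually_elim
      case (elim x)
      have "(%n. G n x) \<longlonglongrightarrow> max 0 (min 1 (R + 1 - norm x)) * max (-M) (min M (Q x))"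
        unfolding G_def using g(2)[OF elim] by (intro tendsto_intros)
      moreover have "max (-M) (min M (Q x)) = Q x" using M[of x] by (auto simp: max_def min_def)
      moreover have "max 0 (min 1 (R + 1 - norm x)) * Q x = Q x"
        using R[of x] by (cases "R < norm x") auto
      ultimately show ?case by simp
    qed
    show "pairing_cont (G n) H" for n
      by (rule pairing_cont_continuous[OF H iH K Gc compact_cball G0])
  qed
qed

text \<open>Truncate \<open>Q\<close> at height \<open>n\<close>; the \<open>q\<close>-th power of
  \<open>Q\<close> dominates the error.\<close>
lemma pairing_cont:
  fixes H :: "'a::euclidean_space => real"
  assumes H[measurable]: "H \<in> borel_measurable borel" and iH: "integrable lborel (%x. \<bar>H x\<bar> powr p)"
    and K: "compact K" "!!x. x \<notin> K ==> H x = 0"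
    and Q[measurable]: "Q \<in> borel_measurable borel" and iQ: "integrable lborel (%x. \<bar>Q x\<bar> powr q)"
    and R: "!!x. R < norm x ==> Q x = 0"
  shows "pairing_cont Q H"
proof -
  define T where "T n x = max (- real n) (min (real n) (Q x))" for n x
  have T: "\<bar>T n x\<bar> <= \<bar>Q x\<bar>" "\<bar>Q x - T n x\<bar> <= \<bar>Q x\<bar>" "\<bar>T n x\<bar> <= real n" for n x by (auto simp: T_def)
  show ?thesis
  proof (rule pairing_cont_approx[OF H iH Q iQ _ iQ, where Qn = T])
    show [measurable]: "T n \<in> borel_measurable borel" for n by (simp add: T_def[abs_def])
    show "AE x in lborel. \<bar>Q x - T n x\<bar> powr q <= \<bar>Q x\<bar> powr q" for n
      using T q by (auto intro!: powr_mono2)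
    show "integrable lborel (%x. \<bar>T n x\<bar> powr q)" for n
      by (rule Bochner_Integration.integrable_bound[OF iQ]) (use T q in \<open>auto intro!: powr_mono2\<close>)
    have "eventually (%n. T n x = Q x) sequentially" for x
    proof -
      obtain N where "\<bar>Q x\<bar> <= real N" using real_arch_simple by blast
      then show ?thesis unfolding eventually_sequentially T_def by (intro exI[of _ N]) auto
    qed
    then show "AE x in lborel. (%n. T n x) \<longlonglongrightarrow> Q x" by (intro AE_I2 tendsto_eventually)
    show "pairing_cont (T n) H" for n
      by (rule pairing_cont_bounded[OF H iH K _ T(3), where R = R]) (auto simp: T_def R)
  qed
qed

text \<open>By the theorem of Fubini the left-hand side is an average, with weight \<open>molls
  n\<close>, of the pairings of \<open>Q\<close> with the translates of \<open>H\<close>.\<close>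
lemma conv_molls_pairing:
  fixes H Q :: "real^'n::finite => real"
  assumes H[measurable]: "H \<in> borel_measurable borel" and iH: "integrable lborel (%x. \<bar>H x\<bar> powr p)"
    and K: "compact K" "!!x. x \<notin> K ==> H x = 0"
    and Q[measurable]: "Q \<in> borel_measurable borel" and iQ: "integrable lborel (%x. \<bar>Q x\<bar> powr q)"
    and R: "!!x. R < norm x ==> Q x = 0"
  shows "(%n. LBINT x. Q x * conv H (molls n) x) \<longlonglongrightarrow> (LBINT x. Q x * H x)"
proof -
  define c where "c y = (LBINT x. Q x * H (x - y))" for y
  define C where "C = (LBINT x. \<bar>Q x\<bar> powr q) + (LBINT x. \<bar>H x\<bar> powr p)"
  note itm = integrable_translate_mult[OF Q H iQ iH]
  have abs_le: "(LBINT x. \<bar>Q x * H (x - y)\<bar>) <= C" for y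
  proof -
    have iHy: "integrable lborel (%x. \<bar>H (x - y)\<bar> powr p)"
      and eqH: "(LBINT x. \<bar>H (x - y)\<bar> powr p) = (LBINT x. \<bar>H x\<bar> powr p)"
      using integral_lborel_translate[of "%x. \<bar>H x\<bar> powr p" "-y"] iH by auto
    have "(LBINT x. \<bar>Q x * H (x - y)\<bar>) <= (LBINT x. \<bar>Q x\<bar> powr q + \<bar>H (x - y)\<bar> powr p)"
      using itm[of y] iHy iQ young by (intro integral_mono) auto
    also have "... = C" using iHy iQ eqH by (simp add: C_def)
    finally show ?thesis .
  qed
  have swap: "(LBINT x. Q x * conv H \<phi> x) = (LBINT y. \<phi> y * c y)" (is ?A)
    and ic: "integrable lborel (%y. \<phi> y * c y)" (is ?B) if m: "mollifier d \<phi>" for d \<phi>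
  proof -
    note [measurable] = mollifierD(6)[OF m]
    define F where "F x y = \<phi> y * (Q x * H (x - y))" for x y
    have [measurable]: "case_prod F \<in> borel_measurable (lborel \<Otimes>\<^sub>M lborel)"
      unfolding F_def[abs_def] by measurable
    have "integrable (lborel \<Otimes>\<^sub>M lborel) (%(y, x). F x y)"
    proof (rule lborel_pair.Fubini_integrable)
      show "(%(y, x). F x y) \<in> borel_measurable (lborel \<Otimes>\<^sub>M lborel)" unfolding F_def by measurable
      show "AE y in lborel. integrable lborel (%x. case (y, x) of (y, x) => F x y)"
        using itm by (intro AE_I2) (auto simp: F_def)
      show "integrable lborel (%y. LBINT x. norm (case (y, x) of (y, x) => F x y))"
      proof (rule Bochner_Integration.integrable_bound[where f = "%y. C * \<phi> y"])
        show "integrable lborel (%y. C * \<phi> y)" using mollifierD(7)[OF m] by simp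
        show "(%y. LBINT x. norm (case (y, x) of (y, x) => F x y)) \<in> borel_measurable lborel"
          unfolding F_def split_def by measurable
        have "(LBINT x. \<bar>F x y\<bar>) <= C * \<phi> y" for y
        proof -
          have "(LBINT x. \<bar>F x y\<bar>) = \<phi> y * (LBINT x. \<bar>Q x * H (x - y)\<bar>)"
            using mollifierD(2)[OF m, of y] by (simp add: F_def abs_mult)
          also have "... <= \<phi> y * C" using mollifierD(2)[OF m] abs_le by (intro mult_left_mono)
          finally show ?thesis by (simp add: mult.commute)
        qed
        then show "AE y in lborel. norm (LBINT x. norm (case (y, x) of (y, x) => F x y)) <= norm (C * \<phi> y)"
          by (intro AE_I2) (auto intro: order_trans[OF _ abs_ge_self])
      qed
    qed
    then have iF: "integrable (lborel \<Otimes>\<^sub>M lborel) (case_prod F)"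
      using lborel_pair.integrable_product_swap_iff[of "case_prod F"] by simp
    have "(LBINT x. Q x * conv H \<phi> x) = (LBINT x. LBINT y. F x y)"
      by (simp add: conv_def F_def mult.commute mult.left_commute flip: integral_mult_right_zero)
    also have "... = (LBINT y. LBINT x. F x y)"
      by (rule lborel_pair.Fubini_integral[OF iF, symmetric])
    also have "... = (LBINT y. \<phi> y * c y)" by (simp add: F_def c_def)
    finally show ?A .
    have "integrable lborel (%y. LBINT x. F x y)"
      using lborel_pair.integrable_snd[OF iF] by simp
    then show ?B by (simp add: F_def c_def)
  qed
  have c0: "c 0 = (LBINT x. Q x * H x)" by (simp add: c_def)
  show ?thesis
  proof (rule tendstoI)
    fix e :: real assume e: "0 < e"
    obtain d where d: "0 < d" "!!y. norm y < d ==> \<bar>c y - c 0\<bar> <= e / 2"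
    proof -
      have "0 < e / 2" using e by simp
      have "pairing_cont Q H" by (rule pairing_cont[OF H iH K Q iQ R])
      from this[unfolded pairing_cont_def, rule_format, OF \<open>0 < e / 2\<close>] that
      show ?thesis by (auto simp: c_def)
    qed
    show "\<forall>\<^sub>F n in sequentially. dist (LBINT x. Q x * conv H (molls n) x) (LBINT x. Q x * H x) < e"
      using eventually_inverse_Suc_less[OF d(1)]
    proof eventually_elim
      case (elim n)
      have m: "mollifier (1 / real (Suc n)) (molls n :: real^'n => real)" by (rule molls)
      have i2: "integrable lborel (molls n :: real^'n => real)" by (rule mollifierD(7)[OF m])
      have "(LBINT x. Q x * conv H (molls n) x) - (LBINT x. Q x * H x) =
        (LBINT y. molls n y * c y) - (LBINT (y::real^'n). molls n y * c 0)"
        using mollifierD(4)[OF m] by (simp add: swap[OF m] c0)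
      also have "... = (LBINT y. molls n y * (c y - c 0))"
        using ic[OF m] i2 by (simp add: right_diff_distrib)
      also have "\<bar>...\<bar> <= (LBINT (y::real^'n). molls n y * (e/2))"
      proof (rule order_trans[OF integral_abs_bound], rule integral_mono)
        show "integrable lborel (%y. \<bar>molls n y * (c y - c 0)\<bar>)"
          using ic[OF m] i2 by (simp add: right_diff_distrib)
        show "\<bar>molls n y * (c y - c 0)\<bar> <= molls n y * (e/2)" for y
        proof (cases "norm y < 1 / real (Suc n)")
          case True
          then have "molls n y * \<bar>c y - c 0\<bar> <= molls n y * (e/2)"
            using d(2)[of y] elim mollifierD(2)[OF m, of y] by (intro mult_left_mono) auto
          then show ?thesis using mollifierD(2)[OF m, of y] by (simp add: abs_mult)
        qed (use mollifierD(3)[OF m, of y] in simp)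
      qed (use i2 in simp)
      also have "... = e / 2" using mollifierD(4)[OF m] by simp
      finally show ?case using e by (simp add: dist_real_def)
    qed
  qed
qed

end

section \<open>Enlarging the class of test functions\<close>

lemma partial_deriv_reflect:
  fixes f :: "real^'n::finite => real"
  assumes "f differentiable (at (x - y))"
  shows "pd i (%y. f (x - y)) y = - pd i f (x - y)"
proof -
  have "((%y. f (x - y)) has_derivative (%v. grad f (x - y) \<bullet> (- v))) (at y)"
    by (rule has_derivative_compose[where f = "%y. x - y" and f' = "%v. - v" and g = f
          and g' = "%v. grad f (x - y) \<bullet> v", OF _ differentiable_has_derivative_grad[OF assms]])
      (auto intro!: derivative_eq_intros)
  from partial_deriv_eqI[OF this] show ?thesis by (simp add: inner_axis grad_def)
qed

lemma Ck_reflect: "Ck k f ==> Ck k (%y::real^'n::finite. f (x - y))"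
proof (induction k arbitrary: f)
  case 0
  then have "continuous_on UNIV f" by simp
  then have "continuous_on UNIV (%y. f (x - y))"
    by (rule continuous_on_compose2) (auto intro: continuous_intros)
  then show ?case by simp
next
  case (Suc k)
  have d: "f differentiable (at y)" for y using Suc.prems by simp
  have "pd i (%y. f (x - y)) = (%y. -1 * pd i f (x - y))" for i
    using partial_deriv_reflect[OF d] by auto
  moreover have "Ck k (%y. -1 * pd i f (x - y))" for i
    using Suc by (intro Ck_cmult) simp
  moreover have "(%y. f (x - y)) differentiable (at y)" for y
    by (rule differentiable_compose[OF d]) simp
  ultimately show ?case by simp
qed

text \<open>The homogeneous equation that says that the second order distribution with densities
  \<open>Q\<close> balances the first order one with densities \<open>B\<close>. For the equation
  at hand \<open>Q = \<rho>A - G\<close> and \<open>B = \<rho>b - h\<close> on \<open>D\<close>.\<close>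
locale double_divergence = conjugate_exponents +
  fixes D :: "(real^'n::finite) set" and Q :: "'n => 'n => real^'n => real" and B :: "'n => real^'n => real"
  assumes D: "open D" "bounded D"
    and Q_borel [measurable]: "!!i j. Q i j \<in> borel_measurable borel"
    and Q_int: "!!i j. integrable lborel (%x. \<bar>Q i j x\<bar> powr q)"
    and Q_0: "!!i j x. x \<notin> D ==> Q i j x = 0"
    and B_int: "!!i. integrable lborel (B i)"
    and B_0: "!!i x. x \<notin> D ==> B i x = 0"
    and equation: "!!\<phi>. \<phi> \<in> C0_infty D ==>
      (LBINT x. (\<Sum>i\<in>UNIV. \<Sum>j\<in>UNIV. Q i j x * pd i (pd j \<phi>) x)
         + (\<Sum>i\<in>UNIV. B i x * pd i \<phi> x)) = 0"
begin

lemma D_radius: obtains R where "!!x. R < norm x ==> x \<notin> D"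
proof -
  obtain R where "!!x. x \<in> D ==> norm x <= R" using D(2) unfolding bounded_iff by blast
  then show thesis using that[of R] by force
qed

text \<open>The test functions are smooth but have arbitrary support. This fits functions with
  compact support and allows translated and reflected mollifiers as test functions.\<close>
definition weak_hessian :: "(real^'n => real) => ('n => 'n => real^'n => real) => bool" where
  "weak_hessian v H \<longleftrightarrow> (\<forall>i j \<psi>. (\<forall>k. Ck k \<psi>) -->
     (LBINT x. v x * pd i (pd j \<psi>) x) = (LBINT x. H i j x * \<psi> x))"

text \<open>Mollify \<open>v\<close>: the mollified function is an admissible test function, its
  second derivatives are the mollifications of \<open>H\<close>, and the pairings with
  \<open>Q\<close> converge by \<open>conv_molls_pairing\<close>, those with \<open>B\<close> by
  uniform convergence.\<close>
lemma equation_weak_hessian: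
  assumes v: "Ck (Suc 0) v" and K: "compact K" "!!x. x \<notin> K ==> v x = 0" "K \<subseteq> D"
    and H[measurable]: "!!i j. H i j \<in> borel_measurable borel"
    and iH: "!!i j. integrable lborel (%x. \<bar>H i j x\<bar> powr p)"
    and H0: "!!i j x. x \<notin> K ==> H i j x = 0"
    and weak: "weak_hessian v H"
  shows "!!i j. integrable lborel (%x. Q i j x * H i j x)"
    and "!!i. integrable lborel (%x. B i x * pd i v x)"
    and "(\<Sum>i\<in>UNIV. \<Sum>j\<in>UNIV. LBINT x. Q i j x * H i j x) + (\<Sum>i\<in>UNIV. LBINT x. B i x * pd i v x) = 0"
proof -
  have vc: "continuous_on UNIV v" by (rule Ck_continuous[OF v])
  have v1c: "continuous_on UNIV (pd i v)" for i by (rule Ck_continuous[OF Ck_partial[OF v]])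
  have v10: "x \<notin> K ==> pd i v x = 0" for i x by (rule partial_deriv_outside[OF K(1,2)])
  have [measurable]: "v \<in> borel_measurable borel" "pd i v \<in> borel_measurable borel"
      "B i \<in> borel_measurable borel" for i
    using vc v1c B_int[THEN borel_measurable_integrable] by (auto intro: borel_measurable_continuous_onI)
  have BB: "integrable lborel (%x. B i x * g x)" if g: "continuous_on UNIV g" "compact L" "!!x. x \<notin> L ==> g x = 0" for i g L
  proof -
    obtain C where C: "!!x. \<bar>g x\<bar> <= C" using continuous_compact_support_bounded[OF g] by blast
    show ?thesis
      by (rule integrable_mult_bounded[OF B_int _ C]) (use borel_measurable_continuous_onI[OF g(1)] in simp)
  qed
  show iB: "integrable lborel (%x. B i x * pd i v x)" for i
    by (rule BB[OF v1c K(1) v10])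
  show iQ: "integrable lborel (%x. Q i j x * H i j x)" for i j
    by (rule integrable_mult_Lp) (use Q_int iH in auto)
  obtain R where R: "!!x. R < norm x ==> x \<notin> D" using D_radius by blast
  obtain K' N where K': "compact K'" "K' \<subseteq> D" "K \<subseteq> K'"
    "!!n. n \<ge> N ==> conv v (molls n) \<in> C0_infty D"
    "!!n x. n \<ge> N ==> x \<notin> K' ==> conv v (molls n) x = 0"
    using conv_molls_C0_infty[OF vc K(1,2) D(1) K(3)] by metis
  obtain R' where "K \<subseteq> cbox (-R') R'" using bounded_subset_cbox_symmetric compact_imp_bounded[OF K(1)] by metis
  then have R': "!!y. y \<notin> cbox (-R') R' ==> v y = 0" using K by auto
  have hess: "pd i (pd j (conv v (molls n))) x = conv (H i j) (molls n) x" for i j n x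
  proof -
    note m = molls[of n]
    let ?f = "molls n :: real^'n => real"
    have C: "Ck k ?f" for k by (rule mollifierD(1)[OF m])
    have C1: "Ck (Suc 0) ?f" "Ck (Suc 0) (pd j ?f)"
      using C[of "Suc 0"] Ck_partial[OF C[of "Suc (Suc 0)"]] by auto
    have [measurable]: "?f \<in> borel_measurable borel" by (rule mollifierD(6)[OF m])
    have "conv v ?f = conv ?f v" by (rule ext, rule conv_commute) auto
    then have "pd i (pd j (conv v ?f)) = conv (pd i (pd j ?f)) v"
      by (simp add: partial_deriv_conv[OF C1(1) vc R'] partial_deriv_conv[OF C1(2) vc R'])
    then have "pd i (pd j (conv v ?f)) x = (LBINT y. pd i (pd j ?f) (x - y) * v y)"
      by (simp add: conv_def)
    also have "... = (LBINT y. v y * pd i (pd j (%y. ?f (x - y))) y)"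
    proof (rule Bochner_Integration.integral_cong[OF refl])
      fix y
      have "pd j (%y. ?f (x - y)) = (%y. -1 * pd j ?f (x - y))"
        using partial_deriv_reflect[OF Ck_Suc_differentiable[OF C1(1)]] by auto
      moreover have "(%y. pd j ?f (x - y)) differentiable (at y)"
        by (rule Ck_Suc_differentiable[OF Ck_reflect[OF C1(2)]])
      ultimately have "pd i (pd j (%y. ?f (x - y))) y = pd i (pd j ?f) (x - y)"
        using partial_deriv_mult[of "%y. -1" y "%y. pd j ?f (x - y)" i]
          partial_deriv_reflect[OF Ck_Suc_differentiable[OF C1(2)], of i x y] by simp
      then show "pd i (pd j ?f) (x - y) * v y =
         v y * pd i (pd j (%y. ?f (x - y))) y" by simp
    qed
    also have "... = (LBINT y. H i j y * ?f (x - y))"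
      using weak Ck_reflect[OF C] unfolding weak_hessian_def by blast
    also have "... = conv ?f (H i j) x" by (simp add: conv_def mult.commute)
    also have "... = conv (H i j) ?f x" by (rule conv_commute) auto
    finally show ?thesis .
  qed
  have p1: "pd i (conv v (molls n)) = conv (pd i v) (molls n)" for i n
    by (rule partial_conv_molls[OF v])
  let ?S = "%n. (\<Sum>i\<in>UNIV. \<Sum>j\<in>UNIV. LBINT x. Q i j x * conv (H i j) (molls n) x)
      + (\<Sum>i\<in>UNIV. LBINT x. B i x * conv (pd i v) (molls n) x)"
  have S0: "?S n = 0" if n: "n \<ge> N" for n
  proof -
    have phi: "conv v (molls n) \<in> C0_infty D" by (rule K'(4)[OF n])
    then have phiC: "Ck k (conv v (molls n))" for k by (simp add: C0_infty_def del: Ck.simps)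
    have z: "x \<notin> K' ==> conv v (molls n) x = 0" for x by (rule K'(5)[OF n])
    have c1: "continuous_on UNIV (pd i (conv v (molls n)))" for i
      by (rule Ck_continuous[OF Ck_partial[OF phiC[of "Suc 0"]]])
    have c2: "continuous_on UNIV (pd i (pd j (conv v (molls n))))" for i j
      by (rule Ck_continuous[OF Ck_partial[OF Ck_partial[OF phiC[of "Suc (Suc 0)"]]]])
    have z1: "x \<notin> K' ==> pd i (conv v (molls n)) x = 0" for i x
      by (rule partial_deriv_outside[OF K'(1) z])
    have z2: "x \<notin> K' ==> pd i (pd j (conv v (molls n))) x = 0" for i j x
      by (rule partial_deriv_outside[OF K'(1) z1])
    have i1: "integrable lborel (%x. B i x * pd i (conv v (molls n)) x)" for i
      by (rule BB[OF c1 K'(1) z1])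
    have i2: "integrable lborel (%x. Q i j x * pd i (pd j (conv v (molls n))) x)" for i j
    proof (rule integrable_mult_Lp[OF _ _ Q_int])
      show [measurable]: "pd i (pd j (conv v (molls n))) \<in> borel_measurable lborel"
        using borel_measurable_continuous_onI[OF c2] by simp
      show "integrable lborel (%x. \<bar>pd i (pd j (conv v (molls n))) x\<bar> powr p)"
        by (rule integrable_continuous_compact_support[OF _ K'(1)])
          (use z2 p c2 in \<open>auto intro!: continuous_intros continuous_on_powr'\<close>)
    qed simp
    have "?S n = (\<Sum>i\<in>UNIV. \<Sum>j\<in>UNIV. LBINT x. Q i j x * pd i (pd j (conv v (molls n))) x)
      + (\<Sum>i\<in>UNIV. LBINT x. B i x * pd i (conv v (molls n)) x)"
      by (simp only: hess[symmetric] p1[symmetric])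
    also have "... = (LBINT x. (\<Sum>i\<in>UNIV. \<Sum>j\<in>UNIV. Q i j x * pd i (pd j (conv v (molls n))) x)
         + (\<Sum>i\<in>UNIV. B i x * pd i (conv v (molls n)) x))"
      using i1 i2 by (simp add: Bochner_Integration.integral_add Bochner_Integration.integral_sum Bochner_Integration.integrable_sum)
    also have "... = 0" by (rule equation[OF phi])
    finally show ?thesis .
  qed
  have "?S \<longlonglongrightarrow> (\<Sum>i\<in>UNIV. \<Sum>j\<in>UNIV. LBINT x. Q i j x * H i j x) + (\<Sum>i\<in>UNIV. LBINT x. B i x * pd i v x)"
  proof (intro tendsto_add tendsto_sum)
    fix i j :: 'n
    show "(%n. LBINT x. Q i j x * conv (H i j) (molls n) x) \<longlonglongrightarrow> (LBINT x. Q i j x * H i j x)"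
      by (rule conv_molls_pairing[OF H iH K(1) H0 Q_borel Q_int]) (use R Q_0 in auto)
  next
    fix i :: 'n
    have w0: "x \<notin> K' ==> pd i v x = 0" for x using v10 K'(3) by blast
    have "(%n. LBINT x. B i x * conv (pd i v) (molls (n + N)) x) \<longlonglongrightarrow> (LBINT x. B i x * pd i v x)"
    proof (rule tendsto_integral_uniform[OF _ K'(1) v1c w0])
      show "integrable lborel (%x. indicat_real K' x * B i x)"
        using integrable_mult_bounded[OF B_int, of "indicat_real K'" 1] borel_measurable_indicator[OF borel_compact[OF K'(1)]]
        by (auto simp: mult.commute[of "indicat_real _ _"])
      show "continuous_on UNIV (conv (pd i v) (molls (n + N)))" for n
        by (rule continuous_conv[OF v1c mollifierD(5)[OF molls] mollifierD(8)[OF molls]])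
      show "conv (pd i v) (molls (n + N)) x = 0" if "x \<notin> K'" for n x
        unfolding p1[symmetric] by (rule partial_deriv_outside[OF K'(1) K'(5) that]) auto
      show "uniform_limit UNIV (%n. conv (pd i v) (molls (n + N))) (pd i v) sequentially"
        using filterlim_compose[OF conv_molls_uniform[OF v1c K(1) v10] filterlim_add_const_nat_at_top] by simp
    qed
    then show "(%n. LBINT x. B i x * conv (pd i v) (molls n) x) \<longlonglongrightarrow> (LBINT x. B i x * pd i v x)"
      by (rule LIMSEQ_offset)
  qed
  moreover have "?S \<longlonglongrightarrow> 0"
    by (rule tendsto_eventually) (use S0 in \<open>auto simp: eventually_sequentially\<close>)
  ultimately show "(\<Sum>i\<in>UNIV. \<Sum>j\<in>UNIV. LBINT x. Q i j x * H i j x) + (\<Sum>i\<in>UNIV. LBINT x. B i x * pd i v x) = 0"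
    by (rule LIMSEQ_unique)
qed

lemma weak_hessian_C2:
  assumes v: "Ck 2 v" and K: "compact K" "!!x. x \<notin> K ==> v x = 0"
  shows "weak_hessian v (%i j. pd j (pd i v))"
  unfolding weak_hessian_def
proof (intro allI impI)
  fix i j and \<psi> :: "real^'n => real" assume psi: "\<forall>k. Ck k \<psi>"
  note C = Ck_2_partials[OF v] and P = Ck_2_partials[OF psi[rule_format]]
  have "(LBINT x. v x * pd i (pd j \<psi>) x) = - (LBINT x. pd i v x * pd j \<psi> x)"
    by (rule integration_by_parts[OF C(1) P(2) K])
  also have "... = (LBINT x. pd j (pd i v) x * \<psi> x)"
    using integration_by_parts[OF C(2) P(1) K(1) partial_deriv_outside[OF K]] by simp
  finally show "(LBINT x. v x * pd i (pd j \<psi>) x) =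
    (LBINT x. pd j (pd i v) x * \<psi> x)" .
qed

lemma equation_C2:
  assumes v: "Ck 2 v" and K: "compact K" "!!x. x \<notin> K ==> v x = 0" "K \<subseteq> D"
  shows "!!i j. integrable lborel (%x. Q i j x * pd j (pd i v) x)"
    and "!!i. integrable lborel (%x. B i x * pd i v x)"
    and "(\<Sum>i\<in>UNIV. \<Sum>j\<in>UNIV. LBINT x. Q i j x * pd j (pd i v) x)
      + (\<Sum>i\<in>UNIV. LBINT x. B i x * pd i v x) = 0"
proof -
  note C = Ck_2_partials[OF v]
  have z2: "x \<notin> K ==> pd j (pd i v) x = 0" for i j x
    by (rule partial_deriv_outside[OF K(1) partial_deriv_outside[OF K(1,2)]])
  have "integrable lborel (%x. \<bar>pd j (pd i v) x\<bar> powr p)" for i j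
    by (rule integrable_continuous_compact_support[OF _ K(1)])
      (use z2 p C(5) in \<open>auto intro!: continuous_intros continuous_on_powr'\<close>)
  note * = equation_weak_hessian[OF C(1) K borel_measurable_continuous_onI[OF C(5)] this z2 weak_hessian_C2[OF v K(1,2)]]
  show "integrable lborel (%x. Q i j x * pd j (pd i v) x)" for i j by (rule *(1))
  show "integrable lborel (%x. B i x * pd i v x)" for i by (rule *(2))
  show "(\<Sum>i\<in>UNIV. \<Sum>j\<in>UNIV. LBINT x. Q i j x * pd j (pd i v) x)
      + (\<Sum>i\<in>UNIV. LBINT x. B i x * pd i v x) = 0"
    by (rule *(3))
qed

text \<open>The factor \<open>f\<close> is used on \<open>D\<close> only, where it is regular.\<close>
definition cutoff :: "(real^'n => real) => (real^'n => real) => real^'n => real" where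
  "cutoff f \<zeta> x = (if x \<in> D then f x * \<zeta> x else 0)"

lemma cutoff_C1:
  assumes f: "!!x. x \<in> D ==> f differentiable (at x)" "!!i. continuous_on D (pd i f)"
    and \<zeta>: "Ck (Suc 0) \<zeta>" and K: "compact K" "!!x. x \<notin> K ==> \<zeta> x = 0" "K \<subseteq> D"
  shows "Ck (Suc 0) (cutoff f \<zeta>)"
    and "pd i (cutoff f \<zeta>) x = (if x \<in> D then pd i f x * \<zeta> x + f x * pd i \<zeta> x else 0)"
    and "x \<notin> K ==> cutoff f \<zeta> x = 0"
proof -
  show z: "x \<notin> K ==> cutoff f \<zeta> x = 0" for x using K by (simp add: cutoff_def)
  have dz: "\<zeta> differentiable (at x)" for x by (rule Ck_Suc_differentiable[OF \<zeta>])
  have p: "pd i (cutoff f \<zeta>) x = (if x \<in> D then pd i f x * \<zeta> x + f x * pd i \<zeta> x else 0)" for i x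
  proof (cases "x \<in> D")
    case True
    have "pd i (cutoff f \<zeta>) x = pd i (%x. f x * \<zeta> x) x"
      by (rule partial_deriv_cong_open[OF D(1) True]) (simp add: cutoff_def)
    then show ?thesis using True partial_deriv_mult[OF f(1)[OF True] dz] by simp
  next
    case False
    then show ?thesis using partial_deriv_outside[of K "cutoff f \<zeta>" x i] z K by auto
  qed
  show "pd i (cutoff f \<zeta>) x = (if x \<in> D then pd i f x * \<zeta> x + f x * pd i \<zeta> x else 0)"
    by (rule p)
  have fc: "continuous_on D f"
    by (rule continuous_at_imp_continuous_on) (use f(1) differentiable_imp_continuous_within in blast)
  have "cutoff f \<zeta> differentiable (at x)" for x
  proof (cases "x \<in> D")
    case True
    then have "(%x. f x * \<zeta> x) differentiable (at x)" using f(1) dz by (intro differentiable_mult)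
    then show ?thesis unfolding differentiable_def
      using has_derivative_transform_within_open[OF _ D(1) True, of "%x. f x * \<zeta> x" _ UNIV "cutoff f \<zeta>"] by (auto simp: cutoff_def)
  next
    case False
    then have x: "x \<in> - K" "open (- K)" using K compact_imp_closed by auto
    have "((%x. 0::real) has_derivative (%v. 0)) (at x)" by simp
    then have "(cutoff f \<zeta> has_derivative (%v. 0)) (at x)"
      by (rule has_derivative_transform_within_open[OF _ x(2,1)]) (use z in auto)
    then show ?thesis by (auto simp: differentiable_def)
  qed
  moreover have "continuous_on UNIV (pd i (cutoff f \<zeta>))" for i
  proof -
    have U: "D \<union> - K = UNIV" "open (- K)" using K compact_imp_closed by auto
    have "continuous_on D (%x. pd i f x * \<zeta> x + f x * pd i \<zeta> x)"
      using Ck_continuous[OF \<zeta>] Ck_continuous[OF Ck_partial[OF \<zeta>]] fc f(2) by (intro continuous_intros)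
    then have "continuous_on D (pd i (cutoff f \<zeta>))"
      by (rule continuous_on_eq) (simp add: p)
    moreover have "continuous_on (- K) (pd i (cutoff f \<zeta>))"
      by (rule continuous_on_eq[of _ "%x. 0"]) (use partial_deriv_outside[OF K(1) z] in auto)
    ultimately show ?thesis using continuous_on_open_Un[OF D(1) U(2)] U(1) by metis
  qed
  ultimately show "Ck (Suc 0) (cutoff f \<zeta>)" by simp
qed

text \<open>The product rule for weak second derivatives. Testing with \<open>\<psi>\<close> is
  reduced to testing \<open>u\<close> with the second derivatives of \<open>\<zeta>
  \<psi>\<close>, which has compact support in \<open>D\<close>; the mixed terms are integrated by
  parts.\<close>
lemma weak_hessian_cutoff:
  assumes u: "!!x. x \<in> D ==> u differentiable (at x)" "!!i. continuous_on D (pd i u)"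
    and H[measurable]: "!!i j. H i j \<in> borel_measurable borel"
    and Hloc: "!!i j. Lloc D (H i j)"
    and ub[measurable]: "u \<in> borel_measurable borel"
    and weak: "!!i j \<phi>. \<phi> \<in> C0_infty D ==>
       (LBINT x. u x * pd i (pd j \<phi>) x) = (LBINT x. H i j x * \<phi> x)"
    and \<zeta>: "Ck 2 \<zeta>" and K: "compact K" "!!x. x \<notin> K ==> \<zeta> x = 0" "K \<subseteq> D"
  shows "weak_hessian (cutoff u \<zeta>) (%i j x. if x \<in> D then H i j x * \<zeta> x + pd i u x * pd j \<zeta> x
      + pd j u x * pd i \<zeta> x + u x * pd j (pd i \<zeta>) x else 0)"
  unfolding weak_hessian_def
proof (intro allI impI)
  fix i j and \<psi> :: "real^'n => real" assume psi: "\<forall>k. Ck k \<psi>"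
  note C = Ck_2_partials[OF \<zeta>] and P = Ck_2_partials[OF psi[rule_format]]
  have z1: "x \<notin> K ==> pd i \<zeta> x = 0" for i x by (rule partial_deriv_outside[OF K(1,2)])
  have z2: "x \<notin> K ==> pd j (pd i \<zeta>) x = 0" for i j x
    by (rule partial_deriv_outside[OF K(1) z1])
  have uc: "continuous_on D u"
    by (rule continuous_at_imp_continuous_on) (use u(1) differentiable_imp_continuous_within in blast)
  have outside: "x \<notin> K" if "x \<notin> D" for x using that K(3) by blast
  have int: "integrable lborel (%x. if x \<in> D then g x else 0)" if "continuous_on D g" "!!x. x \<notin> K ==> g x = 0" for g :: "real^'n => real"
  proof -
    have "(%x. if x \<in> D then g x else 0) = (%x. indicator K x *\<^sub>R g x)"
      using that(2) K(3) by (auto simp: indicator_def fun_eq_iff)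
    then show ?thesis
      using borel_integrable_compact[OF K(1) continuous_on_subset[OF that(1) K(3)]] by simp
  qed
  have ulocal: "Lloc D u" unfolding Lloc_def
    using borel_integrable_compact[OF _ continuous_on_subset[OF uc]] ub by (auto simp: real_scaleR_def[symmetric] simp del: real_scaleR_def)
  have zp: "Ck 2 (%x. \<zeta> x * \<psi> x)" using \<zeta> psi by (intro Ck_mult) auto
  have w: "(LBINT x. u x * pd i (pd j (%x. \<zeta> x * \<psi> x)) x) = (LBINT x. H i j x * (\<zeta> x * \<psi> x))"
    by (rule weak_derivative2_C2_test[OF D(1) ulocal Hloc weak zp K(1) _ K(3)]) (auto simp: K(2))
  have e1: "pd j (%x. \<zeta> x * \<psi> x) = (%x. pd j \<zeta> x * \<psi> x + \<zeta> x * pd j \<psi> x)"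
    by (rule ext, rule partial_deriv_mult[OF C(6) P(6)])
  have e2: "pd i (pd j (%x. \<zeta> x * \<psi> x)) x =
      (pd i (pd j \<zeta>) x * \<psi> x + pd j \<zeta> x * pd i \<psi> x)
     + (pd i \<zeta> x * pd j \<psi> x + \<zeta> x * pd i (pd j \<psi>) x)" for x
    unfolding e1 by (subst partial_deriv_add)
      (auto intro!: differentiable_mult C P simp: partial_deriv_mult[OF C(7) P(6)] partial_deriv_mult[OF C(6) P(7)])
  define T0 where "T0 x = cutoff u \<zeta> x * pd i (pd j \<psi>) x" for x
  define T1 where "T1 x = (if x \<in> D then u x * pd i (pd j \<zeta>) x * \<psi> x else 0)" for x
  define T2 where "T2 x = cutoff u (pd j \<zeta>) x * pd i \<psi> x" for x
  define T3 where "T3 x = cutoff u (pd i \<zeta>) x * pd j \<psi> x" for x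
  define S2 where "S2 x = (if x \<in> D then (pd i u x * pd j \<zeta> x + u x * pd i (pd j \<zeta>) x) * \<psi> x else 0)" for x
  define S3 where "S3 x = (if x \<in> D then (pd j u x * pd i \<zeta> x + u x * pd j (pd i \<zeta>) x) * \<psi> x else 0)" for x
  note cc = uc u(2) continuous_on_mult continuous_on_add C(3-5) P(3-5)
  have iT0: "integrable lborel T0"
  proof -
    have "T0 = (%x. if x \<in> D then u x * \<zeta> x * pd i (pd j \<psi>) x else 0)"
      by (auto simp: T0_def cutoff_def)
    then show ?thesis by (simp only:) (intro int cc, simp add: K(2))
  qed
  have iT1: "integrable lborel T1" unfolding T1_def by (intro int cc) (simp add: z2)
  have iT2: "integrable lborel T2"
  proof -
    have "T2 = (%x. if x \<in> D then u x * pd j \<zeta> x * pd i \<psi> x else 0)"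
      by (auto simp: T2_def cutoff_def)
    then show ?thesis by (simp only:) (intro int cc, simp add: z1)
  qed
  have iT3: "integrable lborel T3"
  proof -
    have "T3 = (%x. if x \<in> D then u x * pd i \<zeta> x * pd j \<psi> x else 0)"
      by (auto simp: T3_def cutoff_def)
    then show ?thesis by (simp only:) (intro int cc, simp add: z1)
  qed
  have iS2: "integrable lborel S2" unfolding S2_def by (intro int cc) (simp add: z1 z2)
  have iS3: "integrable lborel S3" unfolding S3_def by (intro int cc) (simp add: z1 z2)
  have iH: "integrable lborel (%x. H i j x * (\<zeta> x * \<psi> x))"
  proof -
    have c: "continuous_on UNIV (%x. \<zeta> x * \<psi> x)" by (intro cc)
    obtain M where M: "!!x. \<bar>\<zeta> x * \<psi> x\<bar> <= M"
      using continuous_compact_support_bounded[OF c K(1)] K(2) by (metis mult_zero_left)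
    have i: "integrable lborel (%x. indicator K x * H i j x)" using Hloc K by (auto simp: Lloc_def)
    have "integrable lborel (%x. (indicator K x * H i j x) * (\<zeta> x * \<psi> x))"
      by (rule integrable_mult_bounded[OF i _ M]) (use borel_measurable_continuous_onI[OF c] in simp)
    moreover have "(%x. (indicator K x * H i j x) * (\<zeta> x * \<psi> x)) = (%x. H i j x * (\<zeta> x * \<psi> x))"
      using K(2) by (auto simp: indicator_def fun_eq_iff)
    ultimately show ?thesis by simp
  qed
  have "(LBINT x. H i j x * (\<zeta> x * \<psi> x)) = (LBINT x. ((T1 x + T2 x) + T3 x) + T0 x)"
    unfolding w[symmetric] e2
    by (rule Bochner_Integration.integral_cong[OF refl])
      (auto simp: T0_def T1_def T2_def T3_def cutoff_def algebra_simps z1 z2 K(2) outside)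
  also have "... = ((LBINT x. T1 x) + (LBINT x. T2 x)) + (LBINT x. T3 x) + (LBINT x. T0 x)"
    using iT0 iT1 iT2 iT3 by simp
  finally have eq1: "(LBINT x. H i j x * (\<zeta> x * \<psi> x)) =
    (LBINT x. T1 x) + (LBINT x. T2 x) + (LBINT x. T3 x) + (LBINT x. T0 x)" .
  have IBP: "(LBINT x. cutoff u (pd k \<zeta>) x * pd l \<psi> x) =
     - (LBINT x. (if x \<in> D then (pd l u x * pd k \<zeta> x + u x * pd l (pd k \<zeta>) x) * \<psi> x else 0))"
    for k l
  proof -
    note cu = cutoff_C1[OF u C(2) K(1) z1 K(3)]
    show ?thesis
      by (subst integration_by_parts[OF cu(1) P(1) K(1) cu(3)])
        (auto simp: cu(2) intro!: Bochner_Integration.integral_cong)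
  qed
  have eq2: "(LBINT x. T2 x) = - (LBINT x. S2 x)" "(LBINT x. T3 x) = - (LBINT x. S3 x)"
    unfolding T2_def T3_def S2_def S3_def by (rule IBP)+
  have "(LBINT x. T0 x) = (LBINT x. H i j x * (\<zeta> x * \<psi> x)) - (LBINT x. T1 x) + (LBINT x. S2 x) + (LBINT x. S3 x)"
    using eq1 eq2 by simp
  also have "... = (LBINT x. ((H i j x * (\<zeta> x * \<psi> x) - T1 x) + S2 x) + S3 x)"
    using iH iT1 iS2 iS3 by simp
  also have "... = (LBINT x. (if x \<in> D then H i j x * \<zeta> x + pd i u x * pd j \<zeta> x
      + pd j u x * pd i \<zeta> x + u x * pd j (pd i \<zeta>) x else 0) * \<psi> x)"
    by (rule Bochner_Integration.integral_cong[OF refl])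
      (auto simp: T1_def S2_def S3_def algebra_simps K(2) outside)
  finally show "(LBINT x. cutoff u \<zeta> x * pd i (pd j \<psi>) x) =
    (LBINT x. (if x \<in> D then H i j x * \<zeta> x + pd i u x * pd j \<zeta> x
      + pd j u x * pd i \<zeta> x + u x * pd j (pd i \<zeta>) x else 0) * \<psi> x)"
    by (simp add: T0_def)
qed

end

section \<open>Metric outer measures\<close>

definition metric_outer_measure :: "('a::metric_space set => ennreal) => bool" where
  "metric_outer_measure f \<longleftrightarrow> f {} = 0 \<and> (\<forall>A B. A \<subseteq> B --> f A <= f B) \<and>
     (\<forall>A :: nat => 'a set. f (\<Union>n. A n) <= (\<Sum>n. f (A n))) \<and>
     (\<forall>A B d. 0 < d --> (\<forall>x\<in>A. \<forall>y\<in>B. d <= dist x y) --> f A + f B <= f (A \<union> B))"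

lemma metric_outer_measureD:
  assumes "metric_outer_measure f"
  shows "f {} = 0" "A \<subseteq> B ==> f A <= f B" "f (\<Union>n. C n) <= (\<Sum>n. f (C n :: 'a::metric_space set))"
    "0 < d ==> (!!x y. x \<in> A ==> y \<in> B ==> d <= dist x y) ==> f A + f B <= f (A \<union> B)"
  using assms unfolding metric_outer_measure_def by blast+

lemma metric_outer_measure_Un:
  assumes f: "metric_outer_measure f" shows "f (A \<union> B) <= f A + f B"
proof -
  have "f (\<Union>n. binaryset A B n) <= (\<Sum>n. f (binaryset A B n))" by (rule metric_outer_measureD(3)[OF f])
  also have "... = f A + f B" by (rule suminf_binaryset_eq) (rule metric_outer_measureD(1)[OF f])
  finally show ?thesis by (simp add: UN_binaryset_eq)
qed

lemma suminf_half_ennreal: "0 < e ==> (\<Sum>n. ennreal (e * (1/2)^Suc n)) = ennreal e"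
proof (rule suminf_ennreal_eq)
  show "(%n. e * (1/2)^Suc n) sums e" using sums_mult[OF power_half_series, of e] by (simp only: mult_1_right)
qed simp

text \<open>This is the criterion of Caratheodory. Split the complement of \<open>F\<close> into
  shells by the distance to \<open>F\<close>; shells with indices of equal parity are separated,
  so the sum over all shells converges, and the part of \<open>E\<close> close to \<open>F\<close>
  but off \<open>F\<close> has small outer measure.\<close>
lemma metric_outer_measure_closed:
  fixes F :: "'a::metric_space set"
  assumes f: "metric_outer_measure f" and F: "closed F"
  shows "f (E \<inter> F) + f (E - F) <= f E"
proof (cases "F = {} \<or> f E = \<infinity>")
  case True
  then show ?thesis using metric_outer_measureD(1)[OF f] by auto
next
  case False
  then have F0: "F \<noteq> {}" and fin: "f E \<noteq> \<infinity>" by auto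
  define G where "G n = {x \<in> E. 1 / real (Suc n) <= infdist x F}" for n
  define R where "R n = {x \<in> E. infdist x F < 1 / real (Suc n) \<and> 1 / real (Suc (Suc n)) <= infdist x F}" for n
  note D = metric_outer_measureD[OF f]
  have le1: "f (E \<inter> F) + f (G n) <= f E" for n
  proof -
    have "f (E \<inter> F) + f (G n) <= f ((E \<inter> F) \<union> G n)"
    proof (rule D(4)[of "1 / real (Suc n)"])
      fix x y assume "x \<in> E \<inter> F" "y \<in> G n"
      then show "1 / real (Suc n) <= dist x y"
        using infdist_le[of x F y] by (simp add: G_def dist_commute)
    qed simp
    also have "... <= f E" by (rule D(2)) (auto simp: G_def)
    finally show ?thesis .
  qed
  have sep: "1 / real (Suc (Suc i)) - 1 / real (Suc j) <= dist x y" if "x \<in> R i" "y \<in> R j" for i j x y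
    using that infdist_triangle[of x F y] by (auto simp: R_def)
  have alt: "(\<Sum>i<n. f (R (2 * i + k))) <= f E" for n k
  proof -
    define d where "d j = 1 / real (2 * j + k) - 1 / real (Suc (2 * j + k))" for j
    have "(\<Sum>i<n. f (R (2 * i + k))) <= f (\<Union>i<n. R (2 * i + k))"
    proof (induction n)
      case (Suc n)
      show ?case
      proof (cases "n = 0")
        case True
        then show ?thesis by (simp add: lessThan_Suc)
      next
        case nz: False
        then have dp: "0 < d n" by (simp add: d_def frac_less2)
        have "(\<Sum>i<Suc n. f (R (2 * i + k))) <= f (\<Union>i<n. R (2 * i + k)) + f (R (2 * n + k))" using Suc by (simp add: add_right_mono)
        also have "... <= f ((\<Union>i<n. R (2 * i + k)) \<union> R (2 * n + k))"
        proof (rule D(4)[OF dp])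
          fix x y assume "x \<in> (\<Union>i<n. R (2 * i + k))" and y: "y \<in> R (2 * n + k)"
          then obtain i where i: "i < n" "x \<in> R (2 * i + k)" by auto
          have "1 / real (2 * n + k) <= 1 / real (Suc (Suc (2 * i + k)))"
            using i by (intro divide_left_mono) auto
          then show "d n <= dist x y" using sep[OF i(2) y] unfolding d_def by linarith
        qed
        also have "(\<Union>i<n. R (2 * i + k)) \<union> R (2 * n + k) = (\<Union>i<Suc n. R (2 * i + k))" by (auto simp: less_Suc_eq)
        finally show ?thesis .
      qed
    qed (use D(1) in simp)
    also have "... <= f E" by (rule D(2)) (auto simp: R_def)
    finally show ?thesis .
  qed
  have total: "(\<Sum>i<n. f (R i)) <= 2 * f E" for n
  proof -
    have "(\<Sum>i<n. f (R i)) <= (\<Sum>i<2*n. f (R i))" by (intro sum_mono2) auto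
    also have "... = (\<Sum>i<n. f (R (2 * i + 0))) + (\<Sum>i<n. f (R (2 * i + 1)))"
      by (induction n) (auto simp: ac_simps)
    also have "... <= f E + f E" by (intro add_mono alt)
    finally show ?thesis by (simp add: mult_2)
  qed
  have Rfin: "f (R i) \<noteq> \<infinity>" for i
    using D(2)[of "R i" E] fin by (auto simp: R_def top_unique)
  define r where "r i = enn2real (f (R i))" for i
  have fr: "f (R i) = ennreal (r i)" for i using Rfin[of i] by (simp add: r_def less_top)
  have "(\<Sum>i. ennreal (r i)) <= 2 * f E"
    unfolding fr[symmetric] suminf_eq_SUP by (intro SUP_least total)
  then have "(\<Sum>i. ennreal (r i)) \<noteq> top" using fin by (auto simp: top_unique ennreal_mult_eq_top_iff)
  then have sr: "summable r" by (rule summable_suminf_not_top[rotated]) (simp add: r_def)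
  show ?thesis
  proof (rule ennreal_le_epsilon)
    fix e :: real assume e: "0 < e"
    obtain N where N: "!!n. n \<ge> N ==> norm (\<Sum>i. r (i + n)) < e"
      using suminf_exist_split[OF e sr] by blast
    have sN: "summable (%i. r (i + N))" using sr by (simp add: summable_iff_shift)
    have "f (E - F) <= f (G N \<union> (\<Union>i. R (i + N)))"
    proof (rule D(2), rule subsetI)
      fix x assume x: "x \<in> E - F"
      then have pos: "0 < infdist x F" using infdist_pos_not_in_closed[OF F F0] by simp
      show "x \<in> G N \<union> (\<Union>i. R (i + N))"
      proof (cases "1 / real (Suc N) <= infdist x F")
        case True then show ?thesis using x by (simp add: G_def)
      next
        case False
        obtain M where M: "inverse (real (Suc M)) < infdist x F" using reals_Archimedean[OF pos] by blast
        define m where "m = (LEAST m. 1 / real (Suc m) <= infdist x F)"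
        have m: "1 / real (Suc m) <= infdist x F" unfolding m_def
          by (rule LeastI[of _ M]) (use M in \<open>simp add: inverse_eq_divide\<close>)
        have least: "!!k. k < m ==> \<not> 1 / real (Suc k) <= infdist x F"
          unfolding m_def by (rule not_less_Least)
        have "N < m"
        proof (rule ccontr)
          assume "\<not> N < m"
          then have "1 / real (Suc N) <= 1 / real (Suc m)" by (intro divide_left_mono) auto
          then show False using m False by linarith
        qed
        then obtain i where i: "m = Suc (i + N)" by (metis add.commute less_iff_Suc_add)
        then have "x \<in> R (i + N)" using x m least[of "i + N"] by (simp add: R_def)
        then show ?thesis by blast
      qed
    qed
    also have "... <= f (G N) + f (\<Union>i. R (i + N))" by (rule metric_outer_measure_Un[OF f])
    also have "f (\<Union>i. R (i + N)) <= (\<Sum>i. f (R (i + N)))" by (rule D(3))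
    also have "... = ennreal (\<Sum>i. r (i + N))"
      unfolding fr by (rule suminf_ennreal2[OF _ sN]) (simp add: r_def)
    also have "... <= ennreal e" using N[of N] by (intro ennreal_leI) (simp add: abs_less_iff less_imp_le)
    finally have "f (E - F) <= f (G N) + ennreal e" by (simp add: add_left_mono)
    then have "f (E \<inter> F) + f (E - F) <= (f (E \<inter> F) + f (G N)) + ennreal e"
      by (simp add: add.assoc add_left_mono)
    also have "... <= f E + ennreal e" by (intro add_right_mono le1)
    finally show "f (E \<inter> F) + f (E - F) <= f E + ennreal e" .
  qed
qed

lemma metric_outer_measure_borel:
  fixes f :: "'a::metric_space set => ennreal"
  assumes f: "metric_outer_measure f"
  shows "measure_space UNIV (sets borel) f" and "E \<in> sets borel ==> emeasure (measure_of UNIV (sets borel) f) E = f E"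
proof -
  note D = metric_outer_measureD[OF f]
  interpret P: sigma_algebra "UNIV :: 'a set" "Pow UNIV" by (rule sigma_algebra_Pow)
  define L where "L = lambda_system UNIV (Pow UNIV) f"
  have "outer_measure_space (Pow UNIV) f"
    unfolding outer_measure_space_def positive_def increasing_def countably_subadditive_def using D by auto
  then have ms: "measure_space UNIV L f" unfolding L_def by (rule P.caratheodory_lemma)
  then have sL: "sigma_algebra UNIV L" by (simp add: measure_space_def)
  have "F \<in> L" if "closed F" for F
    unfolding L_def P.lambda_system_eq
  proof (intro CollectI conjI ballI)
    fix x :: "'a set"
    have "f x <= f (x \<inter> F) + f (x - F)"
      using metric_outer_measure_Un[OF f, of "x \<inter> F" "x - F"] by (simp add: Int_Diff_Un)
    then show "f (x \<inter> F) + f (x - F) = f x"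
      using metric_outer_measure_closed[OF f that, of x] by simp
  qed simp
  then have "sigma_sets UNIV (Collect closed) \<subseteq> L"
    by (intro sigma_algebra.sigma_sets_subset[OF sL]) auto
  then have bL: "sets borel \<subseteq> L" by (simp add: borel_eq_closed)
  show b: "measure_space UNIV (sets borel) f"
    unfolding measure_space_def
  proof (intro conjI)
    show "sigma_algebra UNIV (sets (borel::'a measure))" using sets.sigma_algebra_axioms[of "borel::'a measure"] by simp
    show "positive (sets borel) f" using D(1) by (simp add: positive_def)
    have "countably_additive L f" using ms by (simp add: measure_space_def)
    then show "countably_additive (sets borel) f"
      using bL unfolding countably_additive_def by (meson sets.countable_UN subset_iff subset_trans top.extremum)
  qed
  show "E \<in> sets borel ==> emeasure (measure_of UNIV (sets borel) f) E = f E"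
    by (rule emeasure_measure_of_sigma) (use b in \<open>auto simp: measure_space_def\<close>)
qed

section \<open>Hausdorff measure\<close>

definition hcover :: "real => (real^'n::finite) set => (nat => (real^'n) set) set" where
  "hcover \<delta> S = {C. S \<subseteq> (\<Union>k. C k) \<and> (\<forall>k. bounded (C k) \<and> diameter (C k) <= \<delta>)}"

definition hval :: "nat => (real^'n::finite) set => ennreal" where
  "hval s C = (if C = {} then 0 else ennreal (unit_ball_vol (real s) * (diameter C / 2) ^ s))"

lemma hausdorff_outer_eq: "hausdorff_outer s S = (SUP \<delta>\<in>{0<..}. INF C\<in>hcover \<delta> S. \<Sum>k. hval s (C k))"
  by (simp add: hausdorff_outer_def hcover_def hval_def)

lemma hval_mono: "A \<subseteq> B ==> bounded B ==> hval s A <= hval s B"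
  using diameter_subset[of A B] unit_ball_vol_nonneg[of "real s"] diameter_ge_0[of A] bounded_subset[of B A]
  by (auto simp: hval_def intro!: ennreal_leI mult_left_mono power_mono)

lemma hausdorff_metric_outer_measure: "metric_outer_measure (hausdorff_outer s :: (real^'n::finite) set => ennreal)"
  unfolding metric_outer_measure_def
proof (intro conjI allI impI)
  let ?H = "hausdorff_outer s :: (real^'n) set => ennreal"
  define pre where "pre \<delta> S = (INF C\<in>hcover \<delta> S. \<Sum>k. hval s (C k))" for \<delta> and S :: "(real^'n) set"
  have H: "?H S = (SUP \<delta>\<in>{0<..}. pre \<delta> S)" for S by (simp add: hausdorff_outer_eq pre_def)
  have mono: "pre \<delta> A <= pre \<delta> B" if "A \<subseteq> B" for \<delta> A B
    unfolding pre_def by (rule INF_superset_mono) (use that in \<open>auto simp: hcover_def\<close>)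
  have anti: "pre \<delta> A <= pre \<delta>' A" if "\<delta>' <= \<delta>" for \<delta> \<delta>' A
    unfolding pre_def by (rule INF_superset_mono) (use that in \<open>auto simp: hcover_def intro: order_trans\<close>)
  have "pre \<delta> {} = 0" if "0 < \<delta>" for \<delta>
  proof -
    have "pre \<delta> {} <= (\<Sum>k::nat. hval s ({} :: (real^'n) set))"
      unfolding pre_def by (rule INF_lower2[where i = "%_. {}"]) (use that in \<open>auto simp: hcover_def\<close>)
    then show ?thesis by (simp add: hval_def)
  qed
  then show "?H {} = 0" by (simp add: H)
  show "?H A <= ?H B" if "A \<subseteq> B" for A B unfolding H by (intro SUP_mono) (use mono[OF that] in blast)
  show "?H (\<Union>n. A n) <= (\<Sum>n. ?H (A n))" for A :: "nat => (real^'n) set"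
    unfolding H
  proof (rule SUP_least)
    fix \<delta> :: real assume d: "\<delta> \<in> {0<..}"
    have "pre \<delta> (\<Union>n. A n) <= (\<Sum>n. pre \<delta> (A n))"
    proof (rule ennreal_le_epsilon)
      fix e :: real assume e: "0 < e" and fin: "(\<Sum>n. pre \<delta> (A n)) < top"
      have "\<exists>C\<in>hcover \<delta> (A n). (\<Sum>k. hval s (C k)) <= pre \<delta> (A n) + ennreal (e * (1/2)^Suc n)" for n
      proof -
        have "pre \<delta> (A n) \<noteq> top" using ennreal_suminf_lessD[OF fin, of n] by simp
        then have "pre \<delta> (A n) < pre \<delta> (A n) + ennreal (e * (1/2)^Suc n)"
          using e by (simp add: less_top)
        then show ?thesis unfolding pre_def INF_less_iff using less_imp_le by blast
      qed
      then obtain C where C: "!!n. C n \<in> hcover \<delta> (A n)"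
        "!!n. (\<Sum>k. hval s (C n k)) <= pre \<delta> (A n) + ennreal (e * (1/2)^Suc n)" by metis
      define C' where "C' m = (case prod_decode m of (n, k) => C n k)" for m
      have "C' \<in> hcover \<delta> (\<Union>n. A n)"
      proof -
        have "(\<Union>n. A n) \<subseteq> (\<Union>m. C' m)"
        proof
          fix x assume "x \<in> (\<Union>n. A n)"
          then obtain n where "x \<in> A n" by blast
          then obtain k where "x \<in> C n k" using C(1)[of n] by (auto simp: hcover_def)
          then have "x \<in> C' (prod_encode (n, k))" by (simp add: C'_def)
          then show "x \<in> (\<Union>m. C' m)" by blast
        qed
        then show ?thesis using C(1) by (auto simp: hcover_def C'_def split: prod.split)
      qed
      then have "pre \<delta> (\<Union>n. A n) <= (\<Sum>m. hval s (C' m))" unfolding pre_def by (rule INF_lower)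
      also have "... = (\<Sum>m. (%(n, k). hval s (C n k)) (prod_decode m))"
        by (intro suminf_cong) (simp add: C'_def split_def)
      also have "... = (\<Sum>n. \<Sum>k. hval s (C n k))" by (rule suminf_ennreal_2dimen) simp
      also have "... <= (\<Sum>n. pre \<delta> (A n) + ennreal (e * (1/2)^Suc n))"
        by (intro suminf_le C(2)) auto
      also have "... = (\<Sum>n. pre \<delta> (A n)) + (\<Sum>n. ennreal (e * (1/2)^Suc n))" by (rule suminf_add[symmetric]) auto
      also have "(\<Sum>n. ennreal (e * (1/2)^Suc n)) = ennreal e"
        by (rule suminf_half_ennreal[OF e])
      finally show "pre \<delta> (\<Union>n. A n) <= (\<Sum>n. pre \<delta> (A n)) + ennreal e" .
    qed
    also have "... <= (\<Sum>n. SUP \<delta>\<in>{0<..}. pre \<delta> (A n))"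
      by (intro suminf_le SUP_upper d) auto
    finally show "pre \<delta> (\<Union>n. A n) <= (\<Sum>n. SUP \<delta>\<in>{0<..}. pre \<delta> (A n))" .
  qed
  fix A B :: "(real^'n) set" and d :: real
  assume d: "0 < d" and sep: "\<forall>x\<in>A. \<forall>y\<in>B. d <= dist x y"
  have small: "pre \<delta> A + pre \<delta> B <= pre \<delta> (A \<union> B)" if "\<delta> < d" "0 < \<delta>" for \<delta>
    unfolding pre_def[of _ "A \<union> B"]
  proof (rule INF_greatest)
    fix C assume C: "C \<in> hcover \<delta> (A \<union> B)"
    have one: "C k \<inter> A = {} \<or> C k \<inter> B = {}" for k
    proof (rule ccontr)
      assume "\<not> ?thesis"
      then obtain x y where "x \<in> C k" "x \<in> A" "y \<in> C k" "y \<in> B" by blast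
      then have "d <= dist x y" "dist x y <= diameter (C k)"
        using sep C diameter_bounded_bound[of "C k" x y] by (auto simp: hcover_def)
      then show False using C that by (auto simp: hcover_def) (meson not_less order_trans)
    qed
    have bd: "bounded (C k)" for k using C by (simp add: hcover_def)
    have sub: "(%k. C k \<inter> X) \<in> hcover \<delta> X" if "X \<subseteq> A \<union> B" for X
      using C that unfolding hcover_def
      by (auto intro: bounded_Int order_trans[OF diameter_subset[OF Int_lower1]])
    have "pre \<delta> A + pre \<delta> B <= (\<Sum>k. hval s (C k \<inter> A)) + (\<Sum>k. hval s (C k \<inter> B))"
      unfolding pre_def by (intro add_mono INF_lower sub) auto
    also have "... = (\<Sum>k. hval s (C k \<inter> A) + hval s (C k \<inter> B))" by (rule suminf_add) auto
    also have "... <= (\<Sum>k. hval s (C k))"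
    proof (intro suminf_le)
      fix k
      show "hval s (C k \<inter> A) + hval s (C k \<inter> B) <= hval s (C k)"
        using one[of k] hval_mono[OF Int_lower1 bd, of s k A] hval_mono[OF Int_lower1 bd, of s k B]
        by (auto simp: hval_def[of s "{}"])
    qed auto
    finally show "pre \<delta> A + pre \<delta> B <= (\<Sum>k. hval s (C k))" .
  qed
  have "pre a A + pre b B <= ?H (A \<union> B)" if "0 < a" "0 < b" for a b
  proof -
    define \<delta> where "\<delta> = min (min a b) (d / 2)"
    have \<delta>: "0 < \<delta>" "\<delta> < d" "\<delta> <= a" "\<delta> <= b" using that d by (auto simp: \<delta>_def)
    have "pre a A + pre b B <= pre \<delta> A + pre \<delta> B" by (intro add_mono anti \<delta>)
    also have "... <= pre \<delta> (A \<union> B)" by (rule small[OF \<delta>(2,1)])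
    also have "... <= ?H (A \<union> B)" unfolding H by (rule SUP_upper) (use \<delta> in simp)
    finally show ?thesis .
  qed
  then have "(SUP a\<in>{0<..}. pre a A) + pre b B <= ?H (A \<union> B)" if "0 < b" for b
    using that by (subst ennreal_SUP_add_left[symmetric]) (auto intro!: SUP_least)
  then have "?H A + (SUP b\<in>{0<..}. pre b B) <= ?H (A \<union> B)"
    unfolding H[of A] add.commute[of "(SUP a\<in>{0<..}. pre a A)"]
    by (subst ennreal_SUP_add_left[symmetric]) (auto intro!: SUP_least simp: add.commute)
  then show "?H A + ?H B <= ?H (A \<union> B)" by (simp add: H)
qed

lemma sets_hausdorff_measure [simp, measurable_cong]: "sets (hausdorff_measure s) = sets borel"
  using sets.sigma_sets_eq[of borel] by (simp add: hausdorff_measure_def)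

lemma space_hausdorff_measure [simp]: "space (hausdorff_measure s) = UNIV"
  by (simp add: hausdorff_measure_def)

lemma emeasure_hausdorff_measure: "E \<in> sets borel ==> emeasure (hausdorff_measure s) E = hausdorff_outer s E"
  unfolding hausdorff_measure_def by (rule metric_outer_measure_borel(2)[OF hausdorff_metric_outer_measure])

section \<open>Subsequential limits of families of functionals\<close>

text \<open>The product of the compact intervals \<open>[- B i, B i]\<close> is compact by the
  theorem of Tychonoff. A filter replaces a subsequence, which need not exist for uncountably many
  indices \<open>i\<close>.\<close>
lemma bounded_families_converge_along_filter:
  fixes X :: "nat => 'i => real"
  assumes b: "!!n i. \<bar>X n i\<bar> <= B i"
  obtains F L where "F <= sequentially" "F \<noteq> bot" "!!i. ((%n. X n i) \<longlongrightarrow> L i) F"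
proof -
  have "compactin (product_topology (%i. euclideanreal) UNIV) (\<Pi>\<^sub>E i\<in>UNIV. {- B i..B i})"
    by (subst compactin_PiE) (simp add: compactin_euclidean_iff)
  then have cpt: "compact (\<Pi>\<^sub>E i\<in>UNIV. {- B i..B i})"
    by (simp add: euclidean_product_topology)
  define G where "G = filtermap X sequentially"
  have "G \<noteq> bot" by (simp add: G_def filtermap_bot_iff)
  moreover have "eventually (%x. x \<in> (\<Pi>\<^sub>E i\<in>UNIV. {- B i..B i})) G"
    unfolding G_def eventually_filtermap using b by (auto simp: abs_le_iff minus_le_iff intro!: always_eventually)
  ultimately obtain L where L: "inf (nhds L) G \<noteq> bot"
    using cpt unfolding compact_filter by blast
  define F where "F = inf sequentially (filtercomap X (nhds L))"
  have "F \<noteq> bot"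
  proof
    assume "F = bot"
    then have "eventually (%_. False) F" by simp
    then obtain P R where P: "eventually P sequentially" and R: "eventually R (filtercomap X (nhds L))"
      and PR: "!!n. P n ==> R n ==> False"
      unfolding F_def eventually_inf by blast
    obtain S where S: "eventually S (nhds L)" "!!n. S (X n) ==> R n"
      using R unfolding eventually_filtercomap by blast
    have "eventually (%x. \<exists>n. P n \<and> x = X n) G"
      unfolding G_def eventually_filtermap using P by eventually_elim auto
    then have "eventually (%_. False) (inf (nhds L) G)"
      unfolding eventually_inf using S PR by (intro exI[of _ S] exI conjI) auto
    then show False using L by (simp add: trivial_limit_def)
  qed
  moreover have "((%n. X n i) \<longlongrightarrow> L i) F" for i
  proof -
    have "filterlim X (nhds L) F"
      unfolding filterlim_def F_def by (meson filtermap_filtercomap filtermap_mono inf_le2 order_trans)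
    moreover have "((%x. x i) \<longlongrightarrow> L i) (nhds L)"
    proof (rule topological_tendstoI)
      fix S :: "real set" assume S: "open S" "L i \<in> S"
      have "open ((%x::'i => real. x i) -` S)"
        using continuous_on_open_vimage[OF open_UNIV, THEN iffD1, OF continuous_on_product_coordinates[of i]] S(1) by auto
      then show "eventually (%x. x i \<in> S) (nhds L)"
        using S(2) by (intro eventually_nhds[THEN iffD2] exI[of _ "(%x. x i) -` S"]) auto
    qed
    ultimately show ?thesis by (rule filterlim_compose[rotated])
  qed
  moreover have "F <= sequentially" by (simp add: F_def)
  ultimately show thesis using that by blast
qed

section \<open>Riesz representation\<close>

definition cover_fns :: "'a::metric_space set => 'a set => (nat => 'a => real) set" where
  "cover_fns K E = {fs. (\<forall>n. continuous_on UNIV (fs n) \<and> (\<forall>x. 0 <= fs n x)) \<and>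
     (\<forall>x\<in>E \<inter> K. 1 <= (\<Sum>n. ennreal (fs n x)))}"

text \<open>Covering by countably many continuous functions rather than by sets makes countable
  subadditivity immediate.\<close>
definition daniell_outer :: "'a::metric_space set => (('a => real) => real) => 'a set => ennreal" where
  "daniell_outer K L E = (INF fs\<in>cover_fns K E. \<Sum>n. ennreal (L (fs n)))"

text \<open>The functional is defined on continuous functions on the whole space, but positivity
  on \<open>K\<close> makes it depend on the values on \<open>K\<close> only.\<close>
locale positive_functional =
  fixes K :: "'a::metric_space set" and L :: "('a => real) => real"
  assumes K: "compact K"
    and add: "!!f g. continuous_on UNIV f ==> continuous_on UNIV g ==> L (%x. f x + g x) = L f + L g"
    and cmult: "!!f c. continuous_on UNIV f ==> L (%x. c * f x) = c * L f"
    and pos: "!!f. continuous_on UNIV f ==> (!!x. x \<in> K ==> 0 <= f x) ==> 0 <= L f"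
begin

lemma mono: "continuous_on UNIV f ==> continuous_on UNIV g ==> (!!x. x \<in> K ==> f x <= g x) ==> L f <= L g"
  using pos[of "%x. g x + (-1) * f x"] add[of g "%x. (-1) * f x"] cmult[of f "-1"]
  by (simp add: continuous_on_diff continuous_on_minus)

lemma zero: "L (%x. 0) = 0" using cmult[of "%x. 0" 0] by simp

lemma sum: "(!!i. i \<in> I ==> continuous_on UNIV (f i)) ==> L (%x. \<Sum>i\<in>I. f i x) = (\<Sum>i\<in>I. L (f i))"
proof (induction I rule: infinite_finite_induct)
  case (insert i I)
  then show ?case using add[of "f i" "%x. \<Sum>i\<in>I. f i x"] by (simp add: continuous_on_sum)
qed (simp_all add: zero)

lemma single_cover:
  assumes "continuous_on UNIV g" "!!x. 0 <= g x" "!!x. x \<in> E \<inter> K ==> 1 <= g x"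
  shows "daniell_outer K L E <= ennreal (L g)"
proof -
  define fs where "fs n = (if n = 0 then g else (%x. 0))" for n :: nat
  have s: "(\<Sum>n. ennreal (F (fs n))) = ennreal (F g)" if "F (%x. 0) = 0" for F :: "('a => real) => real"
  proof -
    have "(\<Sum>n. ennreal (F (fs n))) = (\<Sum>n\<in>{0}. ennreal (F (fs n)))"
      by (rule suminf_finite) (auto simp: fs_def that)
    then show ?thesis by (simp add: fs_def)
  qed
  have "fs \<in> cover_fns K E"
    unfolding cover_fns_def
  proof (intro CollectI conjI allI ballI)
    fix x assume "x \<in> E \<inter> K"
    then have "ennreal 1 <= ennreal (g x)" using assms(3) by (intro ennreal_leI)
    then show "1 <= (\<Sum>n. ennreal (fs n x))" using s[of "%f. f x"] by simp
  qed (use assms in \<open>auto simp: fs_def\<close>)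
  then have "daniell_outer K L E <= (\<Sum>n. ennreal (L (fs n)))"
    unfolding daniell_outer_def by (rule INF_lower)
  then show ?thesis using s[of L, OF zero] by simp
qed

text \<open>For separated sets a continuous function that is 1 on one set and 0 on the other
  splits every cover into two.\<close>
lemma metric_outer: "metric_outer_measure (daniell_outer K L)"
  unfolding metric_outer_measure_def
proof (intro conjI allI impI)
  have "daniell_outer K L {} <= ennreal (L (%x. 0))" by (rule single_cover) auto
  then show "daniell_outer K L {} = 0" by (simp add: zero)
  show "daniell_outer K L A <= daniell_outer K L B" if "A \<subseteq> B" for A B
    unfolding daniell_outer_def by (rule INF_superset_mono) (use that in \<open>auto simp: cover_fns_def\<close>)
  show "daniell_outer K L (\<Union>n. A n) <= (\<Sum>n. daniell_outer K L (A n))" for A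
  proof (rule ennreal_le_epsilon)
    fix e :: real assume e: "0 < e" and fin: "(\<Sum>n. daniell_outer K L (A n)) < top"
    have "\<exists>C\<in>cover_fns K (A n). (\<Sum>k. ennreal (L (C k))) <= daniell_outer K L (A n) + ennreal (e * (1/2)^Suc n)" for n
    proof -
      have "daniell_outer K L (A n) \<noteq> top" using ennreal_suminf_lessD[OF fin, of n] by simp
      then have "daniell_outer K L (A n) < daniell_outer K L (A n) + ennreal (e * (1/2)^Suc n)"
        using e by (simp add: less_top)
      then show ?thesis unfolding daniell_outer_def INF_less_iff using less_imp_le by blast
    qed
    then obtain C where C: "!!n. C n \<in> cover_fns K (A n)"
      "!!n. (\<Sum>k. ennreal (L (C n k))) <= daniell_outer K L (A n) + ennreal (e * (1/2)^Suc n)" by metis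
    define C' where "C' m = (case prod_decode m of (n, k) => C n k)" for m
    have "C' \<in> cover_fns K (\<Union>n. A n)"
      unfolding cover_fns_def
    proof (intro CollectI conjI allI ballI)
      fix x assume x: "x \<in> (\<Union>n. A n) \<inter> K"
      then obtain n where n: "x \<in> A n \<inter> K" by blast
      have "1 <= (\<Sum>k. ennreal (C n k x))" using C(1)[of n] n by (auto simp: cover_fns_def)
      also have "... <= (\<Sum>n. \<Sum>k. ennreal (C n k x))"
        using sum_le_suminf[of "%n. \<Sum>k. ennreal (C n k x)" "{n}"] by simp
      also have "... = (\<Sum>m. (%(n, k). ennreal (C n k x)) (prod_decode m))"
        by (rule suminf_ennreal_2dimen[symmetric]) simp
      also have "... = (\<Sum>m. ennreal (C' m x))" by (intro suminf_cong) (simp add: C'_def split_def)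
      finally show "1 <= (\<Sum>m. ennreal (C' m x))" .
    qed (use C(1) in \<open>auto simp: cover_fns_def C'_def split_def\<close>)
    then have "daniell_outer K L (\<Union>n. A n) <= (\<Sum>m. ennreal (L (C' m)))" unfolding daniell_outer_def by (rule INF_lower)
    also have "... = (\<Sum>m. (%(n, k). ennreal (L (C n k))) (prod_decode m))"
      by (intro suminf_cong) (simp add: C'_def split_def)
    also have "... = (\<Sum>n. \<Sum>k. ennreal (L (C n k)))" by (rule suminf_ennreal_2dimen) simp
    also have "... <= (\<Sum>n. daniell_outer K L (A n) + ennreal (e * (1/2)^Suc n))"
      by (intro suminf_le C(2)) auto
    also have "... = (\<Sum>n. daniell_outer K L (A n)) + (\<Sum>n. ennreal (e * (1/2)^Suc n))" by (rule suminf_add[symmetric]) auto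
    also have "(\<Sum>n. ennreal (e * (1/2)^Suc n)) = ennreal e"
      by (rule suminf_half_ennreal[OF e])
    finally show "daniell_outer K L (\<Union>n. A n) <= (\<Sum>n. daniell_outer K L (A n)) + ennreal e" .
  qed
  fix A B :: "'a set" and d :: real
  assume d: "0 < d" and sep: "\<forall>x\<in>A. \<forall>y\<in>B. d <= dist x y"
  show "daniell_outer K L A + daniell_outer K L B <= daniell_outer K L (A \<union> B)"
  proof (cases "B = {}")
    case True
    then show ?thesis using \<open>daniell_outer K L {} = 0\<close> by simp
  next
    case False
    define \<phi> where "\<phi> x = min 1 (infdist x B / d)" for x
    have \<phi>: "continuous_on UNIV \<phi>" unfolding \<phi>_def[abs_def] by (intro continuous_intros) (use d in auto)
    have \<phi>01: "0 <= \<phi> x" "\<phi> x <= 1" for x using d infdist_nonneg[of x B] by (auto simp: \<phi>_def)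
    have \<phi>A: "\<phi> x = 1" if "x \<in> A" for x
    proof -
      have "d <= infdist x B" unfolding infdist_def using False sep that by (auto intro!: cINF_greatest)
      then show ?thesis using d by (simp add: \<phi>_def)
    qed
    have \<phi>B: "\<phi> x = 0" if "x \<in> B" for x using that by (simp add: \<phi>_def)
    show ?thesis
      unfolding daniell_outer_def[of K L "A \<union> B"]
    proof (rule INF_greatest)
      fix C assume C: "C \<in> cover_fns K (A \<union> B)"
      then have Cc: "continuous_on UNIV (C n)" and C0: "0 <= C n x" for n x by (auto simp: cover_fns_def)
      have c1: "continuous_on UNIV (%x. \<phi> x * C n x)" and c2: "continuous_on UNIV (%x. (1 - \<phi> x) * C n x)" for n
        by (intro continuous_intros \<phi> Cc)+
      have "(%n x. \<phi> x * C n x) \<in> cover_fns K A"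
        using C c1 C0 \<phi>01 \<phi>A by (auto simp: cover_fns_def)
      moreover have "(%n x. (1 - \<phi> x) * C n x) \<in> cover_fns K B"
        using C c2 C0 \<phi>01 \<phi>B by (auto simp: cover_fns_def)
      ultimately have "daniell_outer K L A + daniell_outer K L B
          <= (\<Sum>n. ennreal (L (%x. \<phi> x * C n x))) + (\<Sum>n. ennreal (L (%x. (1 - \<phi> x) * C n x)))"
        unfolding daniell_outer_def by (intro add_mono INF_lower2[OF _ order_refl])
      also have "... = (\<Sum>n. ennreal (L (%x. \<phi> x * C n x)) + ennreal (L (%x. (1 - \<phi> x) * C n x)))"
        by (rule suminf_add) auto
      also have "... = (\<Sum>n. ennreal (L (C n)))"
      proof (rule suminf_cong)
        fix n
        have "L (%x. \<phi> x * C n x) + L (%x. (1 - \<phi> x) * C n x) = L (C n)"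
          using add[OF c1 c2, of n n] by (simp add: algebra_simps)
        moreover have "0 <= L (%x. \<phi> x * C n x)" "0 <= L (%x. (1 - \<phi> x) * C n x)"
          using C0 \<phi>01 by (auto intro!: pos c1 c2)
        ultimately show "ennreal (L (%x. \<phi> x * C n x)) + ennreal (L (%x. (1 - \<phi> x) * C n x)) = ennreal (L (C n))"
          by (simp add: ennreal_plus[symmetric] del: ennreal_plus)
      qed
      finally show "daniell_outer K L A + daniell_outer K L B <= (\<Sum>n. ennreal (L (C n)))" .
    qed
  qed
qed

definition repr :: "'a measure" where "repr = measure_of UNIV (sets borel) (daniell_outer K L)"

lemma sets_repr [simp, measurable_cong]: "sets repr = sets borel" and space_repr [simp]: "space repr = UNIV"
  using sets.sigma_sets_eq[of borel] by (simp_all add: repr_def)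

lemma emeasure_repr: "E \<in> sets borel ==> emeasure repr E = daniell_outer K L E"
  unfolding repr_def by (rule metric_outer_measure_borel(2)[OF metric_outer])

lemma emeasure_repr_le:
  assumes "E \<in> sets borel" "continuous_on UNIV g" "!!x. 0 <= g x" "!!x. x \<in> E ==> x \<in> K ==> 1 <= g x"
  shows "emeasure repr E <= ennreal (L g)"
  using single_cover[of g E] assms by (simp add: emeasure_repr)

lemma null_outside: "emeasure repr (- K) = 0"
proof -
  have "emeasure repr (- K) <= ennreal (L (%x. 0))"
    using compact_imp_closed[OF K] by (intro emeasure_repr_le) auto
  then show ?thesis by (simp add: zero)
qed

text \<open>A cover of the compact set \<open>K\<close> by continuous functions has finite partial
  sums that exceed \<open>1 - \<epsilon>\<close> on \<open>K\<close>, since the sets where they do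
  are open and increase.\<close>
lemma total: "emeasure repr UNIV = ennreal (L (%x. 1))"
proof (rule antisym)
  show "emeasure repr UNIV <= ennreal (L (%x. 1))" by (rule emeasure_repr_le) auto
  have L1: "0 <= L (%x. 1)" by (rule pos) auto
  have "ennreal (L (%x. 1)) <= (\<Sum>n. ennreal (L (C n)))" if C: "C \<in> cover_fns K UNIV" for C
  proof (rule ennreal_le_epsilon)
    fix e :: real assume e: "0 < e"
    define \<delta> where "\<delta> = e / (L (%x. 1) + 1)"
    have \<delta>: "0 < \<delta>" using e L1 by (simp add: \<delta>_def)
    have Cc: "continuous_on UNIV (C n)" and C0: "0 <= C n x" for n x using C by (auto simp: cover_fns_def)
    have Sc: "continuous_on UNIV (%x. \<Sum>n<N. C n x)" for N by (intro continuous_intros Cc)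
    define U where "U N = {x. 1 - \<delta> < (\<Sum>n<N. C n x)}" for N
    have op: "open (U N)" for N unfolding U_def by (rule open_Collect_less) (auto intro: Sc)
    have cov: "K \<subseteq> (\<Union>N. U N)"
    proof
      fix x assume "x \<in> K"
      then have "1 <= (\<Sum>n. ennreal (C n x))" using C by (auto simp: cover_fns_def)
      moreover have "ennreal (1 - \<delta>) < 1"
        using ennreal_lessI[of 1 "1 - \<delta>"] \<delta> by simp
      ultimately have "ennreal (1 - \<delta>) < (\<Sum>n. ennreal (C n x))" by (rule less_le_trans[rotated])
      then have "ennreal (1 - \<delta>) < (SUP N. \<Sum>n<N. ennreal (C n x))" by (simp only: suminf_eq_SUP)
      then obtain N where "ennreal (1 - \<delta>) < (\<Sum>n<N. ennreal (C n x))" unfolding less_SUP_iff by blast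
      then have "ennreal (1 - \<delta>) < ennreal (\<Sum>n<N. C n x)" using C0 by (simp add: sum_ennreal)
      then have "1 - \<delta> < (\<Sum>n<N. C n x)" using ennreal_leI[of "\<Sum>n<N. C n x" "1 - \<delta>"] by (simp add: not_less[symmetric] del: ennreal_le_iff2 ennreal_le_iff) (use not_less in blast)
      then show "x \<in> (\<Union>N. U N)" by (auto simp: U_def)
    qed
    obtain I where I: "finite I" "K \<subseteq> (\<Union>N\<in>I. U N)"
      by (rule compactE_image[OF K op cov])
    define N where "N = Max (insert 0 I)"
    have "U M \<subseteq> U N" if "M \<in> I" for M
    proof -
      have "M <= N" using that I by (simp add: N_def)
      then have "(\<Sum>n<M. C n x) <= (\<Sum>n<N. C n x)" for x using C0 by (intro sum_mono2) auto
      then show ?thesis unfolding U_def by (auto intro: less_le_trans)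
    qed
    then have KN: "K \<subseteq> U N" using I by blast
    have "(1 - \<delta>) * L (%x. 1) = L (%x. (1 - \<delta>) * 1)" by (rule cmult[symmetric]) simp
    also have "... <= L (%x. \<Sum>n<N. C n x)" by (rule mono) (use KN Sc in \<open>auto simp: U_def less_imp_le\<close>)
    also have "... = (\<Sum>n<N. L (C n))" by (rule sum) (rule Cc)
    finally have "L (%x. 1) <= (\<Sum>n<N. L (C n)) + \<delta> * L (%x. 1)" by (simp add: algebra_simps)
    also have "\<delta> * L (%x. 1) <= e" using e L1 by (simp add: \<delta>_def field_simps)
    finally have "ennreal (L (%x. 1)) <= ennreal ((\<Sum>n<N. L (C n)) + e)" by (intro ennreal_leI) simp
    also have "... = (\<Sum>n<N. ennreal (L (C n))) + ennreal e"
      using e pos[OF Cc] C0 by (simp add: sum_nonneg sum_ennreal)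
    also have "... <= (\<Sum>n. ennreal (L (C n))) + ennreal e"
      by (intro add_right_mono sum_le_suminf) auto
    finally show "ennreal (L (%x. 1)) <= (\<Sum>n. ennreal (L (C n))) + ennreal e" .
  qed
  then show "ennreal (L (%x. 1)) <= emeasure repr UNIV"
    by (simp add: emeasure_repr daniell_outer_def le_INF_iff)
qed

lemma finite_repr: "finite_measure repr"
  by (rule finite_measureI) (simp add: total)

lemma integrable_repr:
  fixes f :: "'a => real"
  assumes "continuous_on UNIV f" "!!x. \<bar>f x\<bar> <= B"
  shows "integrable repr f"
proof -
  interpret finite_measure repr by (rule finite_repr)
  have "f \<in> borel_measurable repr" using borel_measurable_continuous_onI[OF assms(1)] by simp
  then show ?thesis by (rule integrable_const_bound[of _ B, rotated]) (use assms in auto)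
qed

text \<open>Slice \<open>f\<close> into \<open>n\<close> layers of height \<open>1/n\<close>. The
  measure of the set where \<open>f\<close> exceeds a level is at most the value of
  \<open>L\<close> at the slice below it, scaled by \<open>n\<close>.\<close>
lemma integral_le:
  assumes f: "continuous_on UNIV f" and f01: "!!x. 0 <= f x" "!!x. f x <= 1"
  shows "(LINT x|repr. f x) <= L f"
proof (rule field_le_epsilon)
  interpret finite_measure repr by (rule finite_repr)
  fix e :: real assume e: "0 < e"
  have [measurable]: "f \<in> borel_measurable borel" by (rule borel_measurable_continuous_onI[OF f])
  define m where "m = measure repr UNIV"
  obtain n :: nat where n: "m / e < real n" using reals_Archimedean2 by blast
  have m0: "0 <= m" by (simp add: m_def)
  have "0 <= m / e" using e m0 by simp
  then have n0: "0 < n" using n by (cases n) auto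
  define g where "g k x = min (f x) (real k / real n)" for k x
  define h where "h k x = g (Suc k) x - g k x" for k x
  define P where "P k = {x. real (Suc k) / real n <= f x}" for k
  have [measurable]: "P k \<in> sets borel" for k unfolding P_def by measurable
  have hc: "continuous_on UNIV (h k)" for k unfolding h_def g_def by (intro continuous_intros f)
  have h0: "0 <= h k x" for k x
    unfolding h_def g_def using n0 by (auto simp: min_def divide_right_mono field_simps)
  have hP: "1 <= real n * h k x" if "x \<in> P k" for k x
    using that n0 by (auto simp: h_def g_def P_def min_def field_simps)
  have hs: "(\<Sum>k<n. h k x) = f x" for x
  proof -
    have "(\<Sum>k<n. h k x) = g n x - g 0 x"
      unfolding h_def by (rule sum_lessThan_telescope[of "%k. g k x"])
    then show ?thesis using f01[of x] n0 by (simp add: g_def)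
  qed
  have mP: "measure repr (P k) <= real n * L (h k)" for k
  proof -
    have c: "continuous_on UNIV (%x. real n * h k x)" by (intro continuous_intros hc)
    have nn: "0 <= L (h k)" by (rule pos[OF hc]) (rule h0)
    have "emeasure repr (P k) <= ennreal (L (%x. real n * h k x))"
      by (rule emeasure_repr_le[OF _ c]) (use h0 hP in auto)
    then show ?thesis using nn by (simp add: cmult[OF hc] emeasure_eq_measure)
  qed
  have bound: "f x <= 1 / real n + (\<Sum>k<n. 1 / real n * indicator (P k) x)" for x
  proof -
    have "h k x <= 1 / real n * indicator (P k) x + (if real k / real n < f x \<and> f x < real (Suc k) / real n then 1 / real n else 0)" for k
      using n0 by (auto simp: h_def g_def P_def min_def field_simps indicator_def)
    then have "f x <= (\<Sum>k<n. 1 / real n * indicator (P k) x) + (\<Sum>k<n. if real k / real n < f x \<and> f x < real (Suc k) / real n then 1 / real n else 0)"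
      unfolding hs[symmetric, of x] sum.distrib[symmetric] by (intro sum_mono) (simp add: hs)
    also have "(\<Sum>k<n. if real k / real n < f x \<and> f x < real (Suc k) / real n then 1 / real n else 0) <= 1 / real n"
    proof -
      define S where "S = {k\<in>{..<n}. real k / real n < f x \<and> f x < real (Suc k) / real n}"
      have "\<exists>a. S \<subseteq> {a}"
      proof (cases "S = {}")
        case False
        then obtain a where a: "a \<in> S" by blast
        have "b = a" if "b \<in> S" for b
        proof -
          have "real b < real (Suc a)" "real a < real (Suc b)"
            using that a n0 by (auto simp: S_def field_simps intro: less_trans)
          then show ?thesis by simp
        qed
        then show ?thesis by blast
      qed auto
      then have "card S <= 1" by (metis card.empty card_insert_le_m1 card_mono finite.emptyI finite_insert is_singletonI is_singleton_altdef)
      have "(\<Sum>k<n. if real k / real n < f x \<and> f x < real (Suc k) / real n then 1 / real n else 0) = real (card S) / real n"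
        unfolding S_def by (subst sum.inter_filter[symmetric]) auto
      then show ?thesis using \<open>card S <= 1\<close> n0 by (simp add: divide_right_mono)
    qed
    finally show ?thesis by simp
  qed
  define J where "J k x = 1 / real n * indicator (P k) x" for k x
  have iJ: "integrable repr (J k)" for k
    unfolding J_def by (intro integrable_mult_right integrable_real_indicator) (auto simp: less_top[symmetric])
  have eJ: "(LINT x|repr. J k x) = 1 / real n * measure repr (P k)" for k
    unfolding J_def by simp
  have "(LINT x|repr. f x) <= (LINT x|repr. 1 / real n + (\<Sum>k<n. J k x))"
  proof (rule integral_mono)
    show "integrable repr f" by (rule integrable_repr[OF f, of 1]) (use f01 in \<open>simp add: abs_le_iff order_trans[of _ 0]\<close>)
    show "integrable repr (%x. 1 / real n + (\<Sum>k<n. J k x))" using iJ by simp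
  qed (use bound in \<open>simp add: J_def\<close>)
  also have "... = m / real n + (\<Sum>k<n. 1 / real n * measure repr (P k))"
    using iJ by (simp add: m_def eJ)
  also have "(\<Sum>k<n. 1 / real n * measure repr (P k)) <= (\<Sum>k<n. L (h k))"
    using mP n0 by (intro sum_mono) (simp add: divide_le_eq mult.commute)
  also have "(\<Sum>k<n. L (h k)) = L f" using sum[of "{..<n}" h] hc hs by simp
  also have "m / real n <= e" using n n0 e by (simp add: field_simps)
  finally show "(LINT x|repr. f x) <= L f + e" by simp
qed

text \<open>Move the values of \<open>f\<close> into the unit interval by an affine change. The
  upper bounds \<open>integral_le\<close> for the result and for 1 minus the result add up to
  \<open>total\<close>, so both are equalities.\<close>
theorem integral_repr:
  assumes f: "continuous_on UNIV f" and B: "!!x. \<bar>f x\<bar> <= B"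
  shows "(LINT x|repr. f x) = L f"
proof -
  interpret finite_measure repr by (rule finite_repr)
  define c where "c = 2 * (\<bar>B\<bar> + 1)"
  have c: "0 < c" by (simp add: c_def)
  define F where "F x = 1 / c * f x + 1 / 2" for x
  have Fc: "continuous_on UNIV F" unfolding F_def by (intro continuous_intros f)
  have F01: "0 <= F x" "F x <= 1" for x
  proof -
    have "\<bar>f x\<bar> <= c / 2" using B[of x] by (simp add: c_def)
    then have "- (c / 2) <= f x" "f x <= c / 2" by linarith+
    then show "0 <= F x" "F x <= 1" using c by (auto simp: F_def field_simps)
  qed
  have fi: "integrable repr f" by (rule integrable_repr[OF f B])
  have Fi: "(LINT x|repr. F x) = 1 / c * (LINT x|repr. f x) + 1 / 2 * measure repr UNIV"
    unfolding F_def using fi by simp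
  have FL: "L F = 1 / c * L f + 1 / 2 * L (%x. 1)"
  proof -
    have "continuous_on UNIV (%x. 1 / c * f x)" by (intro continuous_intros f)
    from add[OF this continuous_on_const[of _ "1 / 2"]] show ?thesis
      unfolding F_def using cmult[OF f, of "1 / c"] cmult[of "%x. 1" "1 / 2"] by simp
  qed
  have t: "measure repr UNIV = L (%x. 1)"
    using total pos[of "%x. 1"] by (simp add: emeasure_eq_measure)
  have 1: "(LINT x|repr. F x) <= L F" by (rule integral_le[OF Fc F01])
  have "(LINT x|repr. 1 + (-1) * F x) <= L (%x. 1 + (-1) * F x)"
    by (rule integral_le) (use Fc F01 in \<open>auto intro!: continuous_intros\<close>)
  moreover have "L (%x. 1 + (-1) * F x) = L (%x. 1) - L F"
    using add[of "%x. 1" "%x. (-1) * F x"] cmult[OF Fc, of "-1"] Fc by (simp add: continuous_on_minus)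
  moreover have "integrable repr F" by (rule integrable_repr[OF Fc, of 1]) (use F01 in \<open>simp add: abs_le_iff order_trans[of _ 0]\<close>)
  then have "(LINT x|repr. 1 + (-1) * F x) = measure repr UNIV - (LINT x|repr. F x)" by simp
  ultimately have "(LINT x|repr. F x) = L F" using 1 t by simp
  then show ?thesis using Fi FL t c by simp
qed

end

section \<open>Signed measures given by densities\<close>

text \<open>The supremum that defines the positive variation is attained at the intersection with
  the set where the density is positive; hence the positive variation has density \<open>max 0
  s\<close>.\<close>
lemma signed_density:
  fixes S :: "'a::topological_space set" and M :: "'a measure"
  assumes sets: "sets M = sets (restrict_space borel S)" and M: "finite_measure M"
    and s: "integrable M s" and \<eta>: "!!B. B \<in> sets M ==> \<eta> B = (LINT x:B|M. s x)"
  shows "bounded_signed_measure S \<eta>"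
    and "f \<in> borel_measurable M ==> signed_integral S \<eta> f =
      (LINT x|M. max 0 (s x) * f x) - (LINT x|M. max 0 (- s x) * f x)"
proof -
  interpret finite_measure M by (rule M)
  have sp: "space M = S" using sets_eq_imp_space_eq[OF sets] by (simp add: space_restrict_space)
  have [measurable]: "s \<in> borel_measurable M" using s by simp
  have si: "set_integrable M B s" if "B \<in> sets M" for B
    unfolding set_integrable_def using integrable_mult_indicator[OF that s] .
  show "bounded_signed_measure S \<eta>"
    unfolding bounded_signed_measure_def sets[symmetric]
  proof (intro conjI allI impI)
    fix F :: "nat => 'a set" assume "range F \<subseteq> sets M \<and> disjoint_family F"
    then have F: "!!k. F k \<in> sets M" and dj: "disjoint_family F" by auto
    have "(%k. LINT x:F k|M. s x) sums (LINT x|M. (\<Sum>k. indicator (F k) x *\<^sub>R s x))"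
      unfolding set_lebesgue_integral_def
    proof (rule sums_integral)
      show "integrable M (%x. indicator (F k) x *\<^sub>R s x)" for k using integrable_mult_indicator[OF F s] .
      have ind: "(%k. indicat_real (F k) x * c) sums (indicat_real (\<Union>k. F k) x * c)" for x c
        using sums_mult2[OF indicator_sums[of F x], of c] dj by (auto simp: disjoint_family_on_def)
      show "AE x in M. summable (%k. norm (indicator (F k) x *\<^sub>R s x))"
        using ind[THEN sums_summable] by (intro AE_I2) (simp add: abs_mult)
      have nn: "(\<Sum>k. ennreal (LINT x|M. norm (indicator (F k) x *\<^sub>R s x))) <= ennreal (LINT x|M. norm (s x))"
      proof -
        have "(\<Sum>k. ennreal (LINT x|M. norm (indicator (F k) x *\<^sub>R s x))) = (\<Sum>k. \<integral>\<^sup>+x. ennreal (norm (indicator (F k) x *\<^sub>R s x)) \<partial>M)"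
          using integrable_mult_indicator[OF F s]
          by (intro suminf_cong nn_integral_eq_integral[symmetric]) auto
        also have "... = (\<integral>\<^sup>+x. (\<Sum>k. ennreal (norm (indicator (F k) x *\<^sub>R s x))) \<partial>M)"
          using F by (intro nn_integral_suminf[symmetric]) auto
        also have "... <= (\<integral>\<^sup>+x. ennreal (norm (s x)) \<partial>M)"
        proof (rule nn_integral_mono)
          fix x
          have "(\<Sum>k. ennreal (indicat_real (F k) x * \<bar>s x\<bar>)) = ennreal (indicat_real (\<Union>k. F k) x * \<bar>s x\<bar>)"
            by (rule suminf_ennreal_eq[OF _ ind]) simp
          also have "... <= ennreal \<bar>s x\<bar>" by (intro ennreal_leI) (simp add: indicator_def)
          finally show "(\<Sum>k. ennreal (norm (indicator (F k) x *\<^sub>R s x))) <= ennreal (norm (s x))" by (simp add: abs_mult)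
        qed
        also have "... = ennreal (LINT x|M. norm (s x))"
          using s by (intro nn_integral_eq_integral) auto
        finally show ?thesis .
      qed
      then have "(\<Sum>k. ennreal (LINT x|M. norm (indicator (F k) x *\<^sub>R s x))) \<noteq> top"
        by (metis ennreal_neq_top top_unique)
      then show "summable (%k. LINT x|M. norm (indicator (F k) x *\<^sub>R s x))"
        by (rule summable_suminf_not_top[rotated]) simp
    qed
    also have "(LINT x|M. (\<Sum>k. indicator (F k) x *\<^sub>R s x)) = (LINT x:(\<Union>k. F k)|M. s x)"
    proof -
      have "(\<Sum>k. indicat_real (F k) x * c) = indicat_real (\<Union>k. F k) x * c" for x c
        by (rule sums_unique[symmetric])
          (use sums_mult2[OF indicator_sums[of F x], of c] dj in \<open>auto simp: disjoint_family_on_def\<close>)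
      then show ?thesis by (simp add: set_lebesgue_integral_def)
    qed
    finally show "(%k. \<eta> (F k)) sums \<eta> (\<Union>k. F k)" using \<eta> F by simp
  next
    show "\<exists>m. \<forall>B\<in>sets M. \<bar>\<eta> B\<bar> <= m"
    proof (intro exI ballI)
      fix B assume B: "B \<in> sets M"
      have "\<bar>LINT x:B|M. s x\<bar> <= (LINT x|M. \<bar>indicator B x *\<^sub>R s x\<bar>)"
        unfolding set_lebesgue_integral_def by (rule integral_abs_bound)
      also have "... <= (LINT x|M. \<bar>s x\<bar>)"
        using integrable_mult_indicator[OF B s] s by (intro integral_mono) (auto simp: indicator_def)
      finally show "\<bar>\<eta> B\<bar> <= (LINT x|M. \<bar>s x\<bar>)" using \<eta>[OF B] by simp
    qed
  qed
  have pv: "positive_variation S \<theta> = density M (%x. ennreal (max 0 (t x)))"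
    if t: "integrable M t" and \<theta>: "!!B. B \<in> sets M ==> \<theta> B = (LINT x:B|M. t x)" for \<theta> t
  proof -
    have [measurable]: "t \<in> borel_measurable M" using t by simp
    define N where "N = density M (%x. ennreal (max 0 (t x)))"
    have iB: "integrable M (%x. indicator E x *\<^sub>R max 0 (t x))" if "E \<in> sets M" for E
      by (rule integrable_mult_indicator[OF that]) (use t in \<open>rule integrable_max[OF integrable_zero]\<close>)
    have eN: "emeasure N E = ennreal (LINT x:E|M. max 0 (t x))" if E: "E \<in> sets M" for E
    proof -
      have "emeasure N E = (\<integral>\<^sup>+x. ennreal (max 0 (t x)) * indicator E x \<partial>M)"
        unfolding N_def by (rule emeasure_density) (use E in auto)
      also have "... = (\<integral>\<^sup>+x. ennreal (indicator E x *\<^sub>R max 0 (t x)) \<partial>M)"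
        by (intro nn_integral_cong) (simp add: indicator_def)
      also have "... = ennreal (LINT x:E|M. max 0 (t x))"
        unfolding set_lebesgue_integral_def
        by (rule nn_integral_eq_integral[OF iB[OF E]]) (simp add: indicator_def)
      finally show ?thesis .
    qed
    have eq: "(SUP E\<in>{E \<in> sets M. E \<subseteq> B}. ennreal (\<theta> E)) = emeasure N B" if B: "B \<in> sets M" for B
    proof (rule antisym)
      show "(SUP E\<in>{E \<in> sets M. E \<subseteq> B}. ennreal (\<theta> E)) <= emeasure N B"
      proof (rule SUP_least)
        fix E assume "E \<in> {E \<in> sets M. E \<subseteq> B}"
        then have E: "E \<in> sets M" "E \<subseteq> B" by auto
        have "\<theta> E <= (LINT x:E|M. max 0 (t x))"
          unfolding \<theta>[OF E(1)] set_lebesgue_integral_def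
          using integrable_mult_indicator[OF E(1) t] iB[OF E(1)] by (intro integral_mono) (auto simp: indicator_def)
        then have "ennreal (\<theta> E) <= emeasure N E" unfolding eN[OF E(1)] by (rule ennreal_leI)
        also have "... <= emeasure N B" by (rule emeasure_mono[OF E(2)]) (use B in \<open>simp add: N_def\<close>)
        finally show "ennreal (\<theta> E) <= emeasure N B" .
      qed
      define P where "P = {x\<in>space M. 0 <= t x} \<inter> B"
      have P: "P \<in> sets M" "P \<subseteq> B" unfolding P_def using B by auto
      have "emeasure N B = ennreal (\<theta> P)"
        unfolding eN[OF B] \<theta>[OF P(1)] set_lebesgue_integral_def
        by (intro arg_cong[where f=ennreal] Bochner_Integration.integral_cong) (auto simp: P_def indicator_def)
      also have "... <= (SUP E\<in>{E \<in> sets M. E \<subseteq> B}. ennreal (\<theta> E))"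
        by (rule SUP_upper) (use P in auto)
      finally show "emeasure N B <= (SUP E\<in>{E \<in> sets M. E \<subseteq> B}. ennreal (\<theta> E))" .
    qed
    have "positive_variation S \<theta> = measure_of (space N) (sets N) (emeasure N)"
    proof -
      have N: "space N = S" "sets N = sets M" by (simp_all add: N_def sp)
      have "sets M \<subseteq> Pow S" using sets.space_closed[of M] by (simp add: sp)
      moreover have "sigma_sets S (sets M) = sets M" using sets.sigma_sets_eq[of M] by (simp add: sp)
      ultimately show ?thesis
        unfolding positive_variation_def sets[symmetric] N using eq by (intro measure_of_eq) auto
    qed
    then show ?thesis using measure_of_of_measure[of N] by (simp only: N_def)
  qed
  assume [measurable]: "f \<in> borel_measurable M"
  have "(LINT x|positive_variation S \<eta>. f x) = (LINT x|M. max 0 (s x) * f x)"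
  proof -
    have "positive_variation S \<eta> = density M (%x. ennreal (max 0 (s x)))" by (rule pv[OF s]) (rule \<eta>)
    then show ?thesis by (simp only:) (subst integral_density, auto)
  qed
  moreover have "(LINT x|positive_variation S (%B. - \<eta> B). f x) = (LINT x|M. max 0 (- s x) * f x)"
  proof (subst pv[of "%x. - s x"])
    show "- \<eta> B = (LINT x:B|M. - s x)" if "B \<in> sets M" for B
      unfolding \<eta>[OF that] set_lebesgue_integral_def by simp
    show "(LINT x|density M (%x. ennreal (max 0 (- s x))). f x) = (LINT x|M. max 0 (- s x) * f x)"
      by (subst integral_density) auto
  qed (use s in auto)
  ultimately show "signed_integral S \<eta> f =
      (LINT x|M. max 0 (s x) * f x) - (LINT x|M. max 0 (- s x) * f x)"
    by (simp add: signed_integral_def)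
qed

text \<open>The Radon-Nikodym derivative is at most \<open>C\<close> almost everywhere, so it can
  be cut off at \<open>C\<close>.\<close>
lemma bounded_density:
  fixes M N :: "'a measure"
  assumes M: "finite_measure M" and sets: "sets N = sets M" and C: "0 <= C"
    and le: "!!B. B \<in> sets M ==> emeasure N B <= ennreal C * emeasure M B"
  obtains f where "f \<in> borel_measurable M" "!!x. 0 <= f x" "!!x. f x <= C" "N = density M (%x. ennreal (f x))"
proof -
  interpret finite_measure M by (rule M)
  have "absolutely_continuous M N"
    unfolding absolutely_continuous_def
  proof
    fix B assume "B \<in> null_sets M"
    then show "B \<in> null_sets N" using le[of B] by (auto simp: null_sets_def sets)
  qed
  then obtain g where g[measurable]: "g \<in> borel_measurable M" and N: "density M g = N"
    using Radon_Nikodym[OF _ sets] by blast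
  have "AE x in M. g x <= ennreal C"
  proof -
    define A where "A = {x\<in>space M. ennreal C < g x}"
    have [measurable]: "A \<in> sets M" unfolding A_def by measurable
    have fin: "(\<integral>\<^sup>+x. ennreal C * indicator A x \<partial>M) < \<infinity>"
      by (simp add: nn_integral_cmult_indicator ennreal_mult_less_top) (simp add: less_top[symmetric])
    have "(\<integral>\<^sup>+x. g x * indicator A x \<partial>M) <= (\<integral>\<^sup>+x. ennreal C * indicator A x \<partial>M)"
      using le[of A] by (simp add: N[symmetric] emeasure_density nn_integral_cmult_indicator)
    moreover have "(\<integral>\<^sup>+x. g x * indicator A x - ennreal C * indicator A x \<partial>M) =
       (\<integral>\<^sup>+x. g x * indicator A x \<partial>M) - (\<integral>\<^sup>+x. ennreal C * indicator A x \<partial>M)"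
      by (rule nn_integral_diff) (use fin in \<open>auto simp: A_def indicator_def intro!: AE_I2 less_imp_le\<close>)
    ultimately have "(\<integral>\<^sup>+x. g x * indicator A x - ennreal C * indicator A x \<partial>M) = 0"
      using le_less_trans[OF _ fin, of "\<integral>\<^sup>+x. g x * indicator A x \<partial>M"] by (simp add: diff_eq_0_iff_ennreal)
    then have "AE x in M. g x * indicator A x - ennreal C * indicator A x = 0"
      by (subst (asm) nn_integral_0_iff_AE) auto
    then show ?thesis
    proof (rule AE_mp, intro AE_I2 impI)
      fix x assume x: "x \<in> space M" and z: "g x * indicator A x - ennreal C * indicator A x = 0"
      show "g x <= ennreal C"
      proof (rule ccontr)
        assume "\<not> g x <= ennreal C"
        then have "x \<in> A" "ennreal C < g x" using x by (auto simp: A_def)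
        then show False using z by (auto simp: diff_eq_0_iff_ennreal)
      qed
    qed
  qed
  then have "AE x in M. g x = ennreal (min C (enn2real (g x)))"
  proof eventually_elim
    case (elim x)
    then have "g x < top" using ennreal_less_top le_less_trans by blast
    then have "g x = ennreal (enn2real (g x))" by simp
    moreover from this have "enn2real (g x) <= C" using elim C by (metis enn2real_leI)
    ultimately show ?case by simp
  qed
  then have "density M g = density M (%x. ennreal (min C (enn2real (g x))))"
    by (intro density_cong) auto
  then show thesis using that[of "%x. min C (enn2real (g x))"] C N by (simp add: enn2real_nonneg)
qed

section \<open>Geometry of the boundary\<close>

lemma directional_limit:
  fixes f :: "real^'n::finite => real"
  assumes "f differentiable (at x)"
  shows "((%t. (f (x + t *\<^sub>R v) - f x) / t) \<longlongrightarrow> grad f x \<bullet> v) (at_right 0)"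
proof -
  have "((%t. f (x + t *\<^sub>R v)) has_derivative (%t. grad f x \<bullet> (t *\<^sub>R v))) (at 0)"
    by (rule has_derivative_compose[where f = "%t. x + t *\<^sub>R v" and f' = "%t. t *\<^sub>R v" and g = f])
      (use differentiable_has_derivative_grad[OF assms] in \<open>auto intro!: derivative_eq_intros\<close>)
  then have "((%t. f (x + t *\<^sub>R v)) has_real_derivative (grad f x \<bullet> v)) (at 0)"
    by (simp add: has_field_derivative_def mult.commute[of _ "grad f x \<bullet> v"])
  then have "((%t. (f (x + t *\<^sub>R v) - f x) / t) \<longlongrightarrow> grad f x \<bullet> v) (at 0)"
    by (simp add: has_field_derivative_iff)
  then show ?thesis by (rule filterlim_mono[OF _ order_refl]) (simp add: at_within_le_at)
qed

lemma halfspace_inclusion: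
  fixes a b :: "'a::real_inner"
  assumes a: "a \<noteq> 0" and ab: "!!v. 0 < a \<bullet> v ==> 0 <= b \<bullet> v"
  obtains c where "0 <= c" "b = c *\<^sub>R a"
proof -
  define c where "c = (b \<bullet> a) / (a \<bullet> a)"
  define w where "w = b - c *\<^sub>R a"
  have aa: "0 < a \<bullet> a" using a by simp
  have wa: "w \<bullet> a = 0" using aa by (simp add: w_def c_def inner_diff_left)
  have c: "0 <= c" using ab[of a] aa by (simp add: c_def)
  have "w \<bullet> w <= e" if e: "0 < e" for e
  proof -
    define t where "t = e / (b \<bullet> a + 1)"
    have ba: "0 <= b \<bullet> a" using ab[of a] aa by simp
    have t: "0 < t" "t * (b \<bullet> a) <= e" using e ba by (auto simp: t_def field_simps)
    have "0 <= b \<bullet> (t *\<^sub>R a - w)"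
      by (rule ab) (use t aa wa in \<open>simp add: inner_diff_right inner_commute[of a w]\<close>)
    moreover have "b \<bullet> w = w \<bullet> w"
    proof -
      have "b \<bullet> w = (w + c *\<^sub>R a) \<bullet> w" by (simp add: w_def)
      also have "... = w \<bullet> w" using wa by (simp add: inner_add_left inner_commute[of a w])
      finally show ?thesis .
    qed
    ultimately show ?thesis using t by (simp add: inner_diff_right)
  qed
  then have "w \<bullet> w <= 0" by (meson dense_ge)
  then have "w = 0" using inner_ge_zero[of w] by (metis inner_eq_zero_iff order_antisym)
  then show thesis using that[of c] c by (simp add: w_def)
qed

text \<open>A direction in which \<open>f\<close> increases leads into the common set of
  positivity, hence \<open>g\<close> does not decrease in it.\<close>
lemma gradient_of_same_positivity_set:
  fixes f g :: "real^'n::finite => real"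
  assumes f: "f differentiable (at x)" "f x = 0" "grad f x \<noteq> 0"
    and g: "g differentiable (at x)" "g x = 0"
    and same: "0 < \<epsilon>" "!!y. y \<in> ball x \<epsilon> ==> 0 < f y \<longleftrightarrow> 0 < g y"
  obtains c where "0 <= c" "grad g x = c *\<^sub>R grad f x"
proof (rule halfspace_inclusion[OF f(3)])
  fix v assume v: "0 < grad f x \<bullet> v"
  have "eventually (%t. 0 < (f (x + t *\<^sub>R v) - f x) / t) (at_right 0)"
    using order_tendstoD(1)[OF directional_limit[OF f(1)] v] .
  moreover have "eventually (%t::real. 0 < t) (at_right 0)" by (simp add: eventually_at_right_less)
  moreover have "eventually (%t. x + t *\<^sub>R v \<in> ball x \<epsilon>) (at_right 0)"
  proof -
    have "((%t. x + t *\<^sub>R v) \<longlongrightarrow> x + 0 *\<^sub>R v) (at_right 0)" by (intro tendsto_intros)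
    then have "((%t. x + t *\<^sub>R v) \<longlongrightarrow> x) (at_right 0)" by simp
    then show ?thesis by (rule topological_tendstoD) (use same in auto)
  qed
  ultimately have "eventually (%t. 0 <= (g (x + t *\<^sub>R v) - g x) / t) (at_right 0)"
  proof eventually_elim
    case (elim t)
    then have "0 < f (x + t *\<^sub>R v)" using f(2) by (simp add: zero_less_divide_iff)
    then have "0 < g (x + t *\<^sub>R v)" using same(2) elim by blast
    then show ?case using g(2) elim by simp
  qed
  then show "0 <= grad g x \<bullet> v"
    by (rule tendsto_lowerbound[OF directional_limit[OF g(1)]]) simp
qed

lemma C2_graph_function:
  fixes D :: "(real^'n::finite) set"
  assumes g: "C2_graph_at D x0 e \<gamma> R" and D: "open D"
  defines "f \<equiv> %x. x \<bullet> e - \<gamma> x"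
  shows "Ck 2 f" "x \<in> ball x0 R ==> x \<in> D \<longleftrightarrow> 0 < f x" "x \<in> frontier D ==> x \<in> ball x0 R ==> f x = 0"
    "f (x + t *\<^sub>R e) = f x + t" "grad f x = e - grad \<gamma> x" "grad f x \<noteq> 0"
proof -
  have G: "norm e = 1" "0 < R" "Ck 2 \<gamma>" "!!x t. \<gamma> (x + t *\<^sub>R e) = \<gamma> x" "D \<inter> ball x0 R = {x \<in> ball x0 R. \<gamma> x < x \<bullet> e}"
    using g by (auto simp: C2_graph_at_def)
  show C: "Ck 2 f" unfolding f_def by (intro Ck_diff Ck_inner_const G)
  show D_iff: "x \<in> ball x0 R ==> x \<in> D \<longleftrightarrow> 0 < f x" for x
    using G(5) by (auto simp: f_def set_eq_iff)
  have ee: "e \<bullet> e = 1" using G(1) by (simp add: dot_square_norm)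
  show fe: "f (x + t *\<^sub>R e) = f x + t" for x t using G(4) ee by (simp add: f_def inner_add_left)
  show "f x = 0" if x: "x \<in> frontier D" "x \<in> ball x0 R" for x
  proof -
    have "x \<notin> D" using x(1) D by (simp add: frontier_def interior_open)
    then have "f x <= 0" using D_iff[OF x(2)] by simp
    moreover have "\<not> f x < 0"
    proof
      assume "f x < 0"
      define U where "U = {y. f y < 0} \<inter> ball x0 R"
      have "open U" unfolding U_def
        by (intro open_Int open_Collect_less) (auto intro: Ck_continuous[OF C])
      moreover have "x \<in> U" using \<open>f x < 0\<close> x by (simp add: U_def)
      moreover have "x \<in> closure D" using x(1) by (simp add: frontier_def)
      ultimately obtain y where "y \<in> D" "y \<in> U" using closure_iff_nhds_not_empty by blast
      then show False using D_iff[of y] by (auto simp: U_def)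
    qed
    ultimately show ?thesis by simp
  qed
  have "(f has_derivative (%v. v \<bullet> e - grad \<gamma> x \<bullet> v)) (at x)"
    unfolding f_def
    by (intro has_derivative_diff differentiable_has_derivative_grad[OF Ck_2_partials(6)[OF G(3)]])
      (auto intro!: derivative_eq_intros)
  moreover have "(%v. v \<bullet> e - grad \<gamma> x \<bullet> v) = (%v. (e - grad \<gamma> x) \<bullet> v)"
    by (rule ext) (simp add: inner_diff_left inner_commute[of _ e])
  ultimately have "(f has_derivative (%v. (e - grad \<gamma> x) \<bullet> v)) (at x)" by simp
  then show "grad f x = e - grad \<gamma> x" by (rule grad_eqI)
  have "((%t. (f (x + t *\<^sub>R e) - f x) / t) \<longlongrightarrow> grad f x \<bullet> e) (at_right 0)"
    by (rule directional_limit) (rule Ck_2_partials(6)[OF C])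
  moreover have "((%t::real. (f (x + t *\<^sub>R e) - f x) / t) \<longlongrightarrow> 1) (at_right 0)"
    by (rule tendsto_eventually) (auto simp: fe eventually_at_filter)
  ultimately have "grad f x \<bullet> e = 1" using tendsto_unique trivial_limit_at_right_real by blast
  then show "grad f x \<noteq> 0" by auto
qed

text \<open>Every local graph representation gives a function with the same set of positivity as
  \<open>r\<close> near \<open>x\<close>, whose gradient is therefore a positive multiple of that
  of \<open>r\<close>.\<close>
lemma outer_normal_eq:
  fixes D :: "(real^'n::finite) set"
  assumes D: "open D" and b: "C2_boundary D" and x: "x \<in> frontier D"
    and r: "Ck 2 r" "r x = 0" "grad r x \<noteq> 0" "!!y. 0 < r y \<longleftrightarrow> y \<in> D"
  shows "outer_normal D x = - sgn (grad r x)"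
proof -
  have key: "sgn (grad \<gamma> x - e) = - sgn (grad r x)" if G: "C2_graph_at D x e \<gamma> R" for e \<gamma> R
  proof -
    define f where "f y = y \<bullet> e - \<gamma> y" for y
    have R: "0 < R" using G by (simp add: C2_graph_at_def)
    note F = C2_graph_function[OF G D, folded f_def]
    have "f x = 0" using F(3)[OF x] R by simp
    obtain c where c: "0 <= c" "grad f x = c *\<^sub>R grad r x"
      by (rule gradient_of_same_positivity_set[where f = r and g = f and x = x, OF _ r(2,3) _ \<open>f x = 0\<close> R])
        (use Ck_2_partials(6) r(1) F(1,2) r(4) in auto)
    have "c \<noteq> 0" using c F(6)[of x] by auto
    then have "sgn (grad f x) = sgn (grad r x)" using c by (simp add: sgn_scaleR)
    moreover have "sgn (grad \<gamma> x - e) = - sgn (grad f x)"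
      unfolding F(5) by (metis minus_diff_eq sgn_minus)
    ultimately show ?thesis by simp
  qed
  obtain e \<gamma> R where G: "C2_graph_at D x e \<gamma> R" using b x by (auto simp: C2_boundary_def)
  show ?thesis unfolding outer_normal_def
  proof (rule the_equality)
    show "\<exists>e \<gamma> R. C2_graph_at D x e \<gamma> R \<and> - sgn (grad r x) = sgn (grad \<gamma> x - e)"
      using G key[OF G] by metis
  qed (use key in blast)
qed

text \<open>Cover the closure of \<open>D\<close> by finitely many balls and add up local graph
  functions, or the constant 1 in the interior, each multiplied by a bump on its ball. On the
  boundary a direction into \<open>D\<close> along which one local function increases does not
  decrease the others, so the gradients cannot cancel. Cubing the positive part makes the bumps
  twice differentiable.\<close>
lemma defining_function_exists:
  fixes D :: "(real^'n::finite) set"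
  assumes D: "open D" "bounded D" and b: "C2_boundary D"
  obtains r where "Ck 2 r" "!!x. 0 < r x \<longleftrightarrow> x \<in> D" "!!x. x \<in> frontier D ==> r x = 0 \<and> grad r x \<noteq> 0"
proof -
  define good where "good x f e R \<longleftrightarrow> 0 < R \<and> Ck 2 f \<and> (\<forall>y\<in>ball x R. y \<in> D \<longleftrightarrow> 0 < f y) \<and>
     (\<forall>y\<in>ball x R. y \<in> frontier D --> f y = 0 \<and> (\<forall>t. f (y + t *\<^sub>R e) = t))" for x :: "real^'n" and f e R
  have "\<exists>f e R. good x f e R" if x: "x \<in> closure D" for x
  proof (cases "x \<in> D")
    case True
    then obtain R where R: "0 < R" "ball x R \<subseteq> D" using D(1) open_contains_ball by blast
    have "ball x R \<inter> frontier D = {}" using R D(1) by (auto simp: frontier_def interior_open)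
    then have "good x (%x. 1) 0 R" using R by (auto simp: good_def)
    then show ?thesis by blast
  next
    case False
    then have "x \<in> frontier D" using x D(1) by (simp add: frontier_def interior_open)
    then obtain e \<gamma> R where G: "C2_graph_at D x e \<gamma> R" using b by (auto simp: C2_boundary_def)
    note F = C2_graph_function[OF G D(1)]
    have "good x (%x. x \<bullet> e - \<gamma> x) e R"
      unfolding good_def using F(1-4) G by (auto simp: C2_graph_at_def)
    then show ?thesis by blast
  qed
  then obtain f e R where g: "!!x. x \<in> closure D ==> good x (f x) (e x) (R x)" by metis
  have cpt: "compact (closure D)" using D(2) by simp
  have cov: "closure D \<subseteq> (\<Union>x\<in>closure D. ball x (R x))" using g by (force simp: good_def)
  obtain F where F: "F \<subseteq> closure D" "finite F" "closure D \<subseteq> (\<Union>x\<in>F. ball x (R x))"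
    by (rule compactE_image[OF cpt _ cov]) auto
  define w where "w x y = pcube ((R x)\<^sup>2 - (y - x) \<bullet> (y - x))" for x y
  define r where "r y = (\<Sum>x\<in>F. w x y * f x y)" for y
  have w: "0 <= w x y" "y \<in> ball x (R x) ==> 0 < w x y" "y \<notin> ball x (R x) ==> x \<in> F ==> w x y = 0" for x y
  proof -
    show "0 <= w x y" by (simp add: w_def pcube_def)
    have e: "(y - x) \<bullet> (y - x) = (dist x y)\<^sup>2" by (simp add: dist_norm power2_norm_eq_inner norm_minus_commute[of x])
    show "0 < w x y" if "y \<in> ball x (R x)"
      using that power_strict_mono[of "dist x y" "R x" 2] by (simp add: w_def pcube_def e)
    show "w x y = 0" if "y \<notin> ball x (R x)" "x \<in> F"
    proof -
      have "0 < R x" using g F(1) that by (auto simp: good_def)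
      then have "(R x)\<^sup>2 <= (dist x y)\<^sup>2" using that by (intro power_mono) auto
      then show ?thesis by (simp add: w_def pcube_def e)
    qed
  qed
  have C: "Ck 2 r" unfolding r_def[abs_def] w_def
    by (intro Ck_sum Ck_mult Ck_pcube Ck_diff Ck_const Ck_norm_sq) (use g F(1) in \<open>auto simp: good_def\<close>)
  have nonneg_term: "0 <= w x y * f x y" if "y \<in> D" "x \<in> F" for x y
    using w(1)[of x y] w(3)[of y x] g[of x] F(1) that by (cases "y \<in> ball x (R x)") (auto simp: good_def)
  have pos: "0 < r y" if y: "y \<in> D" for y
  proof -
    obtain x where x: "x \<in> F" "y \<in> ball x (R x)" using y F(3) closure_subset by blast
    have "0 < f x y" using g[of x] F(1) x y by (auto simp: good_def)
    then have "0 < w x y * f x y" using w(2)[OF x(2)] by simp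
    then show ?thesis unfolding r_def
      by (rule sum_pos2[OF F(2) x(1)]) (use nonneg_term y in auto)
  qed
  have neg: "r y <= 0" if y: "y \<notin> D" for y
    unfolding r_def
  proof (rule sum_nonpos)
    fix x assume x: "x \<in> F"
    show "w x y * f x y <= 0"
    proof (cases "y \<in> ball x (R x)")
      case True
      then have "f x y <= 0" using g[of x] F(1) x y by (force simp: good_def)
      then show ?thesis using w(1)[of x y] by (simp add: mult_nonneg_nonpos)
    qed (use w(3)[OF _ x] in simp)
  qed
  have "r y = 0 \<and> grad r y \<noteq> 0" if y: "y \<in> frontier D" for y
  proof
    have yD: "y \<notin> D" "y \<in> closure D" using y D(1) by (auto simp: frontier_def interior_open)
    have "w x y * f x y = 0" if "x \<in> F" for x
      using g[of x] F(1) that y w(3)[of y x] by (cases "y \<in> ball x (R x)") (auto simp: good_def)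
    then show r0: "r y = 0" unfolding r_def by (intro sum.neutral) blast
    obtain x where x: "x \<in> F" "y \<in> ball x (R x)" using yD F(3) by blast
    have fx: "!!t. f x (y + t *\<^sub>R e x) = t" "!!z. z \<in> ball x (R x) ==> z \<in> D \<longleftrightarrow> 0 < f x z"
      using g[of x] F(1) x y by (auto simp: good_def)
    have l: "((%t. y + t *\<^sub>R e x) \<longlongrightarrow> y) (at_right 0)"
    proof -
      have "((%t. y + t *\<^sub>R e x) \<longlongrightarrow> y + 0 *\<^sub>R e x) (at_right 0)" by (intro tendsto_intros)
      then show ?thesis by simp
    qed
    have wc: "isCont (w x) y"
    proof -
      have "Ck 2 (w x)" unfolding w_def[abs_def] by (intro Ck_pcube Ck_diff Ck_const Ck_norm_sq)
      then have "continuous_on UNIV (w x)" by (rule Ck_continuous)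
      then show ?thesis by (simp add: continuous_on_eq_continuous_at)
    qed
    have "eventually (%t. w x (y + t *\<^sub>R e x) <= (r (y + t *\<^sub>R e x) - r y) / t) (at_right 0)"
    proof -
      have "eventually (%t. y + t *\<^sub>R e x \<in> ball x (R x)) (at_right 0)"
        by (rule topological_tendstoD[OF l]) (use x in auto)
      moreover have "eventually (%t::real. 0 < t) (at_right 0)" by (simp add: eventually_at_right_less)
      ultimately show ?thesis
      proof eventually_elim
        case (elim t)
        define z where "z = y + t *\<^sub>R e x"
        have zD: "z \<in> D" using fx elim by (simp add: z_def)
        have "w x z * f x z <= r z" unfolding r_def
          by (rule member_le_sum[OF x(1)]) (use nonneg_term zD F(2) in auto)
        then show ?case using elim fx(1)[of t] r0 by (simp add: z_def field_simps)
      qed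
    qed
    then have "w x y <= grad r y \<bullet> e x"
      by (rule tendsto_le[OF trivial_limit_at_right_real directional_limit[OF Ck_2_partials(6)[OF C]] isCont_tendsto_compose[OF wc l]])
    then show "grad r y \<noteq> 0" using w(2)[OF x(2)] by auto
  qed
  moreover have "0 < r x \<longleftrightarrow> x \<in> D" for x using pos[of x] neg[of x] by (cases "x \<in> D") auto
  ultimately show thesis using that C by blast
qed

locale defining_function =
  fixes D :: "(real^'n::finite) set" and r :: "real^'n => real"
  assumes D_open: "open D" and D_bounded: "bounded D" and r_C2: "Ck 2 r"
    and r_pos: "!!x. 0 < r x \<longleftrightarrow> x \<in> D"
    and r_frontier: "!!x. x \<in> frontier D ==> r x = 0"
    and grad_r_frontier: "!!x. x \<in> frontier D ==> grad r x \<noteq> 0"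
begin

lemmas r_partials = Ck_2_partials[OF r_C2]

lemma grad_r_continuous: "continuous_on S (grad r)"
  by (rule Ck_grad_continuous[OF r_partials(1)])

lemma compact_frontier_D: "compact (frontier D)" using D_bounded by (rule compact_frontier_bounded)

lemma frontier_iff: "x \<in> frontier D \<longleftrightarrow> x \<in> closure D \<and> x \<notin> D"
  using D_open by (simp add: frontier_def interior_open)

lemma compact_superlevel: "0 < s ==> compact {x. s <= r x}"
proof -
  assume s: "0 < s"
  have "closed {x. s <= r x}" by (intro closed_Collect_le continuous_on_const r_partials(3))
  moreover have "{x. s <= r x} \<subseteq> D" using s r_pos by (auto intro: less_le_trans)
  then have "bounded {x. s <= r x}" using D_bounded bounded_subset by blast
  ultimately show ?thesis by (simp add: compact_eq_bounded_closed)
qed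

lemma superlevel_subset: "0 < s ==> {x. s <= r x} \<subseteq> D"
  using r_pos by (auto intro: less_le_trans)

text \<open>Near a boundary point the gradient of \<open>r\<close> is close to its value there;
  compactness of the boundary makes radius and lower bound uniform.\<close>
lemma uniform_direction:
  obtains R c where "0 < R" "0 < c" "!!x0 x. x0 \<in> frontier D ==> x \<in> ball x0 R ==> c <= grad r x \<bullet> sgn (grad r x0)"
proof (cases "frontier D = {}")
  case True
  then show thesis using that[of 1 1] by simp
next
  case False
  have "continuous_on (frontier D) (%x. norm (grad r x))" by (intro continuous_intros grad_r_continuous)
  then obtain y where y: "y \<in> frontier D" "!!x. x \<in> frontier D ==> norm (grad r y) <= norm (grad r x)"
    using continuous_attains_inf[OF compact_frontier_D False] by blast
  define c where "c = norm (grad r y) / 2"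
  have c: "0 < c" using grad_r_frontier[OF y(1)] by (simp add: c_def)
  obtain B where B: "!!x. x \<in> frontier D ==> norm x <= B" using compact_imp_bounded[OF compact_frontier_D] unfolding bounded_iff by blast
  have "uniformly_continuous_on (cball 0 (B + 1)) (grad r)"
    by (rule compact_uniformly_continuous[OF grad_r_continuous compact_cball])
  then have "\<exists>d>0. \<forall>x\<in>cball 0 (B + 1). \<forall>x'\<in>cball 0 (B + 1). dist x' x < d --> dist (grad r x') (grad r x) < c"
    using c unfolding uniformly_continuous_on_def by simp
  then obtain d where d: "0 < d" "\<forall>x\<in>cball 0 (B + 1). \<forall>x'\<in>cball 0 (B + 1). dist x' x < d --> dist (grad r x') (grad r x) < c"
    by (elim exE conjE)
  show thesis
  proof (rule that[of "min d 1" c])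
    fix x0 x assume x0: "x0 \<in> frontier D" and x: "x \<in> ball x0 (min d 1)"
    have "norm x <= B + 1" using B[OF x0] x norm_triangle_sub[of x x0] by (simp add: dist_norm norm_minus_commute)
    then have "dist (grad r x) (grad r x0) < c" using d(2)[rule_format, of x0 x] B[OF x0] x by (simp add: dist_commute)
    moreover have "\<bar>(grad r x - grad r x0) \<bullet> sgn (grad r x0)\<bar> <= norm (grad r x - grad r x0) * norm (sgn (grad r x0))"
      by (rule Cauchy_Schwarz_ineq2)
    moreover have "norm (sgn (grad r x0)) = 1" using grad_r_frontier[OF x0] by (simp add: norm_sgn)
    moreover have "grad r x0 \<bullet> sgn (grad r x0) = norm (grad r x0)"
      using grad_r_frontier[OF x0] by (simp add: sgn_div_norm dot_square_norm power2_eq_square)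
    moreover have "2 * c <= norm (grad r x0)" using y(2)[OF x0] by (simp add: c_def)
    moreover have "(grad r x - grad r x0) \<bullet> sgn (grad r x0) = grad r x \<bullet> sgn (grad r x0) - grad r x0 \<bullet> sgn (grad r x0)"
      by (rule inner_diff_left)
    ultimately show "c <= grad r x \<bullet> sgn (grad r x0)"
      unfolding dist_norm by (simp only: mult_1_right)
  qed (use c d in auto)
qed

lemma r_mvt:
  assumes t: "0 < t"
  obtains \<xi> where "0 < \<xi>" "\<xi> < t" "r (x + t *\<^sub>R e) - r x = t * (grad r (x + \<xi> *\<^sub>R e) \<bullet> e)"
proof -
  have "((%s. r (x + s *\<^sub>R e)) has_derivative (%h. grad r (x + s *\<^sub>R e) \<bullet> (h *\<^sub>R e))) (at s)" for s
    by (rule has_derivative_compose[where f = "%t. x + t *\<^sub>R e" and f' = "%t. t *\<^sub>R e" and g = r])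
      (use differentiable_has_derivative_grad[OF r_partials(6)] in \<open>auto intro!: derivative_eq_intros\<close>)
  moreover have "continuous_on {0..t} (%s. r (x + s *\<^sub>R e))"
    by (rule continuous_on_compose2[OF r_partials(3)[of UNIV]]) (auto intro!: continuous_intros)
  ultimately obtain \<xi> where "0 < \<xi>" "\<xi> < t" "r (x + t *\<^sub>R e) - r (x + 0 *\<^sub>R e) = grad r (x + \<xi> *\<^sub>R e) \<bullet> ((t - 0) *\<^sub>R e)"
    using mvt[OF t, of "%s. r (x + s *\<^sub>R e)" "%s h. grad r (x + s *\<^sub>R e) \<bullet> (h *\<^sub>R e)"] by metis
  then show thesis using that[of \<xi>] by simp
qed

lemma r_increasing:
  assumes dir: "!!x. x \<in> ball x0 R ==> c <= grad r x \<bullet> e"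
    and x: "x \<in> ball x0 R" "x + t *\<^sub>R e \<in> ball x0 R" and t: "0 <= t"
  shows "r x + c * t <= r (x + t *\<^sub>R e)"
proof (cases "t = 0")
  case False
  then have t: "0 < t" using t by simp
  obtain \<xi> where \<xi>: "0 < \<xi>" "\<xi> < t" "r (x + t *\<^sub>R e) - r x = t * (grad r (x + \<xi> *\<^sub>R e) \<bullet> e)"
    using r_mvt[OF t, of x e] by blast
  have "x + \<xi> *\<^sub>R e = (1 - \<xi> / t) *\<^sub>R x + (\<xi> / t) *\<^sub>R (x + t *\<^sub>R e)"
    using t by (simp add: algebra_simps)
  also have "... \<in> ball x0 R" by (rule convexD[OF convex_ball x]) (use t \<xi> in auto)
  finally have "c <= grad r (x + \<xi> *\<^sub>R e) \<bullet> e" by (rule dir)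
  then have "t * c <= t * (grad r (x + \<xi> *\<^sub>R e) \<bullet> e)" using t by (intro mult_left_mono) auto
  then show ?thesis using \<xi>(3) by (simp add: mult.commute)
qed simp

text \<open>Translates of the layer in the direction \<open>e\<close> by multiples of
  \<open>3s/c\<close> are disjoint because \<open>r\<close> increases at rate at least
  \<open>c\<close>. About \<open>c \<sigma> / s\<close> of them fit into a ball of radius \<open>2
  \<sigma>\<close>.\<close>
lemma layer_volume:
  assumes dir: "!!x. x \<in> ball x0 R ==> c <= grad r x \<bullet> e" and e: "norm e = 1" and c: "0 < c"
    and s: "0 < s" "3 * s / c <= \<sigma>" and \<sigma>: "\<sigma> <= R"
  shows "measure lborel {x \<in> ball x0 \<sigma>. \<bar>r x\<bar> <= s} \<le>
     (6 / c * 2 ^ CARD('n) * measure lborel (ball (0::real^'n) 1)) * s * \<sigma> ^ (CARD('n) - 1)"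
proof -
  define S where "S = {x \<in> ball x0 \<sigma>. \<bar>r x\<bar> <= s}"
  define h where "h = 3 * s / c"
  have h: "0 < h" "h <= \<sigma>" "c * h = 3 * s" using s c by (auto simp: h_def)
  define N where "N = nat \<lfloor>\<sigma> / h\<rfloor>"
  have "1 <= \<sigma> / h" using h by simp
  then have N1: "1 <= N" unfolding N_def by (simp add: le_nat_floor)
  have Nle: "real N * h <= \<sigma>"
  proof -
    have "real N <= \<sigma> / h" using h \<open>1 <= \<sigma> / h\<close> by (simp add: N_def of_nat_nat)
    then show ?thesis using h by (simp add: field_simps)
  qed
  have Nge: "\<sigma> / h <= 2 * real N"
  proof -
    have "\<sigma> / h < real N + 1" using h \<open>1 <= \<sigma> / h\<close> by (simp add: N_def of_nat_nat)
    then show ?thesis using N1 by simp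
  qed
  define T where "T k = (%x. (real k * h) *\<^sub>R e + x) ` S" for k :: nat
  have [measurable]: "r \<in> borel_measurable borel" by (rule borel_measurable_continuous_onI[OF r_partials(3)])
  have Sm[measurable]: "S \<in> sets borel" unfolding S_def by measurable
  have Tm: "T k \<in> sets borel" "emeasure lborel (T k) = emeasure lborel S" for k :: nat
  proof -
    have "T k = (%x. x - (real k * h) *\<^sub>R e) -` S"
      unfolding T_def by (force simp: image_iff)
    moreover have m: "(%x::real^'n. x - (real k * h) *\<^sub>R e) \<in> borel \<rightarrow>\<^sub>M borel" by measurable
    ultimately show "T k \<in> sets borel" using measurable_sets[OF m Sm] by simp
    have "emeasure lborel S = emeasure (distr lborel borel (%x. - (real k * h) *\<^sub>R e + x)) S"
      by (simp only: lborel_distr_plus)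
    also have "... = emeasure lborel ((%x. - (real k * h) *\<^sub>R e + x) -` S)"
      by (subst emeasure_distr) auto
    also have "(%x. - (real k * h) *\<^sub>R e + x) -` S = T k"
      unfolding T_def by (force simp: image_iff)
    finally show "emeasure lborel (T k) = emeasure lborel S" by simp
  qed
  have disj: "disjoint_family_on T {..<N}"
    unfolding disjoint_family_on_def
  proof (intro ballI impI)
    have no: "T k \<inter> T l = {}" if kl: "k < l" for k l :: nat
    proof (rule ccontr)
      assume "T k \<inter> T l \<noteq> {}"
      then obtain x y where xy: "x \<in> S" "y \<in> S" "(real k * h) *\<^sub>R e + x = (real l * h) *\<^sub>R e + y"
        by (auto simp: T_def)
      define t where "t = (real l - real k) * h"
      have x: "x = y + t *\<^sub>R e" using xy(3) by (simp add: t_def algebra_simps)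
      have "1 * h <= (real l - real k) * h" by (rule mult_right_mono) (use kl h in auto)
      then have t: "h <= t" by (simp add: t_def)
      have B: "x \<in> ball x0 R" "y \<in> ball x0 R" using xy \<sigma> by (auto simp: S_def)
      have "r y + c * t <= r (y + t *\<^sub>R e)"
        by (rule r_increasing[OF dir]) (use B x t h in auto)
      moreover have "c * h <= c * t" using t c by simp
      ultimately have "r y + 3 * s <= r x" using x h(3) by simp
      moreover have "\<bar>r x\<bar> <= s" "\<bar>r y\<bar> <= s" using xy by (auto simp: S_def)
      ultimately show False using s(1) by linarith
    qed
    fix k l :: nat assume "k \<noteq> l"
    then show "T k \<inter> T l = {}" using no[of k l] no[of l k] by (cases "k < l") auto
  qed
  have sub: "(\<Union>k<N. T k) \<subseteq> ball x0 (2 * \<sigma>)"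
  proof
    fix z assume "z \<in> (\<Union>k<N. T k)"
    then obtain k x where kx: "k < N" "x \<in> S" "z = (real k * h) *\<^sub>R e + x" by (auto simp: T_def)
    have "dist x0 z <= dist x0 x + norm ((real k * h) *\<^sub>R e)"
      unfolding kx(3) using dist_triangle[of x0 _ x] by (simp add: dist_norm norm_minus_commute)
         (metis add.commute diff_diff_add norm_triangle_ineq4 norm_scaleR)
    also have "norm ((real k * h) *\<^sub>R e) <= real N * h" using kx(1) h e by simp
    also have "dist x0 x < \<sigma>" using kx(2) by (simp add: S_def)
    finally show "z \<in> ball x0 (2 * \<sigma>)" using Nle by simp
  qed
  have fin: "emeasure lborel S < \<infinity>"
  proof -
    have "S \<subseteq> ball x0 \<sigma>" by (auto simp: S_def)
    then have "emeasure lborel S <= emeasure lborel (ball x0 \<sigma>)" by (rule emeasure_mono) simp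
    then show ?thesis using emeasure_lborel_ball_finite[of x0 \<sigma>] by (rule le_less_trans)
  qed
  have "of_nat N * emeasure lborel S = (\<Sum>k<N. emeasure lborel (T k))" by (simp add: Tm)
  also have "... = emeasure lborel (\<Union>k<N. T k)"
    by (rule sum_emeasure) (use Tm disj in auto)
  also have "... <= emeasure lborel (ball x0 (2 * \<sigma>))" by (rule emeasure_mono[OF sub]) simp
  finally have le: "of_nat N * emeasure lborel S <= emeasure lborel (ball x0 (2 * \<sigma>))" .
  have "real N * measure lborel S <= measure lborel (ball x0 (2 * \<sigma>))"
  proof -
    have "ennreal (real N * measure lborel S) <= ennreal (measure lborel (ball x0 (2 * \<sigma>)))"
      using le fin emeasure_lborel_ball_finite[of x0 "2 * \<sigma>"]
      by (simp add: emeasure_eq_ennreal_measure less_top ennreal_mult ennreal_of_nat_eq_real_of_nat)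
    then show ?thesis by simp
  qed
  also have "measure lborel (ball x0 (2 * \<sigma>)) = (2 * \<sigma>) ^ CARD('n) * measure lborel (ball (0::real^'n) 1)"
    using content_ball_conv_unit_ball[of "2 * \<sigma>" x0] h by simp
  finally have *: "real N * measure lborel S <= (2 * \<sigma>) ^ CARD('n) * measure lborel (ball (0::real^'n) 1)" .
  have "\<sigma> / h * measure lborel S <= 2 * (real N * measure lborel S)"
    using mult_right_mono[OF Nge, of "measure lborel S"] by simp
  also have "... <= 2 * ((2 * \<sigma>) ^ CARD('n) * measure lborel (ball (0::real^'n) 1))" using * by simp
  finally have "measure lborel S <= h / \<sigma> * (2 * ((2 * \<sigma>) ^ CARD('n) * measure lborel (ball (0::real^'n) 1)))"
    using h by (simp add: field_simps)
  also have "... = (6 / c * 2 ^ CARD('n) * measure lborel (ball (0::real^'n) 1)) * s * (\<sigma> ^ CARD('n) / \<sigma>)"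
    by (simp add: h_def power_mult_distrib)
  also have "\<sigma> ^ CARD('n) / \<sigma> = \<sigma> ^ (CARD('n) - 1)"
    using h by (simp add: power_diff)
  finally show ?thesis by (simp add: S_def)
qed

end

lemma ball_fmeasurable: "ball (x::'a::euclidean_space) R \<in> fmeasurable lborel"
  by (rule fmeasurableI) (use emeasure_lborel_ball_finite[of x R] in auto)

context defining_function
begin

lemma layer_in_neighbourhood:
  assumes "open U" "frontier D \<subseteq> U"
  obtains s where "0 < s" "!!x. x \<in> D ==> r x <= s ==> x \<in> U"
proof (cases "closure D - U = {}")
  case True
  then show thesis using that[of 1] closure_subset by fastforce
next
  case False
  have "compact (closure D - U)" using D_bounded assms(1) by (intro compact_diff) auto
  then obtain m where m: "m \<in> closure D - U" "!!y. y \<in> closure D - U ==> r m <= r y"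
    using continuous_attains_inf[OF _ False r_partials(3)] by blast
  have "m \<in> D" using m(1) assms(2) frontier_iff by blast
  then have "0 < r m" using r_pos by simp
  show thesis
  proof (rule that[of "r m / 2"])
    fix x assume x: "x \<in> D" "r x <= r m / 2"
    show "x \<in> U"
    proof (rule ccontr)
      assume "x \<notin> U"
      then have "r m <= r x" using x closure_subset by (intro m(2)) auto
      then show False using x(2) \<open>0 < r m\<close> by linarith
    qed
  qed (use \<open>0 < r m\<close> in simp)
qed

lemma uniform_on_layer:
  fixes f :: "real^'n => real"
  assumes f: "!!x0. x0 \<in> frontier D ==> (f \<longlongrightarrow> 0) (at x0 within D)" and e: "0 < e"
  obtains s where "0 < s" "!!x. x \<in> D ==> r x <= s ==> \<bar>f x\<bar> < e"
proof -
  have "\<exists>d>0. \<forall>x\<in>D. dist x x0 < d --> \<bar>f x\<bar> < e" if x0: "x0 \<in> frontier D" for x0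
  proof -
    have "eventually (%x. dist (f x) 0 < e) (at x0 within D)" by (rule tendstoD[OF f[OF x0] e])
    then obtain d where d: "0 < d" "\<forall>x\<in>D. x \<noteq> x0 \<and> dist x x0 < d --> dist (f x) 0 < e"
      unfolding eventually_at by blast
    have "x0 \<notin> D" using x0 frontier_iff by blast
    then show ?thesis using d by (intro exI[of _ d]) auto
  qed
  then obtain d where d: "!!x0. x0 \<in> frontier D ==> 0 < d x0 \<and> (\<forall>x\<in>D. dist x x0 < d x0 --> \<bar>f x\<bar> < e)" by metis
  obtain s where s: "0 < s" "!!x. x \<in> D ==> r x <= s ==> x \<in> (\<Union>x0\<in>frontier D. ball x0 (d x0))"
    by (rule layer_in_neighbourhood[of "\<Union>x0\<in>frontier D. ball x0 (d x0)"]) (use d in \<open>auto intro!: bexI\<close>)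
  have "\<bar>f x\<bar> < e" if x: "x \<in> D" "r x <= s" for x
  proof -
    obtain x0 where "x0 \<in> frontier D" "dist x0 x < d x0" using s(2)[OF x] by auto
    then show ?thesis using d[of x0] x by (auto simp: dist_commute)
  qed
  then show thesis using that s by blast
qed

lemma unit_sgn_grad_r: "x \<in> frontier D ==> norm (sgn (grad r x)) = 1"
  using grad_r_frontier by (simp add: norm_sgn)

lemma local_layer_volume:
  obtains R a C where "0 < R" "0 < a" "0 <= C"
    "!!x0 \<sigma> s. x0 \<in> frontier D ==> \<sigma> <= R ==> 0 < s ==> s <= a * \<sigma> ==>
      measure lborel {x \<in> ball x0 \<sigma>. \<bar>r x\<bar> <= s} <= C * s * \<sigma> ^ (CARD('n) - 1)"
proof -
  obtain R c where R: "0 < R" "0 < c" "!!x0 x. x0 \<in> frontier D ==> x \<in> ball x0 R ==> c <= grad r x \<bullet> sgn (grad r x0)"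
    using uniform_direction by blast
  show thesis
  proof (rule that[of R "c / 3" "6 / c * 2 ^ CARD('n) * measure lborel (ball (0::real^'n) 1)"])
    fix x0 \<sigma> s assume x0: "x0 \<in> frontier D" and \<sigma>: "\<sigma> <= R" and s: "0 < s" "s <= c / 3 * \<sigma>"
    show "measure lborel {x \<in> ball x0 \<sigma>. \<bar>r x\<bar> <= s} <= 6 / c * 2 ^ CARD('n) * measure lborel (ball (0::real^'n) 1) * s * \<sigma> ^ (CARD('n) - 1)"
      by (rule layer_volume[OF R(3)[OF x0] unit_sgn_grad_r[OF x0] R(2) s(1) _ \<sigma>]) (use s R(2) in \<open>auto simp: field_simps\<close>)
  qed (use R in auto)
qed

lemma layer_measurable [measurable]: "{x \<in> D. r x <= s} \<in> sets borel" "{x \<in> ball x0 \<sigma>. \<bar>r x\<bar> <= s} \<in> sets borel"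
  "D \<in> sets borel" "r \<in> borel_measurable borel"
proof -
  show [measurable]: "r \<in> borel_measurable borel" by (rule borel_measurable_continuous_onI[OF r_partials(3)])
  show [measurable]: "D \<in> sets borel" using D_open by simp
  show "{x \<in> D. r x <= s} \<in> sets borel" "{x \<in> ball x0 \<sigma>. \<bar>r x\<bar> <= s} \<in> sets borel" by measurable
qed

lemma total_layer_volume:
  obtains C s0 where "0 <= C" "0 < s0" "!!s. 0 < s ==> s <= s0 ==> measure lborel {x \<in> D. r x <= s} <= C * s"
proof -
  obtain R a C where R: "0 < R" "0 < a" "0 <= C"
    "!!x0 \<sigma> s. x0 \<in> frontier D ==> \<sigma> <= R ==> 0 < s ==> s <= a * \<sigma> ==>
      measure lborel {x \<in> ball x0 \<sigma>. \<bar>r x\<bar> <= s} <= C * s * \<sigma> ^ (CARD('n) - 1)"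
    using local_layer_volume by blast
  have "frontier D \<subseteq> (\<Union>x\<in>frontier D. ball x R)" using R(1) by auto
  then obtain F where F: "F \<subseteq> frontier D" "finite F" "frontier D \<subseteq> (\<Union>x\<in>F. ball x R)"
    by (rule compactE_image[OF compact_frontier_D, of "frontier D" "%x. ball x R", rotated]) auto
  obtain s1 where s1: "0 < s1" "!!x. x \<in> D ==> r x <= s1 ==> x \<in> (\<Union>x\<in>F. ball x R)"
    by (rule layer_in_neighbourhood[OF _ F(3)]) auto
  show thesis
  proof (rule that[of "real (card F) * (C * R ^ (CARD('n) - 1))" "min s1 (a * R)"])
    fix s assume s: "0 < s" "s <= min s1 (a * R)"
    have "{x \<in> D. r x <= s} \<subseteq> (\<Union>x0\<in>F. {x \<in> ball x0 R. \<bar>r x\<bar> <= s})"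
    proof
      fix x assume x: "x \<in> {x \<in> D. r x <= s}"
      then obtain x0 where x0: "x0 \<in> F" "x \<in> ball x0 R" using s1(2)[of x] s by auto
      moreover have "0 < r x" using x r_pos by simp
      ultimately show "x \<in> (\<Union>x0\<in>F. {x \<in> ball x0 R. \<bar>r x\<bar> <= s})" using x by auto
    qed
    then have "measure lborel {x \<in> D. r x <= s} <= measure lborel (\<Union>x0\<in>F. {x \<in> ball x0 R. \<bar>r x\<bar> <= s})"
    proof (rule measure_mono_fmeasurable)
      have "{x \<in> ball x0 R. \<bar>r x\<bar> <= s} \<in> fmeasurable lborel" for x0
        by (rule fmeasurableI2[OF ball_fmeasurable[of x0 R]]) auto
      then show "(\<Union>x0\<in>F. {x \<in> ball x0 R. \<bar>r x\<bar> <= s}) \<in> fmeasurable lborel"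
        by (intro fmeasurable.finite_UN F(2)) auto
    qed simp
    also have "... <= (\<Sum>x0\<in>F. measure lborel {x \<in> ball x0 R. \<bar>r x\<bar> <= s})"
      by (rule measure_UNION_le[OF F(2)]) simp
    also have "... <= (\<Sum>x0\<in>F. C * s * R ^ (CARD('n) - 1))"
      by (intro sum_mono R(4)) (use F(1) s in auto)
    also have "... = real (card F) * (C * R ^ (CARD('n) - 1)) * s" by simp
    finally show "measure lborel {x \<in> D. r x <= s} <= real (card F) * (C * R ^ (CARD('n) - 1)) * s" .
  qed (use R s1 in auto)
qed

text \<open>Volumes of layers bound the number of points in a separated subset of the boundary,
  and a maximal separated subset gives efficient coverings.\<close>
lemma hausdorff_frontier_finite: "hausdorff_outer (CARD('n) - 1) (frontier D) < \<infinity>"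
proof -
  let ?d = "CARD('n) - 1"
  obtain R a C where R: "0 < R" "0 < a" "0 <= C"
    "!!x0 \<sigma> s. x0 \<in> frontier D ==> \<sigma> <= R ==> 0 < s ==> s <= a * \<sigma> ==>
      measure lborel {x \<in> ball x0 \<sigma>. \<bar>r x\<bar> <= s} <= C * s * \<sigma> ^ ?d"
    using local_layer_volume by blast
  have local: "hausdorff_outer ?d (frontier D \<inter> ball x0 (R/2)) < \<infinity>" if x0: "x0 \<in> frontier D" for x0
  proof -
    define F where "F = frontier D \<inter> ball x0 (R/2)"
    have "compact (grad r ` cball x0 R)" by (intro compact_continuous_image grad_r_continuous compact_cball)
    then have "bounded (grad r ` cball x0 R)" by (rule compact_imp_bounded)
    then obtain L0 where L0: "\<forall>y\<in>grad r ` cball x0 R. norm y <= L0" unfolding bounded_iff by (elim exE)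
    define L where "L = \<bar>L0\<bar> + 1"
    have L: "0 < L" by (simp add: L_def)
    have lip: "\<bar>r y - r x\<bar> <= L * norm (y - x)" if "x \<in> ball x0 R" "y \<in> ball x0 R" for x y
    proof -
      have "norm (r y - r x) <= L * norm (y - x)"
      proof (rule differentiable_bound[OF convex_ball[of x0 R], where f' = "%x v. grad r x \<bullet> v"])
        fix z assume z: "z \<in> ball x0 R"
        show "(r has_derivative (%v. grad r z \<bullet> v)) (at z within ball x0 R)"
          by (rule has_derivative_at_withinI[OF differentiable_has_derivative_grad[OF r_partials(6)]])
        have "z \<in> cball x0 R" using z by simp
        then have "norm (grad r z) <= L0" using L0 by blast
        then have "norm (grad r z) <= L" by (simp add: L_def)
        then show "onorm (%v. grad r z \<bullet> v) <= L"
          by (intro onorm_le) (metis Cauchy_Schwarz_ineq2 mult_right_mono norm_ge_zero order_trans real_norm_def)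
      qed (use that in auto)
      then show ?thesis by simp
    qed
    define V where "V = measure lborel (ball (0::real^'n) 1)"
    have V: "0 < V" unfolding V_def using content_ball_pos[of 1 "0::real^'n"] by simp
    define P where "P = 2 ^ ?d * C * L * R ^ ?d / V"
    have P: "0 <= P" using R L V by (simp add: P_def)
    \<comment> \<open>Disjoint balls of radius \<open>\<delta>/2\<close> with centres in \<open>F\<close> lie in a layer of height of order \<open>\<delta>\<close>,
      whose volume is of order \<open>\<delta>\<close>; hence their number is at most of order \<open>\<delta>\<close> to the power \<open>1 - d\<close>.\<close>
    have pack: "real (card T) * \<delta> ^ ?d <= P"
      if T: "finite T" "T \<subseteq> F" "!!x y. x \<in> T ==> y \<in> T ==> x \<noteq> y ==> \<delta> <= dist x y"
        and \<delta>: "0 < \<delta>" "\<delta> <= R" "L * \<delta> / 2 <= a * R" for T \<delta>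
    proof -
      have sub: "(\<Union>x\<in>T. ball x (\<delta>/2)) \<subseteq> {x \<in> ball x0 R. \<bar>r x\<bar> <= L * \<delta> / 2}"
      proof
        fix y assume "y \<in> (\<Union>x\<in>T. ball x (\<delta>/2))"
        then obtain x where x: "x \<in> T" "dist x y < \<delta>/2" by auto
        have xF: "x \<in> frontier D" "dist x0 x < R / 2" using T(2) x by (auto simp: F_def)
        have yb: "y \<in> ball x0 R" using dist_triangle[of x0 y x] x xF \<delta> by simp
        have "\<bar>r y - r x\<bar> <= L * norm (y - x)" by (rule lip) (use xF yb R in auto)
        also have "... <= L * (\<delta> / 2)" using x L by (intro mult_left_mono) (auto simp: dist_norm norm_minus_commute)
        finally show "y \<in> {x \<in> ball x0 R. \<bar>r x\<bar> <= L * \<delta> / 2}" using yb r_frontier[OF xF(1)] by simp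
      qed
      have fm: "{x \<in> ball x0 R. \<bar>r x\<bar> <= L * \<delta> / 2} \<in> fmeasurable lborel"
        by (rule fmeasurableI2[OF ball_fmeasurable[of x0 R]]) auto
      have dj: "disjoint_family_on (%x. ball x (\<delta>/2)) T"
        unfolding disjoint_family_on_def
      proof (intro ballI impI)
        fix x y assume xy: "x \<in> T" "y \<in> T" "x \<noteq> y"
        show "ball x (\<delta>/2) \<inter> ball y (\<delta>/2) = {}"
        proof (rule ccontr)
          assume "ball x (\<delta>/2) \<inter> ball y (\<delta>/2) \<noteq> {}"
          then obtain z where "dist x z < \<delta>/2" "dist y z < \<delta>/2" by auto
          then have "dist x y < \<delta>" using dist_triangle2[of x y z] by simp
          then show False using T(3)[OF xy] by simp
        qed
      qed
      have "real (card T) * ((\<delta>/2) ^ CARD('n) * V) = (\<Sum>x\<in>T. measure lborel (ball x (\<delta>/2)))"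
      proof -
        have "measure lborel (ball x (\<delta>/2)) = (\<delta>/2) ^ CARD('n) * V" for x :: "real^'n"
          using content_ball_conv_unit_ball[of "\<delta>/2" x] \<delta> by (simp add: V_def)
        then show ?thesis by simp
      qed
      also have "... = measure lborel (\<Union>x\<in>T. ball x (\<delta>/2))"
        by (rule measure_finite_Union[symmetric, OF T(1) _ dj])
          (use emeasure_lborel_ball_finite in \<open>auto simp: less_top\<close>)
      also have "... <= measure lborel {x \<in> ball x0 R. \<bar>r x\<bar> <= L * \<delta> / 2}"
        by (rule measure_mono_fmeasurable[OF sub _ fm]) (use T(1) in auto)
      also have "... <= C * (L * \<delta> / 2) * R ^ ?d"
        by (rule R(4)[OF x0]) (use \<delta> L in auto)
      finally have 1: "real (card T) * ((\<delta>/2) ^ CARD('n) * V) <= C * (L * \<delta> / 2) * R ^ ?d" .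
      have "CARD('n) = Suc ?d" by (simp add: Suc_pred')
      then have pw: "(\<delta>/2) ^ CARD('n) = \<delta> / 2 * (\<delta> ^ ?d / 2 ^ ?d)" by (metis power_Suc power_divide)
      have "(\<delta> / 2) * (real (card T) * (\<delta> ^ ?d / 2 ^ ?d) * V) <= (\<delta> / 2) * (C * L * R ^ ?d)"
        using 1 unfolding pw by (simp add: algebra_simps)
      then have "real (card T) * (\<delta> ^ ?d / 2 ^ ?d) * V <= C * L * R ^ ?d"
        using \<delta>(1) by (simp only: mult_le_cancel_left_pos half_gt_zero)
      then show ?thesis using V by (simp add: P_def field_simps)
    qed
    \<comment> \<open>The balls of radius \<open>\<delta>\<close> around a maximal \<open>\<delta>\<close>-separated subset of \<open>F\<close> cover \<open>F\<close>.\<close>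
    have cover: "\<exists>T. finite T \<and> T \<subseteq> F \<and> F \<subseteq> (\<Union>x\<in>T. ball x \<delta>) \<and> real (card T) * \<delta> ^ ?d <= P"
      if \<delta>: "0 < \<delta>" "\<delta> <= R" "L * \<delta> / 2 <= a * R" for \<delta>
    proof -
      define sepd where "sepd T \<longleftrightarrow> finite T \<and> T \<subseteq> F \<and> (\<forall>x\<in>T. \<forall>y\<in>T. x \<noteq> y --> \<delta> <= dist x y)" for T
      obtain M :: nat where M: "P / \<delta> ^ ?d < real M" using reals_Archimedean2 by blast
      have bd: "card T <= M" if "sepd T" for T
      proof -
        have "real (card T) * \<delta> ^ ?d <= P" using pack[OF _ _ _ \<delta>] that by (auto simp: sepd_def)
        then have "real (card T) <= P / \<delta> ^ ?d" using \<delta> by (simp add: pos_le_divide_eq)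
        then show ?thesis using M by simp
      qed
      have "sepd {}" by (simp add: sepd_def)
      then obtain T where T: "sepd T" "!!T'. sepd T' ==> card T' <= card T"
        using ex_has_greatest_nat[of sepd "{}" card "Suc M"] bd by (auto simp: less_Suc_eq_le)
      have "F \<subseteq> (\<Union>x\<in>T. ball x \<delta>)"
      proof (rule ccontr)
        assume "\<not> F \<subseteq> (\<Union>x\<in>T. ball x \<delta>)"
        then obtain z where z: "z \<in> F" "!!x. x \<in> T ==> \<delta> <= dist x z" by force
        then have "z \<notin> T" using \<delta> by force
        moreover have "sepd (insert z T)" using T(1) z by (auto simp: sepd_def dist_commute)
        ultimately show False using T(2)[of "insert z T"] T(1) by (simp add: sepd_def)
      qed
      moreover have "real (card T) * \<delta> ^ ?d <= P" using pack[OF _ _ _ \<delta>] T(1) by (auto simp: sepd_def)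
      ultimately show ?thesis using T(1) by (auto simp: sepd_def)
    qed
    have "hausdorff_outer ?d F <= ennreal (unit_ball_vol (real ?d) * P)"
      unfolding hausdorff_outer_eq
    proof (rule SUP_least)
      fix \<epsilon> :: real assume \<epsilon>: "\<epsilon> \<in> {0<..}"
      define \<delta> where "\<delta> = min (min (\<epsilon> / 2) R) (2 * a * R / L)"
      have \<delta>: "0 < \<delta>" "\<delta> <= R" "2 * \<delta> <= \<epsilon>" "L * \<delta> / 2 <= a * R"
      proof -
        have "\<delta> <= 2 * a * R / L" by (simp add: \<delta>_def)
        then have "L * \<delta> <= 2 * a * R" using L by (simp add: pos_le_divide_eq mult.commute)
        then show "L * \<delta> / 2 <= a * R" by simp
      qed (use \<epsilon> R L in \<open>auto simp: \<delta>_def\<close>)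
      obtain T where T: "finite T" "T \<subseteq> F" "F \<subseteq> (\<Union>x\<in>T. ball x \<delta>)" "real (card T) * \<delta> ^ ?d <= P"
        using cover[OF \<delta>(1,2,4)] by blast
      obtain f :: "nat => real^'n" where f: "bij_betw f {0..<card T} T" using ex_bij_betw_nat_finite[OF T(1)] by blast
      define Cv where "Cv k = (if k < card T then ball (f k) \<delta> else {})" for k
      have dm: "diameter (ball x \<delta>) <= 2 * \<delta>" for x :: "real^'n" using \<delta> by (simp add: diameter_ball)
      have "Cv \<in> hcover \<epsilon> F"
        unfolding hcover_def
      proof (intro CollectI conjI allI)
        show "F \<subseteq> (\<Union>k. Cv k)"
        proof
          fix x assume "x \<in> F"
          then obtain t where t: "t \<in> T" "x \<in> ball t \<delta>" using T(3) by blast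
          then have "t \<in> f ` {0..<card T}" using f by (simp add: bij_betw_def)
          then obtain k where "k < card T" "f k = t" by auto
          then show "x \<in> (\<Union>k. Cv k)" using t by (auto simp: Cv_def)
        qed
        show "bounded (Cv k)" "diameter (Cv k) <= \<epsilon>" for k using dm[of "f k"] \<delta> \<epsilon> by (auto simp: Cv_def)
      qed
      then have "(INF C\<in>hcover \<epsilon> F. \<Sum>k. hval ?d (C k)) <= (\<Sum>k. hval ?d (Cv k))" by (rule INF_lower)
      also have "... = (\<Sum>k<card T. hval ?d (Cv k))" by (rule suminf_finite) (auto simp: Cv_def hval_def)
      also have "... <= (\<Sum>k<card T. ennreal (unit_ball_vol (real ?d) * \<delta> ^ ?d))"
      proof (rule sum_mono)
        fix k
        show "hval ?d (Cv k) <= ennreal (unit_ball_vol (real ?d) * \<delta> ^ ?d)"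
          using dm[of "f k"] \<delta> unit_ball_vol_nonneg[of "real ?d"] diameter_ge_0[of "ball (f k) \<delta>"]
          by (auto simp: hval_def Cv_def intro!: ennreal_leI mult_left_mono power_mono)
      qed
      also have "... = ennreal (unit_ball_vol (real ?d) * (real (card T) * \<delta> ^ ?d))"
        using \<delta> by (simp add: ennreal_of_nat_eq_real_of_nat ennreal_mult[symmetric] mult.left_commute mult.assoc)
      also have "... <= ennreal (unit_ball_vol (real ?d) * P)"
        using T(4) by (intro ennreal_leI mult_left_mono) auto
      finally show "(INF C\<in>hcover \<epsilon> F. \<Sum>k. hval ?d (C k)) <= ennreal (unit_ball_vol (real ?d) * P)" .
    qed
    also have "... < \<infinity>" by simp
    finally show ?thesis by (simp add: F_def)
  qed
  have cov: "frontier D \<subseteq> (\<Union>x\<in>frontier D. ball x (R/2))" using R(1) by auto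
  obtain F where F: "F \<subseteq> frontier D" "finite F" "frontier D \<subseteq> (\<Union>x\<in>F. ball x (R/2))"
    by (rule compactE_image[OF compact_frontier_D _ cov]) auto
  note H = metric_outer_measureD[OF hausdorff_metric_outer_measure] metric_outer_measure_Un[OF hausdorff_metric_outer_measure]
  have "hausdorff_outer ?d (\<Union>x\<in>F'. frontier D \<inter> ball x (R/2)) < \<infinity>" if "F' \<subseteq> F" for F'
    using finite_subset[OF that F(2)] that
  proof (induction F' rule: finite_induct)
    case (insert x F')
    have "hausdorff_outer ?d (\<Union>x\<in>insert x F'. frontier D \<inter> ball x (R/2)) \<le>
      hausdorff_outer ?d (frontier D \<inter> ball x (R/2)) + hausdorff_outer ?d (\<Union>x\<in>F'. frontier D \<inter> ball x (R/2))"
      using H(5)[of ?d "frontier D \<inter> ball x (R/2)"] by simp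
    also have "... < \<infinity>" using insert local[of x] F(1) by (auto simp: ennreal_add_less_top)
    finally show ?case .
  qed (simp add: H(1))
  moreover have "frontier D \<subseteq> (\<Union>x\<in>F. frontier D \<inter> ball x (R/2))" using F(3) by blast
  ultimately show ?thesis using H(2) le_less_trans by (meson order_refl)
qed

end

text \<open>A set of diameter \<open>t\<close> that meets \<open>S\<close> lies in a closed ball
  of radius \<open>t\<close> around a point of \<open>S\<close>; sum over a covering.\<close>
lemma measure_le_hausdorff:
  fixes \<mu> :: "(real^'n::finite) measure"
  assumes sets: "sets \<mu> = sets borel" and C: "0 < C" and R: "0 < R"
    and le: "!!x t. x \<in> S ==> 0 < t ==> t <= R ==> emeasure \<mu> (cball x t) <= ennreal (C * t ^ d)"
    and E: "E \<in> sets borel" "E \<subseteq> S"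
  shows "emeasure \<mu> E <= ennreal (C * 2 ^ d / unit_ball_vol (real d)) * hausdorff_outer d E"
proof -
  define K where "K = C * 2 ^ d / unit_ball_vol (real d)"
  have ubv: "0 < unit_ball_vol (real d)" by simp
  have ubv0: "unit_ball_vol (real d) \<noteq> 0" using ubv by linarith
  have K: "0 < K" using C ubv by (simp add: K_def)
  have ball: "emeasure \<mu> (cball x t) <= ennreal (C * t ^ d)" if x: "x \<in> S" and t: "0 <= t" "t < R" for x t
  proof (rule tendsto_lowerbound)
    show "((%s. ennreal (C * s ^ d)) \<longlongrightarrow> ennreal (C * t ^ d)) (at_right t)"
      by (intro tendsto_intros tendsto_ennrealI)
    have "eventually (%s. s \<in> {t<..<R}) (at_right t)" using t by (intro eventually_at_right_field[THEN iffD2]) auto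
    then show "\<forall>\<^sub>F s in at_right t. emeasure \<mu> (cball x t) <= ennreal (C * s ^ d)"
    proof eventually_elim
      case (elim s)
      have "emeasure \<mu> (cball x t) <= emeasure \<mu> (cball x s)" using elim sets by (intro emeasure_mono) auto
      also have "... <= ennreal (C * s ^ d)" using elim t by (intro le[OF x]) auto
      finally show ?case .
    qed
  qed simp
  have cov: "emeasure \<mu> E <= ennreal K * (\<Sum>k. hval d (Cv k))" if Cv: "Cv \<in> hcover (R/2) E" for Cv
  proof -
    define B where "B k = (if Cv k \<inter> S = {} then {} else cball (SOME x. x \<in> Cv k \<inter> S) (diameter (Cv k)))" for k
    have Bm: "B k \<in> sets \<mu>" for k using sets by (simp add: B_def)
    have x: "(SOME x. x \<in> Cv k \<inter> S) \<in> Cv k \<inter> S" if "Cv k \<inter> S \<noteq> {}" for k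
      using someI_ex[of "%x. x \<in> Cv k \<inter> S"] that by blast
    have "E \<subseteq> (\<Union>k. B k)"
    proof
      fix y assume y: "y \<in> E"
      then obtain k where k: "y \<in> Cv k" using Cv by (auto simp: hcover_def)
      then have ne: "Cv k \<inter> S \<noteq> {}" using y E by blast
      have "dist (SOME x. x \<in> Cv k \<inter> S) y <= diameter (Cv k)"
        using diameter_bounded_bound[of "Cv k" _ y] x[OF ne] k Cv by (auto simp: hcover_def)
      then show "y \<in> (\<Union>k. B k)" using ne by (auto simp: B_def)
    qed
    then have "emeasure \<mu> E <= emeasure \<mu> (\<Union>k. B k)" using Bm by (intro emeasure_mono) auto
    also have "... <= (\<Sum>k. emeasure \<mu> (B k))" using Bm by (intro emeasure_subadditive_countably) auto
    also have "... <= (\<Sum>k. ennreal K * hval d (Cv k))"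
    proof (intro suminf_le)
      fix k
      show "emeasure \<mu> (B k) <= ennreal K * hval d (Cv k)"
      proof (cases "Cv k \<inter> S = {}")
        case False
        then have ne: "Cv k \<noteq> {}" by blast
        have "emeasure \<mu> (B k) <= ennreal (C * diameter (Cv k) ^ d)"
        proof -
          have "diameter (Cv k) <= R / 2" "0 <= diameter (Cv k)"
            using Cv diameter_ge_0[of "Cv k"] by (auto simp: hcover_def)
          then have "emeasure \<mu> (cball (SOME x. x \<in> Cv k \<inter> S) (diameter (Cv k))) <= ennreal (C * diameter (Cv k) ^ d)"
            using x[OF False] R by (intro ball) auto
          then show ?thesis using False by (simp only: B_def if_False)
        qed
        also have "C * diameter (Cv k) ^ d = K * (unit_ball_vol (real d) * (diameter (Cv k) / 2) ^ d)"
          using ubv0 by (simp add: K_def power_divide)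
        also have "ennreal ... = ennreal K * hval d (Cv k)" using ne K by (simp add: hval_def ennreal_mult' less_imp_le)
        finally show ?thesis .
      qed (simp add: B_def)
    qed auto
    also have "... = ennreal K * (\<Sum>k. hval d (Cv k))" by simp
    finally show ?thesis .
  qed
  have "emeasure \<mu> E / ennreal K <= (INF Cv\<in>hcover (R/2) E. (\<Sum>k. hval d (Cv k)))"
  proof (rule INF_greatest)
    fix Cv assume "Cv \<in> hcover (R/2) E"
    from cov[OF this] show "emeasure \<mu> E / ennreal K <= (\<Sum>k. hval d (Cv k))"
      using K by (intro divide_le_posI_ennreal) (auto simp: mult.commute)
  qed
  also have "... <= hausdorff_outer d E"
    unfolding hausdorff_outer_eq by (intro SUP_upper) (use R in auto)
  finally have "emeasure \<mu> E / ennreal K * ennreal K <= hausdorff_outer d E * ennreal K" by (rule mult_right_mono) simp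
  moreover have "emeasure \<mu> E / ennreal K * ennreal K = emeasure \<mu> E"
  proof -
    have "inverse (ennreal K) * ennreal K = 1"
      using ennreal_divide_self[of "ennreal K"] K by (simp add: divide_ennreal_def mult.commute)
    then show ?thesis by (simp add: divide_ennreal_def mult.assoc)
  qed
  ultimately show ?thesis by (simp add: K_def mult.commute)
qed

section \<open>Functions vanishing on the boundary\<close>

text \<open>Here \<open>g\<close> is the continuous extension of the gradient of \<open>u\<close>
  up to the boundary.\<close>
locale boundary_vanishing = defining_function +
  fixes u :: "real^'n => real" and g :: "real^'n => real^'n"
  assumes u_cont: "continuous_on (closure D) u" and u_diff: "!!x. x \<in> D ==> u differentiable (at x)"
    and g_cont: "continuous_on (closure D) g" and g_grad: "!!x. x \<in> D ==> g x = grad u x"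
    and u_0: "!!x. x \<in> frontier D ==> u x = 0"
begin

definition w :: "real^'n => real" where "w x = (g x \<bullet> grad r x) / (grad r x \<bullet> grad r x)"

text \<open>Moving from \<open>x\<close> against the direction \<open>e\<close> lowers
  \<open>r\<close> at rate at least \<open>c\<close>, so the boundary is reached within the
  distance \<open>r x / c\<close>.\<close>
lemma hitting_point:
  assumes x0: "x0 \<in> frontier D" and dir: "!!x. x \<in> ball x0 R ==> c <= grad r x \<bullet> e" and c: "0 < c" and e: "norm e = 1"
    and x: "x \<in> D" "dist x0 x < R / 2" "r x / c < R / 2"
  obtains t where "0 < t" "t <= r x / c" "x - t *\<^sub>R e \<in> frontier D" "!!s. 0 <= s ==> s < t ==> x - s *\<^sub>R e \<in> D"
proof -
  define \<tau> where "\<tau> = r x / c"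
  have rx: "0 < r x" using x r_pos by simp
  have \<tau>: "0 < \<tau>" using rx c by (simp add: \<tau>_def)
  have \<phi>c: "continuous_on S (%s. r (x - s *\<^sub>R e))" for S :: "real set"
    by (rule continuous_on_compose2[OF r_partials(3)[of UNIV]]) (auto intro!: continuous_intros)
  have inb: "x - \<tau> *\<^sub>R e \<in> ball x0 R" "x \<in> ball x0 R"
  proof -
    have "dist x0 (x - \<tau> *\<^sub>R e) <= dist x0 x + dist x (x - \<tau> *\<^sub>R e)" by (rule dist_triangle)
    also have "dist x (x - \<tau> *\<^sub>R e) = \<tau>" using e \<tau> by (simp add: dist_norm)
    finally show "x - \<tau> *\<^sub>R e \<in> ball x0 R" using x(2,3) unfolding \<tau>_def mem_ball by linarith
    show "x \<in> ball x0 R" using x(2) zero_le_dist[of x0 x] unfolding mem_ball by linarith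
  qed
  have "r (x - \<tau> *\<^sub>R e) + c * \<tau> <= r ((x - \<tau> *\<^sub>R e) + \<tau> *\<^sub>R e)"
    by (rule r_increasing[OF dir]) (use inb \<tau> in auto)
  then have neg_end: "r (x - \<tau> *\<^sub>R e) <= 0" using c by (simp add: \<tau>_def)
  define Z where "Z = {0..\<tau>} \<inter> {s. r (x - s *\<^sub>R e) <= 0}"
  have "closed {s. r (x - s *\<^sub>R e) <= 0}" by (intro closed_Collect_le \<phi>c continuous_on_const)
  then have "compact Z" unfolding Z_def by (intro compact_Int_closed) auto
  moreover have "\<tau> \<in> Z" using neg_end \<tau> by (simp add: Z_def)
  then have "Z \<noteq> {}" by blast
  ultimately obtain t where t: "t \<in> Z" "!!s. s \<in> Z ==> t <= s" using compact_attains_inf by metis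
  have t0: "0 < t" using t(1) rx by (cases "t = 0") (auto simp: Z_def)
  have inside: "x - s *\<^sub>R e \<in> D" if "0 <= s" "s < t" for s
  proof (rule ccontr)
    assume "x - s *\<^sub>R e \<notin> D"
    then have "s \<in> Z" using that t(1) r_pos[of "x - s *\<^sub>R e"] by (auto simp: Z_def)
    then show False using t(2) that by force
  qed
  have "x - t *\<^sub>R e \<notin> D" using t(1) r_pos[of "x - t *\<^sub>R e"] by (auto simp: Z_def)
  moreover have "x - t *\<^sub>R e \<in> closure D"
  proof -
    have "(%s. x - s *\<^sub>R e) ` closure {0..<t} \<subseteq> closure D"
      by (rule image_closure_subset) (use subsetD[OF closure_subset inside] in \<open>auto intro!: continuous_intros\<close>)
    moreover have "t \<in> closure {0..<t}" using t0 by (simp add: closure_atLeastLessThan)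
    ultimately show ?thesis by blast
  qed
  ultimately have "x - t *\<^sub>R e \<in> frontier D" using frontier_iff by blast
  then show thesis using that[of t] t0 inside t(1) by (auto simp: Z_def \<tau>_def)
qed

lemma u_mvt:
  assumes t: "0 < t" and in_D: "!!s. 0 < s ==> s < t ==> y + s *\<^sub>R e \<in> D"
    and cl: "y \<in> closure D" "y + t *\<^sub>R e \<in> closure D"
  obtains \<xi> where "0 < \<xi>" "\<xi> < t" "u (y + t *\<^sub>R e) - u y = t * (g (y + \<xi> *\<^sub>R e) \<bullet> e)"
proof -
  have "((%s. u (y + s *\<^sub>R e)) has_derivative (%h. grad u (y + s *\<^sub>R e) \<bullet> (h *\<^sub>R e))) (at s)" if "0 < s" "s < t" for s
    by (rule has_derivative_compose[where f = "%t. y + t *\<^sub>R e" and f' = "%t. t *\<^sub>R e" and g = u])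
      (use differentiable_has_derivative_grad[OF u_diff[OF in_D[OF that]]] in \<open>auto intro!: derivative_eq_intros\<close>)
  moreover have "continuous_on {0..t} (%s. u (y + s *\<^sub>R e))"
  proof (rule continuous_on_compose2[OF u_cont])
    show "(%s. y + s *\<^sub>R e) ` {0..t} \<subseteq> closure D"
    proof
      fix z assume "z \<in> (%s. y + s *\<^sub>R e) ` {0..t}"
      then obtain s where s: "0 <= s" "s <= t" "z = y + s *\<^sub>R e" by auto
      show "z \<in> closure D"
        using s cl in_D[of s] closure_subset by (cases "s = 0"; cases "s = t") auto
    qed
  qed (intro continuous_intros)
  ultimately obtain \<xi> where \<xi>: "0 < \<xi>" "\<xi> < t" "u (y + t *\<^sub>R e) - u (y + 0 *\<^sub>R e) = grad u (y + \<xi> *\<^sub>R e) \<bullet> ((t - 0) *\<^sub>R e)"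
    using mvt[OF t, of "%s. u (y + s *\<^sub>R e)" "%s h. grad u (y + s *\<^sub>R e) \<bullet> (h *\<^sub>R e)"] by metis
  then show thesis using that[of \<xi>] g_grad[OF in_D[OF \<xi>(1,2)]] by simp
qed

text \<open>Compare \<open>u\<close> and \<open>r\<close> on the segment from \<open>x\<close> to
  the boundary point where it leaves \<open>D\<close>: by the mean value theorem their quotient is
  a quotient of directional derivatives at points that tend to \<open>x0\<close>.\<close>
lemma quotient_limit:
  assumes x0: "x0 \<in> frontier D"
  shows "((%x. u x / r x) \<longlongrightarrow> w x0) (at x0 within D)"
proof -
  obtain R c where R: "0 < R" "0 < c" "!!x0 x. x0 \<in> frontier D ==> x \<in> ball x0 R ==> c <= grad r x \<bullet> sgn (grad r x0)"
    using uniform_direction by blast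
  define e where "e = sgn (grad r x0)"
  have e: "norm e = 1" unfolding e_def by (rule unit_sgn_grad_r[OF x0])
  have x0cl: "x0 \<in> closure D" using x0 frontier_iff by blast
  note dir = R(3)[OF x0, folded e_def]
  let ?F = "at x0 within D"
  have id: "((%x. x) \<longlongrightarrow> x0) ?F" by (rule tendsto_ident_at)
  have rl: "((%x. r x / c) \<longlongrightarrow> 0) ?F"
  proof -
    have "((%x. r x / c) \<longlongrightarrow> r x0 / c) ?F"
      using R(2) by (intro tendsto_divide tendsto_const continuous_on_tendsto_compose[OF r_partials(3)[of UNIV] id]) auto
    then show ?thesis using r_frontier[OF x0] by simp
  qed
  have ev: "eventually (%x. x \<in> D \<and> dist x0 x < R / 2 \<and> r x / c < R / 2) ?F"
  proof (intro eventually_conj)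
    show "eventually (%x. x \<in> D) ?F" by (simp add: eventually_at_filter)
    show "eventually (%x. dist x0 x < R / 2) ?F" using tendstoD[OF id, of "R/2"] R(1) by (simp add: dist_commute)
    show "eventually (%x. r x / c < R / 2) ?F" by (rule order_tendstoD(2)[OF rl]) (use R(1) in simp)
  qed
  have "\<exists>z z'. z \<in> D \<and> dist z x <= r x / c \<and> dist z' x <= r x / c \<and> u x / r x = (g z \<bullet> e) / (grad r z' \<bullet> e)"
    if x: "x \<in> D \<and> dist x0 x < R / 2 \<and> r x / c < R / 2" for x
  proof -
    obtain t where t: "0 < t" "t <= r x / c" "x - t *\<^sub>R e \<in> frontier D" "!!s. 0 <= s ==> s < t ==> x - s *\<^sub>R e \<in> D"
      by (rule hitting_point[where R = R and c = c and e = e and x = x, OF x0 _ R(2) e]) (use dir x in auto)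
    define y where "y = x - t *\<^sub>R e"
    have seg: "y + s *\<^sub>R e \<in> D" if "0 < s" "s <= t" for s
      using t(4)[of "t - s"] that by (simp add: y_def algebra_simps)
    have xy: "x = y + t *\<^sub>R e" by (simp add: y_def)
    have ycl: "y \<in> closure D" using t(3) frontier_iff by (simp add: y_def)
    obtain \<xi> where \<xi>: "0 < \<xi>" "\<xi> < t" "u (y + t *\<^sub>R e) - u y = t * (g (y + \<xi> *\<^sub>R e) \<bullet> e)"
      by (rule u_mvt[OF t(1), of y e]) (use seg ycl t(1) closure_subset in auto)
    obtain \<zeta> where \<zeta>: "0 < \<zeta>" "\<zeta> < t" "r (y + t *\<^sub>R e) - r y = t * (grad r (y + \<zeta> *\<^sub>R e) \<bullet> e)"
      using r_mvt[OF t(1), of y e] by blast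
    have y0: "u y = 0" "r y = 0" using t(3) u_0 r_frontier by (auto simp: y_def)
    have dst: "dist (y + s *\<^sub>R e) x <= r x / c" if "0 < s" "s < t" for s
    proof -
      have "dist (y + s *\<^sub>R e) x = norm ((s - t) *\<^sub>R e)" by (simp add: xy dist_norm scaleR_diff_left)
      also have "... <= t" using e that by simp
      finally show ?thesis using t(2) by simp
    qed
    have "u x / r x = (t * (g (y + \<xi> *\<^sub>R e) \<bullet> e)) / (t * (grad r (y + \<zeta> *\<^sub>R e) \<bullet> e))"
      using \<xi>(3) \<zeta>(3) y0 by (simp add: xy)
    also have "... = (g (y + \<xi> *\<^sub>R e) \<bullet> e) / (grad r (y + \<zeta> *\<^sub>R e) \<bullet> e)" using t(1) by simp
    finally show ?thesis using seg[of \<xi>] \<xi> \<zeta> dst by (intro exI[of _ "y + \<xi> *\<^sub>R e"] exI[of _ "y + \<zeta> *\<^sub>R e"]) auto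
  qed
  then obtain Z Z' where Z: "!!x. x \<in> D \<and> dist x0 x < R / 2 \<and> r x / c < R / 2 ==>
      Z x \<in> D \<and> dist (Z x) x <= r x / c \<and> dist (Z' x) x <= r x / c \<and> u x / r x = (g (Z x) \<bullet> e) / (grad r (Z' x) \<bullet> e)" by metis
  have lim: "(Y \<longlongrightarrow> x0) ?F" if "eventually (%x. dist (Y x) x <= r x / c) ?F" for Y
  proof -
    have "((%x. dist (Y x) x) \<longlongrightarrow> 0) ?F"
      by (rule tendsto_sandwich[OF _ that tendsto_const rl]) simp
    then have "((%x. Y x - x) \<longlongrightarrow> 0) ?F" by (simp add: dist_norm tendsto_norm_zero_iff)
    from tendsto_add[OF this id] show ?thesis by simp
  qed
  have "(Z \<longlongrightarrow> x0) ?F" by (rule lim) (use ev Z in \<open>auto elim: eventually_mono\<close>)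
  then have gz: "((%x. g (Z x)) \<longlongrightarrow> g x0) ?F"
    by (rule continuous_on_tendsto_compose[OF g_cont _ x0cl])
      (rule eventually_mono[OF ev], use Z closure_subset in blast)
  have "(Z' \<longlongrightarrow> x0) ?F" by (rule lim) (use ev Z in \<open>auto elim: eventually_mono\<close>)
  then have rz: "((%x. grad r (Z' x)) \<longlongrightarrow> grad r x0) ?F"
    by (rule continuous_on_tendsto_compose[OF grad_r_continuous[of UNIV]]) auto
  have nz: "grad r x0 \<bullet> e \<noteq> 0" using dir[of x0] R by auto
  have "((%x. (g (Z x) \<bullet> e) / (grad r (Z' x) \<bullet> e)) \<longlongrightarrow> (g x0 \<bullet> e) / (grad r x0 \<bullet> e)) ?F"
    by (intro tendsto_intros gz rz nz)
  moreover have "(g x0 \<bullet> e) / (grad r x0 \<bullet> e) = w x0"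
    using grad_r_frontier[OF x0] by (simp add: e_def sgn_div_norm w_def)
  moreover have "eventually (%x. (g (Z x) \<bullet> e) / (grad r (Z' x) \<bullet> e) = u x / r x) ?F"
    by (rule eventually_mono[OF ev]) (use Z in auto)
  ultimately show ?thesis using Lim_transform_eventually by fastforce
qed

text \<open>Since \<open>u\<close> vanishes on the boundary, the extended gradient has no
  tangential part. This follows from \<open>quotient_limit\<close> applied along every direction
  that points into \<open>D\<close>.\<close>
lemma boundary_gradient:
  assumes x0: "x0 \<in> frontier D"
  shows "g x0 = w x0 *\<^sub>R grad r x0"
proof -
  have x0cl: "x0 \<in> closure D" "x0 \<notin> D" using x0 frontier_iff by blast+
  have dirl: "g x0 \<bullet> v = w x0 * (grad r x0 \<bullet> v)" if v: "0 < grad r x0 \<bullet> v" for v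
  proof -
    let ?F = "at_right (0::real)"
    have dl: "((%t. (r (x0 + t *\<^sub>R v) - r x0) / t) \<longlongrightarrow> grad r x0 \<bullet> v) ?F"
      by (rule directional_limit[OF r_partials(6)])
    have "eventually (%t. 0 < (r (x0 + t *\<^sub>R v) - r x0) / t) ?F" by (rule order_tendstoD(1)[OF dl v])
    then obtain b where b: "0 < b" "!!t. 0 < t ==> t < b ==> 0 < (r (x0 + t *\<^sub>R v) - r x0) / t"
      unfolding eventually_at_right_field by auto
    have inD: "x0 + t *\<^sub>R v \<in> D" if "0 < t" "t < b" for t
      using b(2)[OF that] that r_frontier[OF x0] r_pos by (simp add: zero_less_divide_iff)
    have evb: "eventually (%t. 0 < t \<and> t < b) ?F"
      using b(1) unfolding eventually_at_right_field by auto
    have "\<exists>\<xi>. 0 < \<xi> \<and> \<xi> < t \<and> u (x0 + t *\<^sub>R v) / t = g (x0 + \<xi> *\<^sub>R v) \<bullet> v" if t: "0 < t \<and> t < b" for t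
    proof -
      obtain \<xi> where "0 < \<xi>" "\<xi> < t" "u (x0 + t *\<^sub>R v) - u x0 = t * (g (x0 + \<xi> *\<^sub>R v) \<bullet> v)"
        by (rule u_mvt[of t x0 v]) (use t inD x0cl closure_subset in auto)
      then show ?thesis using t u_0[OF x0] by (intro exI[of _ \<xi>]) simp
    qed
    then obtain \<xi> where \<xi>: "!!t. 0 < t \<and> t < b ==> 0 < \<xi> t \<and> \<xi> t < t \<and> u (x0 + t *\<^sub>R v) / t = g (x0 + \<xi> t *\<^sub>R v) \<bullet> v" by metis
    have idr: "((%t::real. t) \<longlongrightarrow> 0) ?F" by (rule tendsto_ident_at)
    have "(\<xi> \<longlongrightarrow> 0) ?F"
      by (rule tendsto_sandwich[OF _ _ tendsto_const idr])
        (rule eventually_mono[OF evb], use \<xi> in force)+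
    then have "((%t. x0 + \<xi> t *\<^sub>R v) \<longlongrightarrow> x0 + 0 *\<^sub>R v) ?F" by (intro tendsto_intros)
    then have "((%t. g (x0 + \<xi> t *\<^sub>R v)) \<longlongrightarrow> g x0) ?F"
      by (intro continuous_on_tendsto_compose[OF g_cont _ x0cl(1)])
        (simp, rule eventually_mono[OF evb], use \<xi> inD closure_subset in \<open>meson less_trans subsetD\<close>)
    then have l1: "((%t. g (x0 + \<xi> t *\<^sub>R v) \<bullet> v) \<longlongrightarrow> g x0 \<bullet> v) ?F" by (intro tendsto_intros)
    have "filterlim (%t. x0 + t *\<^sub>R v) (at x0 within D) ?F"
      unfolding filterlim_at
    proof
      have "((%t. x0 + t *\<^sub>R v) \<longlongrightarrow> x0 + 0 *\<^sub>R v) ?F" by (intro tendsto_intros)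
      then show "((%t. x0 + t *\<^sub>R v) \<longlongrightarrow> x0) ?F" by simp
      show "\<forall>\<^sub>F t in ?F. x0 + t *\<^sub>R v \<in> D \<and> x0 + t *\<^sub>R v \<noteq> x0"
        by (rule eventually_mono[OF evb]) (use inD x0cl in metis)
    qed
    from filterlim_compose[OF quotient_limit[OF x0] this]
    have "((%t. u (x0 + t *\<^sub>R v) / r (x0 + t *\<^sub>R v)) \<longlongrightarrow> w x0) ?F" .
    from tendsto_mult[OF this dl]
    have l2: "((%t. u (x0 + t *\<^sub>R v) / r (x0 + t *\<^sub>R v) * ((r (x0 + t *\<^sub>R v) - r x0) / t)) \<longlongrightarrow> w x0 * (grad r x0 \<bullet> v)) ?F" .
    have "eventually (%t. u (x0 + t *\<^sub>R v) / r (x0 + t *\<^sub>R v) * ((r (x0 + t *\<^sub>R v) - r x0) / t) = g (x0 + \<xi> t *\<^sub>R v) \<bullet> v) ?F"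
    proof (rule eventually_mono[OF evb])
      fix t assume t: "0 < t \<and> t < b"
      have "0 < r (x0 + t *\<^sub>R v)" using inD[of t] t r_pos by simp
      then show "u (x0 + t *\<^sub>R v) / r (x0 + t *\<^sub>R v) * ((r (x0 + t *\<^sub>R v) - r x0) / t) = g (x0 + \<xi> t *\<^sub>R v) \<bullet> v"
        using \<xi>[OF t] r_frontier[OF x0] t by simp
    qed
    from Lim_transform_eventually[OF l2 this] show ?thesis
      using tendsto_unique[OF trivial_limit_at_right_real l1] by blast
  qed
  define z where "z = g x0 - w x0 *\<^sub>R grad r x0"
  have z: "z \<bullet> v = 0" if "0 < grad r x0 \<bullet> v" for v
    using dirl[OF that] by (simp add: z_def inner_diff_left)
  have aa: "0 < grad r x0 \<bullet> grad r x0" using grad_r_frontier[OF x0] by simp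
  have za: "z \<bullet> grad r x0 = 0" by (rule z[OF aa])
  have "z \<bullet> (grad r x0 + z) = 0" by (rule z) (use aa za in \<open>simp add: inner_add_right inner_commute\<close>)
  then have "z \<bullet> z = 0" using za by (simp add: inner_add_right)
  then show ?thesis by (simp add: z_def)
qed

end

section \<open>The boundary functional\<close>

text \<open>A primitive of \<open>step\<close>, that is, a convex function with two continuous
  derivatives that vanishes on the negative half-line.\<close>
definition step0 :: "real => real" where "step0 t = integral {- 1..t} step"

lemma step0_zero: "t <= 0 ==> step0 t = 0"
proof -
  assume t: "t <= 0"
  have "integral {- 1..t} step = integral {- 1..t} (%_. 0)"
    by (rule Henstock_Kurzweil_Integration.integral_cong) (use t in \<open>simp add: step_simps\<close>)
  then show ?thesis by (simp add: step0_def)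
qed

lemma step0_DERIV: "(step0 has_real_derivative step t) (at t)"
proof (cases "t < 0")
  case True
  have "((%_. 0) has_real_derivative 0) (at t)" by simp
  then have "(step0 has_real_derivative 0) (at t)"
    by (rule has_field_derivative_transform_within_open[where S="{..<0}"]) (use True in \<open>auto simp: step0_zero\<close>)
  then show ?thesis using True by (simp add: step_simps)
next
  case False
  have "((%u. integral {- 1..u} step) has_vector_derivative step t) (at t within {- 1..t + 1})"
    by (rule integral_has_vector_derivative[OF continuous_step(1)]) (use False in auto)
  moreover have "at t within {- 1..t + 1} = at t" by (rule at_within_Icc_at) (use False in auto)
  ultimately show ?thesis
    by (simp add: step0_def[abs_def] has_real_derivative_iff_has_vector_derivative)
qed

locale boundary_trace = double_divergence p q D Q B + defining_function D r
  for p q :: real and D :: "(real^'n::finite) set" and Q B r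
begin

definition Qn :: "real^'n => real" where
  "Qn x = (\<Sum>i\<in>UNIV. \<Sum>j\<in>UNIV. Q i j x * pd i r x * pd j r x)"

definition Qabs :: "real^'n => real" where "Qabs x = (\<Sum>i\<in>UNIV. \<Sum>j\<in>UNIV. \<bar>Q i j x\<bar>)"

definition layer :: "real => (real^'n) set" where "layer s = {x. s <= r x \<and> r x <= 2 * s}"

definition profile :: "real => real" where "profile t = 2 * step1 (t - 1) + t * step2 (t - 1)"

text \<open>This kernel is what remains of the second derivatives of \<open>u step(r/s -
  1)\<close> near the boundary when \<open>u\<close> is replaced by \<open>W r\<close> with
  \<open>W\<close> constant: the cut-off contributes twice its first derivative, from the mixed
  terms, and \<open>r\<close> times its second derivative.\<close>
definition layer_density :: "real => real^'n => real" where
  "layer_density s x = 1 / s * profile (r x / s) * Qn x"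

lemma Q_integrable: "integrable lborel (Q i j)"
proof -
  interpret sw: conjugate_exponents q p by unfold_locales (use p q pq in auto)
  show ?thesis
  proof (rule sw.Lp_compact_support_integrable[OF Q_borel Q_int, of "closure D"])
    show "Q i j x = 0" if "x \<notin> closure D" for x using that closure_subset[of D] by (intro Q_0) blast
  qed (use D(2) in simp)
qed

lemma Qabs_integrable: "integrable lborel Qabs"
  unfolding Qabs_def[abs_def] by (intro Bochner_Integration.integrable_sum integrable_abs Q_integrable)

lemma Qabs_nonneg: "0 <= Qabs x" by (simp add: Qabs_def sum_nonneg)

lemma sum_Q_le:
  assumes "!!i j. \<bar>c i j\<bar> <= M"
  shows "\<bar>\<Sum>i\<in>UNIV. \<Sum>j\<in>UNIV. Q i j x * c i j\<bar> <= M * Qabs x"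
proof -
  have "\<bar>\<Sum>i\<in>UNIV. \<Sum>j\<in>UNIV. Q i j x * c i j\<bar> <= (\<Sum>i\<in>UNIV. \<Sum>j\<in>UNIV. \<bar>Q i j x * c i j\<bar>)"
    by (rule order_trans[OF sum_abs]) (intro sum_mono sum_abs)
  also have "... <= (\<Sum>i\<in>UNIV. \<Sum>j\<in>UNIV. M * \<bar>Q i j x\<bar>)"
    using mult_left_mono[OF assms abs_ge_zero] by (intro sum_mono) (simp only: abs_mult mult.commute[of M])
  also have "... = M * Qabs x" by (simp add: Qabs_def sum_distrib_left)
  finally show ?thesis .
qed

lemma measurable_ingredients [measurable]:
  "pd i r \<in> borel_measurable borel" "pd i (pd j r) \<in> borel_measurable borel"
  "Qn \<in> borel_measurable borel" "Qabs \<in> borel_measurable borel" "B i \<in> borel_measurable borel"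
  "layer s \<in> sets borel" "step \<in> borel_measurable borel" "step1 \<in> borel_measurable borel" "step2 \<in> borel_measurable borel"
  "profile \<in> borel_measurable borel"
proof -
  show [measurable]: "pd i r \<in> borel_measurable borel" "pd i (pd j r) \<in> borel_measurable borel"
    "step \<in> borel_measurable borel" "step1 \<in> borel_measurable borel" "step2 \<in> borel_measurable borel" for i j
    by (rule borel_measurable_continuous_onI, rule r_partials continuous_step)+
  show "Qn \<in> borel_measurable borel" unfolding Qn_def[abs_def] by measurable
  show "Qabs \<in> borel_measurable borel" unfolding Qabs_def[abs_def] by measurable
  show "B i \<in> borel_measurable borel" using B_int[THEN borel_measurable_integrable, of i] by simp
  show "layer s \<in> sets borel" unfolding layer_def by measurable
  show "profile \<in> borel_measurable borel" unfolding profile_def[abs_def] by measurable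
qed

lemma layer_subset: "0 < s ==> layer s \<subseteq> D"
  using r_pos by (auto simp: layer_def intro: less_le_trans)

lemma closure_bound:
  assumes "continuous_on UNIV f"
  obtains M where "0 < M" "!!x. x \<in> closure D ==> \<bar>f x :: real\<bar> <= M"
proof -
  have "compact (f ` closure D)"
    using D(2) by (intro compact_continuous_image continuous_on_subset[OF assms]) auto
  then have "bounded (f ` closure D)" by (rule compact_imp_bounded)
  then obtain M where "\<forall>y\<in>f ` closure D. norm y <= M" unfolding bounded_iff by (elim exE)
  then have "\<bar>f x\<bar> <= \<bar>M\<bar> + 1" if "x \<in> closure D" for x using that by fastforce
  then show thesis using that[of "\<bar>M\<bar> + 1"] by simp
qed

lemma closure_bound_family:
  assumes "!!a. continuous_on UNIV (f a)"
  obtains M where "0 < M" "!!a x. x \<in> closure D ==> \<bar>f (a::'k::finite) x :: real\<bar> <= M"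
proof -
  have "continuous_on UNIV (%x. \<Sum>a\<in>UNIV. \<bar>f a x\<bar>)" by (intro continuous_intros assms)
  from closure_bound[OF this] obtain M where M: "0 < M" "!!x. x \<in> closure D ==> \<bar>\<Sum>a\<in>UNIV. \<bar>f a x\<bar>\<bar> <= M" by blast
  have "\<bar>f a x\<bar> <= M" if "x \<in> closure D" for a x
  proof -
    have "\<bar>f a x\<bar> <= (\<Sum>a\<in>UNIV. \<bar>f a x\<bar>)" by (rule member_le_sum) auto
    then show ?thesis using M(2)[OF that] by linarith
  qed
  then show thesis using that M(1) by blast
qed

lemma profile_bound: obtains P where "0 < P" "!!t. \<bar>profile t\<bar> <= P" "!!t. t \<notin> {1..2} ==> profile t = 0"
proof -
  obtain C where C: "C > 0" "!!t. \<bar>step1 t\<bar> <= C" "!!t. \<bar>step2 t\<bar> <= C" using step_derivs_bounded by blast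
  have z: "profile t = 0" if "t \<notin> {1..2}" for t
    using that step_simps(3-6)[of "t - 1"] by (auto simp: profile_def)
  have "\<bar>profile t\<bar> <= 4 * C" for t
  proof (cases "t \<in> {1..2}")
    case True
    have "\<bar>t * step2 (t - 1)\<bar> <= 2 * C" unfolding abs_mult using True C by (intro mult_mono) auto
    then show ?thesis unfolding profile_def using C(2)[of "t - 1"] by linarith
  qed (use z C in simp)
  then show thesis using that[of "4 * C"] z C by simp
qed

lemma layer_density_bound:
  obtains P where "0 < P" "!!s x. 0 < s ==> \<bar>layer_density s x\<bar> <= P / s * (indicator (layer s) x * Qabs x)"
proof -
  obtain P where P: "0 < P" "!!t. \<bar>profile t\<bar> <= P" "!!t. t \<notin> {1..2} ==> profile t = 0" using profile_bound by blast
  obtain G where G: "0 < G" "!!i x. x \<in> closure D ==> \<bar>pd i r x\<bar> <= G"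
    using closure_bound_family[of "%i. pd i r"] r_partials(4) by blast
  have Qn: "\<bar>Qn x\<bar> <= (G * G) * Qabs x" if "x \<in> D" for x
  proof -
    have xc: "x \<in> closure D" using that closure_subset by blast
    have "\<bar>\<Sum>i\<in>UNIV. \<Sum>j\<in>UNIV. Q i j x * (pd i r x * pd j r x)\<bar> <= (G * G) * Qabs x"
      by (rule sum_Q_le) (use G(1) G(2)[OF xc] in \<open>auto simp: abs_mult intro!: mult_mono\<close>)
    then show ?thesis by (simp add: Qn_def mult.assoc)
  qed
  show thesis
  proof (rule that[of "P * (G * G)"])
    fix s x assume s: "0 < (s::real)"
    show "\<bar>layer_density s x\<bar> <= P * (G * G) / s * (indicator (layer s) x * Qabs x)"
    proof (cases "x \<in> layer s")
      case True
      then have "x \<in> D" using layer_subset[OF s] by blast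
      have "\<bar>layer_density s x\<bar> = 1 / s * (\<bar>profile (r x / s)\<bar> * \<bar>Qn x\<bar>)"
        using s by (simp add: layer_density_def abs_mult)
      also have "... <= 1 / s * (P * ((G * G) * Qabs x))"
        using s P Qn[OF \<open>x \<in> D\<close>] by (intro mult_left_mono mult_mono) auto
      finally show ?thesis using True by simp
    next
      case False
      then have "r x / s \<notin> {1..2}" using s by (auto simp: layer_def field_simps)
      then show ?thesis using False P(3) by (simp add: layer_density_def)
    qed
  qed (use P G in simp)
qed

lemma layer_density_integrable:
  assumes s: "0 < s" shows "integrable lborel (layer_density s)"
proof -
  obtain P where P: "0 < P" "!!s x. 0 < s ==> \<bar>layer_density s x\<bar> <= P / s * (indicator (layer s) x * Qabs x)"
    using layer_density_bound by blast
  show ?thesis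
  proof (rule Bochner_Integration.integrable_bound[where f = "%x. P / s * (indicator (layer s) x * Qabs x)"])
    show "integrable lborel (%x. P / s * (indicator (layer s) x * Qabs x))"
      using integrable_mult_indicator[OF _ Qabs_integrable, of "layer s"] by simp
    show "layer_density s \<in> borel_measurable lborel" unfolding layer_density_def[abs_def] by measurable
    show "AE x in lborel. norm (layer_density s x) <= norm (P / s * (indicator (layer s) x * Qabs x))"
      by (intro AE_I2) (simp only: real_norm_def, rule order_trans[OF P(2)[OF s] abs_ge_self])
  qed
qed

text \<open>The part of the equation for a function of \<open>r\<close> that multiplies the first
  derivative of that function.\<close>
definition lower_order :: "real^'n => real" where
  "lower_order x = (\<Sum>i\<in>UNIV. \<Sum>j\<in>UNIV. Q i j x * pd j (pd i r) x) + (\<Sum>i\<in>UNIV. B i x * pd i r x)"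

lemma lower_order_measurable [measurable]: "lower_order \<in> borel_measurable borel"
  unfolding lower_order_def[abs_def] by measurable

lemma lower_order_bound:
  obtains T where "integrable lborel T" "!!x. \<bar>lower_order x\<bar> <= T x"
proof -
  obtain G where G: "0 < G" "!!i x. x \<in> closure D ==> \<bar>pd i r x\<bar> <= G"
    using closure_bound_family[of "%i. pd i r"] r_partials(4) by blast
  obtain G2 where G2: "0 < G2" "!!ij x. x \<in> closure D ==> \<bar>pd (fst ij) (pd (snd ij) r) x\<bar> <= G2"
    using closure_bound_family[of "%ij :: 'n \<times> 'n. pd (fst ij) (pd (snd ij) r)"] r_partials(5) by blast
  define T where "T x = G2 * Qabs x + (\<Sum>i\<in>UNIV. G * \<bar>B i x\<bar>)" for x
  have iT: "integrable lborel T" unfolding T_def[abs_def]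
    by (intro Bochner_Integration.integrable_add Bochner_Integration.integrable_sum integrable_mult_right integrable_abs Qabs_integrable B_int)
  have ST: "\<bar>lower_order x\<bar> <= T x" for x
  proof (cases "x \<in> D")
    case True
    then have xc: "x \<in> closure D" using closure_subset by blast
    have "\<bar>\<Sum>i\<in>UNIV. B i x * pd i r x\<bar> <= (\<Sum>i\<in>UNIV. G * \<bar>B i x\<bar>)"
      using mult_left_mono[OF G(2)[OF xc] abs_ge_zero] by (intro order_trans[OF sum_abs] sum_mono) (simp add: abs_mult mult.commute)
    moreover have "\<bar>\<Sum>i\<in>UNIV. \<Sum>j\<in>UNIV. Q i j x * pd j (pd i r) x\<bar> <= G2 * Qabs x"
      by (rule sum_Q_le) (use G2(2)[OF xc, of "(_, _)"] in simp)
    ultimately show ?thesis unfolding lower_order_def T_def by linarith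
  next
    case False
    then show ?thesis using Q_0 B_0 by (simp add: lower_order_def T_def Qabs_def)
  qed
  then show thesis using that iT by blast
qed

lemma lower_order_integrable: "integrable lborel lower_order"
proof -
  obtain T where iT: "integrable lborel T" and ST: "!!x. \<bar>lower_order x\<bar> <= T x" using lower_order_bound by blast
  show ?thesis
    by (rule Bochner_Integration.integrable_bound[OF iT]) (use ST in \<open>auto intro!: AE_I2 order_trans[OF ST abs_ge_self]\<close>)
qed

text \<open>Test the equation with a convex function of \<open>r\<close> whose second derivative
  is of order \<open>1/s\<close> on the layer and whose first derivative is at most 1. The terms
  with the first derivative are bounded by a fixed integral, hence so is \<open>1/s\<close> times
  the integral of \<open>Qn\<close> over the layer; there \<open>Qn\<close> dominates
  \<open>P\<close> up to a constant, and the volume of the layer is of order \<open>s\<close>.\<close>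
lemma layer_bound:
  assumes c: "0 < c" and s1: "0 < s1" and M: "0 <= M" and P: "integrable lborel P" "!!x. 0 <= P x"
    and low: "!!x. x \<in> D ==> r x <= s1 ==> c * P x - M <= Qn x"
  obtains M' s0 where "0 < s0" "!!s. 0 < s ==> s <= s0 ==> (LBINT x. indicator (layer s) x * P x) <= M' * s"
proof -
  obtain Cv sv where V: "0 <= Cv" "0 < sv" "!!s. 0 < s ==> s <= sv ==> measure lborel {x \<in> D. r x <= s} <= Cv * s"
    using total_layer_volume by blast
  obtain C where C: "C > 0" "!!t. \<bar>step1 t\<bar> <= C" "!!t. \<bar>step2 t\<bar> <= C" using step_derivs_bounded by blast
  have [measurable]: "P \<in> borel_measurable borel" using borel_measurable_integrable[OF P(1)] by simp
  obtain m where m: "0 < m" "!!t. t \<in> {1/4..3/4} ==> m <= step1 t"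
  proof -
    have ne: "{1/4..3/4::real} \<noteq> {}" by simp
    obtain t0 where t0: "t0 \<in> {1/4..3/4}" "!!t. t \<in> {1/4..3/4} ==> step1 t0 <= step1 t"
      using continuous_attains_inf[OF compact_Icc ne continuous_step(2)] by blast
    have "0 < step1 t0" by (rule step1_pos) (use t0(1) in auto)
    then show thesis using that[of "step1 t0"] t0(2) by blast
  qed
  obtain T where iT: "integrable lborel T" and ST: "!!x. \<bar>lower_order x\<bar> <= T x" using lower_order_bound by blast
  note iS = lower_order_integrable
  define C1 where "C1 = (LBINT x. T x)"
  define s0 where "s0 = min (s1 / 3) (sv / 3)"
  define M' where "M' = 2 / (m * c) * (C1 + M * (C / 2) * (3 * Cv))"
  show thesis
  proof (rule that[of s0 M'])
    fix s assume s: "0 < s" "s <= s0"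
    have s3: "3 * s <= s1" "3 * s <= sv" using s(2) by (auto simp: s0_def)
    define \<psi>1 where "\<psi>1 t = step ((t - s / 2) / (2 * s))" for t
    define \<psi>2 where "\<psi>2 t = step1 ((t - s / 2) / (2 * s)) / (2 * s)" for t
    have d2: "(\<psi>1 has_real_derivative \<psi>2 t) (at t)" for t
      unfolding \<psi>1_def[abs_def] \<psi>2_def
      by (rule DERIV_chain2[OF step_DERIV, THEN DERIV_cong]) (use s in \<open>auto intro!: derivative_eq_intros simp: field_simps\<close>)
    have c1: "continuous_on UNIV \<psi>1" by (meson d2 DERIV_continuous continuous_at_imp_continuous_on)
    have c2: "continuous_on UNIV \<psi>2" unfolding \<psi>2_def
      by (intro continuous_intros continuous_on_compose2[OF continuous_step(2)[of UNIV]]) (use s in auto)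
    define \<psi> where "\<psi> t = 2 * s * step0 ((t - s/2) / (2 * s))" for t
    have d1: "(\<psi> has_real_derivative \<psi>1 t) (at t)" for t
      unfolding \<psi>_def[abs_def] \<psi>1_def
      by (rule DERIV_cmult[OF DERIV_chain2[OF step0_DERIV], THEN DERIV_cong])
        (use s in \<open>auto intro!: derivative_eq_intros simp: field_simps\<close>)
    have \<psi>z: "\<psi> t = 0" if "t <= s/2" for t
    proof -
      have "(t - s/2) / (2 * s) <= 0" using that s by (simp add: divide_le_0_iff)
      then show ?thesis by (simp add: \<psi>_def step0_zero)
    qed
    define v where "v x = \<psi> (r x)" for x
    have vC: "Ck 2 v" unfolding v_def[abs_def] by (rule Ck_2_compose[OF d1 d2 c2 r_C2])
    have v1: "pd i v x = \<psi>1 (r x) * pd i r x" for i x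
      unfolding v_def[abs_def] by (rule partial_deriv_compose[OF r_partials(6) d1])
    have v2: "pd j (pd i v) x = \<psi>2 (r x) * pd j r x * pd i r x + \<psi>1 (r x) * pd j (pd i r) x" for i j x
      unfolding v_def[abs_def] by (rule Ck_2_partial_compose[OF d1 d2 r_C2])
    have s2: "0 < s / 2" using s by simp
    have v0: "v x = 0" if "x \<notin> {x. s/2 <= r x}" for x using that \<psi>z by (simp add: v_def)
    note E = equation_C2[OF vC compact_superlevel[OF s2] v0 superlevel_subset[OF s2]]
    define I where "I x = \<psi>2 (r x) * Qn x" for x
    have eqI: "(\<Sum>i\<in>UNIV. \<Sum>j\<in>UNIV. Q i j x * pd j (pd i v) x) + (\<Sum>i\<in>UNIV. B i x * pd i v x)
       = I x + \<psi>1 (r x) * lower_order x" for x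
      unfolding v1 v2 I_def lower_order_def Qn_def
      by (simp add: sum_distrib_left sum.distrib algebra_simps)
    have [measurable]: "\<psi>1 \<in> borel_measurable borel" "\<psi>2 \<in> borel_measurable borel"
      by (rule borel_measurable_continuous_onI, rule c1 c2)+
    have \<psi>1b: "\<bar>\<psi>1 t\<bar> <= 1" for t using step_bounds by (simp add: \<psi>1_def)
    have iF: "integrable lborel (%x. \<psi>1 (r x) * lower_order x)"
      using integrable_mult_bounded[OF iS, of "%x. \<psi>1 (r x)" 1] \<psi>1b by (simp add: mult.commute)
    have tot: "(LBINT x. I x + \<psi>1 (r x) * lower_order x) = 0" and itot: "integrable lborel (%x. I x + \<psi>1 (r x) * lower_order x)"
      unfolding eqI[symmetric] using E
      by (simp_all add: Bochner_Integration.integral_add Bochner_Integration.integral_sum Bochner_Integration.integrable_sum)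
    have iI: "integrable lborel I" using Bochner_Integration.integrable_diff[OF itot iF] by simp
    have "(LBINT x. I x) = - (LBINT x. \<psi>1 (r x) * lower_order x)" using tot iI iF by simp
    also have "... <= \<bar>LBINT x. \<psi>1 (r x) * lower_order x\<bar>" by simp
    also have "... <= (LBINT x. T x)"
    proof (rule order_trans[OF integral_abs_bound], rule integral_mono)
      show "\<bar>\<psi>1 (r x) * lower_order x\<bar> <= T x" for x
        using mult_mono[OF \<psi>1b[of "r x"] ST[of x]] by (simp add: abs_mult)
    qed (use iF iT in auto)
    finally have I_le: "(LBINT x. I x) <= C1" by (simp add: C1_def)
    \<comment> \<open>\<open>\<psi>2 \<circ> r\<close> is concentrated on \<open>s/2 <= r <= 5s/2\<close> and at least \<open>m / (2s)\<close> on the layer.\<close>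
    define U where "U = {x \<in> D. r x <= 3 * s}"
    have Um[measurable]: "U \<in> sets borel" unfolding U_def by measurable
    have Uf: "U \<in> fmeasurable lborel"
    proof -
      obtain R where "D \<subseteq> ball 0 R" using bounded_subset_ballD[OF D(2)] by blast
      then show ?thesis by (intro fmeasurableI2[OF ball_fmeasurable[of 0 R]]) (auto simp: U_def)
    qed
    have \<psi>2nn: "0 <= \<psi>2 t" for t using step1_nonneg s by (simp add: \<psi>2_def)
    have \<psi>2b: "\<psi>2 t <= C / (2 * s)" for t using C(2)[of "(t - s/2) / (2 * s)"] s by (simp add: \<psi>2_def divide_right_mono)
    have \<psi>2z: "\<psi>2 t = 0" if "t <= 0 \<or> 3 * s < t" for t
    proof -
      have "(t - s/2) / (2 * s) <= 0 \<or> 1 <= (t - s/2) / (2 * s)" using that s by (auto simp: divide_le_0_iff le_divide_eq)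
      then show ?thesis unfolding \<psi>2_def using step_simps(3,4) by auto
    qed
    have pt: "m * c / (2 * s) * (indicator (layer s) x * P x) <= I x + M * (C / (2 * s)) * indicator U x" for x
    proof (cases "x \<in> U")
      case True
      then have x: "x \<in> D" "r x <= s1" using s3 by (auto simp: U_def)
      have l: "m / (2 * s) * indicator (layer s) x <= \<psi>2 (r x)"
      proof (cases "x \<in> layer s")
        case L: True
        then have "(r x - s/2) / (2 * s) \<in> {1/4..3/4}" using s by (auto simp: layer_def field_simps)
        then show ?thesis using m(2) L s by (simp add: \<psi>2_def divide_right_mono)
      qed (use \<psi>2nn in simp)
      have "m * c / (2 * s) * (indicator (layer s) x * P x) = (m / (2 * s) * indicator (layer s) x) * (c * P x)" by simp
      also have "... <= \<psi>2 (r x) * (c * P x)" using l c P(2) by (intro mult_right_mono) auto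
      also have "... <= \<psi>2 (r x) * (Qn x + M)" using low[OF x] \<psi>2nn by (intro mult_left_mono) auto
      also have "... = I x + M * \<psi>2 (r x)" by (simp add: I_def algebra_simps)
      also have "... <= I x + M * (C / (2 * s))" using \<psi>2b M by (intro add_left_mono mult_left_mono) auto
      finally show ?thesis using True by simp
    next
      case False
      then have nl: "x \<notin> layer s" using s layer_subset[OF s(1)] by (auto simp: U_def layer_def)
      have "r x <= 0 \<or> 3 * s < r x" using False r_pos[of x] by (auto simp: U_def not_less[symmetric])
      then have "I x = 0" using \<psi>2z by (simp add: I_def)
      then show ?thesis using nl False by simp
    qed
    have iL: "integrable lborel (%x. indicator (layer s) x * P x)"
      using integrable_mult_indicator[OF _ P(1), of "layer s"] by simp
    have iU: "integrable lborel (%x. indicat_real U x)" using Uf by (simp add: fmeasurable_def)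
    have "m * c / (2 * s) * (LBINT x. indicator (layer s) x * P x) = (LBINT x. m * c / (2 * s) * (indicator (layer s) x * P x))" by simp
    also have "... <= (LBINT x. I x + M * (C / (2 * s)) * indicator U x)"
      by (rule integral_mono) (use iL iI iU pt in auto)
    also have "... = (LBINT x. I x) + M * (C / (2 * s)) * measure lborel U" using iI iU by simp
    also have "... <= C1 + M * (C / (2 * s)) * (Cv * (3 * s))"
      using I_le V(3)[of "3 * s"] s s3 M C(1) by (intro add_mono mult_left_mono) (auto simp: U_def)
    also have "... = C1 + M * (C / 2) * (3 * Cv)" using s by simp
    finally have "m * c / (2 * s) * (LBINT x. indicator (layer s) x * P x) <= C1 + M * (C / 2) * (3 * Cv)" .
    then show "(LBINT x. indicator (layer s) x * P x) <= M' * s"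
      using s m(1) c unfolding M'_def by (simp add: field_simps)
  qed (use s1 V in \<open>simp add: s0_def\<close>)
qed

end

context conjugate_exponents
begin

lemma Lp_add:
  assumes [measurable]: "a \<in> borel_measurable M" "b \<in> borel_measurable M"
    and "integrable M (%x. \<bar>a x\<bar> powr p)" "integrable M (%x. \<bar>b x\<bar> powr p)"
  shows "integrable M (%x. \<bar>a x + b x\<bar> powr p)"
proof (rule Bochner_Integration.integrable_bound[where f = "%x. 2 powr p * (\<bar>a x\<bar> powr p + \<bar>b x\<bar> powr p)"])
  show "integrable M (%x. 2 powr p * (\<bar>a x\<bar> powr p + \<bar>b x\<bar> powr p))" using assms by simp
  have "\<bar>s + t\<bar> powr p <= 2 powr p * (\<bar>s\<bar> powr p + \<bar>t\<bar> powr p)" for s t :: real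
  proof -
    have "\<bar>s + t\<bar> powr p <= (2 * max \<bar>s\<bar> \<bar>t\<bar>) powr p" using p by (intro powr_mono2) auto
    also have "... = 2 powr p * (max \<bar>s\<bar> \<bar>t\<bar>) powr p" by (rule powr_mult)
    also have "(max \<bar>s\<bar> \<bar>t\<bar>) powr p <= \<bar>s\<bar> powr p + \<bar>t\<bar> powr p" by (auto simp: max_def)
    finally show ?thesis by simp
  qed
  then show "AE x in M. norm (\<bar>a x + b x\<bar> powr p) <= norm (2 powr p * (\<bar>a x\<bar> powr p + \<bar>b x\<bar> powr p))"
    by (intro AE_I2) (auto intro: order_trans[OF _ abs_ge_self])
qed measurable

end

context boundary_trace
begin

definition height_cut :: "real => real^'n => real" where "height_cut s x = step (r x / s - 1)"

lemma height_cut_derivs: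
  assumes s: "0 < s"
  shows "Ck 2 (height_cut s)"
    and "pd i (height_cut s) x = step1 (r x / s - 1) / s * pd i r x"
    and "pd j (pd i (height_cut s)) x =
       step2 (r x / s - 1) / s / s * pd j r x * pd i r x + step1 (r x / s - 1) / s * pd j (pd i r) x"
    and "x \<notin> {x. s <= r x} ==> height_cut s x = 0"
proof -
  have d1: "((%t. step (t / s - 1)) has_real_derivative step1 (t / s - 1) / s) (at t)" for t
    by (rule DERIV_chain2[OF step_DERIV, THEN DERIV_cong]) (use s in \<open>auto intro!: derivative_eq_intros\<close>)
  have d2: "((%t. step1 (t / s - 1) / s) has_real_derivative step2 (t / s - 1) / s / s) (at t)" for t
    by (rule DERIV_cdivide[OF DERIV_chain2[OF step1_DERIV], THEN DERIV_cong]) (use s in \<open>auto intro!: derivative_eq_intros\<close>)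
  have c: "continuous_on UNIV (%t. step2 (t / s - 1) / s / s)"
    by (intro continuous_intros continuous_on_compose2[OF continuous_step(3)[of UNIV]]) (use s in auto)
  show "Ck 2 (height_cut s)" unfolding height_cut_def[abs_def] by (rule Ck_2_compose[OF d1 d2 c r_C2])
  show "pd i (height_cut s) x = step1 (r x / s - 1) / s * pd i r x"
    unfolding height_cut_def[abs_def] by (rule partial_deriv_compose[OF r_partials(6) d1])
  show "pd j (pd i (height_cut s)) x =
       step2 (r x / s - 1) / s / s * pd j r x * pd i r x + step1 (r x / s - 1) / s * pd j (pd i r) x"
    unfolding height_cut_def[abs_def] by (rule Ck_2_partial_compose[OF d1 d2 r_C2])
  show "height_cut s x = 0" if "x \<notin> {x. s <= r x}"
  proof -
    have "r x / s - 1 <= 0" using that s by simp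
    then show ?thesis unfolding height_cut_def by (rule step_simps(1))
  qed
qed

end

text \<open>A function that vanishes on the boundary, together with Borel representatives
  \<open>H\<close> of its second derivatives and an extension \<open>W\<close> to the whole space
  of the factor between its boundary gradient and that of \<open>r\<close>.\<close>
definition boundary_test :: "real => (real^'n::finite) set => (real^'n => real) =>
    (real^'n => real) => ('n => 'n => real^'n => real) => (real^'n => real) => bool" where
  "boundary_test p D r u H W \<longleftrightarrow> u \<in> borel_measurable borel \<and>
     (\<forall>i j. H i j \<in> borel_measurable borel \<and> integrable lborel (%x. \<bar>H i j x\<bar> powr p) \<and>
        (\<forall>x. x \<notin> D --> H i j x = 0) \<and> (\<forall>\<phi>\<in>C0_infty D.
        (LBINT x. u x * pd i (pd j \<phi>) x) = (LBINT x. H i j x * \<phi> x))) \<and>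
     continuous_on UNIV W \<and> (\<exists>C. \<forall>x. \<bar>W x\<bar> <= C) \<and>
     (\<exists>g. boundary_vanishing D r u g \<and> (\<forall>x\<in>frontier D. g x = W x *\<^sub>R grad r x))"

text \<open>The identity for \<open>boundary_test\<close> data with boundary term; the two
  measures come from the positive and from the negative part of the layer densities.\<close>
definition boundary_pair :: "real => (real^'n::finite) set => (real^'n => real) =>
    ('n => 'n => real^'n => real) => ('n => real^'n => real) => (bool => (real^'n) measure) => bool" where
  "boundary_pair p D r Q B \<mu> \<longleftrightarrow>
     (\<forall>b. sets (\<mu> b) = sets borel \<and> finite_measure (\<mu> b) \<and> emeasure (\<mu> b) (- frontier D) = 0) \<and>
     (\<forall>u H W. boundary_test p D r u H W -->
        (\<Sum>i\<in>UNIV. \<Sum>j\<in>UNIV. LBINT x. Q i j x * H i j x) + (\<Sum>i\<in>UNIV. LBINT x. B i x * pd i u x)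
          = (LINT x|\<mu> False. W x) - (LINT x|\<mu> True. W x))"

definition ball_growth :: "(real^'n::finite) set => (real^'n) measure => bool" where
  "ball_growth S \<mu> \<longleftrightarrow> (\<exists>C R. 0 < C \<and> 0 < R \<and>
     (\<forall>x\<in>S. \<forall>t. 0 < t --> t <= R --> emeasure \<mu> (cball x t) <= ennreal (C * t ^ (CARD('n) - 1))))"

text \<open>A mass of order \<open>s\<close> in the layer of height \<open>s\<close> is what keeps
  the total variation of the layer densities bounded.\<close>
locale boundary_trace_data = boundary_trace p q D Q B r
  for p q :: real and D :: "(real^'n::finite) set" and Q B r +
  fixes M0 s0 :: real
  assumes s0: "0 < s0"
    and layer_mass: "!!s. 0 < s ==> s <= s0 ==> (LBINT x. indicator (layer s) x * Qabs x) <= M0 * s"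
begin

lemma M0: "0 <= M0"
proof -
  have "0 <= (LBINT x. indicator (layer s0) x * Qabs x)" using Qabs_nonneg by simp
  also have "... <= M0 * s0" using layer_mass s0 by simp
  finally show ?thesis using s0 by (simp add: zero_le_mult_iff)
qed

text \<open>Any positive sequence below \<open>s0\<close> that tends to 0 would serve.\<close>
definition height :: "nat => real" where "height n = s0 / real (Suc n)"

lemma height: "0 < height n" "height n <= s0"
  using s0 by (auto simp: height_def divide_le_eq)

lemma height_small: "0 < e ==> eventually (%n. height n < e) sequentially"
proof -
  assume "0 < e"
  then have "eventually (%n. 1 / real (Suc n) < e / s0) sequentially" using s0 by (intro eventually_inverse_Suc_less) simp
  then show ?thesis by eventually_elim (use s0 in \<open>simp add: height_def field_simps\<close>)
qed

lemma layer_integrable: "integrable lborel (%x. indicator (layer s) x * Qabs x)"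
  using integrable_mult_indicator[OF _ Qabs_integrable, of "layer s"] by simp

lemma layer_density_outside: "x \<notin> D ==> layer_density s x = 0"
  by (simp add: layer_density_def Qn_def Q_0)

text \<open>The equation holds for \<open>u\<close> times the cut-off at height \<open>s\<close>,
  whose second derivatives are known. On the layer \<open>u\<close> is close to \<open>W r\<close>
  and its gradient to \<open>W\<close> times that of \<open>r\<close>, up to errors of order
  \<open>o(s)\<close> and \<open>o(1)\<close>; since the mass of the layer is of order
  \<open>s\<close> and the kernels are of order \<open>1/s\<close>, the errors disappear in the
  limit.\<close>
lemma layer_limit:
  assumes bv: "boundary_vanishing D r u g" and ub[measurable]: "u \<in> borel_measurable borel"
    and H[measurable]: "!!i j. H i j \<in> borel_measurable borel"
    and iH: "!!i j. integrable lborel (%x. \<bar>H i j x\<bar> powr p)"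
    and H0: "!!i j x. x \<notin> D ==> H i j x = 0"
    and weak: "!!i j \<phi>. \<phi> \<in> C0_infty D ==>
       (LBINT x. u x * pd i (pd j \<phi>) x) = (LBINT x. H i j x * \<phi> x)"
    and W: "continuous_on UNIV W" "!!x. x \<in> frontier D ==> g x = W x *\<^sub>R grad r x"
  shows "!!i j. integrable lborel (%x. Q i j x * H i j x)" and "!!i. integrable lborel (%x. B i x * pd i u x)"
    and "(%n. LBINT x. layer_density (height n) x * W x) \<longlonglongrightarrow>
      - ((\<Sum>i\<in>UNIV. \<Sum>j\<in>UNIV. LBINT x. Q i j x * H i j x) + (\<Sum>i\<in>UNIV. LBINT x. B i x * pd i u x))"
proof -
  interpret bv: boundary_vanishing D r u g by (rule bv)
  have gD: "pd i u x = g x $ i" if "x \<in> D" for i x using bv.g_grad[OF that] by (simp add: grad_def)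
  have gc: "continuous_on (closure D) (%x. g x $ i)" for i by (intro continuous_intros bv.g_cont)
  have uD: "continuous_on D (pd i u)" for i
    by (rule continuous_on_eq[OF continuous_on_subset[OF gc closure_subset]]) (simp add: gD)
  have clc: "compact (closure D)" using D(2) by simp
  obtain Cu where Cu: "0 < Cu" "!!x. x \<in> D ==> \<bar>u x\<bar> <= Cu"
  proof -
    have "bounded (u ` closure D)" by (intro compact_imp_bounded compact_continuous_image bv.u_cont clc)
    then obtain M where "\<forall>y\<in>u ` closure D. norm y <= M" unfolding bounded_iff by (elim exE)
    then have "\<bar>u x\<bar> <= \<bar>M\<bar> + 1" if "x \<in> D" for x using that closure_subset by fastforce
    then show thesis using that[of "\<bar>M\<bar> + 1"] by simp
  qed
  have gb: "\<exists>M. \<forall>x\<in>D. \<bar>g x $ i\<bar> <= M" for i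
  proof -
    have "bounded ((%x. g x $ i) ` closure D)" by (intro compact_imp_bounded compact_continuous_image gc clc)
    then obtain M where "\<forall>y\<in>(%x. g x $ i) ` closure D. norm y <= M" unfolding bounded_iff by (elim exE)
    then show ?thesis using closure_subset by fastforce
  qed
  show iQH: "integrable lborel (%x. Q i j x * H i j x)" for i j
    by (rule integrable_mult_Lp) (use Q_int iH in auto)
  show iBu: "integrable lborel (%x. B i x * pd i u x)" for i
  proof -
    obtain M where M: "\<forall>x\<in>D. \<bar>g x $ i\<bar> <= M" using gb by blast
    define f where "f x = indicator D x * g x $ i" for x
    have [measurable]: "f \<in> borel_measurable borel"
      using borel_measurable_continuous_on_indicator[OF _ continuous_on_subset[OF gc closure_subset], of i] D(1)
      by (simp add: f_def[abs_def])
    have fb: "\<bar>f x\<bar> <= max 0 M" for x using M by (auto simp: f_def indicator_def max_def)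
    have "integrable lborel (%x. B i x * f x)" by (rule integrable_mult_bounded[OF B_int _ fb]) simp
    moreover have "(%x. B i x * f x) = (%x. B i x * pd i u x)"
    proof (rule ext)
      show "B i x * f x = B i x * pd i u x" for x using B_0[of x i] gD[of x i] by (cases "x \<in> D") (simp_all add: f_def)
    qed
    ultimately show ?thesis by simp
  qed
  have iHL: "Lloc D (H i j)" for i j
  proof -
    have "integrable lborel (H i j)"
      by (rule Lp_compact_support_integrable[OF H iH clc]) (use H0 closure_subset in blast)
    then show ?thesis unfolding Lloc_def
      using integrable_mult_indicator[of _ lborel "H i j"] H by (auto simp: borel_compact)
  qed
  obtain C where C: "C > 0" "!!t. \<bar>step1 t\<bar> <= C" "!!t. \<bar>step2 t\<bar> <= C" using step_derivs_bounded by blast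
  obtain G where G: "0 < G" "!!i x. x \<in> closure D ==> \<bar>pd i r x\<bar> <= G"
    using closure_bound_family[of "%i. pd i r"] r_partials(4) by blast
  define T where "T x = (\<Sum>i\<in>UNIV. \<Sum>j\<in>UNIV. Q i j x * H i j x) + (\<Sum>i\<in>UNIV. B i x * pd i u x)" for x
  have iT: "integrable lborel T" unfolding T_def[abs_def]
    by (intro Bochner_Integration.integrable_add Bochner_Integration.integrable_sum iQH iBu)
  have [measurable]: "T \<in> borel_measurable borel" using borel_measurable_integrable[OF iT] by simp
  have intT: "(LBINT x. T x) = (\<Sum>i\<in>UNIV. \<Sum>j\<in>UNIV. LBINT x. Q i j x * H i j x) + (\<Sum>i\<in>UNIV. LBINT x. B i x * pd i u x)"
    unfolding T_def using iQH iBu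
    by (simp add: Bochner_Integration.integral_add Bochner_Integration.integral_sum Bochner_Integration.integrable_sum)
  define I1 where "I1 s x = height_cut s x * T x" for s x
  define I2 where "I2 s x = step1 (r x / s - 1) / s * u x * lower_order x" for s x
  define I3 where "I3 s x = (\<Sum>i\<in>UNIV. \<Sum>j\<in>UNIV. Q i j x * (step1 (r x / s - 1) / s *
     (pd i u x * pd j r x + pd j u x * pd i r x)
     + step2 (r x / s - 1) / s / s * u x * pd i r x * pd j r x))" for s x
  have i1: "integrable lborel (I1 s)" for s
  proof -
    have "\<bar>height_cut s x\<bar> <= 1" for x using step_bounds by (simp add: height_cut_def)
    moreover have "height_cut s \<in> borel_measurable lborel" unfolding height_cut_def[abs_def] by measurable
    ultimately show ?thesis
      using integrable_mult_bounded[OF iT, of "height_cut s" 1] by (simp add: I1_def[abs_def] mult.commute)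
  qed
  have i2: "integrable lborel (I2 s)" if s: "0 < s" for s
  proof -
    have eq: "I2 s = (%x. lower_order x * (step1 (r x / s - 1) / s * (indicator D x * u x)))"
    proof
      fix x
      show "I2 s x = lower_order x * (step1 (r x / s - 1) / s * (indicator D x * u x))"
        by (cases "x \<in> D") (simp_all add: I2_def lower_order_def Q_0 B_0)
    qed
    have b: "\<bar>step1 (r x / s - 1) / s * (indicator D x * u x)\<bar> <= C / s * Cu" for x
      unfolding abs_mult using C Cu s
      by (intro mult_mono) (auto simp: indicator_def divide_right_mono abs_divide)
    show ?thesis unfolding eq by (rule integrable_mult_bounded[OF lower_order_integrable _ b]) measurable
  qed
  have balance: "integrable lborel (I3 s)" "(LBINT x. I3 s x) = - (LBINT x. I1 s x) - (LBINT x. I2 s x)"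
    if s: "0 < s" for s
  proof -
    note hc = height_cut_derivs[OF s]
    let ?\<zeta> = "height_cut s" and ?K = "{x. s <= r x}"
    note K = compact_superlevel[OF s] and KD = superlevel_subset[OF s]
    define Hc where "Hc i j x = (if x \<in> D then H i j x * ?\<zeta> x + pd i u x * pd j ?\<zeta> x
      + pd j u x * pd i ?\<zeta> x + u x * pd j (pd i ?\<zeta>) x else 0)" for i j x
    have z0: "x \<notin> ?K ==> ?\<zeta> x = 0" for x by (rule hc(4))
    have z1: "x \<notin> ?K ==> pd i ?\<zeta> x = 0" for i x by (rule partial_deriv_outside[OF K z0])
    have z2: "x \<notin> ?K ==> pd j (pd i ?\<zeta>) x = 0" for i j x by (rule partial_deriv_outside[OF K z1])
    note zc = Ck_2_partials[OF hc(1)]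
    define c where "c i j x = pd i u x * pd j ?\<zeta> x
      + pd j u x * pd i ?\<zeta> x + u x * pd j (pd i ?\<zeta>) x" for i j x
    have cc: "continuous_on ?K (c i j)" for i j unfolding c_def
      by (intro continuous_intros continuous_on_subset[OF uD KD] continuous_on_subset[OF continuous_on_subset[OF bv.u_cont closure_subset] KD] zc)
    have Hc_eq: "Hc i j x = H i j x * ?\<zeta> x + indicator ?K x *\<^sub>R c i j x" for i j x
    proof (cases "x \<in> ?K")
      case True then show ?thesis using KD by (auto simp: Hc_def c_def)
    next
      case False then show ?thesis using z0 z1 z2 by (simp add: Hc_def c_def)
    qed
    have Km: "?K \<in> sets borel" using K by (rule borel_compact)
    have zm: "?\<zeta> \<in> borel_measurable borel" by (rule borel_measurable_continuous_onI[OF zc(3)])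
    have cm: "(%x. indicator ?K x *\<^sub>R c i j x) \<in> borel_measurable borel" for i j
      by (rule borel_measurable_continuous_on_indicator[OF Km cc])
    have Hm: "Hc i j \<in> borel_measurable borel" for i j
      unfolding Hc_eq[abs_def] using cm zm by measurable
    have iHc: "integrable lborel (%x. \<bar>Hc i j x\<bar> powr p)" for i j
      unfolding Hc_eq
    proof (rule Lp_add)
      show "integrable lborel (%x. \<bar>H i j x * ?\<zeta> x\<bar> powr p)"
      proof (rule Bochner_Integration.integrable_bound[OF iH])
        have "\<bar>H i j x * ?\<zeta> x\<bar> powr p <= \<bar>H i j x\<bar> powr p" for x
          using step_bounds[of "r x / s - 1"] p unfolding height_cut_def
          by (intro powr_mono2) (auto simp: abs_mult intro: mult_left_le)
        then show "AE x in lborel. norm (\<bar>H i j x * ?\<zeta> x\<bar> powr p) <= norm (\<bar>H i j x\<bar> powr p)" by (intro AE_I2) simp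
      qed (use zm in measurable)
      have "(%x. \<bar>indicator ?K x *\<^sub>R c i j x\<bar> powr p) = (%x. indicator ?K x *\<^sub>R (\<bar>c i j x\<bar> powr p))"
        by (auto simp: indicator_def fun_eq_iff)
      moreover have "integrable lborel (%x. indicator ?K x *\<^sub>R (\<bar>c i j x\<bar> powr p))"
        by (rule borel_integrable_compact[OF K]) (use cc p in \<open>auto intro!: continuous_intros continuous_on_powr'\<close>)
      ultimately show "integrable lborel (%x. \<bar>indicator ?K x *\<^sub>R c i j x\<bar> powr p)" by simp
    qed (use cm zm in measurable)
    have Hc0: "x \<notin> ?K ==> Hc i j x = 0" for i j x unfolding Hc_eq using z0 by simp
    note cu = cutoff_C1[OF bv.u_diff uD zc(1) K z0 KD]
    have cu2: "pd i (cutoff u ?\<zeta>) x = (if x \<in> D then pd i u x * ?\<zeta> x + u x * pd i ?\<zeta> x else 0)" for i x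
      by (rule cutoff_C1(2)[OF bv.u_diff uD zc(1) K z0 KD])
    have wk: "weak_hessian (cutoff u ?\<zeta>) Hc"
      unfolding Hc_def[abs_def]
      by (rule weak_hessian_cutoff[OF bv.u_diff uD H iHL ub weak hc(1) K z0 KD])
    note E = equation_weak_hessian[OF cu(1) K cu(3) KD Hm iHc Hc0 wk]
    have pt: "(\<Sum>i\<in>UNIV. \<Sum>j\<in>UNIV. Q i j x * Hc i j x) + (\<Sum>i\<in>UNIV. B i x * pd i (cutoff u ?\<zeta>) x) = I1 s x + I2 s x + I3 s x" for x
    proof (cases "x \<in> D")
      case True
      have a: "Q i j x * Hc i j x = ?\<zeta> x * (Q i j x * H i j x) + step1 (r x / s - 1) / s * u x * (Q i j x * pd j (pd i r) x)
         + Q i j x * (step1 (r x / s - 1) / s *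
     (pd i u x * pd j r x + pd j u x * pd i r x)
     + step2 (r x / s - 1) / s / s * u x * pd i r x * pd j r x)" for i j
        using True by (simp add: Hc_def hc(2,3) algebra_simps)
      have b: "B i x * pd i (cutoff u ?\<zeta>) x = ?\<zeta> x * (B i x * pd i u x) + step1 (r x / s - 1) / s * u x * (B i x * pd i r x)" for i
        using True by (simp add: cu2 hc(2) algebra_simps)
      show ?thesis unfolding a b I1_def I2_def I3_def T_def lower_order_def sum.distrib
        by (simp add: sum_distrib_left distrib_left)
    next
      case False
      then show ?thesis by (simp add: I1_def I2_def I3_def T_def lower_order_def Q_0 B_0)
    qed
    have int: "integrable lborel (%x. I1 s x + I2 s x + I3 s x)" "(LBINT x. I1 s x + I2 s x + I3 s x) = 0"
      unfolding pt[symmetric] using E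
      by (simp_all add: Bochner_Integration.integral_add Bochner_Integration.integral_sum Bochner_Integration.integrable_sum)
    have i12: "integrable lborel (%x. I1 s x + I2 s x)" using i1 i2[OF s] by (rule Bochner_Integration.integrable_add)
    show i3: "integrable lborel (I3 s)" using Bochner_Integration.integrable_diff[OF int(1) i12] by simp
    have "(LBINT x. I1 s x + I2 s x + I3 s x) = ((LBINT x. I1 s x) + (LBINT x. I2 s x)) + (LBINT x. I3 s x)"
      using i1 i2[OF s] i3 i12 by simp
    then show "(LBINT x. I3 s x) = - (LBINT x. I1 s x) - (LBINT x. I2 s x)" using int(2) by simp
  qed
  \<comment> \<open>\<open>I1\<close> keeps the data of \<open>u\<close>, \<open>I2\<close> has the second derivatives of \<open>r\<close> and the drift, \<open>I3\<close> the
    products of first derivatives. In the limit \<open>I1\<close> loses the cut-off, \<open>I2\<close> vanishes because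
    \<open>u\<close> is of order \<open>s\<close> on the layer, and \<open>I3\<close> approaches \<open>W\<close> times the layer density.\<close>
  have lim1: "(%n. LBINT x. I1 (height n) x) \<longlonglongrightarrow> (LBINT x. T x)"
  proof (rule integral_dominated_convergence[where w = "%x. \<bar>T x\<bar>"])
    show "I1 (height n) \<in> borel_measurable lborel" for n using i1[of "height n"] by simp
    show "AE x in lborel. norm (I1 (height n) x) <= \<bar>T x\<bar>" for n
    proof (rule AE_I2)
      fix x show "norm (I1 (height n) x) <= \<bar>T x\<bar>"
        using step_bounds[of "r x / height n - 1"] by (simp add: I1_def height_cut_def abs_mult mult_left_le_one_le)
    qed
    show "AE x in lborel. (%n. I1 (height n) x) \<longlonglongrightarrow> T x"
    proof (intro AE_I2 tendsto_eventually)
      fix x show "eventually (%n. I1 (height n) x = T x) sequentially"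
      proof (cases "x \<in> D")
        case True
        then have "0 < r x / 2" using r_pos[of x] by simp
        from height_small[OF this] show ?thesis
        proof eventually_elim
          case (elim n)
          then have "1 <= r x / height n - 1" using height[of n] by (simp add: field_simps)
          then show ?case by (simp add: I1_def height_cut_def step_simps)
        qed
      next
        case False
        then show ?thesis by (simp add: I1_def T_def Q_0 B_0)
      qed
    qed
  qed (use iT in auto)
  have dev: "((%x. \<bar>u x / r x - W x\<bar> + (\<Sum>i\<in>UNIV. \<bar>pd i u x - W x * pd i r x\<bar>)) \<longlongrightarrow> 0) (at x0 within D)"
    if x0: "x0 \<in> frontier D" for x0
  proof -
    have x0c: "x0 \<in> closure D" using x0 frontier_iff by blast
    have Wl: "(W \<longlongrightarrow> W x0) (at x0 within D)"
      by (rule continuous_on_tendsto_compose[OF W(1) tendsto_ident_at]) auto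
    have rl: "(pd i r \<longlongrightarrow> pd i r x0) (at x0 within D)" for i
      by (rule continuous_on_tendsto_compose[OF r_partials(4)[of UNIV] tendsto_ident_at]) auto
    have ul: "(pd i u \<longlongrightarrow> g x0 $ i) (at x0 within D)" for i
    proof (rule Lim_transform_eventually)
      show "((%x. g x $ i) \<longlongrightarrow> g x0 $ i) (at x0 within D)"
        using gc[of i] x0c closure_subset[of D] unfolding continuous_on_def by (meson tendsto_within_subset)
      show "\<forall>\<^sub>F x in at x0 within D. g x $ i = pd i u x"
        unfolding eventually_at_filter by (intro always_eventually) (use gD in auto)
    qed
    have w: "bv.w x0 = W x0"
      using W(2)[OF x0] grad_r_frontier[OF x0] by (simp add: bv.w_def)
    have g0: "g x0 $ i = W x0 * pd i r x0" for i using W(2)[OF x0] by (simp add: grad_def)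
    have "((%x. \<bar>u x / r x - W x\<bar> + (\<Sum>i\<in>UNIV. \<bar>pd i u x - W x * pd i r x\<bar>)) \<longlongrightarrow>
        \<bar>W x0 - W x0\<bar> + (\<Sum>i\<in>UNIV. \<bar>g x0 $ i - W x0 * pd i r x0\<bar>)) (at x0 within D)"
      by (intro tendsto_intros Wl rl ul bv.quotient_limit[OF x0, unfolded w])
    then show ?thesis by (simp add: g0)
  qed
  have close: "eventually (%n. \<forall>x\<in>layer (height n). \<bar>u x / r x - W x\<bar> < e \<and> (\<forall>i. \<bar>pd i u x - W x * pd i r x\<bar> < e)) sequentially"
    if e: "0 < e" for e
  proof -
    obtain s where s: "0 < s" "!!x. x \<in> D ==> r x <= s ==>
      \<bar>\<bar>u x / r x - W x\<bar> + (\<Sum>i\<in>UNIV. \<bar>pd i u x - W x * pd i r x\<bar>)\<bar> < e"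
      using uniform_on_layer[OF dev e] by blast
    have "0 < s / 2" using s by simp
    from height_small[OF this] show ?thesis
    proof eventually_elim
      case (elim n)
      show ?case
      proof
        fix x assume x: "x \<in> layer (height n)"
        have "x \<in> D" "r x <= s" using x layer_subset[OF height(1)[of n]] elim by (auto simp: layer_def)
        from s(2)[OF this] have *: "\<bar>u x / r x - W x\<bar> + (\<Sum>i\<in>UNIV. \<bar>pd i u x - W x * pd i r x\<bar>) < e" by linarith
        have nn: "0 <= (\<Sum>i\<in>UNIV. \<bar>pd i u x - W x * pd i r x\<bar>)" by (simp add: sum_nonneg)
        have "\<bar>pd i u x - W x * pd i r x\<bar> <= (\<Sum>i\<in>UNIV. \<bar>pd i u x - W x * pd i r x\<bar>)" for i
          by (rule member_le_sum) auto
        then show "\<bar>u x / r x - W x\<bar> < e \<and> (\<forall>i. \<bar>pd i u x - W x * pd i r x\<bar> < e)"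
          using * nn by (smt (verit))
      qed
    qed
  qed
  obtain Wm where Wm: "0 < Wm" "!!x. x \<in> closure D ==> \<bar>W x\<bar> <= Wm" using closure_bound[OF W(1)] by blast
  have F0: "step1 (r x / s - 1) = 0 \<and> step2 (r x / s - 1) = 0" if "0 < s" "x \<notin> layer s" for s x
  proof -
    have "r x / s - 1 <= 0 \<or> 1 <= r x / s - 1" using that by (auto simp: layer_def field_simps)
    then show ?thesis using step_simps(3-6) by blast
  qed
  have lim2: "(%n. LBINT x. I2 (height n) x) \<longlonglongrightarrow> 0"
  proof -
    obtain N where N: "!!n. n \<ge> N ==> \<forall>x\<in>layer (height n). \<bar>u x / r x - W x\<bar> < 1"
      using close[of 1] unfolding eventually_sequentially by auto
    have "(%n. LBINT x. I2 (height (n + N)) x) \<longlonglongrightarrow> (LBINT (x::real^'n). 0)"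
    proof (rule integral_dominated_convergence[where w = "%x. C * (2 * (Wm + 1)) * \<bar>lower_order x\<bar>"])
      show "I2 (height (n + N)) \<in> borel_measurable lborel" for n using i2[OF height(1), of "n + N"] by simp
      show "integrable lborel (%x. C * (2 * (Wm + 1)) * \<bar>lower_order x\<bar>)" using lower_order_integrable by simp
      show "AE x in lborel. norm (I2 (height (n + N)) x) <= C * (2 * (Wm + 1)) * \<bar>lower_order x\<bar>" for n
      proof (rule AE_I2)
        fix x
        define s where "s = height (n + N)"
        have s: "0 < s" using height by (simp add: s_def)
        show "norm (I2 (height (n + N)) x) <= C * (2 * (Wm + 1)) * \<bar>lower_order x\<bar>"
        proof (cases "x \<in> layer s")
          case True
          then have xD: "x \<in> D" using layer_subset[OF s] by blast
          have rx: "0 < r x" "r x / s <= 2" using r_pos xD True s by (auto simp: layer_def field_simps)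
          have "\<bar>u x / r x\<bar> <= Wm + 1"
            using N[of "n + N"] True Wm(2)[of x] xD closure_subset[of D] by (fastforce simp: s_def)
          then have "\<bar>u x / r x\<bar> * (r x / s) <= (Wm + 1) * 2" using rx s Wm by (intro mult_mono) auto
          then have us: "\<bar>u x\<bar> / s <= 2 * (Wm + 1)" using rx s by (simp add: abs_divide)
          have "norm (I2 s x) = \<bar>step1 (r x / s - 1)\<bar> * (\<bar>u x\<bar> / s) * \<bar>lower_order x\<bar>"
            using s by (simp add: I2_def abs_mult)
          also have "... <= C * (2 * (Wm + 1)) * \<bar>lower_order x\<bar>"
            using C us s by (intro mult_right_mono mult_mono) auto
          finally show ?thesis by (simp add: s_def)
        next
          case False
          then show ?thesis using F0[OF s False] C Wm by (simp add: I2_def s_def[symmetric])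
        qed
      qed
      show "AE x in lborel. (%n. I2 (height (n + N)) x) \<longlonglongrightarrow> 0"
      proof (intro AE_I2)
        fix x
        have "eventually (%n. I2 (height n) x = 0) sequentially"
        proof (cases "x \<in> D")
          case True
          then have "0 < r x / 2" using r_pos[of x] by simp
          from height_small[OF this] show ?thesis
          proof eventually_elim
            case (elim n)
            then have "1 <= r x / height n - 1" using height[of n] by (simp add: field_simps)
            then show ?case by (simp add: I2_def step_simps)
          qed
        next
          case False
          then show ?thesis by (simp add: I2_def lower_order_def Q_0 B_0)
        qed
        then have "(%n. I2 (height n) x) \<longlonglongrightarrow> 0" by (rule tendsto_eventually)
        then show "(%n. I2 (height (n + N)) x) \<longlonglongrightarrow> 0" by (rule LIMSEQ_ignore_initial_segment)
      qed
    qed simp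
    then have "(%n. LBINT x. I2 (height (n + N)) x) \<longlonglongrightarrow> 0" by simp
    then show ?thesis by (rule LIMSEQ_offset)
  qed
  have lim3: "(%n. LBINT x. I3 (height n) x) \<longlonglongrightarrow> - (LBINT x. T x)"
    unfolding balance(2)[OF height(1)] using tendsto_diff[OF tendsto_minus[OF lim1] lim2] by simp
  have Wmeas[measurable]: "W \<in> borel_measurable borel" by (rule borel_measurable_continuous_onI[OF W(1)])
  have iW: "integrable lborel (%x. layer_density s x * W x)" if s: "0 < s" for s
  proof -
    have eq: "(%x. layer_density s x * W x) = (%x. layer_density s x * (indicator D x * W x))"
    proof
      fix x show "layer_density s x * W x = layer_density s x * (indicator D x * W x)"
        by (cases "x \<in> D") (simp_all add: layer_density_outside)
    qed
    have b: "\<bar>indicator D x * W x\<bar> <= Wm" for x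
      using Wm closure_subset[of D] by (auto simp: indicator_def)
    show ?thesis unfolding eq by (rule integrable_mult_bounded[OF layer_density_integrable[OF s] _ b]) measurable
  qed
  have lim4: "(%n. (LBINT x. I3 (height n) x) - (LBINT x. layer_density (height n) x * W x)) \<longlonglongrightarrow> 0"
  proof (rule tendstoI)
    fix e :: real assume e: "0 < e"
    define K where "K = 2 * C * (G + G * G)"
    have K: "0 < K" using C G by (simp add: K_def add_pos_pos)
    define X where "X = K * M0 + 1"
    have "0 <= K * M0" using K M0 by simp
    then have X: "0 < X" by (simp add: X_def)
    define \<eta> where "\<eta> = e / X / 2"
    have \<eta>: "0 < \<eta>" using e X by (simp add: \<eta>_def)
    show "\<forall>\<^sub>F n in sequentially. dist ((LBINT x. I3 (height n) x) - (LBINT x. layer_density (height n) x * W x)) 0 < e"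
      using close[OF \<eta>]
    proof eventually_elim
      case (elim n)
      define s where "s = height n"
      have s: "0 < s" "s <= s0" using height by (auto simp: s_def)
      have pt: "\<bar>I3 s x - layer_density s x * W x\<bar> <= \<eta> * K / s * (indicator (layer s) x * Qabs x)" for x
      proof (cases "x \<in> layer s")
        case True
        then have xD: "x \<in> D" using layer_subset[OF s(1)] by blast
        then have xc: "x \<in> closure D" using closure_subset by blast
        have rx: "0 < r x" "r x / s <= 2" "0 <= r x / s" using r_pos xD True s by (auto simp: layer_def field_simps)
        define F1 where "F1 = step1 (r x / s - 1)"
        define F2 where "F2 = step2 (r x / s - 1)"
        define c where "c i j = F1 / s * ((pd i u x - W x * pd i r x) * pd j r x
           + (pd j u x - W x * pd j r x) * pd i r x)
           + F2 / s * (r x / s) * (u x / r x - W x) * (pd i r x * pd j r x)" for i j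
        have "I3 s x - layer_density s x * W x = (\<Sum>i\<in>UNIV. \<Sum>j\<in>UNIV. Q i j x * c i j)"
        proof -
          have us: "F2 / s * (r x / s) * (u x / r x - W x) = F2 / s / s * u x - F2 / s * (r x / s) * W x"
            using rx s by (simp add: field_simps)
          have "Q i j x * c i j = Q i j x * (F1 / s *
             (pd i u x * pd j r x + pd j u x * pd i r x)
             + F2 / s / s * u x * pd i r x * pd j r x)
             - 1 / s * (2 * F1 + r x / s * F2) * W x * (Q i j x * pd i r x * pd j r x)" for i j
            unfolding c_def us by (simp add: algebra_simps diff_divide_distrib add_divide_distrib)
          then show ?thesis
            unfolding I3_def layer_density_def profile_def Qn_def F1_def[symmetric] F2_def[symmetric]
            by (simp add: sum_subtractf sum_distrib_left mult_ac)
        qed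
        also have "\<bar>...\<bar> <= \<eta> * K / s * Qabs x"
        proof (rule sum_Q_le)
          fix i j
          have el: "\<bar>u x / r x - W x\<bar> <= \<eta>" "!!i. \<bar>pd i u x - W x * pd i r x\<bar> <= \<eta>"
            using elim True by (auto simp: s_def less_imp_le)
          have m1: "\<bar>(pd i u x - W x * pd i r x) * pd j r x\<bar> <= \<eta> * G" for i j
            unfolding abs_mult by (intro mult_mono el G(2)[OF xc]) (use \<eta> in auto)
          have m2: "\<bar>pd i r x * pd j r x\<bar> <= G * G"
            unfolding abs_mult by (intro mult_mono G(2)[OF xc]) (use G in auto)
          have b1: "\<bar>F1 / s\<bar> <= C / s" "\<bar>F2 / s\<bar> <= C / s" using C s by (auto simp: F1_def F2_def abs_divide divide_right_mono)
          have "\<bar>F1 / s * ((pd i u x - W x * pd i r x) * pd j r x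
             + (pd j u x - W x * pd j r x) * pd i r x)\<bar> <= C / s * (2 * (\<eta> * G))"
          proof -
            have "\<bar>(pd i u x - W x * pd i r x) * pd j r x
             + (pd j u x - W x * pd j r x) * pd i r x\<bar> <= 2 * (\<eta> * G)"
              using m1[of i j] m1[of j i] by linarith
            then show ?thesis unfolding abs_mult[of "F1 / s"] using b1 C s by (intro mult_mono) auto
          qed
          moreover have "\<bar>F2 / s * (r x / s) * (u x / r x - W x) * (pd i r x * pd j r x)\<bar> <= C / s * 2 * \<eta> * (G * G)"
          proof -
            have "\<bar>F2 / s\<bar> * \<bar>r x / s\<bar> <= C / s * 2" using b1 rx C s by (intro mult_mono) auto
            then have "\<bar>F2 / s\<bar> * \<bar>r x / s\<bar> * \<bar>u x / r x - W x\<bar> <= C / s * 2 * \<eta>" by (rule mult_mono) (use el C s in auto)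
            then have "\<bar>F2 / s\<bar> * \<bar>r x / s\<bar> * \<bar>u x / r x - W x\<bar> * \<bar>pd i r x * pd j r x\<bar> <= C / s * 2 * \<eta> * (G * G)"
              by (rule mult_mono) (use m2 C s \<eta> in auto)
            then show ?thesis by (simp only: abs_mult)
          qed
          moreover have "C / s * (2 * (\<eta> * G)) + C / s * 2 * \<eta> * (G * G) = \<eta> * K / s"
            by (simp add: K_def algebra_simps add_divide_distrib)
          ultimately show "\<bar>c i j\<bar> <= \<eta> * K / s" unfolding c_def by linarith
        qed
        finally show ?thesis using True by simp
      next
        case False
        then show ?thesis using F0[OF s(1) False] by (simp add: I3_def layer_density_def profile_def)
      qed
      have "\<bar>(LBINT x. I3 s x) - (LBINT x. layer_density s x * W x)\<bar> = \<bar>LBINT x. I3 s x - layer_density s x * W x\<bar>"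
        using balance(1)[OF s(1)] iW[OF s(1)] by simp
      also have "... <= (LBINT x. \<eta> * K / s * (indicator (layer s) x * Qabs x))"
        by (rule order_trans[OF integral_abs_bound], rule integral_mono)
          (use balance(1)[OF s(1)] iW[OF s(1)] layer_integrable pt in auto)
      also have "... = \<eta> * K / s * (LBINT x. indicator (layer s) x * Qabs x)" by simp
      also have "... <= \<eta> * K / s * (M0 * s)" using layer_mass[OF s] \<eta> K s by (intro mult_left_mono) auto
      also have "... = \<eta> * (K * M0)" using s by simp
      also have "... < e"
      proof -
        have "\<eta> * (K * M0) <= \<eta> * X" using \<eta> by (simp add: X_def)
        also have "... = e / 2" using X by (simp add: \<eta>_def)
        finally show ?thesis using e by simp
      qed
      finally show ?case by (simp add: s_def)
    qed
  qed
  show "(%n. LBINT x. layer_density (height n) x * W x) \<longlonglongrightarrow>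
      - ((\<Sum>i\<in>UNIV. \<Sum>j\<in>UNIV. LBINT x. Q i j x * H i j x) + (\<Sum>i\<in>UNIV. LBINT x. B i x * pd i u x))"
    unfolding intT[symmetric] using tendsto_diff[OF lim3 lim4] by simp
qed

definition signed_part :: "bool => real => real" where "signed_part b t = max 0 (if b then t else - t)"

text \<open>The index set has to be a type, so the functional is extended by 0 to discontinuous
  functions.\<close>
definition layer_functional :: "nat => bool \<times> (real^'n => real) => real" where
  "layer_functional n = (%(b, f). if continuous_on UNIV f then LBINT x. signed_part b (layer_density (height n) x) * f x else 0)"

lemma signed_part: "0 <= signed_part b t" "signed_part b t <= \<bar>t\<bar>" "t = signed_part True t - signed_part False t"
  by (auto simp: signed_part_def)

lemma layer_density_measurable [measurable]: "layer_density s \<in> borel_measurable borel"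
  unfolding layer_density_def[abs_def] by measurable

lemma signed_layer:
  assumes f: "continuous_on UNIV f"
  shows "integrable lborel (%x. signed_part b (layer_density (height n) x) * f x)"
proof -
  obtain Wm where Wm: "0 < Wm" "!!x. x \<in> closure D ==> \<bar>f x\<bar> <= Wm" using closure_bound[OF f] by blast
  have [measurable]: "f \<in> borel_measurable borel" by (rule borel_measurable_continuous_onI[OF f])
  have eq: "(%x. signed_part b (layer_density (height n) x) * f x) = (%x. signed_part b (layer_density (height n) x) * (indicator D x * f x))"
  proof
    fix x
    show "signed_part b (layer_density (height n) x) * f x = signed_part b (layer_density (height n) x) * (indicator D x * f x)"
      by (cases "x \<in> D") (simp_all add: layer_density_outside signed_part_def)
  qed
  have bd: "\<bar>indicator D x * f x\<bar> <= Wm" for x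
    using Wm closure_subset[of D] by (auto simp: indicator_def)
  have i: "integrable lborel (%x. signed_part b (layer_density (height n) x))"
    by (rule Bochner_Integration.integrable_bound[OF layer_density_integrable[OF height(1)[of n]]])
      (use signed_part(1,2) in \<open>auto simp: signed_part_def[abs_def]\<close>)
  show ?thesis unfolding eq by (rule integrable_mult_bounded[OF i _ bd]) measurable
qed

lemma total_mass:
  obtains Mass where "0 <= Mass" "!!n. (LBINT x. \<bar>layer_density (height n) x\<bar>) <= Mass"
proof -
  obtain P where P: "0 < P" "!!s x. 0 < s ==> \<bar>layer_density s x\<bar> <= P / s * (indicator (layer s) x * Qabs x)"
    using layer_density_bound by blast
  show thesis
  proof (rule that[of "P * M0"])
    fix n
    define s where "s = height n"
    have s: "0 < s" "s <= s0" using height by (auto simp: s_def)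
    have "(LBINT x. \<bar>layer_density s x\<bar>) <= (LBINT x. P / s * (indicator (layer s) x * Qabs x))"
      using layer_density_integrable[OF s(1)] layer_integrable P(2)[OF s(1)] by (intro integral_mono) auto
    also have "... = P / s * (LBINT x. indicator (layer s) x * Qabs x)" by simp
    also have "... <= P / s * (M0 * s)" using layer_mass[OF s] P(1) s by (intro mult_left_mono) auto
    also have "... = P * M0" using s by simp
    finally show "(LBINT x. \<bar>layer_density (height n) x\<bar>) <= P * M0" by (simp add: s_def)
  qed (use P M0 in simp)
qed

lemma layer_functional_estimate:
  assumes f: "continuous_on UNIV f" and b: "!!x. x \<in> layer (height n) ==> \<bar>f x\<bar> <= M" and M: "0 <= M"
  shows "\<bar>layer_functional n (b, f)\<bar> <= M * (LBINT x. \<bar>layer_density (height n) x\<bar>)"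
proof -
  have z: "layer_density (height n) x = 0" if "x \<notin> layer (height n)" for x
  proof -
    obtain P where P: "0 < P" "!!s x. 0 < s ==> \<bar>layer_density s x\<bar> <= P / s * (indicator (layer s) x * Qabs x)"
      using layer_density_bound by blast
    show ?thesis using P(2)[OF height(1)[of n], of x] that by simp
  qed
  have "\<bar>layer_functional n (b, f)\<bar> <= (LBINT x. \<bar>signed_part b (layer_density (height n) x) * f x\<bar>)"
    using f by (simp add: layer_functional_def integral_abs_bound)
  also have "... <= (LBINT x. M * \<bar>layer_density (height n) x\<bar>)"
  proof (rule integral_mono)
    show "\<bar>signed_part b (layer_density (height n) x) * f x\<bar> <= M * \<bar>layer_density (height n) x\<bar>" for x
    proof (cases "x \<in> layer (height n)")
      case True
      have "\<bar>signed_part b (layer_density (height n) x)\<bar> * \<bar>f x\<bar> <= \<bar>layer_density (height n) x\<bar> * M"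
        using signed_part(1,2)[of b "layer_density (height n) x"] b[OF True] by (intro mult_mono) auto
      then show ?thesis by (simp add: abs_mult mult.commute)
    qed (use z M in \<open>simp add: signed_part_def\<close>)
  qed (use signed_layer[OF f] layer_density_integrable[OF height(1)[of n]] in auto)
  finally show ?thesis by simp
qed

lemma layer_functional_linear:
  assumes "continuous_on UNIV f" "continuous_on UNIV g"
  shows "layer_functional n (b, %x. f x + g x) = layer_functional n (b, f) + layer_functional n (b, g)"
    and "layer_functional n (b, %x. c * f x) = c * layer_functional n (b, f)"
proof -
  have "continuous_on UNIV (%x. f x + g x)" "continuous_on UNIV (%x. c * f x)" using assms by (intro continuous_intros; simp)+
  then show "layer_functional n (b, %x. f x + g x) = layer_functional n (b, f) + layer_functional n (b, g)"
    "layer_functional n (b, %x. c * f x) = c * layer_functional n (b, f)"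
    using signed_layer[OF assms(1)] signed_layer[OF assms(2)] assms
    by (simp_all add: layer_functional_def distrib_left mult.left_commute[of _ c])
qed

text \<open>The positive and negative parts of the layer densities define bounded families of
  functionals. Their limits along a filter are positive functionals, because a function that is
  nonnegative on the boundary is at least \<open>-\<epsilon>\<close> on thin layers. They are
  represented by measures, and \<open>layer_limit\<close> identifies the difference. If
  \<open>Q\<close> is bounded, the functional of a bump at a ball of radius \<open>t\<close> is
  controlled by \<open>1/s\<close> times the volume of the layer in that ball.\<close>
theorem boundary_measures:
  obtains \<mu> where "boundary_pair p D r Q B \<mu>" "!!M b. (!!i j x. \<bar>Q i j x\<bar> <= M) ==> ball_growth (frontier D) (\<mu> b)"
proof -
  obtain Mass where Mass: "0 <= Mass" "!!n. (LBINT x. \<bar>layer_density (height n) x\<bar>) <= Mass" using total_mass by blast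
  have bnd: "\<exists>K. \<forall>n. \<bar>layer_functional n i\<bar> <= K" for i
  proof -
    obtain b f where i: "i = (b, f)" by (cases i) auto
    show ?thesis
    proof (cases "continuous_on UNIV f")
      case True
      obtain Wm where Wm: "0 < Wm" "!!x. x \<in> closure D ==> \<bar>f x\<bar> <= Wm" using closure_bound[OF True] by blast
      have "\<bar>layer_functional n i\<bar> <= Wm * Mass" for n
      proof -
        have "\<bar>layer_functional n i\<bar> <= Wm * (LBINT x. \<bar>layer_density (height n) x\<bar>)"
          unfolding i by (rule layer_functional_estimate[OF True])
            (use Wm layer_subset[OF height(1)[of n]] closure_subset[of D] in auto)
        also have "... <= Wm * Mass" using Mass(2) Wm by (intro mult_left_mono) auto
        finally show ?thesis .
      qed
      then show ?thesis by blast
    qed (auto simp: i layer_functional_def)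
  qed
  then obtain K where K: "!!n i. \<bar>layer_functional n i\<bar> <= K i" by metis
  obtain F L where F: "F <= sequentially" "F \<noteq> bot" "!!i. ((%n. layer_functional n i) \<longlongrightarrow> L i) F"
    by (rule bounded_families_converge_along_filter[where X = layer_functional and B = K, OF K]) (rule that, assumption+)
  have seq: "((%n. X n) \<longlongrightarrow> l) F" if "X \<longlonglongrightarrow> l" for X :: "nat => real" and l
    using that F(1) by (rule filterlim_mono[OF _ order_refl])
  have evF: "eventually P F" if "eventually P sequentially" for P using that F(1) by (rule filter_leD[rotated])
  have pf: "positive_functional (frontier D) (%f. L (b, f))" for b
  proof
    show "compact (frontier D)" by (rule compact_frontier_D)
    show "L (b, %x. f x + g x) = L (b, f) + L (b, g)" if "continuous_on UNIV f" "continuous_on UNIV g" for f g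
      using tendsto_add[OF F(3) F(3), of "(b, f)" "(b, g)"] F(3)[of "(b, %x. f x + g x)"]
      unfolding layer_functional_linear(1)[OF that] by (rule tendsto_unique[OF F(2), rotated])
    show "L (b, %x. c * f x) = c * L (b, f)" if "continuous_on UNIV f" for f c
      using tendsto_mult_left[OF F(3), of c "(b, f)"] F(3)[of "(b, %x. c * f x)"]
      unfolding layer_functional_linear(2)[OF that that] by (rule tendsto_unique[OF F(2), rotated])
    show "0 <= L (b, f)" if f: "continuous_on UNIV f" and f0: "!!x. x \<in> frontier D ==> 0 <= f x" for f
    proof (rule field_le_epsilon)
      fix e :: real assume e: "0 < e"
      define \<eta> where "\<eta> = e / (Mass + 1)"
      have \<eta>: "0 < \<eta>" "\<eta> * Mass <= e" using e Mass(1) by (auto simp: \<eta>_def field_simps)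
      have "open {x. - \<eta> < f x}" by (intro open_Collect_less continuous_on_const f)
      moreover have "frontier D \<subseteq> {x. - \<eta> < f x}"
      proof
        fix x assume "x \<in> frontier D"
        then have "0 <= f x" by (rule f0)
        then show "x \<in> {x. - \<eta> < f x}" using \<eta> by simp
      qed
      ultimately obtain s where s: "0 < s" "!!x. x \<in> D ==> r x <= s ==> x \<in> {x. - \<eta> < f x}"
        by (rule layer_in_neighbourhood) blast
      have s2: "0 < s / 2" using s by simp
      have "eventually (%n. - e <= layer_functional n (b, f)) sequentially"
        using height_small[OF s2]
      proof eventually_elim
        case (elim n)
        define m where "m x = signed_part b (layer_density (height n) x)" for x
        have m: "0 <= m x" "m x <= \<bar>layer_density (height n) x\<bar>" for x using signed_part by (auto simp: m_def)
        have im: "integrable lborel m"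
          using signed_layer[OF continuous_on_const[of _ 1], of b n] by (simp add: m_def[abs_def])
        have pt: "- \<eta> * m x <= m x * f x" for x
        proof (cases "x \<in> layer (height n)")
          case True
          then have "x \<in> D" "r x <= s" using layer_subset[OF height(1)[of n]] elim by (auto simp: layer_def)
          then have "- \<eta> <= f x" using s(2) by (simp add: less_imp_le)
          then show ?thesis using mult_left_mono[OF _ m(1)[of x], of "- \<eta>" "f x"] by (simp add: mult.commute)
        next
          case False
          obtain P where P: "0 < P" "!!s x. 0 < s ==> \<bar>layer_density s x\<bar> <= P / s * (indicator (layer s) x * Qabs x)"
            using layer_density_bound by blast
          have "m x = 0" using P(2)[OF height(1)[of n], of x] False by (simp add: m_def signed_part_def)
          then show ?thesis by simp
        qed
        have "(LBINT x. m x) <= (LBINT x. \<bar>layer_density (height n) x\<bar>)"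
          using im m layer_density_integrable[OF height(1)[of n]] by (intro integral_mono) auto
        then have "(LBINT x. m x) <= Mass" using Mass(2)[of n] by linarith
        then have "\<eta> * (LBINT x. m x) <= \<eta> * Mass" using \<eta> by (intro mult_left_mono) auto
        then have "- e <= - \<eta> * (LBINT x. m x)" using \<eta> by linarith
        also have "... = (LBINT x. - \<eta> * m x)" by simp
        also have "... <= (LBINT x. m x * f x)"
        proof (rule integral_mono)
          show "integrable lborel (%x. m x * f x)" using signed_layer[OF f, of b n] by (simp add: m_def)
        qed (use im pt in simp_all)
        finally show ?case using f by (simp add: layer_functional_def m_def)
      qed
      then have "- e <= L (b, f)" by (rule tendsto_lowerbound[OF F(3) evF F(2)])
      then show "0 <= L (b, f) + e" by simp
    qed
  qed
  define \<mu> where "\<mu> b = positive_functional.repr (frontier D) (%f. L (b, f))" for b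
  note R = positive_functional.sets_repr[OF pf] positive_functional.finite_repr[OF pf] positive_functional.null_outside[OF pf]
    positive_functional.integral_repr[OF pf] positive_functional.emeasure_repr_le[OF pf]
  show thesis
  proof (rule that[of \<mu>])
    show "boundary_pair p D r Q B \<mu>" unfolding boundary_pair_def
    proof (intro conjI allI impI)
      show "sets (\<mu> b) = sets borel" "finite_measure (\<mu> b)" "emeasure (\<mu> b) (- frontier D) = 0" for b
        unfolding \<mu>_def by (rule R)+
    next
    fix u H W assume t: "boundary_test p D r u H W"
    have ex: "\<exists>g. boundary_vanishing D r u g \<and> (\<forall>x\<in>frontier D. g x = W x *\<^sub>R grad r x)" "\<exists>C. \<forall>x. \<bar>W x\<bar> <= C"
      using t by (simp_all only: boundary_test_def)
    obtain g where g: "boundary_vanishing D r u g \<and> (\<forall>x\<in>frontier D. g x = W x *\<^sub>R grad r x)" using ex(1) by (elim exE)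
    obtain C where C: "\<forall>x. \<bar>W x\<bar> <= C" using ex(2) by (elim exE)
    have a: "boundary_vanishing D r u g" "u \<in> borel_measurable borel"
      "!!i j. H i j \<in> borel_measurable borel" "!!i j. integrable lborel (%x. \<bar>H i j x\<bar> powr p)"
      "!!i j x. x \<notin> D ==> H i j x = 0"
      "!!i j \<phi>. \<phi> \<in> C0_infty D ==>
       (LBINT x. u x * pd i (pd j \<phi>) x) = (LBINT x. H i j x * \<phi> x)"
      "continuous_on UNIV W" "!!x. \<bar>W x\<bar> <= C" "!!x. x \<in> frontier D ==> g x = W x *\<^sub>R grad r x"
      using t g C by (simp_all add: boundary_test_def)
    define T where "T = (\<Sum>i\<in>UNIV. \<Sum>j\<in>UNIV. LBINT x. Q i j x * H i j x) + (\<Sum>i\<in>UNIV. LBINT x. B i x * pd i u x)"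
    have "(%n. LBINT x. layer_density (height n) x * W x) \<longlonglongrightarrow> - T"
      unfolding T_def by (rule layer_limit(3)[OF a(1-7,9)])
    then have "((%n. LBINT x. layer_density (height n) x * W x) \<longlongrightarrow> - T) F" by (rule seq)
    moreover have "(LBINT x. layer_density (height n) x * W x) = layer_functional n (True, W) - layer_functional n (False, W)" for n
    proof -
      have "layer_functional n (True, W) - layer_functional n (False, W) =
        (LBINT x. signed_part True (layer_density (height n) x) * W x - signed_part False (layer_density (height n) x) * W x)"
        using a(7) signed_layer[OF a(7), of _ n] by (simp add: layer_functional_def)
      also have "... = (LBINT x. layer_density (height n) x * W x)"
        by (intro Bochner_Integration.integral_cong refl) (simp add: left_diff_distrib[symmetric] signed_part(3)[symmetric])
      finally show ?thesis by simp
    qed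
    moreover have "((%n. layer_functional n (True, W) - layer_functional n (False, W)) \<longlongrightarrow> L (True, W) - L (False, W)) F"
      by (intro tendsto_diff F(3))
    ultimately have "- T = L (True, W) - L (False, W)" using tendsto_unique[OF F(2)] by simp
    then show "(\<Sum>i\<in>UNIV. \<Sum>j\<in>UNIV. LBINT x. Q i j x * H i j x) + (\<Sum>i\<in>UNIV. LBINT x. B i x * pd i u x)
        = (LINT x|\<mu> False. W x) - (LINT x|\<mu> True. W x)"
      unfolding \<mu>_def T_def[symmetric] by (simp add: R(4)[OF a(7,8)])
    qed
  next
    fix M b assume Q: "!!i j x. \<bar>Q i j x\<bar> <= M"
    define M1 where "M1 = real CARD('n) * (real CARD('n) * M)"
    have M: "0 <= M" using Q[of undefined undefined undefined] by linarith
    have Qa: "Qabs x <= M1" for x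
    proof -
      have "Qabs x <= (\<Sum>i\<in>(UNIV::'n set). \<Sum>j\<in>(UNIV::'n set). M)" unfolding Qabs_def by (intro sum_mono Q)
      then show ?thesis by (simp add: M1_def)
    qed
    obtain P where P: "0 < P" "!!s x. 0 < s ==> \<bar>layer_density s x\<bar> <= P / s * (indicator (layer s) x * Qabs x)"
      using layer_density_bound by blast
    obtain R0 a C where R0: "0 < R0" "0 < a" "0 <= C"
      "!!x0 \<sigma> s. x0 \<in> frontier D ==> \<sigma> <= R0 ==> 0 < s ==> s <= a * \<sigma> ==>
      measure lborel {x \<in> ball x0 \<sigma>. \<bar>r x\<bar> <= s} <= C * s * \<sigma> ^ (CARD('n) - 1)"
      using local_layer_volume by blast
    define C' where "C' = P * M1 * (C * 2 * 2 ^ (CARD('n) - 1)) + 1"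
    have M1: "0 <= M1" using M by (simp add: M1_def)
    have C': "0 < C'" using P R0 M1 by (simp add: C'_def add_nonneg_pos)
    have "emeasure (\<mu> b) (cball x t) <= ennreal (C' * t ^ (CARD('n) - 1))" if x: "x \<in> frontier D" and t: "0 < t" "t <= R0 / 2" for x t
    proof -
      define f where "f y = max 0 (min 1 (2 - dist x y / t))" for y
      have f: "continuous_on UNIV f" unfolding f_def by (intro continuous_intros) (use t in auto)
      have f01: "0 <= f y" "f y <= 1" for y by (auto simp: f_def)
      have fz: "f y = 0" if "y \<notin> ball x (2 * t)" for y using that t by (simp add: f_def field_simps)
      have f1: "1 <= f y" if "y \<in> cball x t" for y using that t by (simp add: f_def field_simps)
      have "emeasure (\<mu> b) (cball x t) <= ennreal (L (b, f))"
        unfolding \<mu>_def by (rule R(5)) (use f f01 f1 in auto)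
      also have "L (b, f) <= C' * t ^ (CARD('n) - 1)"
      proof (rule tendsto_upperbound[OF F(3) evF F(2)])
        have at: "0 < a * t" using R0 t by simp
        show "eventually (%n. layer_functional n (b, f) <= C' * t ^ (CARD('n) - 1)) sequentially"
          using height_small[OF at]
        proof eventually_elim
          case (elim n)
          define s where "s = height n"
          have s: "0 < s" "2 * s <= a * (2 * t)" using height[of n] elim by (auto simp: s_def)
          let ?Y = "{y \<in> ball x (2 * t). \<bar>r y\<bar> <= 2 * s}"
          have fm: "?Y \<in> fmeasurable lborel"
            by (rule fmeasurableI2[OF ball_fmeasurable[of x "2 * t"]]) auto
          have iY: "integrable lborel (%y. indicat_real ?Y y)" using fm by (simp add: fmeasurable_def)
          have pt: "signed_part b (layer_density s y) * f y <= P / s * M1 * indicator ?Y y" for y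
          proof (cases "y \<in> ?Y")
            case True
            have "signed_part b (layer_density s y) * f y <= \<bar>layer_density s y\<bar> * 1"
              using signed_part(1,2)[of b "layer_density s y"] f01[of y] by (intro mult_mono) auto
            also have "... <= P / s * (indicator (layer s) y * Qabs y)" using P(2)[OF s(1)] by simp
            also have "... <= P / s * M1"
              using P s Qa[of y] M1 by (intro mult_left_mono) (auto simp: indicator_def)
            finally show ?thesis using True by simp
          next
            case False
            show ?thesis
            proof (cases "y \<in> ball x (2 * t)")
              case True
              then have "y \<notin> layer s" using False s by (auto simp: layer_def)
              then have "layer_density s y = 0" using P(2)[OF s(1), of y] by simp
              then show ?thesis using False by (simp add: signed_part_def)
            qed (use fz False in simp)
          qed
          have "layer_functional n (b, f) = (LBINT y. signed_part b (layer_density s y) * f y)"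
            using f by (simp add: layer_functional_def s_def)
          also have "... <= (LBINT y. P / s * M1 * indicator ?Y y)"
            using signed_layer[OF f, of b n] iY pt by (intro integral_mono) (auto simp: s_def)
          also have "... = P / s * M1 * measure lborel ?Y" by simp
          also have "... <= P / s * M1 * (C * (2 * s) * (2 * t) ^ (CARD('n) - 1))"
            using R0(4)[OF x _ _ s(2)] s t P M1 by (intro mult_left_mono) auto
          also have "... = P * M1 * (C * 2 * 2 ^ (CARD('n) - 1)) * t ^ (CARD('n) - 1)"
            using s by (simp add: power_mult_distrib)
          also have "... <= C' * t ^ (CARD('n) - 1)" using t unfolding C'_def by (intro mult_right_mono) auto
          finally show ?case .
        qed
      qed
      finally show ?thesis by (simp add: ennreal_leI)
    qed
    then show "ball_growth (frontier D) (\<mu> b)"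
      unfolding ball_growth_def using C' R0(1) by (intro exI[of _ C'] exI[of _ "R0 / 2"]) auto
  qed
qed

end

section \<open>Passing between Lebesgue and Borel measurable functions\<close>

text \<open>Statements about Lebesgue measure on a subset are moved to Borel functions on the
  whole space that vanish off the subset.\<close>
lemma lebesgue_on_transfer:
  fixes f f' :: "real^'n::finite => real"
  assumes S: "S \<in> sets lebesgue" and f': "f' \<in> borel_measurable borel" and 0: "!!x. x \<notin> S ==> f' x = 0"
    and ae: "AE x in lborel. x \<in> S --> f x = f' x"
  shows "f \<in> borel_measurable (lebesgue_on S)"
    and "integrable (lebesgue_on S) f \<longleftrightarrow> integrable lborel f'"
    and "(LINT x|lebesgue_on S. f x) = (LBINT x. f' x)"
proof -
  have Sp: "S \<inter> space lebesgue \<in> sets lebesgue" using S by simp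
  have f'L: "f' \<in> borel_measurable lebesgue" using measurable_completion[of f' lborel borel] f' by simp
  have ae': "AE x in lebesgue. f' x = indicator S x *\<^sub>R f x"
    by (rule AE_completion) (use ae 0 in \<open>auto elim!: eventually_mono simp: indicator_def\<close>)
  have m: "(%x. indicator S x *\<^sub>R f x) \<in> borel_measurable lebesgue" by (rule borel_measurable_AE[OF f'L ae'])
  then show "f \<in> borel_measurable (lebesgue_on S)" by (subst borel_measurable_restrict_space_iff[OF Sp])
  have "integrable (lebesgue_on S) f \<longleftrightarrow> integrable lebesgue (%x. indicator S x *\<^sub>R f x)" by (rule integrable_restrict_space[OF Sp])
  also have "... \<longleftrightarrow> integrable lebesgue f'" using integrable_cong_AE[OF f'L m ae'] by simp
  also have "... \<longleftrightarrow> integrable lborel f'" by (rule integrable_completion) (use f' in simp)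
  finally show "integrable (lebesgue_on S) f \<longleftrightarrow> integrable lborel f'" .
  have "(LINT x|lebesgue_on S. f x) = (LINT x|lebesgue. indicator S x *\<^sub>R f x)" by (rule integral_restrict_space[OF Sp])
  also have "... = (LINT x|lebesgue. f' x)" using integral_cong_AE[OF m f'L] ae' by (auto simp: eq_commute)
  also have "... = (LBINT x. f' x)" by (rule integral_completion) (use f' in simp)
  finally show "(LINT x|lebesgue_on S. f x) = (LBINT x. f' x)" .
qed

lemma borel_representative:
  fixes f :: "real^'n::finite => real"
  assumes S: "S \<in> sets borel" and f: "f \<in> borel_measurable (lebesgue_on S)"
  obtains f' where "f' \<in> borel_measurable borel" "!!x. x \<notin> S ==> f' x = 0" "AE x in lborel. x \<in> S --> f x = f' x"
proof -
  have Sp: "S \<inter> space lebesgue \<in> sets lebesgue" using S by simp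
  have "(%x. indicator S x *\<^sub>R f x) \<in> borel_measurable lebesgue"
    using f by (subst (asm) borel_measurable_restrict_space_iff[OF Sp])
  then obtain g where g: "g \<in> borel_measurable lborel" "AE x in lborel. indicator S x * f x = g x"
    using completion_ex_borel_measurable_real[of "%x. indicator S x * f x" lborel] by (auto simp only: real_scaleR_def)
  have "(%x. indicator S x * g x) \<in> borel_measurable borel" using g(1) S by simp
  then show thesis
    by (rule that) (use g(2) in \<open>auto elim!: eventually_mono simp: indicator_def\<close>)
qed

lemma borel_measurable_lebesgue_on_subset:
  fixes f :: "'a::euclidean_space => real"
  assumes "f \<in> borel_measurable (lebesgue_on S)" "T \<subseteq> S"
  shows "f \<in> borel_measurable (lebesgue_on T)"
  using assms by (rule measurable_restrict_mono)

lemma Lp_loc_compact: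
  assumes "Lp_loc s S f" "compact K" "K \<subseteq> S"
  shows "f \<in> borel_measurable (lebesgue_on K)" "integrable (lebesgue_on K) (%x. \<bar>f x\<bar> powr s)"
  using assms(1)[unfolded Lp_loc_def, THEN conjunct2, rule_format, of K]
    borel_measurable_lebesgue_on_subset[OF assms(1)[unfolded Lp_loc_def, THEN conjunct1] assms(3)] assms(2,3)
  by simp_all

lemma lebesgue_on_mono_integrable:
  fixes f :: "real^'n::finite => real"
  assumes f: "integrable (lebesgue_on K) f" and T: "T \<subseteq> K" "T \<in> sets lebesgue" "K \<in> sets lebesgue"
  shows "integrable (lebesgue_on T) f"
proof -
  have "integrable lebesgue (%x. indicator K x *\<^sub>R f x)" using f T by (subst (asm) integrable_restrict_space) auto
  from integrable_mult_indicator[OF T(2) this] have "integrable lebesgue (%x. indicator T x *\<^sub>R (indicator K x *\<^sub>R f x))" .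
  moreover have "(%x. indicator T x *\<^sub>R (indicator K x *\<^sub>R f x)) = (%x. indicator T x *\<^sub>R f x)"
    using T(1) by (auto simp: indicator_def fun_eq_iff)
  ultimately show ?thesis using T by (subst integrable_restrict_space) auto
qed

lemma Lp_loc_Lloc:
  fixes f :: "real^'n::finite => real"
  assumes D: "open D" and f: "Lp_loc 1 D f"
    and f': "f' \<in> borel_measurable borel" "!!x. x \<notin> D ==> f' x = 0" "AE x in lborel. x \<in> D --> f x = f' x"
  shows "Lloc D f'"
  unfolding Lloc_def
proof (intro conjI allI impI f'(1))
  fix K assume K: "compact K \<and> K \<subseteq> D"
  have Kb: "K \<in> sets borel" using K borel_compact by blast
  have "integrable (lebesgue_on K) (%x. \<bar>f x\<bar>)"
    using Lp_loc_compact(2)[OF f, of K] K by simp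
  moreover have "f \<in> borel_measurable (lebesgue_on K)" using Lp_loc_compact(1)[OF f, of K] K by simp
  ultimately have "integrable (lebesgue_on K) f" by (rule integrable_abs_cancel)
  moreover have "integrable (lebesgue_on K) f \<longleftrightarrow> integrable lborel (%x. indicator K x * f' x)"
  proof (rule lebesgue_on_transfer(2))
    show "AE x in lborel. x \<in> K --> f x = indicator K x * f' x"
      using f'(3) K by (auto elim!: eventually_mono)
  qed (use Kb f'(1) in simp_all)
  ultimately show "integrable lborel (%x. indicator K x * f' x)" by simp
qed

section \<open>Assembling the signed measure\<close>

text \<open>The two boundary measures may be singular to each other; both have a bounded density
  with respect to their sum.\<close>
definition sum_measure :: "(bool => 'a measure) => 'a measure" where
  "sum_measure \<mu> = measure_of (space (\<mu> True)) (sets (\<mu> True)) (%E. emeasure (\<mu> True) E + emeasure (\<mu> False) E)"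

lemma sum_measure:
  assumes "sets (\<mu> False) = sets (\<mu> True)"
  shows "sets (sum_measure \<mu>) = sets (\<mu> True)"
    and "E \<in> sets (\<mu> True) ==> emeasure (sum_measure \<mu>) E = emeasure (\<mu> True) E + emeasure (\<mu> False) E"
proof -
  show s: "sets (sum_measure \<mu>) = sets (\<mu> True)" by (simp add: sum_measure_def sets.space_closed sets.sigma_sets_eq)
  show "emeasure (sum_measure \<mu>) E = emeasure (\<mu> True) E + emeasure (\<mu> False) E" if "E \<in> sets (\<mu> True)"
  proof (rule emeasure_measure_of[OF sum_measure_def])
    show "countably_additive (sets (sum_measure \<mu>)) (%E. emeasure (\<mu> True) E + emeasure (\<mu> False) E)"
      unfolding countably_additive_def s
    proof (intro allI impI)
      fix A :: "nat => 'a set" assume A: "range A \<subseteq> sets (\<mu> True)" "disjoint_family A"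
      have "(\<Sum>i. emeasure (\<mu> True) (A i) + emeasure (\<mu> False) (A i)) = (\<Sum>i. emeasure (\<mu> True) (A i)) + (\<Sum>i. emeasure (\<mu> False) (A i))"
        by (rule suminf_add[symmetric]) auto
      also have "... = emeasure (\<mu> True) (\<Union>i. A i) + emeasure (\<mu> False) (\<Union>i. A i)"
        using A assms by (simp add: suminf_emeasure)
      finally show "(\<Sum>i. emeasure (\<mu> True) (A i) + emeasure (\<mu> False) (A i)) = emeasure (\<mu> True) (\<Union>i. A i) + emeasure (\<mu> False) (\<Union>i. A i)" .
    qed
  qed (use that sets.space_closed s in \<open>auto simp: positive_def\<close>)
qed

text \<open>The factor \<open>\<kappa>\<close> turns the pairing of the measures with
  \<open>W\<close> into one with the conormal derivative of the test function.\<close>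
lemma signed_measure_from_parts:
  fixes S :: "(real^'n::finite) set" and \<mu> :: "bool => (real^'n) measure"
  assumes S: "compact S" and M: "sets M = sets (restrict_space borel S)" "finite_measure M" and C: "0 <= C"
    and \<mu>: "!!b. sets (\<mu> b) = sets borel"
    and le: "!!b E. E \<in> sets M ==> emeasure (\<mu> b) E <= ennreal C * emeasure M E"
    and \<kappa>: "continuous_on S \<kappa>"
  obtains \<eta> s K where "bounded_signed_measure S \<eta>" "s \<in> borel_measurable M" "!!x. x \<in> S ==> \<bar>s x\<bar> <= K"
    "!!B. B \<in> sets M ==> \<eta> B = (LINT x:B|M. s x)"
    "!!f. continuous_on S f ==> signed_integral S \<eta> f =
       (LINT x|\<mu> True. indicator S x * (\<kappa> x * f x)) - (LINT x|\<mu> False. indicator S x * (\<kappa> x * f x))"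
proof -
  interpret finite_measure M by (rule M)
  have Sb: "S \<in> sets borel" using S by (rule borel_compact)
  have sp: "space M = S" using sets_eq_imp_space_eq[OF M(1)] by (simp add: space_restrict_space)
  define N where "N b = restrict_space (\<mu> b) S" for b
  have sN: "sets (N b) = sets M" for b unfolding N_def M(1) by (rule sets_restrict_space_cong) (rule \<mu>)
  have Nle: "emeasure (N b) E <= ennreal C * emeasure M E" if E: "E \<in> sets M" for b E
  proof -
    have "E \<subseteq> S" using E sets.sets_into_space[of E M] sp by simp
    then have "emeasure (N b) E = emeasure (\<mu> b) E" unfolding N_def using \<mu> Sb by (intro emeasure_restrict_space) auto
    then show ?thesis using le[OF E] by simp
  qed
  have "\<exists>f. f \<in> borel_measurable M \<and> (\<forall>x. 0 <= f x) \<and> (\<forall>x. f x <= C) \<and> N b = density M (%x. ennreal (f x))" for b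
    using bounded_density[OF M(2) sN C Nle] by metis
  then obtain F where F: "!!b. F b \<in> borel_measurable M" "!!b x. 0 <= F b x" "!!b x. F b x <= C" "!!b. N b = density M (%x. ennreal (F b x))"
    by metis
  note [measurable] = F(1)
  have cont_meas: "f \<in> borel_measurable M" if "continuous_on S f" for f :: "real^'n => real"
    using borel_measurable_continuous_on_restrict[OF that] by (simp add: measurable_cong_sets[OF M(1) refl])
  have cont_bd: "\<exists>K. \<forall>x\<in>S. \<bar>f x\<bar> <= K" if "continuous_on S f" for f :: "real^'n => real"
    using compact_imp_bounded[OF compact_continuous_image[OF that S]] by (auto simp: bounded_iff)
  have [measurable]: "\<kappa> \<in> borel_measurable M" by (rule cont_meas[OF \<kappa>])
  obtain K0 where K0: "\<forall>x\<in>S. \<bar>\<kappa> x\<bar> <= K0" using cont_bd[OF \<kappa>] by blast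
  define s where "s x = \<kappa> x * (F True x - F False x)" for x
  have [measurable]: "s \<in> borel_measurable M" unfolding s_def[abs_def] by measurable
  have sK: "\<bar>s x\<bar> <= \<bar>K0\<bar> * C" if "x \<in> S" for x
  proof -
    have "\<bar>F True x - F False x\<bar> <= C" using F(2,3)[of True x] F(2,3)[of False x] by linarith
    moreover have "\<bar>\<kappa> x\<bar> <= \<bar>K0\<bar>" using K0 that by fastforce
    ultimately show ?thesis unfolding s_def abs_mult by (intro mult_mono) auto
  qed
  have s_int: "integrable M s" by (rule integrable_const_bound[of _ "\<bar>K0\<bar> * C"]) (use sK sp in auto)
  define \<eta> where "\<eta> B = (LINT x:B|M. s x)" for B
  note sd = signed_density[OF M s_int, of \<eta>, OF \<eta>_def]
  have val: "signed_integral S \<eta> f = (LINT x|\<mu> True. indicator S x * (\<kappa> x * f x)) - (LINT x|\<mu> False. indicator S x * (\<kappa> x * f x))"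
    if f: "continuous_on S f" for f
  proof -
    have [measurable]: "f \<in> borel_measurable M" by (rule cont_meas[OF f])
    obtain Kf where Kf: "\<forall>x\<in>S. \<bar>f x\<bar> <= Kf" using cont_bd[OF f] by blast
    have bdd: "integrable M (%x. h x * f x)" if [measurable]: "h \<in> borel_measurable M" and h: "!!x. x \<in> S ==> \<bar>h x\<bar> <= L" for h L
    proof (rule integrable_const_bound[of _ "\<bar>L\<bar> * \<bar>Kf\<bar>"])
      show "AE x in M. norm (h x * f x) <= \<bar>L\<bar> * \<bar>Kf\<bar>"
      proof (rule AE_I2)
        fix x assume "x \<in> space M"
        then have x: "x \<in> S" using sp by simp
        have "\<bar>h x\<bar> <= \<bar>L\<bar>" "\<bar>f x\<bar> <= \<bar>Kf\<bar>" using h[OF x] Kf x by fastforce+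
        then show "norm (h x * f x) <= \<bar>L\<bar> * \<bar>Kf\<bar>" by (simp add: abs_mult mult_mono)
      qed
    qed measurable
    have i1: "integrable M (%x. max 0 (s x) * f x)" "integrable M (%x. max 0 (- s x) * f x)"
      by (rule bdd[of _ "\<bar>K0\<bar> * C"]; use sK in force)+
    have FC: "\<bar>F b x * \<kappa> x\<bar> <= C * \<bar>K0\<bar>" if "x \<in> S" for b x
    proof -
      have "\<bar>\<kappa> x\<bar> <= \<bar>K0\<bar>" using K0 that by fastforce
      then show ?thesis unfolding abs_mult using F(2,3)[of b x] by (intro mult_mono) auto
    qed
    have i2: "integrable M (%x. (F b x * \<kappa> x) * f x)" for b by (rule bdd[OF _ FC]) measurable
    have part: "(LINT x|\<mu> b. indicator S x * (\<kappa> x * f x)) = (LINT x|M. (F b x * \<kappa> x) * f x)" for b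
    proof -
      have "(LINT x|\<mu> b. indicator S x * (\<kappa> x * f x)) = (LINT x|N b. \<kappa> x * f x)"
        unfolding N_def using Sb \<mu> by (subst integral_restrict_space) auto
      also have "... = (LINT x|M. F b x *\<^sub>R (\<kappa> x * f x))"
        unfolding F(4) by (rule integral_density) (use F in auto)
      finally show ?thesis by (simp add: mult.assoc)
    qed
    have "signed_integral S \<eta> f = (LINT x|M. max 0 (s x) * f x) - (LINT x|M. max 0 (- s x) * f x)"
      by (rule sd(2)) measurable
    also have "... = (LINT x|M. max 0 (s x) * f x - max 0 (- s x) * f x)" using i1 by simp
    also have "... = (LINT x|M. (F True x * \<kappa> x) * f x - (F False x * \<kappa> x) * f x)"
    proof (rule Bochner_Integration.integral_cong[OF refl])
      fix x
      have "max 0 (s x) * f x - max 0 (- s x) * f x = s x * f x" by (simp add: max_def)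
      also have "... = (F True x * \<kappa> x) * f x - (F False x * \<kappa> x) * f x" by (simp add: s_def algebra_simps)
      finally show "max 0 (s x) * f x - max 0 (- s x) * f x = (F True x * \<kappa> x) * f x - (F False x * \<kappa> x) * f x" .
    qed
    also have "... = (LINT x|\<mu> True. indicator S x * (\<kappa> x * f x)) - (LINT x|\<mu> False. indicator S x * (\<kappa> x * f x))"
      unfolding part using i2[of True] i2[of False] by simp
    finally show ?thesis .
  qed
  show thesis by (rule that[of \<eta> s "\<bar>K0\<bar> * C"]) (use sd(1) sK val in \<open>auto simp: \<eta>_def\<close>)
qed

section \<open>The Dirichlet problem\<close>

lemma (in defining_function) grad_r_lower:
  obtains c s1 where "0 < c" "0 < s1" "!!x. x \<in> D ==> r x <= s1 ==> c <= grad r x \<bullet> grad r x"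
proof -
  obtain R c where R: "0 < R" "0 < c" "!!x0 x. x0 \<in> frontier D ==> x \<in> ball x0 R ==> c <= grad r x \<bullet> sgn (grad r x0)"
    using uniform_direction by blast
  obtain s where s: "0 < s" "!!x. x \<in> D ==> r x <= s ==> x \<in> (\<Union>x0\<in>frontier D. ball x0 R)"
    by (rule layer_in_neighbourhood[of "\<Union>x0\<in>frontier D. ball x0 R"]) (use R(1) in \<open>auto intro!: bexI\<close>)
  show thesis
  proof (rule that[of "c\<^sup>2" s])
    fix x assume x: "x \<in> D" "r x <= s"
    then obtain x0 where x0: "x0 \<in> frontier D" "x \<in> ball x0 R" using s(2) by blast
    have "grad r x \<bullet> sgn (grad r x0) <= norm (grad r x) * norm (sgn (grad r x0))" by (rule norm_cauchy_schwarz)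
    then have "c <= norm (grad r x)" using R(3)[OF x0] unit_sgn_grad_r[OF x0(1)] by simp
    then have "c\<^sup>2 <= (norm (grad r x))\<^sup>2" using R(2) by (intro power_mono) auto
    then show "c\<^sup>2 <= grad r x \<bullet> grad r x" by (simp add: power2_norm_eq_inner)
  qed (use R s in auto)
qed

text \<open>For bounded functions the mass of a layer is controlled by its volume.\<close>
lemma (in boundary_trace) bounded_layer_mass:
  assumes P: "integrable lborel P" "!!x. 0 <= P x" "!!x. P x <= M"
  obtains M' s0 where "0 < s0" "!!s. 0 < s ==> s <= s0 ==> (LBINT x. indicator (layer s) x * P x) <= M' * s"
proof -
  obtain Cv sv where V: "0 <= Cv" "0 < sv" "!!s. 0 < s ==> s <= sv ==> measure lborel {x \<in> D. r x <= s} <= Cv * s"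
    using total_layer_volume by blast
  have M: "0 <= M" using P(2,3)[of undefined] by linarith
  show thesis
  proof (rule that[of "sv / 2" "M * (Cv * 2)"])
    fix s assume s: "0 < s" "s <= sv / 2"
    define U where "U = {x \<in> D. r x <= 2 * s}"
    have Uf: "U \<in> fmeasurable lborel"
    proof -
      obtain R where "D \<subseteq> ball 0 R" using bounded_subset_ballD[OF D(2)] by blast
      moreover have "U \<in> sets borel" unfolding U_def by measurable
      ultimately show ?thesis by (intro fmeasurableI2[OF ball_fmeasurable[of 0 R]]) (auto simp: U_def)
    qed
    have iU: "integrable lborel (%x. indicat_real U x)" using Uf by (simp add: fmeasurable_def)
    have "(LBINT x. indicator (layer s) x * P x) <= (LBINT x. M * indicator U x)"
    proof (rule integral_mono)
      show "integrable lborel (%x. indicator (layer s) x * P x)"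
        using integrable_mult_indicator[OF _ P(1), of "layer s"] by simp
      show "indicator (layer s) x * P x <= M * indicator U x" for x
        using layer_subset[OF s(1)] P(2,3)[of x] M by (auto simp: indicator_def U_def layer_def)
    qed (use iU in simp)
    also have "... = M * measure lborel U" using Uf by simp
    also have "... <= M * (Cv * (2 * s))" using V(3)[of "2 * s"] s M by (intro mult_left_mono) (auto simp: U_def)
    finally show "(LBINT x. indicator (layer s) x * P x) <= M * (Cv * 2) * s" by simp
  qed (use V in simp)
qed

lemma trace_mult_eq: "trace (A ** H) = (\<Sum>i\<in>UNIV. \<Sum>j\<in>UNIV. A $ j $ i * H $ i $ j)" for A H :: "real^'n::finite^'n"
proof -
  have "trace (A ** H) = (\<Sum>i\<in>UNIV. \<Sum>k\<in>UNIV. A $ i $ k * H $ k $ i)"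
    by (simp add: trace_def matrix_matrix_mult_def)
  also have "... = (\<Sum>k\<in>UNIV. \<Sum>i\<in>UNIV. A $ i $ k * H $ k $ i)" by (rule sum.swap)
  finally show ?thesis .
qed

lemma matrix_form_eq: "(A *v \<xi>) \<bullet> \<xi> = (\<Sum>i\<in>UNIV. \<Sum>j\<in>UNIV. A $ j $ i * \<xi> $ i * \<xi> $ j)" for A :: "real^'n::finite^'n"
proof -
  have "(A *v \<xi>) \<bullet> \<xi> = (\<Sum>j\<in>UNIV. \<Sum>i\<in>UNIV. A $ j $ i * \<xi> $ i * \<xi> $ j)"
    by (simp add: inner_vec_def matrix_vector_mult_def sum_distrib_right)
  also have "... = (\<Sum>i\<in>UNIV. \<Sum>j\<in>UNIV. A $ j $ i * \<xi> $ i * \<xi> $ j)" by (rule sum.swap)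
  finally show ?thesis .
qed

text \<open>The indices of \<open>M\<close> are transposed in the formula, as in the trace of a
  product.\<close>
lemma diff_op_integral:
  fixes M :: "real^'n::finite => real^'n^'n" and v :: "real^'n => real^'n"
  assumes S: "S \<in> sets borel" "D \<subseteq> S" and D: "D \<in> sets borel"
    and M [measurable]: "!!i j. (%x. indicator D x * M x $ i $ j) \<in> borel_measurable borel"
    and v [measurable]: "!!i. (%x. indicator D x * v x $ i) \<in> borel_measurable borel"
    and [measurable]: "k' \<in> borel_measurable borel" "!!i j. H' i j \<in> borel_measurable borel" "!!i. g' i \<in> borel_measurable borel"
    and k: "AE x in lborel. x \<in> D --> k x = k' x"
    and H: "AE x in lborel. x \<in> D --> (\<forall>i j. H x $ i $ j = H' i j x)"
    and g: "!!i x. x \<in> D ==> g x $ i = g' i x"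
    and off: "!!x. x \<in> S - D ==> g x = 0 \<and> H x = 0"
  shows "(LINT x|lebesgue_on S. diff_op M v g H x * k x) =
    (LBINT x. (\<Sum>i\<in>UNIV. \<Sum>j\<in>UNIV. indicator D x * M x $ j $ i * k' x * H' i j x) + (\<Sum>i\<in>UNIV. indicator D x * v x $ i * k' x * g' i x))"
proof (rule lebesgue_on_transfer(3))
  show "S \<in> sets lebesgue" using S by simp
  show "(%x. (\<Sum>i\<in>UNIV. \<Sum>j\<in>UNIV. indicator D x * M x $ j $ i * k' x * H' i j x) + (\<Sum>i\<in>UNIV. indicator D x * v x $ i * k' x * g' i x))
    \<in> borel_measurable borel" by measurable
  show "(\<Sum>i\<in>UNIV. \<Sum>j\<in>UNIV. indicator D x * M x $ j $ i * k' x * H' i j x) + (\<Sum>i\<in>UNIV. indicator D x * v x $ i * k' x * g' i x) = 0"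
    if "x \<notin> S" for x using that S(2) by (auto simp: indicator_def)
  show "AE x in lborel. x \<in> S --> diff_op M v g H x * k x =
    (\<Sum>i\<in>UNIV. \<Sum>j\<in>UNIV. indicator D x * M x $ j $ i * k' x * H' i j x) + (\<Sum>i\<in>UNIV. indicator D x * v x $ i * k' x * g' i x)"
    using k H
  proof eventually_elim
    case (elim x)
    have expand: "diff_op M v g H x = (\<Sum>i\<in>UNIV. \<Sum>j\<in>UNIV. M x $ j $ i * H x $ i $ j) + (\<Sum>i\<in>UNIV. v x $ i * g x $ i)"
      by (simp add: diff_op_def trace_mult_eq inner_vec_def)
    show ?case
    proof (cases "x \<in> D")
      case True
      have "diff_op M v g H x * k x = (\<Sum>i\<in>UNIV. \<Sum>j\<in>UNIV. M x $ j $ i * H' i j x) * k' x + (\<Sum>i\<in>UNIV. v x $ i * g' i x) * k' x"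
        unfolding expand using True elim g by (simp add: distrib_right)
      then show ?thesis using True by (simp add: sum_distrib_right sum_distrib_left mult_ac)
    next
      case False
      then show ?thesis using off[of x] by (simp add: expand)
    qed
  qed
qed

text \<open>\<open>\<rho>'\<close> is a Borel representative of \<open>\<rho>\<close> on
  \<open>D\<close>, extended by 0, on which pointwise bounds can be imposed.\<close>
locale equation_setting =
  fixes \<Omega> D :: "(real^'n::finite) set"
    and A G :: "real^'n => real^'n^'n"
    and b h :: "real^'n => real^'n"
    and \<rho> \<rho>' :: "real^'n => real"
    and p :: real
  assumes fields: "borel_symmetric_matrix_field \<Omega> A" "borel_symmetric_matrix_field \<Omega> G"
      "borel_vector_field \<Omega> b" "borel_vector_field \<Omega> h"
    and H1: "cond_H1 \<Omega> A" and H2: "cond_H2 \<Omega> A" and H3: "cond_H3 p \<Omega> b G h"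
    and G_cont: "\<forall>i j. continuous_on \<Omega> (%x. G x $ i $ j)"
    and rho_Lp: "Lp_loc (conj_exp p) \<Omega> \<rho>"
    and Omega: "open \<Omega>" and solution: "solves_equation \<Omega> A b G h \<rho>"
    and domain: "open D" "bounded D" "C2_boundary D" "closure D \<subseteq> \<Omega>"
    and rho' [measurable]: "\<rho>' \<in> borel_measurable borel"
    and rho'_0: "!!x. x \<notin> D ==> \<rho>' x = 0"
    and rho'_eq: "AE x in lborel. x \<in> D --> \<rho> x = \<rho>' x"
begin

lemma p1: "1 < p"
proof -
  have "0 < CARD('n)" by simp
  then have "1 <= real CARD('n)" by linarith
  moreover have "real CARD('n) < p" using H3 by (simp only: cond_H3_def)
  ultimately show ?thesis by linarith
qed

sublocale conjugate_exponents p "conj_exp p"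
  by unfold_locales (use p1 in \<open>auto simp: conj_exp_def field_simps\<close>)

sublocale dual: conjugate_exponents "conj_exp p" p
  by unfold_locales (use p q pq in auto)

lemma D_subset: "D \<subseteq> \<Omega>" using domain(4) closure_subset by blast

lemma D_borel [measurable]: "D \<in> sets borel" using domain(1) by simp

lemma compact_closure_D: "compact (closure D)" using domain(2) by simp

lemma on_D_measurable:
  fixes f :: "real^'n => real"
  assumes "f \<in> borel_measurable (restrict_space borel \<Omega>)"
  shows "(%x. indicator D x * f x) \<in> borel_measurable borel"
proof -
  have "f \<in> borel_measurable (restrict_space borel D)" by (rule measurable_restrict_mono[OF assms D_subset])
  then have "(%x. indicator D x *\<^sub>R f x) \<in> borel_measurable borel"
    by (subst (asm) borel_measurable_restrict_space_iff) auto
  then show ?thesis by simp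
qed

lemma field_measurable [measurable]:
  "(%x. indicator D x * A x $ i $ j) \<in> borel_measurable borel"
  "(%x. indicator D x * G x $ i $ j) \<in> borel_measurable borel"
  "(%x. indicator D x * b x $ i) \<in> borel_measurable borel"
  "(%x. indicator D x * h x $ i) \<in> borel_measurable borel"
  using fields by (auto intro!: on_D_measurable simp: borel_symmetric_matrix_field_def borel_vector_field_def)

lemma A_cont: "continuous_on \<Omega> (%x. A x $ i $ j)" using H1 by (simp add: cond_H1_def)

lemma entry_bound:
  fixes M :: "real^'n => real^'n^'n"
  assumes "!!i j. continuous_on \<Omega> (%x. M x $ i $ j)"
  obtains K where "0 < K" "!!i j x. \<bar>indicator D x * M x $ i $ j\<bar> <= K"
proof -
  have "\<exists>K. \<forall>x\<in>closure D. \<bar>M x $ i $ j\<bar> <= K" for i j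
  proof -
    have "bounded ((%x. M x $ i $ j) ` closure D)"
      by (intro compact_imp_bounded compact_continuous_image compact_closure_D continuous_on_subset[OF assms domain(4)])
    then obtain K where "\<forall>y\<in>(%x. M x $ i $ j) ` closure D. norm y <= K" unfolding bounded_iff by (elim exE)
    then show ?thesis by auto
  qed
  then obtain K where K: "!!i j x. x \<in> closure D ==> \<bar>M x $ i $ j\<bar> <= K i j" by metis
  define L where "L = (\<Sum>i\<in>UNIV. \<Sum>j\<in>UNIV. \<bar>K i j\<bar>) + 1"
  have L: "\<bar>K i j\<bar> <= L" for i j
  proof -
    have "\<bar>K i j\<bar> <= (\<Sum>j\<in>UNIV. \<bar>K i j\<bar>)" by (rule member_le_sum) auto
    also have "... <= (\<Sum>i\<in>UNIV. \<Sum>j\<in>UNIV. \<bar>K i j\<bar>)" by (rule member_le_sum[where f = "%i. \<Sum>j\<in>UNIV. \<bar>K i j\<bar>"]) (auto intro: sum_nonneg)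
    finally show ?thesis by (simp add: L_def)
  qed
  have L0: "0 < L" by (simp add: L_def add_nonneg_pos sum_nonneg)
  show thesis
  proof (rule that[OF L0])
    fix i j x
    show "\<bar>indicator D x * M x $ i $ j\<bar> <= L"
    proof (cases "x \<in> D")
      case True
      then have "\<bar>M x $ i $ j\<bar> <= K i j" using K closure_subset by blast
      then show ?thesis using L[of i j] True by simp
    qed (use L0 in simp)
  qed
qed

lemma integrable_on_D:
  assumes f: "Lp_loc 1 \<Omega> f" and f': "f' \<in> borel_measurable borel" "!!x. x \<notin> D ==> f' x = 0"
    and ae: "AE x in lborel. x \<in> D --> f x = f' x"
  shows "integrable lborel f'"
proof -
  have "integrable (lebesgue_on (closure D)) (%x. \<bar>f x\<bar>)"
    using Lp_loc_compact(2)[OF f compact_closure_D domain(4)] by simp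
  then have "integrable (lebesgue_on (closure D)) f"
    using Lp_loc_compact(1)[OF f compact_closure_D domain(4)] by (rule integrable_abs_cancel)
  then have "integrable (lebesgue_on D) f" by (rule lebesgue_on_mono_integrable) (use closure_subset in auto)
  then show ?thesis using lebesgue_on_transfer(2)[OF _ f' ae] by simp
qed

lemma Lp_on_D:
  assumes f: "Lp_loc s \<Omega> f"
  shows "Lp_on s D f"
proof -
  have "integrable (lebesgue_on D) (%x. \<bar>f x\<bar> powr s)"
    by (rule lebesgue_on_mono_integrable[OF Lp_loc_compact(2)[OF f compact_closure_D domain(4)]]) (use closure_subset in auto)
  moreover have "f \<in> borel_measurable (lebesgue_on D)"
    by (rule borel_measurable_lebesgue_on_subset[OF f[unfolded Lp_loc_def, THEN conjunct1] D_subset])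
  ultimately show ?thesis by (simp add: Lp_on_def)
qed

lemma Lp_on_transfer:
  assumes f: "Lp_on s D f" and f': "f' \<in> borel_measurable borel" "!!x. x \<notin> D ==> f' x = 0"
    and ae: "AE x in lborel. x \<in> D --> f x = f' x"
  shows "integrable lborel (%x. \<bar>f' x\<bar> powr s)"
proof -
  have "integrable (lebesgue_on D) (%x. \<bar>f x\<bar> powr s) \<longleftrightarrow> integrable lborel (%x. \<bar>f' x\<bar> powr s)"
  proof (rule lebesgue_on_transfer(2))
    show "AE x in lborel. x \<in> D --> \<bar>f x\<bar> powr s = \<bar>f' x\<bar> powr s" using ae by eventually_elim simp
  qed (use f' in auto)
  then show ?thesis using f by (simp add: Lp_on_def)
qed

lemma rho'_Lq: "integrable lborel (%x. \<bar>\<rho>' x\<bar> powr conj_exp p)"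
  by (rule Lp_on_transfer[OF Lp_on_D[OF rho_Lp] rho' rho'_0 rho'_eq])

definition A\<rho> :: "'n => 'n => real^'n => real" where "A\<rho> i j x = indicator D x * A x $ j $ i * \<rho>' x"
definition G1 :: "'n => 'n => real^'n => real" where "G1 i j x = indicator D x * G x $ j $ i"
definition b\<rho> :: "'n => real^'n => real" where "b\<rho> i x = indicator D x * b x $ i * \<rho>' x"
definition h1 :: "'n => real^'n => real" where "h1 i x = indicator D x * h x $ i"
definition Q :: "'n => 'n => real^'n => real" where "Q i j x = A\<rho> i j x - G1 i j x"
definition B :: "'n => real^'n => real" where "B i x = b\<rho> i x - h1 i x"

lemma coefficients_measurable [measurable]:
  "A\<rho> i j \<in> borel_measurable borel" "G1 i j \<in> borel_measurable borel"
  "b\<rho> i \<in> borel_measurable borel" "h1 i \<in> borel_measurable borel"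
  unfolding A\<rho>_def[abs_def] G1_def[abs_def] b\<rho>_def[abs_def] h1_def[abs_def] by measurable

lemma A\<rho>_Lq: "integrable lborel (%x. \<bar>A\<rho> i j x\<bar> powr conj_exp p)"
proof -
  obtain K where K: "0 < K" "!!i j x. \<bar>indicator D x * A x $ i $ j\<bar> <= K" using entry_bound[OF A_cont] by blast
  show ?thesis
  proof (rule Bochner_Integration.integrable_bound)
    show "integrable lborel (%x. K powr conj_exp p * \<bar>\<rho>' x\<bar> powr conj_exp p)" using rho'_Lq by simp
    have "\<bar>A\<rho> i j x\<bar> powr conj_exp p <= K powr conj_exp p * \<bar>\<rho>' x\<bar> powr conj_exp p" for x
    proof -
      have "\<bar>A\<rho> i j x\<bar> <= K * \<bar>\<rho>' x\<bar>" unfolding A\<rho>_def abs_mult[of _ "\<rho>' x"] by (intro mult_right_mono K) simp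
      then have "\<bar>A\<rho> i j x\<bar> powr conj_exp p <= (K * \<bar>\<rho>' x\<bar>) powr conj_exp p" using q by (intro powr_mono2) auto
      then show ?thesis using K by (simp add: powr_mult)
    qed
    then show "AE x in lborel. norm (\<bar>A\<rho> i j x\<bar> powr conj_exp p) <= norm (K powr conj_exp p * \<bar>\<rho>' x\<bar> powr conj_exp p)"
      by (intro AE_I2) simp
  qed measurable
qed

lemma G1_Lq: "integrable lborel (%x. \<bar>G1 i j x\<bar> powr conj_exp p)"
proof (rule Lp_on_transfer)
  show "Lp_on (conj_exp p) D (%x. G x $ j $ i)" using H3 by (intro Lp_on_D) (simp add: cond_H3_def)
qed (auto simp: G1_def)

lemma lower_order_integrable:
  shows "integrable lborel (b\<rho> i)" and "integrable lborel (h1 i)"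
proof -
  show "integrable lborel (b\<rho> i)"
  proof (rule integrable_on_D)
    show "Lp_loc 1 \<Omega> (%x. b x $ i * \<rho> x)" using solution by (simp add: solves_equation_def)
    show "AE x in lborel. x \<in> D --> b x $ i * \<rho> x = b\<rho> i x" using rho'_eq by eventually_elim (simp add: b\<rho>_def)
  qed (auto simp: b\<rho>_def)
  show "integrable lborel (h1 i)"
  proof (rule integrable_on_D)
    show "Lp_loc 1 \<Omega> (%x. h x $ i)" using solution by (simp add: solves_equation_def)
  qed (auto simp: h1_def)
qed

lemma operator_difference:
  assumes S: "S \<in> sets borel" "D \<subseteq> S"
    and [measurable]: "!!i j. H' i j \<in> borel_measurable borel" "!!i. g' i \<in> borel_measurable borel"
    and H: "AE x in lborel. x \<in> D --> (\<forall>i j. H x $ i $ j = H' i j x)"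
    and g: "!!i x. x \<in> D ==> g x $ i = g' i x"
    and off: "!!x. x \<in> S - D ==> g x = 0 \<and> H x = 0"
    and int: "!!i j. integrable lborel (%x. A\<rho> i j x * H' i j x)" "!!i j. integrable lborel (%x. G1 i j x * H' i j x)"
      "!!i. integrable lborel (%x. b\<rho> i x * g' i x)" "!!i. integrable lborel (%x. h1 i x * g' i x)"
  shows "(LINT x|lebesgue_on S. diff_op A b g H x * \<rho> x) - (LINT x|lebesgue_on S. diff_op G h g H x) =
      (\<Sum>i\<in>UNIV. \<Sum>j\<in>UNIV. LBINT x. Q i j x * H' i j x) + (\<Sum>i\<in>UNIV. LBINT x. B i x * g' i x)"
    and "(LBINT x. (\<Sum>i\<in>UNIV. \<Sum>j\<in>UNIV. Q i j x * H' i j x) + (\<Sum>i\<in>UNIV. B i x * g' i x)) =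
      (\<Sum>i\<in>UNIV. \<Sum>j\<in>UNIV. LBINT x. Q i j x * H' i j x) + (\<Sum>i\<in>UNIV. LBINT x. B i x * g' i x)"
proof -
  have 1: "(LINT x|lebesgue_on S. diff_op A b g H x * \<rho> x) =
      (LBINT x. (\<Sum>i\<in>UNIV. \<Sum>j\<in>UNIV. A\<rho> i j x * H' i j x) + (\<Sum>i\<in>UNIV. b\<rho> i x * g' i x))"
    unfolding A\<rho>_def b\<rho>_def
    by (rule diff_op_integral[OF S D_borel _ _ rho' _ _ rho'_eq H g off]) measurable
  have "(LINT x|lebesgue_on S. diff_op G h g H x * 1) =
      (LBINT x. (\<Sum>i\<in>UNIV. \<Sum>j\<in>UNIV. indicator D x * G x $ j $ i * 1 * H' i j x) + (\<Sum>i\<in>UNIV. indicator D x * h x $ i * 1 * g' i x))"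
    by (rule diff_op_integral[OF S D_borel _ _ _ _ _ _ H g off, where k' = "%_. 1"]) simp_all
  then have 2: "(LINT x|lebesgue_on S. diff_op G h g H x) =
      (LBINT x. (\<Sum>i\<in>UNIV. \<Sum>j\<in>UNIV. G1 i j x * H' i j x) + (\<Sum>i\<in>UNIV. h1 i x * g' i x))"
    by (simp add: G1_def h1_def)
  have iQ: "integrable lborel (%x. Q i j x * H' i j x)" "integrable lborel (%x. B i x * g' i x)" for i j
    unfolding Q_def B_def left_diff_distrib by (intro Bochner_Integration.integrable_diff int)+
  show "(LBINT x. (\<Sum>i\<in>UNIV. \<Sum>j\<in>UNIV. Q i j x * H' i j x) + (\<Sum>i\<in>UNIV. B i x * g' i x)) =
      (\<Sum>i\<in>UNIV. \<Sum>j\<in>UNIV. LBINT x. Q i j x * H' i j x) + (\<Sum>i\<in>UNIV. LBINT x. B i x * g' i x)"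
    using iQ by (simp add: Bochner_Integration.integral_add Bochner_Integration.integral_sum Bochner_Integration.integrable_sum)
  have d: "(LBINT x. Q i j x * H' i j x) = (LBINT x. A\<rho> i j x * H' i j x) - (LBINT x. G1 i j x * H' i j x)"
    "(LBINT x. B i x * g' i x) = (LBINT x. b\<rho> i x * g' i x) - (LBINT x. h1 i x * g' i x)" for i j
    unfolding Q_def B_def left_diff_distrib by (intro Bochner_Integration.integral_diff int)+
  show "(LINT x|lebesgue_on S. diff_op A b g H x * \<rho> x) - (LINT x|lebesgue_on S. diff_op G h g H x) =
      (\<Sum>i\<in>UNIV. \<Sum>j\<in>UNIV. LBINT x. Q i j x * H' i j x) + (\<Sum>i\<in>UNIV. LBINT x. B i x * g' i x)"
    unfolding 1 2 d using int
    by (simp add: Bochner_Integration.integral_add Bochner_Integration.integral_sum Bochner_Integration.integrable_sum sum_subtractf)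
qed

lemma double_divergence: "double_divergence p (conj_exp p) D Q B"
proof unfold_locales
  show "integrable lborel (%x. \<bar>Q i j x\<bar> powr conj_exp p)" for i j
  proof -
    have "integrable lborel (%x. \<bar>A\<rho> i j x + - G1 i j x\<bar> powr conj_exp p)"
      by (rule dual.Lp_add) (use A\<rho>_Lq G1_Lq in auto)
    then show ?thesis by (simp add: Q_def)
  qed
  show "integrable lborel (B i)" for i
    unfolding B_def[abs_def] by (intro Bochner_Integration.integrable_diff lower_order_integrable)
  fix \<phi> assume phi: "\<phi> \<in> C0_infty D"
  obtain K where Ck: "!!k. Ck k \<phi>" and K: "compact K" "K \<subseteq> D" "!!x. x \<notin> K ==> \<phi> x = 0"
    by (rule C0_inftyD[OF phi]) (rule that)
  note c = Ck_2_partials[OF Ck[of 2]]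
  have off1: "pd i \<phi> x = 0" if "x \<notin> K" for i x by (rule partial_deriv_outside[OF K(1) K(3) that])
  have off2: "pd i (pd j \<phi>) x = 0" if "x \<notin> K" for i j x
    by (rule partial_deriv_outside[OF K(1) off1 that])
  obtain M1 where M1: "!!i x. \<bar>pd i \<phi> x\<bar> <= M1 i"
  proof -
    have "\<exists>M. \<forall>x. \<bar>pd i \<phi> x\<bar> <= M" for i
    proof (rule continuous_compact_support_bounded[OF c(4) K(1)])
      show "pd i \<phi> x = 0" if "x \<notin> K" for x by (rule off1[OF that])
    qed blast
    then show thesis using that by metis
  qed
  obtain M2 where M2: "!!i j x. \<bar>pd i (pd j \<phi>) x\<bar> <= M2 i j"
  proof -
    have "\<exists>M. \<forall>x. \<bar>pd i (pd j \<phi>) x\<bar> <= M" for i j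
    proof (rule continuous_compact_support_bounded[OF c(5) K(1)])
      show "pd i (pd j \<phi>) x = 0" if "x \<notin> K" for x by (rule off2[OF that])
    qed blast
    then show thesis using that by metis
  qed
  have m [measurable]: "pd i \<phi> \<in> borel_measurable borel" "pd i (pd j \<phi>) \<in> borel_measurable borel" for i j
    by (rule borel_measurable_continuous_onI[OF c(4)], rule borel_measurable_continuous_onI[OF c(5)])
  have iA: "integrable lborel (A\<rho> i j)" "integrable lborel (G1 i j)" for i j
  proof -
    have out: "x \<notin> D" if "x \<notin> closure D" for x using that closure_subset by blast
    show "integrable lborel (A\<rho> i j)"
      by (rule dual.Lp_compact_support_integrable[OF coefficients_measurable(1) A\<rho>_Lq compact_closure_D]) (simp add: A\<rho>_def out)
    show "integrable lborel (G1 i j)"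
      by (rule dual.Lp_compact_support_integrable[OF coefficients_measurable(2) G1_Lq compact_closure_D]) (simp add: G1_def out)
  qed
  have "\<phi> \<in> C0_infty \<Omega>" using phi D_subset by (auto simp: C0_infty_def)
  then have "(LINT x|lebesgue_on \<Omega>. diff_op A b (grad \<phi>) (hess \<phi>) x * \<rho> x) - (LINT x|lebesgue_on \<Omega>. diff_op G h (grad \<phi>) (hess \<phi>) x) = 0"
    using solution by (simp add: solves_equation_def)
  moreover note operator_difference[of \<Omega> "%i j. pd i (pd j \<phi>)" "%i. pd i \<phi>" "hess \<phi>" "grad \<phi>"]
  moreover have "grad \<phi> x = 0 \<and> hess \<phi> x = 0" if "x \<in> \<Omega> - D" for x
    using that K(2) off1[of x] off2[of x] by (auto simp: grad_def hess_def vec_eq_iff)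
  moreover have "integrable lborel (%x. A\<rho> i j x * pd i (pd j \<phi>) x)"
     "integrable lborel (%x. G1 i j x * pd i (pd j \<phi>) x)"
     "integrable lborel (%x. b\<rho> i x * pd i \<phi> x)" "integrable lborel (%x. h1 i x * pd i \<phi> x)" for i j
    by (rule integrable_mult_bounded[OF iA(1) _ M2] integrable_mult_bounded[OF iA(2) _ M2]
        integrable_mult_bounded[OF lower_order_integrable(1) _ M1] integrable_mult_bounded[OF lower_order_integrable(2) _ M1]; simp)+
  ultimately show "(LBINT x. (\<Sum>i\<in>UNIV. \<Sum>j\<in>UNIV. Q i j x * pd i (pd j \<phi>) x)
         + (\<Sum>i\<in>UNIV. B i x * pd i \<phi> x)) = 0"
    using Omega D_subset by (simp add: grad_def hess_def)
qed (use domain in \<open>auto simp: Q_def[abs_def] B_def[abs_def] A\<rho>_def G1_def b\<rho>_def h1_def\<close>)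

end

context equation_setting
begin

lemma boundary_trace:
  assumes "defining_function D r"
  shows "boundary_trace p (conj_exp p) D Q B r"
proof -
  interpret double_divergence p "conj_exp p" D Q B by (rule double_divergence)
  interpret defining_function D r by (rule assms)
  show ?thesis by unfold_locales
qed

lemma bounded_Q:
  assumes "!!x. \<bar>\<rho>' x\<bar> <= M"
  obtains K where "!!i j x. \<bar>Q i j x\<bar> <= K"
proof -
  obtain KA where KA: "0 < KA" "!!i j x. \<bar>indicator D x * A x $ i $ j\<bar> <= KA" using entry_bound[OF A_cont] by blast
  obtain KG where KG: "0 < KG" "!!i j x. \<bar>indicator D x * G x $ i $ j\<bar> <= KG"
    using entry_bound[OF G_cont[rule_format]] by blast
  have "\<bar>Q i j x\<bar> <= KA * M + KG" for i j x
  proof -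
    have "\<bar>A\<rho> i j x\<bar> <= KA * M" unfolding A\<rho>_def abs_mult[of _ "\<rho>' x"] using KA assms by (intro mult_mono) (auto intro: less_imp_le)
    then show ?thesis using KG(2)[of x j i] abs_triangle_ineq4[of "A\<rho> i j x" "G1 i j x"] unfolding Q_def G1_def by linarith
  qed
  then show thesis by (rule that)
qed

text \<open>By ellipticity \<open>Qn\<close> is at least a positive multiple of
  \<open>\<rho>'\<close> minus a constant near the boundary; the constant bounds the contribution
  of \<open>G\<close>, which is continuous on the closure of \<open>D\<close>. Thus
  \<open>layer_bound\<close> controls \<open>\<rho>'\<close>, and \<open>Qabs\<close> is bounded
  by \<open>\<rho>'\<close> and a constant.\<close>
lemma layer_mass_nonneg:
  assumes r: "defining_function D r" and nonneg: "!!x. 0 <= \<rho>' x"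
  shows "\<exists>M0 s0. boundary_trace_data p (conj_exp p) D Q B r M0 s0"
proof -
  interpret boundary_trace p "conj_exp p" D Q B r by (rule boundary_trace[OF r])
  obtain KA where KA: "0 < KA" "!!i j x. \<bar>indicator D x * A x $ i $ j\<bar> <= KA" using entry_bound[OF A_cont] by blast
  obtain KG where KG: "0 < KG" "!!i j x. \<bar>indicator D x * G x $ i $ j\<bar> <= KG"
    using entry_bound[OF G_cont[rule_format]] by blast
  obtain \<theta> where \<theta>: "0 < \<theta>" "!!x \<xi>. x \<in> \<Omega> ==> \<theta> * (\<xi> \<bullet> \<xi>) <= (A x *v \<xi>) \<bullet> \<xi>"
    using H2 unfolding cond_H2_def by blast
  obtain c s1 where c: "0 < c" "0 < s1" "!!x. x \<in> D ==> r x <= s1 ==> c <= grad r x \<bullet> grad r x"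
    using grad_r_lower by blast
  obtain Rm where Rm: "0 < Rm" "!!i x. x \<in> closure D ==> \<bar>pd i r x\<bar> <= Rm"
    using closure_bound_family[of "%i. pd i r"] r_partials(4) by blast
  define N where "N = real CARD('n) * (real CARD('n) * 1)"
  have N: "(\<Sum>i\<in>(UNIV::'n set). \<Sum>j\<in>(UNIV::'n set). t) = N * t" for t by (simp add: N_def)
  have N0: "0 <= N" by (simp add: N_def)
  define M where "M = N * (KG * Rm * Rm)"
  have M0: "0 <= M" using N0 KG Rm by (simp add: M_def)
  have low: "\<theta> * c * \<rho>' x - M <= Qn x" if x: "x \<in> D" "r x <= s1" for x
  proof -
    have xc: "x \<in> closure D" and xO: "x \<in> \<Omega>" using x(1) closure_subset D_subset by blast+
    have "\<theta> * c <= \<theta> * (grad r x \<bullet> grad r x)" using \<theta>(1) c(3)[OF x] by simp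
    also have "... <= (A x *v grad r x) \<bullet> grad r x" by (rule \<theta>(2)[OF xO])
    finally have "\<theta> * c * \<rho>' x <= ((A x *v grad r x) \<bullet> grad r x) * \<rho>' x" using nonneg by (rule mult_right_mono)
    also have "... = (\<Sum>i\<in>UNIV. \<Sum>j\<in>UNIV. A\<rho> i j x * pd i r x * pd j r x)"
      unfolding matrix_form_eq using x(1) by (simp add: A\<rho>_def grad_def sum_distrib_right sum_distrib_left mult_ac)
    also have "... = Qn x + (\<Sum>i\<in>UNIV. \<Sum>j\<in>UNIV. G1 i j x * pd i r x * pd j r x)"
      by (simp add: Qn_def Q_def left_diff_distrib sum_subtractf)
    also have "(\<Sum>i\<in>UNIV. \<Sum>j\<in>UNIV. G1 i j x * pd i r x * pd j r x) <= (\<Sum>i\<in>(UNIV::'n set). \<Sum>j\<in>(UNIV::'n set). KG * Rm * Rm)"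
    proof (intro sum_mono)
      fix i j
      have "G1 i j x * pd i r x * pd j r x <= \<bar>G1 i j x\<bar> * \<bar>pd i r x\<bar> * \<bar>pd j r x\<bar>"
        by (metis abs_ge_self abs_mult)
      also have "... <= KG * Rm * Rm"
        using KG Rm(1) Rm(2)[OF xc] by (intro mult_mono) (auto simp: G1_def intro: mult_nonneg_nonneg less_imp_le)
      finally show "G1 i j x * pd i r x * pd j r x <= KG * Rm * Rm" .
    qed
    finally show ?thesis unfolding N M_def by linarith
  qed
  have i\<rho>: "integrable lborel \<rho>'"
    by (rule dual.Lp_compact_support_integrable[OF rho' rho'_Lq compact_closure_D]) (use rho'_0 closure_subset in blast)
  obtain M1 sa where M1: "0 < sa" "!!s. 0 < s ==> s <= sa ==> (LBINT x. indicator (layer s) x * \<rho>' x) <= M1 * s"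
    by (rule layer_bound[OF _ c(2) M0 i\<rho> nonneg low]) (use \<theta> c in auto)
  have iD: "integrable lborel (%x::real^'n. indicat_real D x)"
  proof -
    obtain R where "D \<subseteq> ball 0 R" using bounded_subset_ballD[OF domain(2)] by blast
    then have "D \<in> fmeasurable lborel" by (intro fmeasurableI2[OF ball_fmeasurable[of 0 R]]) auto
    then show ?thesis by (simp add: fmeasurable_def)
  qed
  obtain M2 sb where M2: "0 < sb" "!!s. 0 < s ==> s <= sb ==> (LBINT x. indicator (layer s) x * indicat_real D x) <= M2 * s"
    by (rule bounded_layer_mass[OF iD, of 1]) (auto simp: indicator_def)
  have Qle: "Qabs x <= N * KA * \<rho>' x + N * KG * indicat_real D x" for x
  proof -
    have "\<bar>Q i j x\<bar> <= KA * \<rho>' x + KG * indicat_real D x" for i j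
    proof (cases "x \<in> D")
      case True
      have "\<bar>A\<rho> i j x\<bar> <= KA * \<rho>' x"
        unfolding A\<rho>_def abs_mult[of _ "\<rho>' x"] abs_of_nonneg[OF nonneg] by (intro mult_right_mono KA nonneg)
      then show ?thesis using KG(2)[of x j i] abs_triangle_ineq4[of "A\<rho> i j x" "G1 i j x"] True by (simp add: Q_def G1_def)
    qed (simp add: Q_0 rho'_0)
    then have "Qabs x <= (\<Sum>i\<in>(UNIV::'n set). \<Sum>j\<in>(UNIV::'n set). KA * \<rho>' x + KG * indicat_real D x)"
      unfolding Qabs_def by (intro sum_mono)
    also have "... = N * KA * \<rho>' x + N * KG * indicat_real D x" unfolding N by (simp add: algebra_simps)
    finally show ?thesis .
  qed
  have "boundary_trace_data p (conj_exp p) D Q B r (N * KA * M1 + N * KG * M2) (min sa sb)"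
  proof unfold_locales
    show "0 < min sa sb" using M1 M2 by simp
    fix s assume s: "0 < s" "s <= min sa sb"
    have i1: "integrable lborel (%x. indicator (layer s) x * \<rho>' x)" "integrable lborel (%x. indicator (layer s) x * indicat_real D x)"
      using integrable_mult_indicator[OF _ i\<rho>, of "layer s"] integrable_mult_indicator[OF _ iD, of "layer s"] by simp_all
    have i2: "integrable lborel (%x. indicator (layer s) x * Qabs x)"
      using integrable_mult_indicator[OF _ Qabs_integrable, of "layer s"] by simp
    have "(LBINT x. indicator (layer s) x * Qabs x) \<le>
      (LBINT x. N * KA * (indicator (layer s) x * \<rho>' x) + N * KG * (indicator (layer s) x * indicat_real D x))"
      using i1 i2 Qle by (intro integral_mono) (auto simp: indicator_def[of "layer s"])
    also have "... = N * KA * (LBINT x. indicator (layer s) x * \<rho>' x) + N * KG * (LBINT x. indicator (layer s) x * indicat_real D x)"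
      using i1 by simp
    also have "... <= N * KA * (M1 * s) + N * KG * (M2 * s)"
      using M1(2)[of s] M2(2)[of s] s N0 KA KG by (intro add_mono mult_left_mono) auto
    finally show "(LBINT x. indicator (layer s) x * Qabs x) <= (N * KA * M1 + N * KG * M2) * s" by (simp add: algebra_simps)
  qed
  then show ?thesis by blast
qed

lemma layer_mass_bounded:
  assumes r: "defining_function D r" and bdd: "!!x. \<bar>\<rho>' x\<bar> <= M"
  shows "\<exists>M0 s0. boundary_trace_data p (conj_exp p) D Q B r M0 s0"
proof -
  interpret boundary_trace p "conj_exp p" D Q B r by (rule boundary_trace[OF r])
  obtain K where K: "!!i j x. \<bar>Q i j x\<bar> <= K" using bounded_Q[OF bdd] by blast
  have "Qabs x <= (\<Sum>i\<in>(UNIV::'n set). \<Sum>j\<in>(UNIV::'n set). K)" for x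
    unfolding Qabs_def by (intro sum_mono K)
  then obtain M' s0 where "0 < s0" "!!s. 0 < s ==> s <= s0 ==> (LBINT x. indicator (layer s) x * Qabs x) <= M' * s"
    by (rule bounded_layer_mass[OF Qabs_integrable Qabs_nonneg]) blast
  then have "boundary_trace_data p (conj_exp p) D Q B r M' s0" by unfold_locales
  then show ?thesis by blast
qed

text \<open>A second generalized derivative is unique up to null sets by
  \<open>fundamental_lemma\<close>. Hence the chosen Hessian inherits the integrability that the
  Sobolev class guarantees for some choice.\<close>
lemma gen_hess_representative:
  assumes u: "u \<in> Sobolev_Wp2 p D"
  obtains H' where "!!i j. H' i j \<in> borel_measurable borel" "!!i j x. x \<notin> D ==> H' i j x = 0"
    "!!i j. integrable lborel (%x. \<bar>H' i j x\<bar> powr p)"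
    "AE x in lborel. x \<in> D --> (\<forall>i j. gen_hess D u x $ i $ j = H' i j x)"
    "!!i j \<phi>. \<phi> \<in> C0_infty D ==>
       (LINT x|lebesgue_on D. u x * pd i (pd j \<phi>) x) = (LBINT x. H' i j x * \<phi> x)"
proof -
  have DL: "D \<in> sets lebesgue" by simp
  have "\<exists>w. gen_partial2 D i j u w \<and> Lp_on p D w" for i j using u by (simp add: Sobolev_Wp2_def)
  then obtain w where w: "!!i j. gen_partial2 D i j u (w i j)" "!!i j. Lp_on p D (w i j)" by metis
  have ex: "\<exists>H. \<forall>i j. gen_partial2 D i j u (%x. H x $ i $ j)"
    by (rule exI[of _ "%x. \<chi> i j. w i j x"]) (simp add: w)
  have "\<forall>i j. gen_partial2 D i j u (%x. gen_hess D u x $ i $ j)"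
    unfolding gen_hess_def by (rule someI_ex[OF ex])
  then have gh: "gen_partial2 D i j u (%x. gen_hess D u x $ i $ j)" for i j by simp
  define represents where "represents f k \<longleftrightarrow>
    k \<in> borel_measurable borel \<and> (\<forall>x. x \<notin> D --> k x = 0) \<and> (AE x in lborel. x \<in> D --> f x = k x)"
    for f k :: "real^'n => real"
  have rep: "\<exists>k. represents f k" if "gen_partial2 D i j u f" for i j f
  proof -
    have "f \<in> borel_measurable (lebesgue_on D)" using that by (simp add: gen_partial2_def Lp_loc_def)
    then obtain k where "k \<in> borel_measurable borel" "!!x. x \<notin> D ==> k x = 0" "AE x in lborel. x \<in> D --> f x = k x"
      by (rule borel_representative[OF D_borel]) (rule that)
    then have "represents f k" by (simp add: represents_def)
    then show ?thesis by blast
  qed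
  obtain w' where w': "!!i j. represents (w i j) (w' i j)" using rep[OF w(1)] by metis
  obtain k' where k': "!!i j. represents (%x. gen_hess D u x $ i $ j) (k' i j)" using rep[OF gh] by metis
  have test: "(LINT x|lebesgue_on D. u x * pd i (pd j \<phi>) x) = (LBINT x. f' x * \<phi> x)"
    if f: "gen_partial2 D i j u f" and f': "represents f f'" and phi: "\<phi> \<in> C0_infty D" for i j f f' \<phi>
  proof -
    have "Ck 0 \<phi>" using phi unfolding C0_infty_def by blast
    then have [measurable]: "\<phi> \<in> borel_measurable borel" by (intro borel_measurable_continuous_onI) simp
    have [measurable]: "f' \<in> borel_measurable borel" using f' by (simp add: represents_def)
    have "(LINT x|lebesgue_on D. f x * \<phi> x) = (LBINT x. f' x * \<phi> x)"
    proof (rule lebesgue_on_transfer(3)[OF DL])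
      have "AE x in lborel. x \<in> D --> f x = f' x" using f' by (simp add: represents_def)
      then show "AE x in lborel. x \<in> D --> f x * \<phi> x = f' x * \<phi> x" by eventually_elim simp
    next
      show "f' x * \<phi> x = 0" if "x \<notin> D" for x using f' that by (simp add: represents_def)
    qed simp
    then show ?thesis using f phi by (simp add: gen_partial2_def)
  qed
  have loc: "Lloc D f'" if f: "gen_partial2 D i j u f" and f': "represents f f'" for i j f f'
  proof (rule Lp_loc_Lloc[OF domain(1)])
    show "Lp_loc 1 D f" using f by (simp add: gen_partial2_def)
  qed (use f' in \<open>simp_all add: represents_def\<close>)
  have eq: "AE x in lborel. x \<in> D --> k' i j x - w' i j x = 0" for i j
  proof (rule fundamental_lemma[OF domain(1)])
    note l = loc[OF gh k'] loc[OF w(1) w']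
    have int: "integrable lborel (%x. indicator K x * k' i j x)" "integrable lborel (%x. indicator K x * w' i j x)"
      if "compact K" "K \<subseteq> D" for K
      using l[of i j] that by (auto simp: Lloc_def)
    show "Lloc D (%x. k' i j x - w' i j x)"
      unfolding Lloc_def right_diff_distrib using l[of i j] int by (auto simp: Lloc_def)
    fix \<phi> assume phi: "\<phi> \<in> C0_infty D"
    obtain K where K: "!!k. Ck k \<phi>" "compact K" "K \<subseteq> D" "!!x. x \<notin> K ==> \<phi> x = 0"
      by (rule C0_inftyD[OF phi]) (rule that)
    have c: "continuous_on UNIV \<phi>" using K(1)[of 0] by simp
    have m: "\<phi> \<in> borel_measurable lborel" using borel_measurable_continuous_onI[OF c] by simp
    obtain M where M: "!!x. \<bar>\<phi> x\<bar> <= M"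
    proof (rule continuous_compact_support_bounded[OF c K(2)])
      show "\<phi> x = 0" if "x \<notin> K" for x by (rule K(4)[OF that])
    qed (rule that)
    have z: "indicator K x * f x * \<phi> x = f x * \<phi> x" for x and f :: "real^'n => real"
      using K(4)[of x] by (cases "x \<in> K") auto
    have "integrable lborel (%x. k' i j x * \<phi> x)" "integrable lborel (%x. w' i j x * \<phi> x)"
      using integrable_mult_bounded[OF int(1)[OF K(2,3)] m M] integrable_mult_bounded[OF int(2)[OF K(2,3)] m M]
      unfolding z by simp_all
    then show "(LBINT x. (k' i j x - w' i j x) * \<phi> x) = 0"
      using test[OF gh k' phi, of i j] test[OF w(1) w' phi, of i j] by (simp add: left_diff_distrib)
  qed
  show thesis
  proof (rule that[of w'])
    show "integrable lborel (%x. \<bar>w' i j x\<bar> powr p)" for i j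
      by (rule Lp_on_transfer[OF w(2)[of i j]]) (use w'[of i j] in \<open>simp_all add: represents_def\<close>)
    have "AE x in lborel. x \<in> D --> gen_hess D u x $ i $ j = w' i j x" for i j
    proof -
      have "AE x in lborel. x \<in> D --> gen_hess D u x $ i $ j = k' i j x" using k' by (simp add: represents_def)
      then show ?thesis using eq[of i j] by eventually_elim auto
    qed
    then have "AE x in lborel. \<forall>i\<in>UNIV. \<forall>j\<in>UNIV. x \<in> D --> gen_hess D u x $ i $ j = w' i j x"
      by (intro AE_finite_allI finite)
    then show "AE x in lborel. x \<in> D --> (\<forall>i j. gen_hess D u x $ i $ j = w' i j x)" by eventually_elim auto
    show "w' i j \<in> borel_measurable borel" "x \<notin> D ==> w' i j x = 0" for i j x
      using w'[of i j] by (simp_all add: represents_def)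
    show "(LINT x|lebesgue_on D. u x * pd i (pd j \<phi>) x) = (LBINT x. w' i j x * \<phi> x)"
      if "\<phi> \<in> C0_infty D" for i j \<phi> by (rule test[OF w(1) w' that])
  qed
qed

text \<open>Off \<open>D\<close> the function is replaced by 0. The factor \<open>W\<close> is
  continuous on the boundary and is extended by the theorem of Tietze.\<close>
lemma dirichlet_identity:
  assumes data: "boundary_trace_data p (conj_exp p) D Q B r M0 s0"
    and u: "u \<in> Sobolev_Wp2 p D" "u \<in> C1_closure D" "\<forall>x\<in>frontier D. u x = 0"
  obtains u0 H' W where "boundary_test p D r u0 H' W"
    "!!x. x \<in> frontier D ==> boundary_grad D u x = W x *\<^sub>R grad r x"
    "(LINT x|lebesgue_on D. diff_op A b (grad u) (gen_hess D u) x * \<rho> x) - (LINT x|lebesgue_on D. diff_op G h (grad u) (gen_hess D u) x) =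
      (\<Sum>i\<in>UNIV. \<Sum>j\<in>UNIV. LBINT x. Q i j x * H' i j x) + (\<Sum>i\<in>UNIV. LBINT x. B i x * pd i u0 x)"
proof -
  note lower_int = lower_order_integrable
  interpret boundary_trace_data p "conj_exp p" D Q B r M0 s0 by (rule data)
  obtain H' where H': "!!i j. H' i j \<in> borel_measurable borel" "!!i j x. x \<notin> D ==> H' i j x = 0"
    "!!i j. integrable lborel (%x. \<bar>H' i j x\<bar> powr p)"
    "AE x in lborel. x \<in> D --> (\<forall>i j. gen_hess D u x $ i $ j = H' i j x)"
    "!!i j \<phi>. \<phi> \<in> C0_infty D ==>
       (LINT x|lebesgue_on D. u x * pd i (pd j \<phi>) x) = (LBINT x. H' i j x * \<phi> x)"
    by (rule gen_hess_representative[OF u(1)]) (rule that)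
  obtain g where uc: "continuous_on (closure D) u" "!!x. x \<in> D ==> u differentiable (at x)"
    and g: "continuous_on (closure D) g" "!!x. x \<in> D ==> g x = grad u x"
    using u(2) unfolding C1_closure_def by blast
  define u0 where "u0 x = (if x \<in> D then u x else 0)" for x
  have cl: "closure D = D \<union> frontier D" using closure_Un_frontier by blast
  have grad0: "pd i u0 x = pd i u x" if "x \<in> D" for i x
    by (rule partial_deriv_cong_open[OF domain(1) that]) (simp add: u0_def)
  have bv: "boundary_vanishing D r u0 g"
  proof unfold_locales
    show "continuous_on (closure D) u0"
      by (rule continuous_on_eq[OF uc(1)]) (use u(3) cl in \<open>auto simp: u0_def\<close>)
    show "u0 differentiable at x" if "x \<in> D" for x
    proof -
      obtain F where "(u has_derivative F) (at x)" using uc(2)[OF \<open>x \<in> D\<close>] unfolding differentiable_def by blast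
      then have "(u0 has_derivative F) (at x)"
        by (rule has_derivative_transform_within_open[OF _ domain(1) \<open>x \<in> D\<close>]) (simp add: u0_def)
      then show ?thesis unfolding differentiable_def by blast
    qed
    show "g x = grad u0 x" if "x \<in> D" for x using g(2)[OF that] grad0[OF that] by (simp add: grad_def)
    show "u0 x = 0" if "x \<in> frontier D" for x using that u(3) by (auto simp: u0_def)
  qed (rule g(1))
  interpret bv: boundary_vanishing D r u0 g by (rule bv)
  have u0m: "u0 \<in> borel_measurable borel"
  proof -
    have "(%x. indicator D x *\<^sub>R u x) \<in> borel_measurable borel"
      by (rule borel_measurable_continuous_on_indicator[OF D_borel continuous_on_subset[OF uc(1) closure_subset]])
    moreover have "(%x. indicator D x *\<^sub>R u x) = u0" by (auto simp: u0_def)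
    ultimately show ?thesis by simp
  qed
  have weak: "(LBINT x. u0 x * pd i (pd j \<phi>) x) = (LBINT x. H' i j x * \<phi> x)"
    if phi: "\<phi> \<in> C0_infty D" for i j \<phi>
  proof -
    have "Ck 2 \<phi>" using phi unfolding C0_infty_def by blast
    from borel_measurable_continuous_onI[OF Ck_2_partials(5)[OF this]]
    have [measurable]: "pd i (pd j \<phi>) \<in> borel_measurable borel" .
    have "(LINT x|lebesgue_on D. u x * pd i (pd j \<phi>) x) = (LBINT x. u0 x * pd i (pd j \<phi>) x)"
    proof (rule lebesgue_on_transfer(3))
      show "(%x. u0 x * pd i (pd j \<phi>) x) \<in> borel_measurable borel" using u0m by measurable
    qed (auto simp: u0_def)
    then show ?thesis using H'(5)[OF phi] by simp
  qed
  have wc: "continuous_on (frontier D) bv.w" unfolding bv.w_def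
    by (intro continuous_intros continuous_on_subset[OF g(1)] continuous_on_subset[OF grad_r_continuous])
      (use grad_r_frontier cl in auto)
  obtain K where K: "\<forall>x\<in>frontier D. \<bar>bv.w x\<bar> <= K"
  proof -
    have "bounded (bv.w ` frontier D)" by (intro compact_imp_bounded compact_continuous_image wc compact_frontier_D)
    then obtain M where "\<forall>y\<in>bv.w ` frontier D. norm y <= M" unfolding bounded_iff by (elim exE)
    then show thesis using that[of M] by simp
  qed
  obtain W where W: "continuous_on UNIV W" "!!x. x \<in> frontier D ==> W x = bv.w x" "!!x. norm (W x) <= \<bar>K\<bar>"
  proof (rule Tietze[OF wc, of UNIV "\<bar>K\<bar>"])
    show "norm (bv.w x) <= \<bar>K\<bar>" if "x \<in> frontier D" for x using K that by fastforce
  qed (use frontier_closed in \<open>auto intro: that\<close>)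
  have gW: "g x = W x *\<^sub>R grad r x" if "x \<in> frontier D" for x using bv.boundary_gradient[OF that] W(2)[OF that] by simp
  have bg: "boundary_grad D u x = W x *\<^sub>R grad r x" if x: "x \<in> frontier D" for x
  proof -
    have xc: "x \<in> closure D" "x \<notin> D" using x unfolding frontier_iff by simp_all
    have "(g \<longlongrightarrow> g x) (at x within closure D)" using g(1) xc by (simp add: continuous_on_def)
    then have "(g \<longlongrightarrow> g x) (at x within D)" by (rule tendsto_mono[OF at_le[OF closure_subset]])
    moreover have "eventually (%y. g y = grad u y) (at x within D)" using g(2) by (simp add: eventually_at_filter)
    ultimately have "(grad u \<longlongrightarrow> g x) (at x within D)" by (rule Lim_transform_eventually)
    moreover have "\<not> trivial_limit (at x within D)" using xc by (simp add: trivial_limit_within closure_def)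
    ultimately have "boundary_grad D u x = g x" unfolding boundary_grad_def by (intro tendsto_Lim) auto
    then show ?thesis using gW[OF x] by simp
  qed
  define g1 where "g1 i x = indicator D x * g x $ i" for i x
  have gc: "continuous_on (closure D) (%x. g x $ i)" for i by (intro continuous_intros g(1))
  have g1m: "g1 i \<in> borel_measurable borel" for i
    using borel_measurable_continuous_on_indicator[OF D_borel continuous_on_subset[OF gc closure_subset], of i]
    by (simp add: g1_def[abs_def])
  have g1b: "\<exists>M. \<forall>x. \<bar>g1 i x\<bar> <= M" for i
  proof -
    have "bounded ((%x. g x $ i) ` closure D)" by (intro compact_imp_bounded compact_continuous_image gc compact_closure_D)
    then obtain M where M: "\<forall>y\<in>(%x. g x $ i) ` closure D. norm y <= M" unfolding bounded_iff by (elim exE)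
    have "\<bar>g1 i x\<bar> <= \<bar>M\<bar>" for x
    proof (cases "x \<in> D")
      case True
      then have "\<bar>g x $ i\<bar> <= M" using M closure_subset[of D] by auto
      then show ?thesis using True by (simp add: g1_def)
    qed (simp add: g1_def)
    then show ?thesis by blast
  qed
  then obtain Mg where Mg: "!!i x. \<bar>g1 i x\<bar> <= Mg i" by metis
  have "(LINT x|lebesgue_on D. diff_op A b (grad u) (gen_hess D u) x * \<rho> x) - (LINT x|lebesgue_on D. diff_op G h (grad u) (gen_hess D u) x) =
      (\<Sum>i\<in>UNIV. \<Sum>j\<in>UNIV. LBINT x. Q i j x * H' i j x) + (\<Sum>i\<in>UNIV. LBINT x. B i x * g1 i x)"
  proof (rule operator_difference(1)[OF D_borel order_refl H'(1) g1m H'(4)])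
    show "grad u x $ i = g1 i x" if "x \<in> D" for i x using g(2)[OF that] that by (simp add: g1_def)
    show "integrable lborel (%x. A\<rho> i j x * H' i j x)" "integrable lborel (%x. G1 i j x * H' i j x)" for i j
      by (rule integrable_mult_Lp; use A\<rho>_Lq G1_Lq H' in simp)+
    show "integrable lborel (%x. b\<rho> i x * g1 i x)" "integrable lborel (%x. h1 i x * g1 i x)" for i
      by (rule integrable_mult_bounded[OF lower_int(1) _ Mg] integrable_mult_bounded[OF lower_int(2) _ Mg]; use g1m in simp)+
  qed simp
  moreover have "B i x * g1 i x = B i x * pd i u0 x" for i x
    using bv.g_grad[of x] B_0[of x i] by (cases "x \<in> D") (auto simp: g1_def grad_def)
  moreover have "boundary_test p D r u0 H' W"
    unfolding boundary_test_def
  proof (intro conjI allI)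
    show "\<exists>C. \<forall>x. \<bar>W x\<bar> <= C" using W(3) by auto
    show "\<exists>g. boundary_vanishing D r u0 g \<and> (\<forall>x\<in>frontier D. g x = W x *\<^sub>R grad r x)" using bv gW by blast
    show "\<forall>\<phi>\<in>C0_infty D. (LBINT x. u0 x * pd i (pd j \<phi>) x) = (LBINT x. H' i j x * \<phi> x)" for i j
      using weak by blast
  qed (use u0m H' W(1) in simp_all)
  ultimately show thesis using bg by (intro that[of u0 H' W]) simp_all
qed

end

context equation_setting
begin

text \<open>The outer normal is minus the normalized gradient of \<open>r\<close>, so the conormal
  derivative of \<open>u\<close> is \<open>- W a / norm (grad r x)\<close> with \<open>a\<close>
  the quadratic form of \<open>A\<close> at the gradient of \<open>r\<close>. Dividing out the
  positive continuous factor turns the pairing with \<open>W\<close> into the required boundary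
  integral.\<close>
lemma dirichlet_problem:
  assumes data: "boundary_trace_data p (conj_exp p) D Q B r M0 s0" and r: "defining_function D r"
    and pair: "boundary_pair p D r Q B \<mu>"
    and M: "sets M = sets (restrict_space borel (frontier D))" "finite_measure M" and C: "0 <= C"
    and le: "!!b E. E \<in> sets M ==> emeasure (\<mu> b) E <= ennreal C * emeasure M E"
  obtains \<eta> s K where "bounded_signed_measure (frontier D) \<eta>" "solves_Dirichlet p D A b G h \<eta> \<rho>"
    "s \<in> borel_measurable M" "!!x. x \<in> frontier D ==> \<bar>s x\<bar> <= K" "!!B. B \<in> sets M ==> \<eta> B = (LINT x:B|M. s x)"
proof -
  interpret defining_function D r by (rule r)
  have \<mu>: "sets (\<mu> b) = sets borel" "finite_measure (\<mu> b)" "emeasure (\<mu> b) (- frontier D) = 0" for b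
    using pair by (simp_all add: boundary_pair_def)
  obtain \<theta> where \<theta>: "0 < \<theta>" "!!x \<xi>. x \<in> \<Omega> ==> \<theta> * (\<xi> \<bullet> \<xi>) <= (A x *v \<xi>) \<bullet> \<xi>"
    using H2 unfolding cond_H2_def by blast
  have sub: "frontier D \<subseteq> \<Omega>" using domain(4) frontier_subset_closed[of "closure D"] by (auto simp: frontier_def)
  define a where "a x = (A x *v grad r x) \<bullet> grad r x" for x
  have a_pos: "0 < a x" if "x \<in> frontier D" for x
  proof -
    have "0 < \<theta> * (grad r x \<bullet> grad r x)" using \<theta>(1) grad_r_frontier[OF that] by simp
    also have "... <= a x" unfolding a_def using \<theta>(2) that sub by blast
    finally show ?thesis .
  qed
  have a_cont: "continuous_on (frontier D) a"
    unfolding a_def[abs_def] matrix_form_eq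
    by (intro continuous_intros continuous_on_subset[OF A_cont sub] continuous_on_subset[OF grad_r_continuous]) auto
  have n_cont: "continuous_on (frontier D) (%x. norm (grad r x))"
    by (intro continuous_intros continuous_on_subset[OF grad_r_continuous]) auto
  define \<kappa> where "\<kappa> x = norm (grad r x) / a x" for x
  have \<kappa>: "continuous_on (frontier D) \<kappa>" unfolding \<kappa>_def
  proof (intro continuous_on_divide n_cont a_cont ballI)
    show "a x \<noteq> 0" if "x \<in> frontier D" for x using a_pos[OF that] by simp
  qed
  have fb: "frontier D \<in> sets borel" using compact_frontier_D by (rule borel_compact)
  have normal: "outer_normal D x = - sgn (grad r x)" if "x \<in> frontier D" for x
    by (rule outer_normal_eq[OF domain(1,3) that r_C2 r_frontier[OF that] grad_r_frontier[OF that] r_pos])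
  obtain \<eta> s K where \<eta>: "bounded_signed_measure (frontier D) \<eta>" and s: "s \<in> borel_measurable M"
    "!!x. x \<in> frontier D ==> \<bar>s x\<bar> <= K" "!!B. B \<in> sets M ==> \<eta> B = (LINT x:B|M. s x)"
    and val: "!!f. continuous_on (frontier D) f ==> signed_integral (frontier D) \<eta> f =
       (LINT x|\<mu> True. indicator (frontier D) x * (\<kappa> x * f x)) - (LINT x|\<mu> False. indicator (frontier D) x * (\<kappa> x * f x))"
    by (rule signed_measure_from_parts[OF compact_frontier_D M C \<mu>(1) le \<kappa>]) (assumption | rule that)+
  have "solves_Dirichlet p D A b G h \<eta> \<rho>"
    unfolding solves_Dirichlet_def
  proof (intro conjI ballI impI Lp_on_D[OF rho_Lp])
    fix u assume u: "u \<in> Sobolev_Wp2 p D \<inter> C1_closure D" "\<forall>x\<in>frontier D. u x = 0"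
    obtain u0 H' W where test: "boundary_test p D r u0 H' W"
      and bg: "!!x. x \<in> frontier D ==> boundary_grad D u x = W x *\<^sub>R grad r x"
      and diff: "(LINT x|lebesgue_on D. diff_op A b (grad u) (gen_hess D u) x * \<rho> x) - (LINT x|lebesgue_on D. diff_op G h (grad u) (gen_hess D u) x) =
      (\<Sum>i\<in>UNIV. \<Sum>j\<in>UNIV. LBINT x. Q i j x * H' i j x) + (\<Sum>i\<in>UNIV. LBINT x. B i x * pd i u0 x)"
      by (rule dirichlet_identity[OF data IntD1[OF u(1)] IntD2[OF u(1)] u(2)]) (rule that)
    have W_cont: "continuous_on UNIV W" using test by (simp add: boundary_test_def)
    define f where "f x = (A x *v boundary_grad D u x) \<bullet> outer_normal D x" for x
    have f_eq: "f x = - W x * (a x / norm (grad r x))" if x: "x \<in> frontier D" for x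
      unfolding f_def bg[OF x] normal[OF x]
      by (simp add: a_def sgn_div_norm matrix_vector_mult_scaleR divide_inverse mult_ac)
    have f_cont: "continuous_on (frontier D) f"
    proof (rule continuous_on_eq)
      show "continuous_on (frontier D) (%x. - W x * (a x / norm (grad r x)))"
        by (intro continuous_intros n_cont a_cont continuous_on_subset[OF W_cont]) (use grad_r_frontier in auto)
    qed (simp add: f_eq)
    have part: "(LINT x|\<mu> c. indicator (frontier D) x * (\<kappa> x * f x)) = - (LINT x|\<mu> c. W x)" for c
    proof -
      have W_meas: "W \<in> borel_measurable (\<mu> c)"
        using borel_measurable_continuous_onI[OF W_cont] by (simp add: measurable_cong_sets[OF \<mu>(1) refl])
      have "(LINT x|\<mu> c. indicator (frontier D) x * (\<kappa> x * f x)) = (LINT x|\<mu> c. indicator (frontier D) x * - W x)"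
      proof (rule Bochner_Integration.integral_cong[OF refl])
        fix x
        show "indicator (frontier D) x * (\<kappa> x * f x) = indicator (frontier D) x * - W x"
        proof (cases "x \<in> frontier D")
          case True
          then show ?thesis using a_pos[OF True] grad_r_frontier[OF True] by (simp add: f_eq \<kappa>_def)
        qed simp
      qed
      also have "... = (LINT x|\<mu> c. - W x)"
      proof (rule integral_cong_AE)
        have "- frontier D \<in> null_sets (\<mu> c)" using \<mu> fb by (intro null_setsI) auto
        then show "AE x in \<mu> c. indicator (frontier D) x * - W x = - W x"
          by (rule AE_I') (auto simp: indicator_def)
      qed (use W_meas fb \<mu>(1) in measurable)
      finally show ?thesis by simp
    qed
    have "signed_integral (frontier D) \<eta> f = (LINT x|\<mu> False. W x) - (LINT x|\<mu> True. W x)"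
      by (simp add: val[OF f_cont] part)
    then show "(LINT x|lebesgue_on D. diff_op A b (grad u) (gen_hess D u) x * \<rho> x) =
        (LINT x|lebesgue_on D. diff_op G h (grad u) (gen_hess D u) x) +
        signed_integral (frontier D) \<eta> (%x. (A x *v boundary_grad D u x) \<bullet> outer_normal D x)"
      using diff pair test by (simp add: f_def[abs_def] boundary_pair_def)
  qed
  then show thesis using that \<eta> s by blast
qed

lemma dirichlet_problem_nonneg:
  assumes "!!x. 0 <= \<rho>' x"
  shows "\<exists>\<eta>. bounded_signed_measure (frontier D) \<eta> \<and> solves_Dirichlet p D A b G h \<eta> \<rho>"
proof -
  obtain r where r: "Ck 2 r" "!!x. 0 < r x \<longleftrightarrow> x \<in> D" "!!x. x \<in> frontier D ==> r x = 0 \<and> grad r x \<noteq> 0"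
    using defining_function_exists[OF domain(1-3)] by blast
  have df: "defining_function D r" by unfold_locales (use r domain in auto)
  obtain M0 s0 where data: "boundary_trace_data p (conj_exp p) D Q B r M0 s0" using layer_mass_nonneg[OF df assms] by blast
  interpret boundary_trace_data p "conj_exp p" D Q B r M0 s0 by (rule data)
  obtain \<mu> where pair: "boundary_pair p D r Q B \<mu>" by (rule boundary_measures) (rule that)
  have \<mu>: "sets (\<mu> b) = sets borel" "finite_measure (\<mu> b)" for b using pair by (simp_all add: boundary_pair_def)
  have fb: "frontier D \<in> sets borel" using compact_frontier_D by (rule borel_compact)
  have eqs: "sets (\<mu> False) = sets (\<mu> True)" using \<mu>(1) by simp
  note sm = sum_measure[of \<mu>, OF eqs]
  define M where "M = restrict_space (sum_measure \<mu>) (frontier D)"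
  have sM: "sets M = sets (restrict_space borel (frontier D))"
    unfolding M_def by (rule sets_restrict_space_cong) (simp add: sm \<mu>)
  have eM: "emeasure M E = emeasure (\<mu> True) E + emeasure (\<mu> False) E" if "E \<in> sets M" for E
  proof -
    have E: "E \<subseteq> frontier D" "E \<in> sets borel"
      using that fb unfolding sM by (auto simp: sets_restrict_space_iff)
    then have "emeasure M E = emeasure (sum_measure \<mu>) E"
      unfolding M_def using fb by (intro emeasure_restrict_space) (auto simp: sm \<mu>)
    then show ?thesis using E(2) by (simp add: sm \<mu>)
  qed
  have fM: "finite_measure M"
  proof
    have "space M \<in> sets M" by simp
    then show "emeasure M (space M) \<noteq> \<infinity>"
      using finite_measure.emeasure_finite[OF \<mu>(2)] by (simp add: eM)
  qed
  have le: "emeasure (\<mu> b) E <= ennreal 1 * emeasure M E" if "E \<in> sets M" for b E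
    using eM[OF that] by (cases b) auto
  show ?thesis
    by (rule dirichlet_problem[OF data df pair sM fM _ le]) (assumption | simp | blast)+
qed

text \<open>The boundary measures of balls grow like the surface measure, which therefore
  dominates them.\<close>
lemma dirichlet_problem_bounded:
  assumes bdd: "!!x. \<bar>\<rho>' x\<bar> <= M"
  shows "\<exists>\<eta>. bounded_signed_measure (frontier D) \<eta> \<and> solves_Dirichlet p D A b G h \<eta> \<rho> \<and> has_bounded_surface_density D \<eta>"
proof -
  obtain r where r: "Ck 2 r" "!!x. 0 < r x \<longleftrightarrow> x \<in> D" "!!x. x \<in> frontier D ==> r x = 0 \<and> grad r x \<noteq> 0"
    using defining_function_exists[OF domain(1-3)] by blast
  have df: "defining_function D r" by unfold_locales (use r domain in auto)
  obtain M0 s0 where data: "boundary_trace_data p (conj_exp p) D Q B r M0 s0" using layer_mass_bounded[OF df bdd] by blast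
  obtain KQ where KQ: "!!i j x. \<bar>Q i j x\<bar> <= KQ" using bounded_Q[OF bdd] by blast
  interpret boundary_trace_data p "conj_exp p" D Q B r M0 s0 by (rule data)
  obtain \<mu> where pair: "boundary_pair p D r Q B \<mu>" and growth: "\<forall>b. ball_growth (frontier D) (\<mu> b)"
  proof (rule boundary_measures)
    fix \<mu> assume pair: "boundary_pair p D r Q B \<mu>"
      and growth: "!!M b. (!!i j x. \<bar>Q i j x\<bar> <= M) ==> ball_growth (frontier D) (\<mu> b)"
    have "\<forall>b. ball_growth (frontier D) (\<mu> b)" using growth[OF KQ] by simp
    with pair show thesis by (rule that)
  qed
  have \<mu>: "sets (\<mu> b) = sets borel" "finite_measure (\<mu> b)" for b using pair by (simp_all add: boundary_pair_def)
  have fb: "frontier D \<in> sets borel" using compact_frontier_D by (rule borel_compact)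
  let ?M = "surface_measure D"
  have sM: "sets ?M = sets (restrict_space borel (frontier D))"
    unfolding surface_measure_def by (rule sets_restrict_space_cong) simp
  have E: "E \<subseteq> frontier D" "E \<in> sets borel" if "E \<in> sets ?M" for E
    using that fb unfolding sM by (auto simp: sets_restrict_space_iff)
  have eM: "emeasure ?M E = hausdorff_outer (CARD('n) - 1) E" if "E \<in> sets ?M" for E
  proof -
    have "emeasure ?M E = emeasure (hausdorff_measure (CARD('n) - 1)) E"
      unfolding surface_measure_def using fb E[OF that] by (intro emeasure_restrict_space) auto
    then show ?thesis using E[OF that] by (simp add: emeasure_hausdorff_measure)
  qed
  have fM: "finite_measure ?M"
  proof
    have "space ?M = frontier D" by (simp add: surface_measure_def space_restrict_space)
    moreover have "space ?M \<in> sets ?M" by simp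
    ultimately show "emeasure ?M (space ?M) \<noteq> \<infinity>"
      using eM[of "space ?M"] hausdorff_frontier_finite by simp
  qed
  have "\<exists>C\<ge>0. \<forall>S\<in>sets ?M. emeasure (\<mu> b) S <= ennreal C * emeasure ?M S" for b
  proof -
    have "ball_growth (frontier D) (\<mu> b)" using growth by blast
    then obtain C R where CR: "0 < C" "0 < R"
      "!!x t. x \<in> frontier D ==> 0 < t ==> t <= R ==> emeasure (\<mu> b) (cball x t) <= ennreal (C * t ^ (CARD('n) - 1))"
      unfolding ball_growth_def by blast
    have "emeasure (\<mu> b) S <= ennreal (C * 2 ^ (CARD('n) - 1) / unit_ball_vol (real (CARD('n) - 1))) * emeasure ?M S" if "S \<in> sets ?M" for S
      unfolding eM[OF that] by (rule measure_le_hausdorff[OF \<mu>(1) CR E(2)[OF that] E(1)[OF that]])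
    then show ?thesis using CR(1) by (intro exI[of _ "C * 2 ^ (CARD('n) - 1) / unit_ball_vol (real (CARD('n) - 1))"]) simp
  qed
  then obtain C where C: "!!b. 0 <= C b" "!!b S. S \<in> sets ?M ==> emeasure (\<mu> b) S <= ennreal (C b) * emeasure ?M S" by metis
  define C' where "C' = max (C True) (C False)"
  have C': "0 <= C'" using C(1)[of True] by (simp add: C'_def)
  have le: "emeasure (\<mu> b) S <= ennreal C' * emeasure ?M S" if "S \<in> sets ?M" for b S
  proof -
    have "ennreal (C b) <= ennreal C'" by (rule ennreal_leI) (cases b; simp add: C'_def)
    then show ?thesis using C(2)[OF that, of b] by (meson mult_right_mono order_trans zero_le)
  qed
  obtain \<eta> s K where \<eta>: "bounded_signed_measure (frontier D) \<eta>" "solves_Dirichlet p D A b G h \<eta> \<rho>"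
    and s: "s \<in> borel_measurable ?M" "!!x. x \<in> frontier D ==> \<bar>s x\<bar> <= K" "!!B. B \<in> sets ?M ==> \<eta> B = (LINT x:B|?M. s x)"
    by (rule dirichlet_problem[OF data df pair sM fM C' le]) (assumption | rule that)+
  have "has_bounded_surface_density D \<eta>"
    unfolding has_bounded_surface_density_def using s by blast
  then show ?thesis using \<eta> by blast
qed

end

theorem theorem2p1:
  fixes \<Omega> D :: "(real^'n::finite) set"
    and A G :: "real^'n \<Rightarrow> real^'n^'n"
    and b h :: "real^'n \<Rightarrow> real^'n"
    and \<rho> :: "real^'n \<Rightarrow> real"
    and p :: real
  assumes "open \<Omega>" and "\<Omega> \<noteq> {}"
    and "borel_symmetric_matrix_field \<Omega> A" and "borel_symmetric_matrix_field \<Omega> G"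
    and "borel_vector_field \<Omega> b" and "borel_vector_field \<Omega> h"
    and "cond_H1 \<Omega> A" and "cond_H2 \<Omega> A" and "cond_H3 p \<Omega> b G h"
    and "\<forall>i j. continuous_on \<Omega> (\<lambda>x. G x $ i $ j)"
    and "Lp_loc (conj_exp p) \<Omega> \<rho>"
    and "solves_equation \<Omega> A b G h \<rho>"
    and "open D" and "connected D" and "D \<noteq> {}" and "bounded D"
    and "C2_boundary D" and "closure D \<subseteq> \<Omega>"
  shows "((AE x in lebesgue_on \<Omega>. 0 \<le> \<rho> x) \<longrightarrow>
            (\<exists>\<eta>. bounded_signed_measure (frontier D) \<eta> \<and>
                 solves_Dirichlet p D A b G h \<eta> \<rho>)) \<and>
         (Linfty_loc \<Omega> \<rho> \<longrightarrow>
            (\<exists>\<eta>. bounded_signed_measure (frontier D) \<eta> \<and>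
                 solves_Dirichlet p D A b G h \<eta> \<rho> \<and>
                 has_bounded_surface_density D \<eta>))"
proof -
  have D: "D \<in> sets borel" "D \<subseteq> closure D" "D \<subseteq> \<Omega>" using assms closure_subset[of D] by auto
  have "\<rho> \<in> borel_measurable (lebesgue_on \<Omega>)" using assms(11) by (simp add: Lp_loc_def)
  then have "\<rho> \<in> borel_measurable (lebesgue_on D)" using D(3) by (rule borel_measurable_lebesgue_on_subset)
  then obtain \<rho>1 where \<rho>1 [measurable]: "\<rho>1 \<in> borel_measurable borel" and \<rho>1_0: "!!x. x \<notin> D ==> \<rho>1 x = 0"
    and \<rho>1_eq: "AE x in lborel. x \<in> D --> \<rho> x = \<rho>1 x"
    by (rule borel_representative[OF D(1)]) (rule that)
  have setting: "equation_setting \<Omega> D A G b h \<rho> \<rho>2 p"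
    if "\<rho>2 \<in> borel_measurable borel" "!!x. x \<notin> D ==> \<rho>2 x = 0" "AE x in lborel. x \<in> D --> \<rho> x = \<rho>2 x" for \<rho>2
    by unfold_locales (fact assms that)+
  show ?thesis
  proof (intro conjI impI)
    assume "AE x in lebesgue_on \<Omega>. 0 <= \<rho> x"
    then have pos: "AE x in lborel. x \<in> \<Omega> --> 0 <= \<rho> x"
      using assms(1) by (simp add: AE_restrict_space_iff AE_completion_iff)
    define \<rho>2 where "\<rho>2 x = max 0 (\<rho>1 x)" for x
    have "AE x in lborel. x \<in> D --> \<rho> x = \<rho>2 x"
      using pos \<rho>1_eq by eventually_elim (use D in \<open>auto simp: \<rho>2_def\<close>)
    then interpret equation_setting \<Omega> D A G b h \<rho> \<rho>2 p
      by (rule setting[rotated 2]) (simp_all add: \<rho>2_def[abs_def] \<rho>1_0)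
    show "\<exists>\<eta>. bounded_signed_measure (frontier D) \<eta> \<and> solves_Dirichlet p D A b G h \<eta> \<rho>"
      by (rule dirichlet_problem_nonneg) (simp add: \<rho>2_def)
  next
    assume inf: "Linfty_loc \<Omega> \<rho>"
    have "compact (closure D)" using assms(16) by simp
    then have "\<exists>M. AE x in lebesgue_on (closure D). \<bar>\<rho> x\<bar> <= M"
      using inf[unfolded Linfty_loc_def, THEN conjunct2, rule_format, of "closure D"] assms(18) by simp
    then obtain M where "AE x in lebesgue_on (closure D). \<bar>\<rho> x\<bar> <= M" by (elim exE)
    then have M: "AE x in lborel. x \<in> closure D --> \<bar>\<rho> x\<bar> <= M"
      by (simp add: AE_restrict_space_iff AE_completion_iff)
    define \<rho>2 where "\<rho>2 x = max (- \<bar>M\<bar>) (min \<bar>M\<bar> (\<rho>1 x))" for x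
    have "AE x in lborel. x \<in> D --> \<rho> x = \<rho>2 x"
      using M \<rho>1_eq by eventually_elim (use D in \<open>auto simp: \<rho>2_def\<close>)
    then interpret equation_setting \<Omega> D A G b h \<rho> \<rho>2 p
      by (rule setting[rotated 2]) (simp_all add: \<rho>2_def[abs_def] \<rho>1_0)
    show "\<exists>\<eta>. bounded_signed_measure (frontier D) \<eta> \<and> solves_Dirichlet p D A b G h \<eta> \<rho> \<and> has_bounded_surface_density D \<eta>"
      by (rule dirichlet_problem_bounded[of "\<bar>M\<bar>"]) (auto simp: \<rho>2_def)
  qed
qed

end
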